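(* Let $(X_1,Y_1),(X_2,Y_2),\ldots$ be independent and identically distributed random vectors with bivariate distribution function $H$ having continuous marginal distribution functions $F$ and $G$ and copula $C$. Let $p_0\in(0,1)$ be fixed and $\mathcal{P}=[p_0,1]$. Suppose that: (i) the first-order partial derivatives $\dot C_1(u,v)=\partial C(u,v)/\partial u$ and $\dot C_2(u,v)=\partial C(u,v)/\partial v$ exist and are continuous, respectively, on $(0,1)\times[0,1]$ and $[0,1]\times(0,1)$; (ii) as $r\to\infty$, \[ \sup_{p\in\mathcal{P}}\left|\int_{[0,p]^2}\{B_r(C)(u,v)-C(u,v)\}\,\mathrm{d}u\,\mathrm{d}v\right|=O(r^{-1}); \] (iii) $m=m(n)$ is a sequence of positive integers with $m\to\infty$ and $\sqrt n/m\to0$ as $n\to\infty$. Then the process \[ \mathbb{Z}_n(p)=\sqrt n\{\widehat{\rho}_{m,n}(p)-\rho(p)\},\qquad p\in\mathcal{P}, \] converges weakly in $\ell^\infty(\mathcal{P})$, as $n\to\infty$, to the centered Gaussian process \[ \mathbb{Z}(p)=\frac{1}{D(p)}\int_{[0,p]^2}\mathbb{G}_C(u,v)\,\mathrm{d}u\,\mathrm{d}v,\qquad p\in\mathcal{P}. \] Moreover, for any $p,q\in\mathcal{P}$, \[ \mathrm{Cov}\{\mathbb{Z}(p),\mathbb{Z}(q)\}=\frac{1}{D(p)D(q)}\int_{[0,p]^2}\int_{[0,q]^2}\Gamma((u,v),(s,t))\,\mathrm{d}u\,\mathrm{d}v\,\mathrm{d}s\,\mathrm{d}t, \] where, inside the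 integral, $(u,v)$ ranges over $[0,p]^2$ and $(s,t)$ over $[0,q]^2$.
   Context: By Sklar's theorem, $C$ is the unique copula with $H(x,y)=C\{F(x),G(y)\}$. For $p\in(0,1]$, set $D(p)=p^3/3-p^4/4$ (which is $>0$). The lower-tail Spearman's rho curve of $C$ is \[ \rho(p)=\frac{\int_{[0,p]^2}C(u,v)\,\mathrm{d}u\,\mathrm{d}v-p^4/4}{D(p)},\qquad p\in(0,1]. \] Let $F_n(x)=n^{-1}\sum_{i=1}^n\mathbf{1}\{X_i\le x\}$ and $G_n(y)=n^{-1}\sum_{i=1}^n\mathbf{1}\{Y_i\le y\}$ be the empirical marginal distribution functions. The empirical copula is \[ C_n(u,v)=\frac1n\sum_{i=1}^n\mathbf{1}\{F_n(X_i)\le u,\;G_n(Y_i)\le v\},\qquad(u,v)\in[0,1]^2. \] For an integer $m\ge1$ and $k=0,\ldots,m$, let $P_{k,m}(u)=\binom{m}{k}u^k(1-u)^{m-k}$, and for a bounded function $h$ on $[0,1]^2$ let \[ B_m(h)(u,v)=\sum_{k=0}^m\sum_{\ell=0}^m h(k/m,\ell/m)P_{k,m}(u)P_{\ell,m}(v). \] The empirical Bernstein copula is $C_{m,n}=B_m(C_n)$, and the Bernstein-smoothed estimator is \[ \widehat{\rho}_{m,n}(p)=\frac{\int_{[0,p]^2}C_{m,n}(u,v)\,\mathrm{d}u\,\mathrm{d}v-p^4/4}{D(p)},\qquad p\in(0,1]. \] For a compact set $T$, $\ell^\infty(T)$ is the Banach space of bounded real-valued functions on $T$ with the supremum norm;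 weak convergence in $\ell^\infty(T)$ is meant in the usual sense of empirical process theory (Hoffmann-J\o rgensen). $\mathbb{B}_C$ denotes the $C$-Brownian bridge on $[0,1]^2$: the centered Gaussian process with continuous sample paths and covariance function \[ K_C((u,v),(s,t))=C(\min(u,s),\min(v,t))-C(u,v)C(s,t). \] The process $\mathbb{G}_C$ is \[ \mathbb{G}_C(u,v)=\mathbb{B}_C(u,v)-\dot C_1(u,v)\mathbb{B}_C(u,1)-\dot C_2(u,v)\mathbb{B}_C(1,v),\qquad(u,v)\in[0,1]^2, \] where at boundary points at which the partial derivatives are not defined by hypothesis (i) they are assigned arbitrary values (the corresponding Brownian bridge terms vanish there). Finally, $\Gamma((u,v),(s,t))=\mathrm{Cov}\{\mathbb{G}_C(u,v),\mathbb{G}_C(s,t)\}$. *)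

theory Defs
  imports "HOL-Probability.Probability" "HOL-Library.Landau_Symbols"
begin

section \<open>Copulas and the Spearman curve\<close>

text \<open>A bivariate copula; only the values of \<open>C\<close> on the closed unit square matter.\<close>

definition copula :: "(real \<times> real \<Rightarrow> real) \<Rightarrow> bool" where
  "copula C \<longleftrightarrow>
     (\<forall>u\<in>{0..1}. C (u, 0) = 0 \<and> C (0, u) = 0 \<and> C (u, 1) = u \<and> C (1, u) = u) \<and>
     (\<forall>u\<in>{0..1}. \<forall>u'\<in>{0..1}. \<forall>v\<in>{0..1}. \<forall>v'\<in>{0..1}. u \<le> u' \<longrightarrow> v \<le> v' \<longrightarrow>
        0 \<le> C (u', v') - C (u', v) - C (u, v') + C (u, v))"

definition joint_cdf :: "(real \<times> real) measure \<Rightarrow> real \<times> real \<Rightarrow> real" where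
  "joint_cdf \<mu> = (\<lambda>(x, y). measure \<mu> ({..x} \<times> {..y}))"

definition D_norm :: "real \<Rightarrow> real" where
  "D_norm p = p ^ 3 / 3 - p ^ 4 / 4"

text \<open>Integrals over squares are taken with respect to the complete Lebesgue measure on the plane,
  so that arbitrary values of an integrand on a null set (see \<open>G_process\<close> below) are harmless.\<close>

definition square_integral :: "(real \<times> real \<Rightarrow> real) \<Rightarrow> real \<Rightarrow> real" where
  "square_integral h p = (LINT z:{0..p} \<times> {0..p}|lebesgue. h z)"

text \<open>The curve \<open>\<rho>\<close> is \<open>spearman_curve C\<close>; the smoothed estimator is the same functional applied to
  the empirical Bernstein copula.\<close>

definition spearman_curve :: "(real \<times> real \<Rightarrow> real) \<Rightarrow> real \<Rightarrow> real" where
  "spearman_curve C p = (square_integral C p - p ^ 4 / 4) / D_norm p"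

definition bernstein_op :: "nat \<Rightarrow> (real \<times> real \<Rightarrow> real) \<Rightarrow> real \<times> real \<Rightarrow> real" where
  "bernstein_op m h = (\<lambda>(u, v). \<Sum>k\<le>m. \<Sum>l\<le>m.
     h (real k / real m, real l / real m) * Bernstein m k u * Bernstein m l v)"

section \<open>Empirical quantities (samples are indexed from 1)\<close>

definition emp_cdf :: "(nat \<Rightarrow> 'a \<Rightarrow> real) \<Rightarrow> nat \<Rightarrow> 'a \<Rightarrow> real \<Rightarrow> real" where
  "emp_cdf X n \<omega> x = (\<Sum>i=1..n. indicat_real {..x} (X i \<omega>)) / real n"

definition emp_copula ::
    "(nat \<Rightarrow> 'a \<Rightarrow> real) \<Rightarrow> (nat \<Rightarrow> 'a \<Rightarrow> real) \<Rightarrow> nat \<Rightarrow> 'a \<Rightarrow> real \<times> real \<Rightarrow> real" where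
  "emp_copula X Y n \<omega> = (\<lambda>(u, v).
     (\<Sum>i=1..n. indicat_real ({..u} \<times> {..v})
        (emp_cdf X n \<omega> (X i \<omega>), emp_cdf Y n \<omega> (Y i \<omega>))) / real n)"

section \<open>Gaussian processes\<close>

definition covariance :: "'b measure \<Rightarrow> ('b \<Rightarrow> real) \<Rightarrow> ('b \<Rightarrow> real) \<Rightarrow> real" where
  "covariance N U V =
     (\<integral>\<omega>. (U \<omega> - (\<integral>\<xi>. U \<xi> \<partial>N)) * (V \<omega> - (\<integral>\<xi>. V \<xi> \<partial>N)) \<partial>N)"

text \<open>Univariate normality, degenerate (almost surely constant) variables included.\<close>

definition normal_rv :: "'b measure \<Rightarrow> ('b \<Rightarrow> real) \<Rightarrow> bool" where
  "normal_rv N U \<longleftrightarrow>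
     (\<exists>\<mu> \<sigma>. 0 < \<sigma> \<and> distributed N lborel U (normal_density \<mu> \<sigma>)) \<or>
     (U \<in> borel_measurable N \<and> (\<exists>\<mu>. AE \<omega> in N. U \<omega> = \<mu>))"

text \<open>Joint normality of the finite-dimensional marginals is expressed, as usual, by normality of
  all linear combinations.\<close>

definition centered_gaussian_process :: "'b measure \<Rightarrow> 't set \<Rightarrow> ('t \<Rightarrow> 'b \<Rightarrow> real) \<Rightarrow> bool" where
  "centered_gaussian_process N T Z \<longleftrightarrow>
     (\<forall>t\<in>T. Z t \<in> borel_measurable N \<and> (\<integral>\<omega>. Z t \<omega> \<partial>N) = 0) \<and>
     (\<forall>I a. finite I \<and> I \<subseteq> T \<longrightarrow> normal_rv N (\<lambda>\<omega>. \<Sum>t\<in>I. a t * Z t \<omega>))"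

definition brownian_bridge ::
    "'b measure \<Rightarrow> (real \<times> real \<Rightarrow> real) \<Rightarrow> (real \<times> real \<Rightarrow> 'b \<Rightarrow> real) \<Rightarrow> bool" where
  "brownian_bridge N C B \<longleftrightarrow>
     centered_gaussian_process N ({0..1} \<times> {0..1}) B \<and>
     (\<forall>\<omega>\<in>space N. continuous_on ({0..1} \<times> {0..1}) (\<lambda>z. B z \<omega>)) \<and>
     (\<forall>u\<in>{0..1}. \<forall>v\<in>{0..1}. \<forall>s\<in>{0..1}. \<forall>t\<in>{0..1}.
        covariance N (B (u, v)) (B (s, t)) = C (min u s, min v t) - C (u, v) * C (s, t))"

text \<open>\<open>d1\<close> and \<open>d2\<close> stand for the first-order partial derivatives of the copula; where these are
  not assumed to exist, their values are arbitrary.\<close>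

definition G_process ::
    "(real \<times> real \<Rightarrow> real) \<Rightarrow> (real \<times> real \<Rightarrow> real) \<Rightarrow> (real \<times> real \<Rightarrow> 'b \<Rightarrow> real) \<Rightarrow>
     real \<times> real \<Rightarrow> 'b \<Rightarrow> real" where
  "G_process d1 d2 B = (\<lambda>(u, v) \<omega>.
     B (u, v) \<omega> - d1 (u, v) * B (u, 1) \<omega> - d2 (u, v) * B (1, v) \<omega>)"

definition Gamma_cov ::
    "'b measure \<Rightarrow> (real \<times> real \<Rightarrow> real) \<Rightarrow> (real \<times> real \<Rightarrow> real) \<Rightarrow> (real \<times> real \<Rightarrow> 'b \<Rightarrow> real) \<Rightarrow>
     real \<times> real \<Rightarrow> real \<times> real \<Rightarrow> real" where
  "Gamma_cov N d1 d2 B w z = covariance N (G_process d1 d2 B w) (G_process d1 d2 B z)"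

definition Z_limit ::
    "(real \<times> real \<Rightarrow> real) \<Rightarrow> (real \<times> real \<Rightarrow> real) \<Rightarrow> (real \<times> real \<Rightarrow> 'b \<Rightarrow> real) \<Rightarrow>
     real \<Rightarrow> 'b \<Rightarrow> real" where
  "Z_limit d1 d2 B p \<omega> = square_integral (\<lambda>z. G_process d1 d2 B z \<omega>) p / D_norm p"

section \<open>Weak convergence in the sense of Hoffmann-Joergensen\<close>

text \<open>The space of bounded real functions on \<open>T\<close> with the supremum metric. Its elements are
  extensional functions, hence the use of \<open>restrict\<close> below.\<close>

abbreviation linf :: "'t set \<Rightarrow> ('t \<Rightarrow> real) metric" where
  "linf T \<equiv> funspace T euclidean_metric"

text \<open>Outer expectation of a bounded, possibly non-measurable function: for such functions it is
  enough to consider real-valued integrable majorants.\<close>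

definition outer_expectation :: "'a measure \<Rightarrow> ('a \<Rightarrow> real) \<Rightarrow> real" where
  "outer_expectation M f =
     Inf {integral\<^sup>L M U | U. integrable M U \<and> (\<forall>\<omega>\<in>space M. f \<omega> \<le> U \<omega>)}"

text \<open>The approximating maps take values in \<open>linf T\<close> but need not be measurable; the limit is a
  Borel measurable map into \<open>linf T\<close>.\<close>

definition weakly_converges_linf ::
    "'a measure \<Rightarrow> (nat \<Rightarrow> 't \<Rightarrow> 'a \<Rightarrow> real) \<Rightarrow> 't set \<Rightarrow> 'b measure \<Rightarrow> ('t \<Rightarrow> 'b \<Rightarrow> real) \<Rightarrow> bool"
  where
  "weakly_converges_linf M Zn T N Z \<longleftrightarrow>
     (\<forall>n. \<forall>\<omega>\<in>space M. (\<lambda>t\<in>T. Zn n t \<omega>) \<in> mspace (linf T)) \<and>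
     (\<forall>\<omega>\<in>space N. (\<lambda>t\<in>T. Z t \<omega>) \<in> mspace (linf T)) \<and>
     (\<forall>S. openin (mtopology_of (linf T)) S \<longrightarrow> {\<omega> \<in> space N. (\<lambda>t\<in>T. Z t \<omega>) \<in> S} \<in> sets N) \<and>
     (\<forall>f :: ('t \<Rightarrow> real) \<Rightarrow> real.
        continuous_map (mtopology_of (linf T)) euclideanreal f \<and>
        bounded (f ` mspace (linf T)) \<longrightarrow>
        (\<lambda>n. outer_expectation M (\<lambda>\<omega>. f (\<lambda>t\<in>T. Zn n t \<omega>)))
          \<longlonglongrightarrow> (\<integral>\<omega>. f (\<lambda>t\<in>T. Z t \<omega>) \<partial>N))"

end

theory Submission
  imports Defs
begin

text \<open>Put \<open>P_i = (F(X_i), G(Y_i))\<close>, let \<open>\<alpha>_n\<close> be the empirical process of this sample and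
  \<open>g_n = \<alpha>_n - C1 \<alpha>_n(\<cdot>, 1) - C2 \<alpha>_n(1, \<cdot>)\<close>. The estimation error is the integral over the square \<open>[0, p]\<^sup>2\<close>
  of the smoothed empirical copula process, plus a deterministic bias that vanishes by (ii) and (iii), divided by \<open>D(p)\<close>.
  Only integrals matter, so it suffices to replace the smoothed process by \<open>g_n\<close> in mean and at each
  interior point of the square; this avoids any uniform oscillation estimate. At a fixed interior point \<open>z\<close> the Bernstein weights
  concentrate near \<open>z\<close>, and there monotonicity compares the empirical copula with \<open>\<alpha>_n\<close> at finitely many points of a
  grid of mesh \<open>\<eta> / sqrt n\<close>.

  The functionals \<open>p \<mapsto> (\<integral> g_n) / D(p)\<close> are linear in the sample, so their finite-dimensional distributions converge
  by the central limit theorem. By Cauchy--Schwarz their increments are at most \<open>sqrt \<bar>p - q\<bar>\<close> times a variable with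
  bounded expectation built from \<open>\<integral> g_n\<^sup>2\<close>, which gives tightness.\<close>

section \<open>Convergence of finite-dimensional distributions\<close>

text \<open>Neither partial derivative need extend continuously to the whole boundary of the square,
  so the linearisation of \<open>C\<close> is not uniform. Uniformity is replaced by convergence in
  mean at each interior point, a bound that does not depend on the point, and dominated convergence
  over the square. That bound comes from the ranks: without ties, the index sets cut out at one
  level by the ranks and by the transformed values are nested, and this keeps the second moments of
  the empirical copula process below 28.

  Prelimit and limit live on different probability spaces. They are compared through characteristic
  functions: a single centred indicator already has the covariance of the bridge, and the covariance
  \<open>Z_cov\<close> of the integrals is an expression in \<open>C\<close>, \<open>C1\<close> and
  \<open>C2\<close> alone.

  The estimator is not assumed measurable as a map into \<open>linf\<close>. Therefore each error is
  bounded at every sample point by an integrable variable, and an outer expectation moves by at most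
  the mean of that variable.\<close>

inductive_set trig_poly :: "nat \<Rightarrow> ((nat \<Rightarrow> real) \<Rightarrow> complex) set" for k :: nat where
  cis: "(\<lambda>x. cis (\<Sum>j<k. a j * x j)) \<in> trig_poly k"
| add: "f \<in> trig_poly k \<Longrightarrow> g \<in> trig_poly k \<Longrightarrow> (\<lambda>x. f x + g x) \<in> trig_poly k"
| scale: "f \<in> trig_poly k \<Longrightarrow> (\<lambda>x. c * f x) \<in> trig_poly k"

lemma trig_poly_const: "(\<lambda>x. c) \<in> trig_poly k"
  using trig_poly.scale[OF trig_poly.cis[of "\<lambda>_. 0"], of c] by simp

lemma trig_poly_mult_cis:
  assumes "f \<in> trig_poly k"
  shows "(\<lambda>x. cis (\<Sum>j<k. a j * x j) * f x) \<in> trig_poly k"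
  using assms
proof induction
  case (cis b)
  have "(\<lambda>x. cis (\<Sum>j<k. a j * x j) * cis (\<Sum>j<k. b j * x j)) =
      (\<lambda>x. cis (\<Sum>j<k. (a j + b j) * x j))"
    by (simp add: cis_mult sum.distrib distrib_right)
  then show ?case
    by (metis trig_poly.cis)
next
  case (add f g)
  then show ?case
    using trig_poly.add[OF add.IH] by (simp add: distrib_left)
next
  case (scale f c)
  then show ?case
    using trig_poly.scale[OF scale.IH, of c] by (simp add: mult.left_commute)
qed

text \<open>Frequency vectors add under products, so the span of the exponentials is an algebra, as
  Stone--Weierstrass requires.\<close>

lemma trig_poly_mult:
  assumes "f \<in> trig_poly k" "g \<in> trig_poly k"
  shows "(\<lambda>x. f x * g x) \<in> trig_poly k"
  using assms
proof induction
  case (cis a)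
  then show ?case by (rule trig_poly_mult_cis)
next
  case (add f f')
  then show ?case
    using trig_poly.add[of "\<lambda>x. f x * g x" k "\<lambda>x. f' x * g x"] by (simp add: distrib_right)
next
  case (scale f c)
  then show ?case
    using trig_poly.scale[of "\<lambda>x. f x * g x" k c] by (simp add: mult.assoc)
qed

lemma trig_poly_sin:
  assumes "j < k"
  shows "(\<lambda>x. complex_of_real (sin (x j / L))) \<in> trig_poly k"
proof -
  \<comment> \<open>\<open>a s\<close> puts the frequency \<open>s / L\<close> on coordinate
    \<open>j\<close> alone, so that the sine is the usual combination of the exponentials for
    \<open>s = 1\<close> and \<open>s = -1\<close>.\<close>
  define a where "a s i = (if i = j then s / L else 0)" for s :: real and i :: nat
  have *: "(\<Sum>i<k. a s i * x i) = s * x j / L" for s x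
    using assms by (simp add: a_def if_distrib[of "\<lambda>t. t * _"] sum.delta cong: if_cong)
  have "(\<lambda>x. 1 / (2 * \<i>) * cis (\<Sum>i<k. a 1 i * x i) + (- 1 / (2 * \<i>)) * cis (\<Sum>i<k. a (-1) i * x i))
      \<in> trig_poly k"
    by (intro trig_poly.intros)
  also have "(\<lambda>x. 1 / (2 * \<i>) * cis (\<Sum>i<k. a 1 i * x i) + (- 1 / (2 * \<i>)) * cis (\<Sum>i<k. a (-1) i * x i))
      = (\<lambda>x. complex_of_real (sin (x j / L)))"
    unfolding * by (auto simp: fun_eq_iff complex_eq_iff cis.sel Re_divide Im_divide)
  finally show ?thesis .
qed

lemma trig_poly_measurable: "f \<in> trig_poly k \<Longrightarrow> f \<in> borel_measurable borel"
proof (induction rule: trig_poly.induct)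
  case (cis a)
  have "continuous_on UNIV (\<lambda>x::nat \<Rightarrow> real. cis (\<Sum>j<k. a j * x j))"
    by (intro continuous_intros continuous_on_cis) (auto intro: continuous_on_product_coordinates)
  then show ?case by (rule borel_measurable_continuous_onI)
qed auto

lemma trig_poly_bounded: "f \<in> trig_poly k \<Longrightarrow> \<exists>B. \<forall>x. cmod (f x) \<le> B"
proof (induction rule: trig_poly.induct)
  case (add f g)
  then obtain B B' where "\<forall>x. cmod (f x) \<le> B" "\<forall>x. cmod (g x) \<le> B'" by blast
  then show ?case
    by (intro exI[of _ "B + B'"] allI) (meson add_mono norm_triangle_le)
next
  case (scale f c)
  then obtain B where "\<forall>x. cmod (f x) \<le> B" by blast
  then show ?case
    by (intro exI[of _ "cmod c * B"] allI) (simp add: norm_mult mult_left_mono)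
qed (auto intro: exI[of _ 1])

lemma trig_poly_continuous: "f \<in> trig_poly k \<Longrightarrow> continuous_on UNIV f"
proof (induction rule: trig_poly.induct)
  case (cis a)
  show ?case
    by (intro continuous_intros continuous_on_cis) (auto intro: continuous_on_product_coordinates)
qed (auto intro: continuous_intros)

lemma trig_poly_integrable:
  assumes "prob_space M" "f \<in> trig_poly k" "W \<in> borel_measurable M"
  shows "integrable M (\<lambda>\<omega>. f (W \<omega>))"
proof -
  interpret prob_space M by fact
  obtain B where "\<forall>x. cmod (f x) \<le> B"
    using trig_poly_bounded[OF assms(2)] by blast
  then show ?thesis
    using trig_poly_measurable[OF assms(2)] assms(3)
    by (intro integrable_const_bound[of _ B]) auto
qed

text \<open>Every element is a finite combination of exponentials, whose means converge by
  \<open>conv\<close>; linearity of the integral does the rest.\<close>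

lemma trig_poly_convergence:
  assumes "prob_space M" "prob_space N" "f \<in> trig_poly k"
    and [measurable]: "\<And>n. W n \<in> borel_measurable M" "Z \<in> borel_measurable N"
    and conv: "\<And>a. (\<lambda>n. \<integral>\<omega>. cis (\<Sum>j<k. a j * W n \<omega> j) \<partial>M)
      \<longlonglongrightarrow> (\<integral>\<omega>. cis (\<Sum>j<k. a j * Z \<omega> j) \<partial>N)"
  shows "(\<lambda>n. \<integral>\<omega>. f (W n \<omega>) \<partial>M) \<longlonglongrightarrow> (\<integral>\<omega>. f (Z \<omega>) \<partial>N)"
  using assms(3)
proof induction
  case (cis a)
  show ?case by (rule conv)
next
  case (add f g)
  then show ?case
    using assms by (simp add: Bochner_Integration.integral_add trig_poly_integrable tendsto_add)
next
  case (scale f c)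
  then show ?case by (simp add: tendsto_mult_left)
qed

text \<open>Vectors of length \<open>k\<close> are encoded as sequences that vanish from index
  \<open>k\<close> on. As \<open>c j = 0\<close> is allowed, a cube in the first \<open>k\<close>
  coordinates is such a box, and Tychonoff's theorem gives its compactness.\<close>

lemma compact_coordinate_box: "compact {x :: nat \<Rightarrow> real. \<forall>j. x j \<in> {- c j .. c j}}"
proof -
  have "compactin (product_topology (\<lambda>_. euclideanreal) UNIV) (\<Pi>\<^sub>E j\<in>UNIV. {- c j .. c j})"
    by (subst compactin_PiE) auto
  moreover have "(\<Pi>\<^sub>E j\<in>UNIV. {- c j .. c j}) = {x. \<forall>j. x j \<in> {- c j .. c j}}"
    by (auto simp: PiE_UNIV_domain)
  ultimately show ?thesis
    by (simp add: euclidean_product_topology)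
qed

text \<open>Stone--Weierstrass is applied to the polynomials in \<open>sin (x j / L)\<close>: they are determined by their
  values on the box, so an approximation there is bounded everywhere.\<close>

lemma trig_poly_approximation:
  fixes h :: "(nat \<Rightarrow> real) \<Rightarrow> real"
  assumes h: "continuous_on UNIV h" "\<And>x. \<bar>h x\<bar> \<le> H" and "0 < L" "0 < \<delta>"
  obtains q where "(\<lambda>x. complex_of_real (q x)) \<in> trig_poly k" "\<And>x. \<bar>q x\<bar> \<le> H + \<delta>"
    "\<And>x. (\<And>j. j < k \<Longrightarrow> \<bar>x j\<bar> \<le> L) \<Longrightarrow> (\<And>j. j \<ge> k \<Longrightarrow> x j = 0) \<Longrightarrow> \<bar>h x - q x\<bar> < \<delta>"
proof -
  \<comment> \<open>The half-width \<open>L * (pi / 2)\<close> lets \<open>x j / L\<close> run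
    through the interval on which the sine is injective; width 0 pins the coordinates from
    \<open>k\<close> on.\<close>
  define c :: "nat \<Rightarrow> real" where "c j = (if j < k then L * (pi / 2) else 0)" for j
  define S where "S = {x :: nat \<Rightarrow> real. \<forall>j. x j \<in> {- c j .. c j}}"
  \<comment> \<open>\<open>r\<close> folds a sequence into the box without changing any
    \<open>sin (x j / L)\<close>. The invariance \<open>q (r x) = q x\<close>, built into
    \<open>R\<close>, carries a bound on the box to all sequences.\<close>
  define r where "r x j = (if j < k then L * arcsin (sin (x j / L)) else 0)" for x :: "nat \<Rightarrow> real" and j
  define R where "R = {q. (\<lambda>x. complex_of_real (q x)) \<in> trig_poly k \<and> (\<forall>x. q (r x) = q x)}"
  have sin_R: "(\<lambda>x. sin (x j / L)) \<in> R" if "j < k" for j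
    using that \<open>0 < L\<close> by (simp add: R_def trig_poly_sin r_def)
  have "L * (- (pi / 2)) \<le> L * arcsin (sin t) \<and> L * arcsin (sin t) \<le> L * (pi / 2)" for t
    using \<open>0 < L\<close> arcsin_bounded[of "sin t"] by (intro conjI mult_left_mono) auto
  then have r_S: "r x \<in> S" for x
    by (auto simp: S_def r_def c_def)
  interpret function_ring_on R S
  proof
    show "compact S" unfolding S_def by (rule compact_coordinate_box)
    show "continuous_on S f" if "f \<in> R" for f
    proof -
      have "continuous_on UNIV (\<lambda>x. Re (complex_of_real (f x)))"
        using that by (intro continuous_intros trig_poly_continuous[of _ k]) (auto simp: R_def)
      then show ?thesis
        by (auto intro: continuous_on_subset)
    qed
    show "(\<lambda>x. f x + g x) \<in> R" if "f \<in> R" "g \<in> R" for f g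
      using that trig_poly.add[of "\<lambda>x. complex_of_real (f x)" k "\<lambda>x. complex_of_real (g x)"]
      by (simp add: R_def)
    show "(\<lambda>x. f x * g x) \<in> R" if "f \<in> R" "g \<in> R" for f g
      using that trig_poly_mult[of "\<lambda>x. complex_of_real (f x)" k "\<lambda>x. complex_of_real (g x)"]
      by (simp add: R_def)
    show "(\<lambda>_. c) \<in> R" for c
      by (simp add: R_def trig_poly_const)
    show "\<exists>f\<in>R. f x \<noteq> f y" if xy: "x \<in> S" "y \<in> S" "x \<noteq> y" for x y
    proof -
      obtain j where j: "x j \<noteq> y j" using xy(3) by auto
      have bd: "x j \<in> {- c j .. c j}" "y j \<in> {- c j .. c j}"
        using xy by (auto simp: S_def)
      have "j < k" using j bd by (auto simp: c_def split: if_splits)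
      have "x j / L \<in> {-(pi/2)..pi/2}" "y j / L \<in> {-(pi/2)..pi/2}"
        using bd \<open>j < k\<close> \<open>0 < L\<close> by (auto simp: c_def field_simps)
      then have "sin (x j / L) \<noteq> sin (y j / L)"
        using sin_inj_pi[of "x j / L" "y j / L"] j \<open>0 < L\<close> by auto
      then show ?thesis by (rule bexI[OF _ sin_R[OF \<open>j < k\<close>]])
    qed
  qed
  obtain q where q: "q \<in> R" "\<And>x. x \<in> S \<Longrightarrow> \<bar>h x - q x\<bar> < \<delta>"
    using Stone_Weierstrass_basic[OF continuous_on_subset[OF h(1)] \<open>0 < \<delta>\<close>] by auto
  show thesis
  proof
    show "(\<lambda>x. complex_of_real (q x)) \<in> trig_poly k" using q by (simp add: R_def)
    show "\<bar>q x\<bar> \<le> H + \<delta>" for x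
    proof -
      have "\<bar>q (r x)\<bar> \<le> H + \<delta>"
        using q(2)[OF r_S, of x] h(2)[of "r x"] by linarith
      then show ?thesis using q(1) by (simp add: R_def)
    qed
    show "\<bar>h x - q x\<bar> < \<delta>" if "\<And>j. j < k \<Longrightarrow> \<bar>x j\<bar> \<le> L" "\<And>j. j \<ge> k \<Longrightarrow> x j = 0" for x
    proof (rule q(2))
      \<comment> \<open>As \<open>pi / 2\<close> exceeds 1, the box contains the cube of radius
        \<open>L\<close> on which the estimate is claimed.\<close>
      have "L * 1 \<le> L * (pi / 2)" using \<open>0 < L\<close> pi_ge_two by (intro mult_left_mono) auto
      then show "x \<in> S"
        using that by (fastforce simp: S_def c_def abs_le_iff not_less)
    qed
  qed
qed

text \<open>A trigonometric polynomial replaces \<open>h\<close> on a large cube, and its mean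
  converges by the assumption on exponentials. Outside the cube the second moments, bounded
  uniformly in \<open>n\<close>, pay for the difference by Chebyshev's inequality.\<close>

lemma cramer_wold:
  fixes W :: "nat \<Rightarrow> 'a \<Rightarrow> nat \<Rightarrow> real" and Z :: "'b \<Rightarrow> nat \<Rightarrow> real"
    and h :: "(nat \<Rightarrow> real) \<Rightarrow> real"
  assumes M: "prob_space M" and N: "prob_space N"
    and W[measurable]: "\<And>n. W n \<in> borel_measurable M" and Z[measurable]: "Z \<in> borel_measurable N"
    and W0: "\<And>n \<omega> j. \<omega> \<in> space M \<Longrightarrow> k \<le> j \<Longrightarrow> W n \<omega> j = 0"
    and Z0: "\<And>\<omega> j. \<omega> \<in> space N \<Longrightarrow> k \<le> j \<Longrightarrow> Z \<omega> j = 0"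
    and W2: "\<And>n j. integrable M (\<lambda>\<omega>. (W n \<omega> j)\<^sup>2)" "\<And>n j. (\<integral>\<omega>. (W n \<omega> j)\<^sup>2 \<partial>M) \<le> c"
    and Z2: "\<And>j. integrable N (\<lambda>\<omega>. (Z \<omega> j)\<^sup>2)" "\<And>j. (\<integral>\<omega>. (Z \<omega> j)\<^sup>2 \<partial>N) \<le> c"
    and conv: "\<And>a. (\<lambda>n. \<integral>\<omega>. cis (\<Sum>j<k. a j * W n \<omega> j) \<partial>M)
      \<longlonglongrightarrow> (\<integral>\<omega>. cis (\<Sum>j<k. a j * Z \<omega> j) \<partial>N)"
    and h: "continuous_on UNIV h" "\<And>x. \<bar>h x\<bar> \<le> H"
  shows "(\<lambda>n. \<integral>\<omega>. h (W n \<omega>) \<partial>M) \<longlonglongrightarrow> (\<integral>\<omega>. h (Z \<omega>) \<partial>N)"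
proof (rule LIMSEQ_I)
  fix e :: real assume "0 < e"
  define \<delta> where "\<delta> = e / 8"
  have "0 < \<delta>" using \<open>0 < e\<close> by (simp add: \<delta>_def)
  have "0 \<le> H" using h(2)[of undefined] by linarith
  have "0 \<le> c" by (rule order_trans[OF _ Z2(2)[of 0]]) simp
  \<comment> \<open>\<open>A / L\<^sup>2\<close> is the Chebyshev cost outside the cube: the bound
    \<open>2 * H + \<delta>\<close> on the difference times the sum of \<open>k\<close> second
    moments. The choice of \<open>L\<close> pushes it below \<delta>.\<close>
  define A where "A = (2 * H + \<delta>) * (real k * c)"
  have "0 \<le> A" using \<open>0 \<le> H\<close> \<open>0 < \<delta>\<close> \<open>0 \<le> c\<close> by (simp add: A_def)
  define L where "L = sqrt (A / \<delta> + 1)"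
  have "0 < L" using \<open>0 \<le> A\<close> \<open>0 < \<delta>\<close> by (simp add: L_def add_nonneg_pos)
  have L2: "L\<^sup>2 = A / \<delta> + 1" using \<open>0 \<le> A\<close> \<open>0 < \<delta>\<close> by (simp add: L_def)
  then have "A \<le> \<delta> * L\<^sup>2" using \<open>0 < \<delta>\<close> by (simp add: field_simps)
  then have AL: "A / L\<^sup>2 \<le> \<delta>" using \<open>0 < L\<close> by (simp add: divide_le_eq)
  obtain q where q: "(\<lambda>x. complex_of_real (q x)) \<in> trig_poly k" "\<And>x. \<bar>q x\<bar> \<le> H + \<delta>"
    "\<And>x. (\<And>j. j < k \<Longrightarrow> \<bar>x j\<bar> \<le> L) \<Longrightarrow> (\<And>j. j \<ge> k \<Longrightarrow> x j = 0) \<Longrightarrow> \<bar>h x - q x\<bar> < \<delta>"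
    using trig_poly_approximation[OF h \<open>0 < L\<close> \<open>0 < \<delta>\<close>] by blast
  have [measurable]: "h \<in> borel_measurable borel" using h(1) by (rule borel_measurable_continuous_onI)
  have "(\<lambda>x. Re (complex_of_real (q x))) \<in> borel_measurable borel"
    using trig_poly_measurable[OF q(1)] by measurable
  then have [measurable]: "q \<in> borel_measurable borel" by simp
  \<comment> \<open>If some coordinate exceeds \<open>L\<close>, the sum of squares over
    \<open>L\<^sup>2\<close> is at least 1; hence one integrable bound covers both cases.\<close>
  have pointwise: "\<bar>h x - q x\<bar> \<le> \<delta> + (2 * H + \<delta>) * (\<Sum>j<k. (x j)\<^sup>2) / L\<^sup>2" if "\<And>j. k \<le> j \<Longrightarrow> x j = 0" for x
  proof (cases "\<forall>j<k. \<bar>x j\<bar> \<le> L")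
    case True
    have "0 \<le> (2 * H + \<delta>) * (\<Sum>j<k. (x j)\<^sup>2) / L\<^sup>2"
      using \<open>0 \<le> H\<close> \<open>0 < \<delta>\<close> by (intro divide_nonneg_nonneg mult_nonneg_nonneg sum_nonneg) auto
    moreover have "\<bar>h x - q x\<bar> < \<delta>" using q(3)[of x] True that by blast
    ultimately show ?thesis by linarith
  next
    case False
    then obtain i where i: "i < k" "L < \<bar>x i\<bar>" by auto
    have "L\<^sup>2 \<le> (x i)\<^sup>2" using i \<open>0 < L\<close> by (metis abs_le_square_iff abs_of_pos less_imp_le)
    also have "\<dots> \<le> (\<Sum>j<k. (x j)\<^sup>2)" using i by (intro member_le_sum) auto
    finally have "1 \<le> (\<Sum>j<k. (x j)\<^sup>2) / L\<^sup>2" using \<open>0 < L\<close> by simp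
    then have "(2 * H + \<delta>) * 1 \<le> (2 * H + \<delta>) * ((\<Sum>j<k. (x j)\<^sup>2) / L\<^sup>2)"
      using \<open>0 \<le> H\<close> \<open>0 < \<delta>\<close> by (intro mult_left_mono) auto
    then show ?thesis using h(2)[of x] q(2)[of x] \<open>0 < \<delta>\<close> by simp
  qed
  \<comment> \<open>Stated for an arbitrary law, since it serves both the prelimit vectors and the
    limit.\<close>
  have gap: "\<bar>(\<integral>\<omega>. h (V \<omega>) \<partial>P) - (\<integral>\<omega>. q (V \<omega>) \<partial>P)\<bar> \<le> 2 * \<delta>"
    if P: "prob_space P" and [measurable]: "V \<in> borel_measurable P"
      and V0: "\<And>\<omega> j. \<omega> \<in> space P \<Longrightarrow> k \<le> j \<Longrightarrow> V \<omega> j = 0"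
      and V2: "\<And>j. integrable P (\<lambda>\<omega>. (V \<omega> j)\<^sup>2)" "\<And>j. (\<integral>\<omega>. (V \<omega> j)\<^sup>2 \<partial>P) \<le> c"
    for P :: "'c measure" and V
  proof -
    interpret P: prob_space P by fact
    have ih: "integrable P (\<lambda>\<omega>. h (V \<omega>))"
      using h(2) by (intro P.integrable_const_bound[of _ H]) auto
    have iq: "integrable P (\<lambda>\<omega>. q (V \<omega>))"
      using q(2) by (intro P.integrable_const_bound[of _ "H + \<delta>"]) auto
    have "\<bar>(\<integral>\<omega>. h (V \<omega>) \<partial>P) - (\<integral>\<omega>. q (V \<omega>) \<partial>P)\<bar> = \<bar>\<integral>\<omega>. h (V \<omega>) - q (V \<omega>) \<partial>P\<bar>"
      using ih iq by simp
    also have "\<dots> \<le> (\<integral>\<omega>. \<bar>h (V \<omega>) - q (V \<omega>)\<bar> \<partial>P)" by (rule integral_abs_bound)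
    also have "\<dots> \<le> (\<integral>\<omega>. \<delta> + (2 * H + \<delta>) * (\<Sum>j<k. (V \<omega> j)\<^sup>2) / L\<^sup>2 \<partial>P)"
      using ih iq V2(1) V0 by (intro integral_mono pointwise) auto
    also have "\<dots> = \<delta> + (2 * H + \<delta>) * (\<Sum>j<k. \<integral>\<omega>. (V \<omega> j)\<^sup>2 \<partial>P) / L\<^sup>2"
      using V2(1) by (simp add: P.prob_space)
    also have "\<dots> \<le> \<delta> + (2 * H + \<delta>) * (\<Sum>j<k. c) / L\<^sup>2"
      using V2(2) \<open>0 \<le> H\<close> \<open>0 < \<delta>\<close> by (intro add_left_mono divide_right_mono mult_left_mono sum_mono) auto
    also have "\<dots> = \<delta> + A / L\<^sup>2" by (simp add: A_def)
    finally show ?thesis using AL by linarith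
  qed
  have "(\<lambda>n. \<integral>\<omega>. complex_of_real (q (W n \<omega>)) \<partial>M) \<longlonglongrightarrow> (\<integral>\<omega>. complex_of_real (q (Z \<omega>)) \<partial>N)"
    by (rule trig_poly_convergence[OF M N q(1) W Z conv])
  then have "(\<lambda>n. \<integral>\<omega>. q (W n \<omega>) \<partial>M) \<longlonglongrightarrow> (\<integral>\<omega>. q (Z \<omega>) \<partial>N)"
    by (simp add: tendsto_of_real_iff)
  then obtain n0 where n0: "\<And>n. n \<ge> n0 \<Longrightarrow> norm ((\<integral>\<omega>. q (W n \<omega>) \<partial>M) - (\<integral>\<omega>. q (Z \<omega>) \<partial>N)) < \<delta>"
    using LIMSEQ_D \<open>0 < \<delta>\<close> by blast
  \<comment> \<open>Two gaps of \<open>2 * \<delta>\<close> and one error below \<delta> stay below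
    \<open>e = 8 * \<delta>\<close>.\<close>
  have "norm ((\<integral>\<omega>. h (W n \<omega>) \<partial>M) - (\<integral>\<omega>. h (Z \<omega>) \<partial>N)) < e" if "n \<ge> n0" for n
    using n0[OF that] gap[OF M W W0 W2(1) W2(2)[of n]] gap[OF N Z Z0 Z2] \<open>0 < e\<close>
    unfolding real_norm_def \<delta>_def by linarith
  then show "\<exists>no. \<forall>n\<ge>no. norm ((\<integral>\<omega>. h (W n \<omega>) \<partial>M) - (\<integral>\<omega>. h (Z \<omega>) \<partial>N)) < e" by blast
qed

section \<open>Weak convergence in spaces of bounded functions\<close>

declare mspace_funspace [simp del] mdist_funspace [simp del]

lemma mspace_linf: "f \<in> mspace (linf T) \<longleftrightarrow> f \<in> extensional T \<and> bounded (f ` T)"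
  by (simp add: mspace_funspace Met_TC.fspace_def)

lemma restrict_in_linf: "(\<And>t. t \<in> T \<Longrightarrow> \<bar>f t\<bar> \<le> B) \<Longrightarrow> (\<lambda>t\<in>T. f t) \<in> mspace (linf T)"
  by (auto simp: mspace_linf intro!: boundedI[of _ B])

lemma linf_dist_le:
  assumes "T \<noteq> {}" "f \<in> mspace (linf T)" "g \<in> mspace (linf T)" "\<And>t. t \<in> T \<Longrightarrow> \<bar>f t - g t\<bar> \<le> B"
  shows "mdist (linf T) f g \<le> B"
  using funspace_mdist_le[OF assms(2,3,1), of B] assms(4) by (auto simp: dist_real_def)

text \<open>The prelimit maps need not be measurable. A continuous \<open>f\<close> is therefore approximated from below by Lipschitz
  functions, whose values at step functions are measurable and close to their values at the process.\<close>

definition inf_convolution :: "'x metric \<Rightarrow> ('x \<Rightarrow> real) \<Rightarrow> real \<Rightarrow> 'x \<Rightarrow> real" where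
  "inf_convolution m f j x = (INF y\<in>mspace m. f y + j * mdist m x y)"

context
  fixes m :: "'x metric" and f :: "'x \<Rightarrow> real" and H j :: real
  assumes f_bound: "\<And>x. x \<in> mspace m \<Longrightarrow> \<bar>f x\<bar> \<le> H" and j: "0 \<le> j"
begin

lemma inf_convolution_bdd: "x \<in> mspace m \<Longrightarrow> bdd_below ((\<lambda>y. f y + j * mdist m x y) ` mspace m)"
proof (rule bdd_belowI2[where m = "- H"])
  fix y assume "y \<in> mspace m"
  moreover have "0 \<le> j * mdist m x y" using j by simp
  ultimately show "- H \<le> f y + j * mdist m x y" using f_bound[of y] by linarith
qed

lemma inf_convolution_le: "x \<in> mspace m \<Longrightarrow> y \<in> mspace m \<Longrightarrow> inf_convolution m f j x \<le> f y + j * mdist m x y"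
  unfolding inf_convolution_def by (rule cINF_lower[OF inf_convolution_bdd])

lemma inf_convolution_le_self: "x \<in> mspace m \<Longrightarrow> inf_convolution m f j x \<le> f x"
  using inf_convolution_le[of x x] Metric_space.mdist_zero[OF Metric_space_mspace_mdist, of x m] by simp

lemma inf_convolution_greatest:
  "x \<in> mspace m \<Longrightarrow> (\<And>y. y \<in> mspace m \<Longrightarrow> c \<le> f y + j * mdist m x y) \<Longrightarrow> c \<le> inf_convolution m f j x"
  unfolding inf_convolution_def by (rule cINF_greatest) auto

lemma inf_convolution_bound: "x \<in> mspace m \<Longrightarrow> \<bar>inf_convolution m f j x\<bar> \<le> H"
proof -
  assume x: "x \<in> mspace m"
  have "- H \<le> f y + j * mdist m x y" if "y \<in> mspace m" for y
    using f_bound[OF that] mult_nonneg_nonneg[OF j mdist_nonneg, of m x y] by linarith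
  then have "- H \<le> inf_convolution m f j x" by (rule inf_convolution_greatest[OF x])
  then show ?thesis using inf_convolution_le_self[OF x] f_bound[OF x] by linarith
qed

text \<open>By the triangle inequality the penalty changes by at most
  \<open>j * mdist m x y\<close>, uniformly in the point over which the infimum runs.\<close>

lemma inf_convolution_Lipschitz:
  assumes x: "x \<in> mspace m" and y: "y \<in> mspace m"
  shows "\<bar>inf_convolution m f j x - inf_convolution m f j y\<bar> \<le> j * mdist m x y"
proof -
  have *: "inf_convolution m f j x - j * mdist m x y \<le> inf_convolution m f j y"
    if x: "x \<in> mspace m" and y: "y \<in> mspace m" for x y
  proof (rule inf_convolution_greatest[OF y])
    fix z assume z: "z \<in> mspace m"
    have "j * mdist m x z \<le> j * (mdist m x y + mdist m y z)"
      using j x y z by (intro mult_left_mono mdist_triangle) auto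
    then show "inf_convolution m f j x - j * mdist m x y \<le> f z + j * mdist m y z"
      using inf_convolution_le[OF x z] by (simp add: distrib_left)
  qed
  show ?thesis using *[OF x y] *[OF y x] by (simp add: mdist_commute abs_le_iff)
qed

end

text \<open>Near \<open>x\<close> continuity keeps \<open>f\<close> above
  \<open>f x - e / 2\<close>; away from \<open>x\<close> the penalty outweighs the oscillation of
  \<open>f\<close>. So the infimum cannot fall far below \<open>f x\<close>.\<close>

lemma inf_convolution_tendsto:
  assumes f_bound: "\<And>x. x \<in> mspace m \<Longrightarrow> \<bar>f x\<bar> \<le> H" and x: "x \<in> mspace m"
    and f: "continuous_map (mtopology_of m) euclideanreal f"
  shows "(\<lambda>j. inf_convolution m f (real j) x) \<longlonglongrightarrow> f x"
proof (rule LIMSEQ_I)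
  fix e :: real assume "0 < e"
  interpret Metric_space "mspace m" "mdist m" by (rule Metric_space_mspace_mdist)
  define U where "U = {y \<in> topspace mtopology. f y \<in> {f x - e / 2<..<f x + e / 2}}"
  have "openin mtopology U"
    using f unfolding U_def mtopology_of_def by (rule openin_continuous_map_preimage) auto
  moreover have "x \<in> U" using x \<open>0 < e\<close> by (simp add: U_def)
  ultimately obtain r where r: "0 < r" "mball x r \<subseteq> U"
    by (auto simp: openin_mtopology)
  \<comment> \<open>From \<open>j0\<close> on, a point at distance \<open>r\<close> or more is
    charged more than \<open>2 * H\<close>.\<close>
  obtain j0 :: nat where j0: "2 * H / r < real j0" using reals_Archimedean2 by blast
  have "norm (inf_convolution m f (real j) x - f x) < e" if "j0 \<le> j" for j
  proof -
    have near: "f x - e / 2 \<le> f y + real j * mdist m x y" if y: "y \<in> mspace m" for y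
    proof (cases "mdist m x y < r")
      case True
      then have "y \<in> U" using r(2) x y by auto
      then have "f x - e / 2 \<le> f y" by (simp add: U_def)
      then show ?thesis by (rule add_increasing2[rotated]) simp
    next
      case False
      have "2 * H < real j0 * r" using j0 r(1) by (simp add: pos_divide_less_eq)
      also have "\<dots> \<le> real j * mdist m x y"
        using False \<open>j0 \<le> j\<close> r(1) by (intro mult_mono) auto
      finally show ?thesis using f_bound[OF x] f_bound[OF y] \<open>0 < e\<close> by linarith
    qed
    have "f x - e / 2 \<le> inf_convolution m f (real j) x"
      by (rule inf_convolution_greatest[where f = f, OF f_bound _ x near]) auto
    then show ?thesis
      using inf_convolution_le_self[where f = f and j = "real j", OF f_bound _ x] \<open>0 < e\<close> by (auto simp: abs_real_def)
  qed
  then show "\<exists>no. \<forall>j\<ge>no. norm (inf_convolution m f (real j) x - f x) < e" by blast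
qed

text \<open>For the indicator of \<open>S\<close> the infimum is the distance to the complement,
  capped at 1. Membership in an open set becomes positivity of a Lipschitz functional, which is how
  Borel measurability of the limit is obtained.\<close>

lemma open_inf_convolution:
  assumes S: "openin (mtopology_of m) S" and x: "x \<in> mspace m"
  shows "x \<in> S \<longleftrightarrow> 0 < inf_convolution m (indicat_real S) 1 x"
proof
  interpret Metric_space "mspace m" "mdist m" by (rule Metric_space_mspace_mdist)
  have bd: "\<bar>indicat_real S y\<bar> \<le> 1" for y by (simp add: indicator_def)
  assume "x \<in> S"
  then obtain r where r: "0 < r" "mball x r \<subseteq> S"
    using S by (auto simp: openin_mtopology mtopology_of_def)
  have "min 1 r \<le> inf_convolution m (indicat_real S) 1 x"
  proof (rule inf_convolution_greatest[where f = "indicat_real S", OF bd _ x])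
    fix y assume y: "y \<in> mspace m"
    show "min 1 r \<le> indicat_real S y + 1 * mdist m x y"
    proof (cases "y \<in> S")
      case False
      then have "r \<le> mdist m x y" using r x y by (auto simp: not_le subset_iff)
      then show ?thesis by (simp add: indicator_def min_le_iff_disj)
    qed (simp add: indicator_def min_le_iff_disj)
  qed auto
  then show "0 < inf_convolution m (indicat_real S) 1 x" using r by linarith
next
  have bd: "\<bar>indicat_real S y\<bar> \<le> 1" for y by (simp add: indicator_def)
  assume "0 < inf_convolution m (indicat_real S) 1 x"
  then show "x \<in> S" using inf_convolution_le_self[where f = "indicat_real S" and j = 1, OF bd _ x] by (cases "x \<in> S") auto
qed

text \<open>\<open>g + e\<close> is an admissible majorant, and every majorant of \<phi> dominates
  \<open>g - e\<close>. This is the bridge from outer expectations to ordinary integrals.\<close>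

lemma outer_expectation_near:
  assumes g: "integrable M g" and e: "integrable M e"
    and near: "\<And>\<omega>. \<omega> \<in> space M \<Longrightarrow> \<bar>\<phi> \<omega> - g \<omega>\<bar> \<le> e \<omega>"
  shows "\<bar>outer_expectation M \<phi> - integral\<^sup>L M g\<bar> \<le> integral\<^sup>L M e"
proof -
  let ?A = "{integral\<^sup>L M U | U. integrable M U \<and> (\<forall>\<omega>\<in>space M. \<phi> \<omega> \<le> U \<omega>)}"
  have lower: "integral\<^sup>L M g - integral\<^sup>L M e \<le> x" if x: "x \<in> ?A" for x
  proof -
    obtain U where U: "x = integral\<^sup>L M U" "integrable M U" "\<And>\<omega>. \<omega> \<in> space M \<Longrightarrow> \<phi> \<omega> \<le> U \<omega>"
      using x by blast
    have "integral\<^sup>L M g - integral\<^sup>L M e = (\<integral>\<omega>. g \<omega> - e \<omega> \<partial>M)" using g e by simp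
    also have "\<dots> \<le> integral\<^sup>L M U"
    proof (rule integral_mono)
      fix \<omega> assume "\<omega> \<in> space M"
      then show "g \<omega> - e \<omega> \<le> U \<omega>" using near[of \<omega>] U(3)[of \<omega>] by linarith
    qed (use g e U in auto)
    finally show ?thesis using U by simp
  qed
  have mem: "(\<integral>\<omega>. g \<omega> + e \<omega> \<partial>M) \<in> ?A"
  proof -
    have "\<phi> \<omega> \<le> g \<omega> + e \<omega>" if "\<omega> \<in> space M" for \<omega> using near[OF that] by linarith
    then show ?thesis using g e by (auto intro!: exI[of _ "\<lambda>\<omega>. g \<omega> + e \<omega>"])
  qed
  have "integral\<^sup>L M g - integral\<^sup>L M e \<le> Inf ?A"
    by (rule cInf_greatest) (use mem lower in auto)
  moreover have "Inf ?A \<le> (\<integral>\<omega>. g \<omega> + e \<omega> \<partial>M)"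
    by (rule cInf_lower[OF mem]) (use lower in \<open>auto simp: bdd_below_def\<close>)
  ultimately show ?thesis
    using g e by (simp add: outer_expectation_def abs_le_iff)
qed

text \<open>The bounds make the set of majorant integrals of \<psi> nonempty and that of \<phi>
  bounded below, which the monotonicity of a real \<open>Inf\<close> under inclusion
  presupposes.\<close>

lemma outer_expectation_mono:
  assumes "prob_space M"
    and le: "\<And>\<omega>. \<omega> \<in> space M \<Longrightarrow> \<phi> \<omega> \<le> \<psi> \<omega>"
    and bound: "\<And>\<omega>. \<omega> \<in> space M \<Longrightarrow> \<psi> \<omega> \<le> b" "\<And>\<omega>. \<omega> \<in> space M \<Longrightarrow> c \<le> \<phi> \<omega>"
  shows "outer_expectation M \<phi> \<le> outer_expectation M \<psi>"
proof -
  interpret prob_space M by fact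
  have "integral\<^sup>L M (\<lambda>_. b) \<in> {integral\<^sup>L M U | U. integrable M U \<and> (\<forall>\<omega>\<in>space M. \<psi> \<omega> \<le> U \<omega>)}"
    using bound(1) by (intro CollectI exI[of _ "\<lambda>_. b"]) simp
  moreover have "bdd_below {integral\<^sup>L M U | U. integrable M U \<and> (\<forall>\<omega>\<in>space M. \<phi> \<omega> \<le> U \<omega>)}"
  proof (rule bdd_belowI[of _ c], clarify)
    fix U assume U: "integrable M U" "\<forall>\<omega>\<in>space M. \<phi> \<omega> \<le> U \<omega>"
    have "(\<integral>\<omega>. c \<partial>M) \<le> integral\<^sup>L M U"
      using U bound(2) by (intro integral_mono) (auto intro: order_trans)
    then show "c \<le> integral\<^sup>L M U" by (simp add: prob_space)
  qed
  ultimately show ?thesis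
    unfolding outer_expectation_def using le
    by (intro cInf_superset_mono) (blast intro: order_trans)+
qed

text \<open>Places a finite vector inside \<open>linf T\<close>: \<open>i t\<close> is the cell of
  \<open>t\<close>, and \<open>x\<close> lists the values of the cells.\<close>

definition step_fun :: "'t set \<Rightarrow> ('t \<Rightarrow> nat) \<Rightarrow> (nat \<Rightarrow> real) \<Rightarrow> 't \<Rightarrow> real" where
  "step_fun T i x = (\<lambda>t\<in>T. x (i t))"

lemma step_fun_linf:
  assumes "\<And>t. t \<in> T \<Longrightarrow> i t < k"
  shows "step_fun T i x \<in> mspace (linf T)"
  unfolding step_fun_def
proof (rule restrict_in_linf)
  fix t assume "t \<in> T"
  then show "\<bar>x (i t)\<bar> \<le> (\<Sum>j<k. \<bar>x j\<bar>)"
    using assms by (intro member_le_sum[of _ _ "\<lambda>j. \<bar>x j\<bar>"]) auto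
qed

text \<open>The embedding of vectors is Lipschitz for the sum of the coordinate differences. A
  Lipschitz functional of the step function thus becomes a continuous function of finitely many
  coordinates, to which \<open>cramer_wold\<close> applies.\<close>

lemma step_fun_Lipschitz_continuous:
  fixes \<phi> :: "('t \<Rightarrow> real) \<Rightarrow> real"
  assumes T: "T \<noteq> {}" and i: "\<And>t. t \<in> T \<Longrightarrow> i t < k"
    and lip: "\<And>f g. f \<in> mspace (linf T) \<Longrightarrow> g \<in> mspace (linf T) \<Longrightarrow> \<bar>\<phi> f - \<phi> g\<bar> \<le> L * mdist (linf T) f g"
    and L: "0 \<le> L"
  shows "continuous_on UNIV (\<lambda>x. \<phi> (step_fun T i x))"
proof -
  have lip': "\<bar>\<phi> (step_fun T i x) - \<phi> (step_fun T i y)\<bar> \<le> L * (\<Sum>j<k. \<bar>x j - y j\<bar>)" for x y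
  proof -
    have "mdist (linf T) (step_fun T i x) (step_fun T i y) \<le> (\<Sum>j<k. \<bar>x j - y j\<bar>)"
    proof (rule linf_dist_le[OF T step_fun_linf step_fun_linf])
      fix t assume "t \<in> T"
      then show "\<bar>step_fun T i x t - step_fun T i y t\<bar> \<le> (\<Sum>j<k. \<bar>x j - y j\<bar>)"
        using i member_le_sum[of "i t" "{..<k}" "\<lambda>j. \<bar>x j - y j\<bar>"] by (auto simp: step_fun_def)
    qed (use i in auto)
    then have "L * mdist (linf T) (step_fun T i x) (step_fun T i y) \<le> L * (\<Sum>j<k. \<bar>x j - y j\<bar>)"
      using L by (rule mult_left_mono)
    with lip[OF step_fun_linf[of T i k x, OF i] step_fun_linf[of T i k y, OF i]]
    show ?thesis by linarith
  qed
  show ?thesis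
    unfolding continuous_on_def
  proof (intro ballI)
    fix x :: "nat \<Rightarrow> real"
    have coord: "((\<lambda>y. y j) \<longlongrightarrow> x j) (at x)" for j
      using continuous_on_product_coordinates[of j, where 'b = real] by (simp add: continuous_on_def)
    have "((\<lambda>y. L * (\<Sum>j<k. \<bar>y j - x j\<bar>)) \<longlongrightarrow> L * (\<Sum>j<k. \<bar>x j - x j\<bar>)) (at x)"
      by (intro tendsto_intros coord)
    then have "((\<lambda>y. L * (\<Sum>j<k. \<bar>y j - x j\<bar>)) \<longlongrightarrow> 0) (at x)" by simp
    then have "((\<lambda>y. \<phi> (step_fun T i y) - \<phi> (step_fun T i x)) \<longlongrightarrow> 0) (at x)"
      by (rule Lim_null_comparison[rotated]) (simp add: lip')
    then show "((\<lambda>y. \<phi> (step_fun T i y)) \<longlongrightarrow> \<phi> (step_fun T i x)) (at x within UNIV)"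
      by (simp add: LIM_zero_iff)
  qed
qed

text \<open>\<open>Zn\<close> is the process of interest, \<open>W\<close> a measurable
  approximation with error \<open>R\<close>, and \<open>pt k (idx k t)\<close> the point of the
  \<open>k\<close>-th net that stands for \<open>t\<close>. Tightness is expressed by moduli
  \<open>\<delta> k * Q n\<close> that hold at every sample point and whose means vanish as
  \<open>k\<close> grows, uniformly in \<open>n\<close>.\<close>

locale linf_approximation =
  fixes T :: "'t set" and M :: "'a measure" and N :: "'b measure"
    and pt :: "nat \<Rightarrow> nat \<Rightarrow> 't" and idx :: "nat \<Rightarrow> 't \<Rightarrow> nat"
    and Zn W :: "nat \<Rightarrow> 't \<Rightarrow> 'a \<Rightarrow> real" and Z :: "'t \<Rightarrow> 'b \<Rightarrow> real"
    and c :: real and \<delta> :: "nat \<Rightarrow> real" and Q R :: "nat \<Rightarrow> 'a \<Rightarrow> real" and Q' :: "'b \<Rightarrow> real"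
  assumes M: "prob_space M" and N: "prob_space N" and T: "T \<noteq> {}"
    and pt: "\<And>k j. pt k j \<in> T" and idx: "\<And>k t. t \<in> T \<Longrightarrow> idx k t \<le> k"
    and Zn_linf: "\<And>n \<omega>. \<omega> \<in> space M \<Longrightarrow> (\<lambda>t\<in>T. Zn n t \<omega>) \<in> mspace (linf T)"
    and Z_linf: "\<And>\<omega>. \<omega> \<in> space N \<Longrightarrow> (\<lambda>t\<in>T. Z t \<omega>) \<in> mspace (linf T)"
    and W_meas[measurable]: "\<And>n t. t \<in> T \<Longrightarrow> W n t \<in> borel_measurable M"
    and Z_meas[measurable]: "\<And>t. t \<in> T \<Longrightarrow> Z t \<in> borel_measurable N"
    and W2: "\<And>n t. t \<in> T \<Longrightarrow> integrable M (\<lambda>\<omega>. (W n t \<omega>)\<^sup>2)"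
      "\<And>n t. t \<in> T \<Longrightarrow> (\<integral>\<omega>. (W n t \<omega>)\<^sup>2 \<partial>M) \<le> c"
    and Z2: "\<And>t. t \<in> T \<Longrightarrow> integrable N (\<lambda>\<omega>. (Z t \<omega>)\<^sup>2)"
      "\<And>t. t \<in> T \<Longrightarrow> (\<integral>\<omega>. (Z t \<omega>)\<^sup>2 \<partial>N) \<le> c"
    and fdd: "\<And>k a. (\<lambda>n. \<integral>\<omega>. cis (\<Sum>j<Suc k. a j * W n (pt k j) \<omega>) \<partial>M)
      \<longlonglongrightarrow> (\<integral>\<omega>. cis (\<Sum>j<Suc k. a j * Z (pt k j) \<omega>) \<partial>N)"
    and \<delta>: "\<delta> \<longlonglongrightarrow> 0"
    and W_mod: "\<And>n k t \<omega>. \<omega> \<in> space M \<Longrightarrow> t \<in> T \<Longrightarrow> \<bar>W n t \<omega> - W n (pt k (idx k t)) \<omega>\<bar> \<le> \<delta> k * Q n \<omega>"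
    and Z_mod: "\<And>k t \<omega>. \<omega> \<in> space N \<Longrightarrow> t \<in> T \<Longrightarrow> \<bar>Z t \<omega> - Z (pt k (idx k t)) \<omega>\<bar> \<le> \<delta> k * Q' \<omega>"
    and Q: "\<And>n. integrable M (Q n)" "\<And>n. \<bar>\<integral>\<omega>. Q n \<omega> \<partial>M\<bar> \<le> c"
    and rem: "\<And>n t \<omega>. \<omega> \<in> space M \<Longrightarrow> t \<in> T \<Longrightarrow> \<bar>Zn n t \<omega> - W n t \<omega>\<bar> \<le> R n \<omega>"
    and R: "\<And>n. integrable M (R n)" "(\<lambda>n. \<integral>\<omega>. R n \<omega> \<partial>M) \<longlonglongrightarrow> 0"
begin

abbreviation Zfun :: "'b \<Rightarrow> 't \<Rightarrow> real" where "Zfun \<omega> \<equiv> (\<lambda>t\<in>T. Z t \<omega>)"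

definition Wvec :: "nat \<Rightarrow> nat \<Rightarrow> 'a \<Rightarrow> nat \<Rightarrow> real" where
  "Wvec k n \<omega> j = (if j < Suc k then W n (pt k j) \<omega> else 0)"

definition Zvec :: "nat \<Rightarrow> 'b \<Rightarrow> nat \<Rightarrow> real" where
  "Zvec k \<omega> j = (if j < Suc k then Z (pt k j) \<omega> else 0)"

lemma Wvec_measurable[measurable]: "Wvec k n \<in> borel_measurable M"
  by (rule measurable_coordinatewise_then_product) (simp add: Wvec_def pt)

lemma Zvec_measurable[measurable]: "Zvec k \<in> borel_measurable N"
  by (rule measurable_coordinatewise_then_product) (simp add: Zvec_def pt)

context
  fixes \<phi> :: "('t \<Rightarrow> real) \<Rightarrow> real" and L H :: real
  assumes lip: "\<And>f g. f \<in> mspace (linf T) \<Longrightarrow> g \<in> mspace (linf T) \<Longrightarrow> \<bar>\<phi> f - \<phi> g\<bar> \<le> L * mdist (linf T) f g"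
    and L: "0 \<le> L" and bd: "\<And>f. f \<in> mspace (linf T) \<Longrightarrow> \<bar>\<phi> f\<bar> \<le> H"
begin

abbreviation \<phi>s :: "nat \<Rightarrow> (nat \<Rightarrow> real) \<Rightarrow> real" where "\<phi>s k x \<equiv> \<phi> (step_fun T (idx k) x)"

lemma idx_less: "t \<in> T \<Longrightarrow> idx k t < Suc k" using idx by (simp add: less_Suc_eq_le)

lemma \<phi>s_continuous: "continuous_on UNIV (\<phi>s k)"
  by (rule step_fun_Lipschitz_continuous[OF T idx_less lip L]) auto

lemma \<phi>s_measurable[measurable]: "\<phi>s k \<in> borel_measurable borel"
  by (rule borel_measurable_continuous_onI[OF \<phi>s_continuous])

lemma \<phi>s_bound: "\<bar>\<phi>s k x\<bar> \<le> H"
  by (rule bd[OF step_fun_linf[OF idx_less]])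

lemma \<phi>_Z_near: "\<omega> \<in> space N \<Longrightarrow> \<bar>\<phi> (Zfun \<omega>) - \<phi>s k (Zvec k \<omega>)\<bar> \<le> L * (\<delta> k * Q' \<omega>)"
proof -
  assume \<omega>: "\<omega> \<in> space N"
  have "mdist (linf T) (Zfun \<omega>) (step_fun T (idx k) (Zvec k \<omega>)) \<le> \<delta> k * Q' \<omega>"
    using Z_mod[OF \<omega>] idx_less
    by (intro linf_dist_le[OF T Z_linf[OF \<omega>] step_fun_linf[OF idx_less]]) (auto simp: step_fun_def Zvec_def)
  then show ?thesis
    using lip[OF Z_linf[OF \<omega>] step_fun_linf[of T "idx k" "Suc k" "Zvec k \<omega>", OF idx_less]] L
    by (meson mult_left_mono order_trans)
qed

lemma \<phi>_Zn_near:
  "\<omega> \<in> space M \<Longrightarrow> \<bar>\<phi> (\<lambda>t\<in>T. Zn n t \<omega>) - \<phi>s k (Wvec k n \<omega>)\<bar> \<le> L * (R n \<omega> + \<delta> k * Q n \<omega>)"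
proof -
  assume \<omega>: "\<omega> \<in> space M"
  have "\<bar>Zn n t \<omega> - W n (pt k (idx k t)) \<omega>\<bar> \<le> R n \<omega> + \<delta> k * Q n \<omega>" if "t \<in> T" for t
    using W_mod[OF \<omega> that, of n k] rem[OF \<omega> that, of n] by linarith
  then have "mdist (linf T) (\<lambda>t\<in>T. Zn n t \<omega>) (step_fun T (idx k) (Wvec k n \<omega>)) \<le> R n \<omega> + \<delta> k * Q n \<omega>"
    using idx_less
    by (intro linf_dist_le[OF T Zn_linf[OF \<omega>] step_fun_linf[OF idx_less]]) (auto simp: step_fun_def Wvec_def)
  then show ?thesis
    using lip[OF Zn_linf[OF \<omega>, of n] step_fun_linf[of T "idx k" "Suc k" "Wvec k n \<omega>", OF idx_less]] L
    by (meson mult_left_mono order_trans)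
qed

lemma \<phi>_Z_limit: "\<omega> \<in> space N \<Longrightarrow> (\<lambda>k. \<phi>s k (Zvec k \<omega>)) \<longlonglongrightarrow> \<phi> (Zfun \<omega>)"
proof -
  assume \<omega>: "\<omega> \<in> space N"
  have "(\<lambda>k. L * (\<delta> k * Q' \<omega>)) \<longlonglongrightarrow> L * (0 * Q' \<omega>)" by (intro tendsto_intros \<delta>)
  then have "(\<lambda>k. L * (\<delta> k * Q' \<omega>)) \<longlonglongrightarrow> 0" by simp
  then have "(\<lambda>k. \<phi>s k (Zvec k \<omega>) - \<phi> (Zfun \<omega>)) \<longlonglongrightarrow> 0"
    by (rule Lim_null_comparison[rotated]) (use \<phi>_Z_near[OF \<omega>] in \<open>simp add: abs_minus_commute\<close>)
  then show ?thesis by (simp add: LIM_zero_iff)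
qed

text \<open>A pointwise limit, along the nets, of continuous functions of finitely many values of
  \<open>Z\<close>.\<close>

lemma \<phi>_Z_measurable: "(\<lambda>\<omega>. \<phi> (Zfun \<omega>)) \<in> borel_measurable N"
  by (rule borel_measurable_LIMSEQ_real[OF \<phi>_Z_limit]) auto

lemma \<phi>_integral_limit: "(\<lambda>k. \<integral>\<omega>. \<phi>s k (Zvec k \<omega>) \<partial>N) \<longlonglongrightarrow> (\<integral>\<omega>. \<phi> (Zfun \<omega>) \<partial>N)"
proof -
  interpret N: prob_space N by (rule N)
  show ?thesis
    by (rule integral_dominated_convergence[where w = "\<lambda>_. H"])
      (auto intro: \<phi>_Z_measurable \<phi>_Z_limit \<phi>s_bound)
qed

lemma \<phi>_fdd: "(\<lambda>n. \<integral>\<omega>. \<phi>s k (Wvec k n \<omega>) \<partial>M) \<longlonglongrightarrow> (\<integral>\<omega>. \<phi>s k (Zvec k \<omega>) \<partial>N)"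
\<comment> \<open>Coordinates beyond the net are zero, so the common moment bound has to be
  nonnegative as well; hence \<open>max c 0\<close>.\<close>
proof (rule cramer_wold[OF M N, where k = "Suc k" and c = "max c 0" and W = "Wvec k" and Z = "Zvec k" and h = "\<phi>s k" and H = H])
  show "integrable M (\<lambda>\<omega>. (Wvec k n \<omega> j)\<^sup>2)" for n j
    using W2(1)[OF pt] by (cases "j < Suc k") (simp_all add: Wvec_def)
  show "(\<integral>\<omega>. (Wvec k n \<omega> j)\<^sup>2 \<partial>M) \<le> max c 0" for n j
    using W2(2)[OF pt] by (cases "j < Suc k") (simp_all add: Wvec_def le_max_iff_disj)
  show "integrable N (\<lambda>\<omega>. (Zvec k \<omega> j)\<^sup>2)" for j
    using Z2(1)[OF pt] by (cases "j < Suc k") (simp_all add: Zvec_def)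
  show "(\<integral>\<omega>. (Zvec k \<omega> j)\<^sup>2 \<partial>N) \<le> max c 0" for j
    using Z2(2)[OF pt] by (cases "j < Suc k") (simp_all add: Zvec_def le_max_iff_disj)
  show "(\<lambda>n. CLINT \<omega>|M. cis (\<Sum>j<Suc k. a j * Wvec k n \<omega> j))
     \<longlonglongrightarrow> (CLINT \<omega>|N. cis (\<Sum>j<Suc k. a j * Zvec k \<omega> j))" for a
    using fdd[of a k] unfolding Wvec_def Zvec_def by (simp del: sum.lessThan_Suc cong: sum.cong_simp)
  show "\<bar>\<phi>s k x\<bar> \<le> H" for x by (rule \<phi>s_bound)
qed (auto simp: Wvec_def Zvec_def intro: \<phi>s_continuous)

text \<open>Three errors add up: from \<open>Zn\<close> to its step function, controlled by
  \<open>R\<close> and by \<delta> uniformly in \<open>n\<close>; between the two step functions,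
  vanishing in \<open>n\<close> for fixed \<open>k\<close>; and from the limit to its own step
  function. The level \<open>k\<close> of the net is therefore fixed before
  \<open>n\<close>.\<close>

lemma outer_convergence:
  "(\<lambda>n. outer_expectation M (\<lambda>\<omega>. \<phi> (\<lambda>t\<in>T. Zn n t \<omega>))) \<longlonglongrightarrow> (\<integral>\<omega>. \<phi> (Zfun \<omega>) \<partial>N)"
proof (rule LIMSEQ_I)
  fix e :: real assume "0 < e"
  interpret M: prob_space M by (rule M)
  have near: "\<bar>outer_expectation M (\<lambda>\<omega>. \<phi> (\<lambda>t\<in>T. Zn n t \<omega>)) - (\<integral>\<omega>. \<phi>s k (Wvec k n \<omega>) \<partial>M)\<bar>
      \<le> L * (\<integral>\<omega>. R n \<omega> \<partial>M) + L * (\<bar>\<delta> k\<bar> * c)" for k n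
  proof -
    have "\<bar>outer_expectation M (\<lambda>\<omega>. \<phi> (\<lambda>t\<in>T. Zn n t \<omega>)) - (\<integral>\<omega>. \<phi>s k (Wvec k n \<omega>) \<partial>M)\<bar>
      \<le> (\<integral>\<omega>. L * (R n \<omega> + \<delta> k * Q n \<omega>) \<partial>M)"
    proof (rule outer_expectation_near[OF _ _ \<phi>_Zn_near])
      show "integrable M (\<lambda>\<omega>. \<phi>s k (Wvec k n \<omega>))"
        by (rule M.integrable_const_bound[of _ H]) (auto intro!: \<phi>s_bound)
    qed (use Q(1) R(1) in auto)
    also have "\<dots> = L * (\<integral>\<omega>. R n \<omega> \<partial>M) + L * (\<delta> k * (\<integral>\<omega>. Q n \<omega> \<partial>M))"
      using Q(1) R(1) by (simp add: distrib_left)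
    also have "\<delta> k * (\<integral>\<omega>. Q n \<omega> \<partial>M) \<le> \<bar>\<delta> k\<bar> * c"
      using Q(2)[of n] by (metis abs_ge_self abs_ge_zero abs_mult mult_left_mono order_trans)
    finally show ?thesis using L by (simp add: mult_left_mono)
  qed
  have e4: "0 < e / 4" using \<open>0 < e\<close> by simp
  have "(\<lambda>k. L * (\<bar>\<delta> k\<bar> * c)) \<longlonglongrightarrow> L * (\<bar>0\<bar> * c)" by (intro tendsto_intros \<delta>)
  then have "(\<lambda>k. L * (\<bar>\<delta> k\<bar> * c)) \<longlonglongrightarrow> 0" by simp
  from tendstoD[OF this e4] have "\<forall>\<^sub>F k in sequentially. norm (L * (\<bar>\<delta> k\<bar> * c)) < e / 4"
    by (simp only: dist_norm diff_zero)
  moreover from tendstoD[OF \<phi>_integral_limit e4]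
  have "\<forall>\<^sub>F k in sequentially. \<bar>(\<integral>\<omega>. \<phi>s k (Zvec k \<omega>) \<partial>N) - (\<integral>\<omega>. \<phi> (Zfun \<omega>) \<partial>N)\<bar> < e / 4"
    by (simp only: dist_real_def)
  ultimately have "\<forall>\<^sub>F k in sequentially. norm (L * (\<bar>\<delta> k\<bar> * c)) < e / 4 \<and>
      \<bar>(\<integral>\<omega>. \<phi>s k (Zvec k \<omega>) \<partial>N) - (\<integral>\<omega>. \<phi> (Zfun \<omega>) \<partial>N)\<bar> < e / 4"
    by (rule eventually_conj)
  then obtain k where k: "norm (L * (\<bar>\<delta> k\<bar> * c)) < e / 4"
      "\<bar>(\<integral>\<omega>. \<phi>s k (Zvec k \<omega>) \<partial>N) - (\<integral>\<omega>. \<phi> (Zfun \<omega>) \<partial>N)\<bar> < e / 4"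
    using eventually_happens'[OF sequentially_bot] by blast
  have "(\<lambda>n. L * (\<integral>\<omega>. R n \<omega> \<partial>M)) \<longlonglongrightarrow> L * 0" by (intro tendsto_intros R)
  then have "(\<lambda>n. L * (\<integral>\<omega>. R n \<omega> \<partial>M)) \<longlonglongrightarrow> 0" by simp
  from tendstoD[OF this e4] have "\<forall>\<^sub>F n in sequentially. \<bar>L * (\<integral>\<omega>. R n \<omega> \<partial>M)\<bar> < e / 4"
    by (simp only: dist_real_def diff_zero)
  moreover from tendstoD[OF \<phi>_fdd[of k] e4]
  have "\<forall>\<^sub>F n in sequentially. \<bar>(\<integral>\<omega>. \<phi>s k (Wvec k n \<omega>) \<partial>M) - (\<integral>\<omega>. \<phi>s k (Zvec k \<omega>) \<partial>N)\<bar> < e / 4"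
    by (simp only: dist_real_def)
  ultimately have "\<forall>\<^sub>F n in sequentially.
      norm (outer_expectation M (\<lambda>\<omega>. \<phi> (\<lambda>t\<in>T. Zn n t \<omega>)) - (\<integral>\<omega>. \<phi> (Zfun \<omega>) \<partial>N)) < e"
  proof eventually_elim
    case (elim n)
    then show ?case using near[of n k] k unfolding real_norm_def by linarith
  qed
  then show "\<exists>no. \<forall>n\<ge>no. norm (outer_expectation M (\<lambda>\<omega>. \<phi> (\<lambda>t\<in>T. Zn n t \<omega>)) - (\<integral>\<omega>. \<phi> (Zfun \<omega>) \<partial>N)) < e"
    by (simp add: eventually_sequentially)
qed

end

text \<open>Outer expectations are monotone but not additive, so \<open>f\<close> is squeezed
  between two Lipschitz functionals; the upper one comes from the lower approximation of
  \<open>- f\<close>.\<close>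

lemma outer_convergence_continuous:
  assumes f: "continuous_map (mtopology_of (linf T)) euclideanreal f"
    and H: "\<And>x. x \<in> mspace (linf T) \<Longrightarrow> \<bar>f x\<bar> \<le> H"
  shows "(\<lambda>n. outer_expectation M (\<lambda>\<omega>. f (\<lambda>t\<in>T. Zn n t \<omega>))) \<longlonglongrightarrow> (\<integral>\<omega>. f (Zfun \<omega>) \<partial>N)"
proof -
  let ?J = "inf_convolution (linf T)"
  \<comment> \<open>Dominated convergence under the limit law selects a Lipschitz constant
    \<open>j\<close> for which the minorant loses less than \<open>e\<close> in the mean.\<close>
  have half: "\<exists>\<psi> L. 0 \<le> L \<and>
      (\<forall>f\<in>mspace (linf T). \<forall>g\<in>mspace (linf T). \<bar>\<psi> f - \<psi> g\<bar> \<le> L * mdist (linf T) f g) \<and>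
      (\<forall>x\<in>mspace (linf T). \<bar>\<psi> x\<bar> \<le> H \<and> \<psi> x \<le> g x) \<and>
      (\<integral>\<omega>. g (Zfun \<omega>) \<partial>N) - e < (\<integral>\<omega>. \<psi> (Zfun \<omega>) \<partial>N)"
    if "0 < e" and g: "continuous_map (mtopology_of (linf T)) euclideanreal g"
      and gH: "\<And>x. x \<in> mspace (linf T) \<Longrightarrow> \<bar>g x\<bar> \<le> H" for e g
  proof -
    interpret N: prob_space N by (rule N)
    have meas: "(\<lambda>\<omega>. ?J g (real j) (Zfun \<omega>)) \<in> borel_measurable N" for j
      by (rule \<phi>_Z_measurable[OF inf_convolution_Lipschitz[where f = g, OF gH] _ inf_convolution_bound[where f = g, OF gH]]) auto
    have lim: "(\<lambda>j. ?J g (real j) (Zfun \<omega>)) \<longlonglongrightarrow> g (Zfun \<omega>)" if "\<omega> \<in> space N" for \<omega>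
      by (rule inf_convolution_tendsto[where f = g, OF gH Z_linf[OF that] g]) 
    have "(\<lambda>j. \<integral>\<omega>. ?J g (real j) (Zfun \<omega>) \<partial>N) \<longlonglongrightarrow> (\<integral>\<omega>. g (Zfun \<omega>) \<partial>N)"
      by (rule integral_dominated_convergence[where w = "\<lambda>_. H"])
        (auto intro: meas lim borel_measurable_LIMSEQ_real[OF lim meas]
          intro!: inf_convolution_bound[where f = g, OF gH] Z_linf)
    then have "\<forall>\<^sub>F j in sequentially. \<bar>(\<integral>\<omega>. ?J g (real j) (Zfun \<omega>) \<partial>N) - (\<integral>\<omega>. g (Zfun \<omega>) \<partial>N)\<bar> < e"
      using \<open>0 < e\<close> by (simp add: tendsto_iff dist_real_def)
    then obtain j :: nat where j: "\<bar>(\<integral>\<omega>. ?J g (real j) (Zfun \<omega>) \<partial>N) - (\<integral>\<omega>. g (Zfun \<omega>) \<partial>N)\<bar> < e"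
      using eventually_happens'[OF sequentially_bot] by blast
    show ?thesis
    proof (intro exI[of _ "?J g (real j)"] exI[of _ "real j"] conjI ballI)
      show "(\<integral>\<omega>. g (Zfun \<omega>) \<partial>N) - e < (\<integral>\<omega>. ?J g (real j) (Zfun \<omega>) \<partial>N)" using j by linarith
    qed (simp_all add: inf_convolution_Lipschitz[where f = g, OF gH] inf_convolution_bound[where f = g, OF gH]
        inf_convolution_le_self[where f = g, OF gH])
  qed
  show ?thesis
  proof (rule LIMSEQ_I)
    fix e :: real assume "0 < e"
    have e2: "0 < e / 2" using \<open>0 < e\<close> by simp
    obtain \<psi> L where \<psi>0: "0 \<le> L"
        "\<forall>f\<in>mspace (linf T). \<forall>g\<in>mspace (linf T). \<bar>\<psi> f - \<psi> g\<bar> \<le> L * mdist (linf T) f g"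
        "\<forall>x\<in>mspace (linf T). \<bar>\<psi> x\<bar> \<le> H \<and> \<psi> x \<le> f x"
        "(\<integral>\<omega>. f (Zfun \<omega>) \<partial>N) - e / 2 < (\<integral>\<omega>. \<psi> (Zfun \<omega>) \<partial>N)"
      using half[OF e2 f H] by blast
    then have \<psi>: "0 \<le> L"
        "\<And>f g. f \<in> mspace (linf T) \<Longrightarrow> g \<in> mspace (linf T) \<Longrightarrow> \<bar>\<psi> f - \<psi> g\<bar> \<le> L * mdist (linf T) f g"
        "\<And>x. x \<in> mspace (linf T) \<Longrightarrow> \<bar>\<psi> x\<bar> \<le> H" "\<And>x. x \<in> mspace (linf T) \<Longrightarrow> \<psi> x \<le> f x"
        "(\<integral>\<omega>. f (Zfun \<omega>) \<partial>N) - e / 2 < (\<integral>\<omega>. \<psi> (Zfun \<omega>) \<partial>N)"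
      by blast+
    have f': "continuous_map (mtopology_of (linf T)) euclideanreal (\<lambda>x. - f x)"
      using f by (rule continuous_map_minus)
    have H': "\<bar>- f x\<bar> \<le> H" if "x \<in> mspace (linf T)" for x using H[OF that] by simp
    obtain \<xi> K where \<xi>0: "0 \<le> K"
        "\<forall>f\<in>mspace (linf T). \<forall>g\<in>mspace (linf T). \<bar>\<xi> f - \<xi> g\<bar> \<le> K * mdist (linf T) f g"
        "\<forall>x\<in>mspace (linf T). \<bar>\<xi> x\<bar> \<le> H \<and> \<xi> x \<le> - f x"
        "(\<integral>\<omega>. (- f (Zfun \<omega>)) \<partial>N) - e / 2 < (\<integral>\<omega>. \<xi> (Zfun \<omega>) \<partial>N)"
      using half[OF e2 f' H'] by blast
    then have \<xi>: "0 \<le> K"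
        "\<And>f g. f \<in> mspace (linf T) \<Longrightarrow> g \<in> mspace (linf T) \<Longrightarrow> \<bar>\<xi> f - \<xi> g\<bar> \<le> K * mdist (linf T) f g"
        "\<And>x. x \<in> mspace (linf T) \<Longrightarrow> \<bar>\<xi> x\<bar> \<le> H" "\<And>x. x \<in> mspace (linf T) \<Longrightarrow> \<xi> x \<le> - f x"
        "(\<integral>\<omega>. (- f (Zfun \<omega>)) \<partial>N) - e / 2 < (\<integral>\<omega>. \<xi> (Zfun \<omega>) \<partial>N)"
      by blast+
    have conv1: "(\<lambda>n. outer_expectation M (\<lambda>\<omega>. \<psi> (\<lambda>t\<in>T. Zn n t \<omega>))) \<longlonglongrightarrow> (\<integral>\<omega>. \<psi> (Zfun \<omega>) \<partial>N)"
      by (rule outer_convergence[OF \<psi>(2,1,3)])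
    have conv2: "(\<lambda>n. outer_expectation M (\<lambda>\<omega>. - \<xi> (\<lambda>t\<in>T. Zn n t \<omega>))) \<longlonglongrightarrow> (\<integral>\<omega>. - \<xi> (Zfun \<omega>) \<partial>N)"
    proof (rule outer_convergence[of "\<lambda>x. - \<xi> x", OF _ \<xi>(1)])
      show "\<bar>- \<xi> f - - \<xi> g\<bar> \<le> K * mdist (linf T) f g"
        if "f \<in> mspace (linf T)" "g \<in> mspace (linf T)" for f g
        using \<xi>(2)[OF that] by (simp add: abs_minus_commute)
    qed (use \<xi>(3) in auto)
    have le1: "outer_expectation M (\<lambda>\<omega>. \<psi> (\<lambda>t\<in>T. Zn n t \<omega>)) \<le> outer_expectation M (\<lambda>\<omega>. f (\<lambda>t\<in>T. Zn n t \<omega>))" for n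
    proof (rule outer_expectation_mono[OF M, where b = H and c = "-H"])
      fix \<omega> assume "\<omega> \<in> space M"
      note Zn = Zn_linf[OF this, of n]
      show "\<psi> (\<lambda>t\<in>T. Zn n t \<omega>) \<le> f (\<lambda>t\<in>T. Zn n t \<omega>)" by (rule \<psi>(4)[OF Zn])
      show "f (\<lambda>t\<in>T. Zn n t \<omega>) \<le> H" using H[OF Zn] by linarith
      show "- H \<le> \<psi> (\<lambda>t\<in>T. Zn n t \<omega>)" using \<psi>(3)[OF Zn] by linarith
    qed
    have le2: "outer_expectation M (\<lambda>\<omega>. f (\<lambda>t\<in>T. Zn n t \<omega>)) \<le> outer_expectation M (\<lambda>\<omega>. - \<xi> (\<lambda>t\<in>T. Zn n t \<omega>))" for n
    proof (rule outer_expectation_mono[OF M, where b = H and c = "-H"])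
      fix \<omega> assume "\<omega> \<in> space M"
      note Zn = Zn_linf[OF this, of n]
      show "f (\<lambda>t\<in>T. Zn n t \<omega>) \<le> - \<xi> (\<lambda>t\<in>T. Zn n t \<omega>)" using \<xi>(4)[OF Zn] by linarith
      show "- H \<le> f (\<lambda>t\<in>T. Zn n t \<omega>)" using H[OF Zn] by linarith
      show "- \<xi> (\<lambda>t\<in>T. Zn n t \<omega>) \<le> H" using \<xi>(3)[OF Zn] by linarith
    qed
    have "\<forall>\<^sub>F n in sequentially. \<bar>outer_expectation M (\<lambda>\<omega>. \<psi> (\<lambda>t\<in>T. Zn n t \<omega>)) - (\<integral>\<omega>. \<psi> (Zfun \<omega>) \<partial>N)\<bar> < e / 2"
      using tendstoD[OF conv1 e2] by (simp only: dist_real_def)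
    moreover have "\<forall>\<^sub>F n in sequentially. \<bar>outer_expectation M (\<lambda>\<omega>. - \<xi> (\<lambda>t\<in>T. Zn n t \<omega>)) - (\<integral>\<omega>. - \<xi> (Zfun \<omega>) \<partial>N)\<bar> < e / 2"
      using tendstoD[OF conv2 e2] by (simp only: dist_real_def)
    ultimately have "\<forall>\<^sub>F n in sequentially.
        norm (outer_expectation M (\<lambda>\<omega>. f (\<lambda>t\<in>T. Zn n t \<omega>)) - (\<integral>\<omega>. f (Zfun \<omega>) \<partial>N)) < e"
    proof eventually_elim
      case (elim n)
      then show ?case
        using le1[of n] le2[of n] \<psi>(5) \<xi>(5)[unfolded Bochner_Integration.integral_minus]
        unfolding real_norm_def Bochner_Integration.integral_minus by linarith
    qed
    then show "\<exists>no. \<forall>n\<ge>no. norm (outer_expectation M (\<lambda>\<omega>. f (\<lambda>t\<in>T. Zn n t \<omega>)) - (\<integral>\<omega>. f (Zfun \<omega>) \<partial>N)) < e"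
      by (simp add: eventually_sequentially)
  qed
qed

theorem weak_convergence: "weakly_converges_linf M Zn T N Z"
  unfolding weakly_converges_linf_def
proof (intro conjI allI ballI impI)
  show "(\<lambda>t\<in>T. Zn n t \<omega>) \<in> mspace (linf T)" if "\<omega> \<in> space M" for n \<omega> by (rule Zn_linf[OF that])
  show "(\<lambda>t\<in>T. Z t \<omega>) \<in> mspace (linf T)" if "\<omega> \<in> space N" for \<omega> by (rule Z_linf[OF that])
  show "{\<omega> \<in> space N. Zfun \<omega> \<in> S} \<in> sets N" if S: "openin (mtopology_of (linf T)) S" for S
  proof -
    have bd: "\<bar>indicat_real S y\<bar> \<le> 1" for y by (simp add: indicator_def)
    have [measurable]: "(\<lambda>\<omega>. inf_convolution (linf T) (indicat_real S) 1 (Zfun \<omega>)) \<in> borel_measurable N"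
      by (rule \<phi>_Z_measurable[OF inf_convolution_Lipschitz[where f = "indicat_real S", OF bd] _ inf_convolution_bound[where f = "indicat_real S", OF bd]]) auto
    have "{\<omega> \<in> space N. Zfun \<omega> \<in> S} = {\<omega> \<in> space N. 0 < inf_convolution (linf T) (indicat_real S) 1 (Zfun \<omega>)}"
      using open_inf_convolution[OF S Z_linf] by blast
    also have "\<dots> \<in> sets N" by measurable
    finally show ?thesis .
  qed
  fix f :: "('t \<Rightarrow> real) \<Rightarrow> real"
  assume f: "continuous_map (mtopology_of (linf T)) euclideanreal f \<and> bounded (f ` mspace (linf T))"
  then obtain H where "\<And>x. x \<in> mspace (linf T) \<Longrightarrow> \<bar>f x\<bar> \<le> H"
    by (auto simp: bounded_iff)
  then show "(\<lambda>n. outer_expectation M (\<lambda>\<omega>. f (\<lambda>t\<in>T. Zn n t \<omega>))) \<longlonglongrightarrow> (\<integral>\<omega>. f (Zfun \<omega>) \<partial>N)"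
    using f outer_convergence_continuous by blast
qed

end

section \<open>Normal variables and the central limit theorem\<close>

lemma char_eq_cis:
  assumes "X \<in> borel_measurable M"
  shows "char (distr M borel X) t = (\<integral>\<omega>. cis (t * X \<omega>) \<partial>M)"
  using assms by (simp add: char_def integral_distr cis_conv_exp)

lemma char_std_normal_cis:
  assumes "prob_space M" "distributed M lborel X std_normal_density"
  shows "(\<integral>\<omega>. cis (t * X \<omega>) \<partial>M) = exp (- t\<^sup>2 / 2)"
proof -
  have X: "X \<in> borel_measurable M" "distr M borel X = std_normal_distribution"
    using assms(2) by (auto simp: distributed_def cong: distr_cong)
  show ?thesis
    using char_eq_cis[OF X(1), of t] by (simp add: X(2) char_std_normal_distribution)
qed

text \<open>Puts the degenerate and the nondegenerate case of \<open>normal_rv\<close> under one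
  formula in the second moment.\<close>

lemma centered_normal_rv:
  assumes N: "prob_space N" and U: "normal_rv N U" "(\<integral>\<omega>. U \<omega> \<partial>N) = 0"
  shows "U \<in> borel_measurable N" "integrable N (\<lambda>\<omega>. (U \<omega>)\<^sup>2)"
    "\<And>t. (\<integral>\<omega>. cis (t * U \<omega>) \<partial>N) = exp (- (t\<^sup>2 * (\<integral>\<omega>. (U \<omega>)\<^sup>2 \<partial>N)) / 2)"
proof -
  interpret prob_space N by fact
  have "U \<in> borel_measurable N \<and> integrable N (\<lambda>\<omega>. (U \<omega>)\<^sup>2) \<and>
    (\<forall>t. (\<integral>\<omega>. cis (t * U \<omega>) \<partial>N) = exp (- (t\<^sup>2 * (\<integral>\<omega>. (U \<omega>)\<^sup>2 \<partial>N)) / 2))"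
    using U(1) unfolding normal_rv_def
  proof (elim disjE exE conjE)
    fix \<mu> \<sigma> :: real assume \<sigma>: "0 < \<sigma>" and D: "distributed N lborel U (normal_density \<mu> \<sigma>)"
    have "\<mu> = 0" using normal_distributed_expectation[OF \<sigma> D] U(2) by simp
    have var: "(\<integral>\<omega>. (U \<omega>)\<^sup>2 \<partial>N) = \<sigma>\<^sup>2" using normal_distributed_variance[OF \<sigma> D] U(2) by simp
    have m: "U \<in> borel_measurable N" using D by (simp add: distributed_def)
    \<comment> \<open>A non-integrable square would have integral 0 by convention, but here the
      integral is the positive number \<open>\<sigma>\<^sup>2\<close>.\<close>
    have i: "integrable N (\<lambda>\<omega>. (U \<omega>)\<^sup>2)"
      using var \<sigma> by (intro ccontr[where P = "integrable _ _"]) (auto dest: not_integrable_integral_eq) 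
    have D': "distributed N lborel (\<lambda>\<omega>. (U \<omega> - \<mu>) / \<sigma>) std_normal_density"
      using normal_standard_normal_convert[OF \<sigma>, of U \<mu>] D by simp
    have "(\<integral>\<omega>. cis (t * U \<omega>) \<partial>N) = exp (- (t\<^sup>2 * \<sigma>\<^sup>2) / 2)" for t
      using char_std_normal_cis[OF N D', of "t * \<sigma>"] \<sigma> \<open>\<mu> = 0\<close> by (simp add: power_mult_distrib)
    then show ?thesis using m i var by simp
  next
    fix \<mu> assume m: "U \<in> borel_measurable N" and ae: "AE \<omega> in N. U \<omega> = \<mu>"
    have "(\<integral>\<omega>. U \<omega> \<partial>N) = (\<integral>\<omega>. \<mu> \<partial>N)" using m ae by (intro integral_cong_AE) auto
    then have "\<mu> = 0" using U(2) by (simp add: prob_space)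
    have 1: "(\<integral>\<omega>. (U \<omega>)\<^sup>2 \<partial>N) = (\<integral>\<omega>. 0 \<partial>N)"
      using m ae \<open>\<mu> = 0\<close> by (intro integral_cong_AE) auto
    have 2: "integrable N (\<lambda>\<omega>. (U \<omega>)\<^sup>2) \<longleftrightarrow> integrable N (\<lambda>_. 0 :: real)"
      using m ae \<open>\<mu> = 0\<close> by (intro integrable_cong_AE) auto
    have 3: "(\<integral>\<omega>. cis (t * U \<omega>) \<partial>N) = (\<integral>\<omega>. 1 \<partial>N)" for t
      using m ae \<open>\<mu> = 0\<close> by (intro integral_cong_AE) (auto simp: cis_conv_exp)
    show ?thesis using m 1 2 3 by (simp add: prob_space)
  qed
  then show "U \<in> borel_measurable N" "integrable N (\<lambda>\<omega>. (U \<omega>)\<^sup>2)"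
    "\<And>t. (\<integral>\<omega>. cis (t * U \<omega>) \<partial>N) = exp (- (t\<^sup>2 * (\<integral>\<omega>. (U \<omega>)\<^sup>2 \<partial>N)) / 2)" by auto
qed

text \<open>Uniqueness of characteristic functions; \<open>s = 0\<close> gives the point mass at 0
  and so the almost surely constant case of \<open>normal_rv\<close>.\<close>

lemma normal_rv_of_char:
  assumes N: "prob_space N" and m[measurable]: "U \<in> borel_measurable N" and "0 \<le> s"
    and ch: "\<And>t. (\<integral>\<omega>. cis (t * U \<omega>) \<partial>N) = exp (- (t\<^sup>2 * s) / 2)"
  shows "normal_rv N U"
proof (cases "s = 0")
  case True
  interpret prob_space N by fact
  have "distr N borel U = return borel 0"
  proof (rule Levy_uniqueness)
    show "real_distribution (distr N borel U)" by (rule real_distribution_distr) simp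
    show "real_distribution (return borel (0 :: real))"
      by (simp add: real_distribution_def real_distribution_axioms_def prob_space_return)
    have "char (distr N borel U) t = char (return borel 0) t" for t
      using ch[of t] True by (simp add: char_eq_cis) (simp add: char_def integral_return)
    then show "char (distr N borel U) = char (return borel 0)" by blast
  qed
  moreover have "AE x in return borel (0 :: real). x = 0" by (subst AE_return) auto
  ultimately have "AE x in distr N borel U. x = 0" by metis
  then have "AE \<omega> in N. U \<omega> = 0" by (subst (asm) AE_distr_iff) auto
  then show ?thesis unfolding normal_rv_def using m by blast
next
  case False
  interpret prob_space N by fact
  define \<sigma> where "\<sigma> = sqrt s"
  have \<sigma>: "0 < \<sigma>" "\<sigma>\<^sup>2 = s" using False \<open>0 \<le> s\<close> by (auto simp: \<sigma>_def)
  have "distr N borel (\<lambda>\<omega>. U \<omega> / \<sigma>) = std_normal_distribution"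
  proof (rule Levy_uniqueness[OF real_distribution_distr real_dist_normal_dist])
    have "char (distr N borel (\<lambda>\<omega>. U \<omega> / \<sigma>)) t = char std_normal_distribution t" for t
      using ch[of "t / \<sigma>"] \<sigma> False by (simp add: char_eq_cis char_std_normal_distribution power_divide)
    then show "char (distr N borel (\<lambda>\<omega>. U \<omega> / \<sigma>)) = char std_normal_distribution" by blast
  qed simp
  then have "distributed N lborel (\<lambda>\<omega>. (U \<omega> - 0) / \<sigma>) std_normal_density"
    by (simp add: distributed_def cong: distr_cong)
  then have "distributed N lborel U (normal_density 0 \<sigma>)"
    using normal_standard_normal_convert[OF \<sigma>(1), of U 0] by simp
  then show ?thesis unfolding normal_rv_def using \<sigma>(1) by blast
qed

text \<open>The variances lie in \<open>{0..c}\<close>, so along a subsequence they converge to some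
  \<open>l\<close>. Pointwise convergence carries the characteristic functions to that of
  \<open>U\<close>, which is therefore the Gaussian one with variance \<open>l\<close>.\<close>

lemma normal_rv_limit:
  assumes N: "prob_space N" and normal: "\<And>k. normal_rv N (V k)" "\<And>k. (\<integral>\<omega>. V k \<omega> \<partial>N) = 0"
    and c: "\<And>k. (\<integral>\<omega>. (V k \<omega>)\<^sup>2 \<partial>N) \<le> c"
    and m: "U \<in> borel_measurable N" and lim: "\<And>\<omega>. \<omega> \<in> space N \<Longrightarrow> (\<lambda>k. V k \<omega>) \<longlonglongrightarrow> U \<omega>"
  shows "normal_rv N U"
proof -
  interpret prob_space N by fact
  note V = centered_normal_rv[OF N normal]
  define s where "s k = (\<integral>\<omega>. (V k \<omega>)\<^sup>2 \<partial>N)" for k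
  have "s k \<in> {0..c}" for k using c by (simp add: s_def)
  then obtain l r where l: "l \<in> {0..c}" "strict_mono (r :: nat \<Rightarrow> nat)" "(s \<circ> r) \<longlonglongrightarrow> l"
    using compact_Icc[of 0 c, unfolded compact_def] by metis
  show ?thesis
  proof (rule normal_rv_of_char[OF N m])
    show "0 \<le> l" using l by simp
    fix t
    have "(\<lambda>k. \<integral>\<omega>. cis (t * V k \<omega>) \<partial>N) \<longlonglongrightarrow> (\<integral>\<omega>. cis (t * U \<omega>) \<partial>N)"
      using V(1) m
      by (intro integral_dominated_convergence[where w = "\<lambda>_. 1"])
        (auto intro!: tendsto_intros lim tendsto_cis simp: cis_conv_exp)
    then have "((\<lambda>k. \<integral>\<omega>. cis (t * V k \<omega>) \<partial>N) \<circ> r) \<longlonglongrightarrow> (\<integral>\<omega>. cis (t * U \<omega>) \<partial>N)"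
      by (rule LIMSEQ_subseq_LIMSEQ[OF _ l(2)])
    moreover have "(\<lambda>k. complex_of_real (exp (- (t\<^sup>2 * (s \<circ> r) k) / 2))) \<longlonglongrightarrow> exp (- (t\<^sup>2 * l) / 2)"
      by (intro tendsto_intros l(3)) auto
    moreover have "(\<lambda>k. \<integral>\<omega>. cis (t * V k \<omega>) \<partial>N) \<circ> r = (\<lambda>k. complex_of_real (exp (- (t\<^sup>2 * (s \<circ> r) k) / 2)))"
      by (auto simp: V(3) s_def)
    ultimately show "(\<integral>\<omega>. cis (t * U \<omega>) \<partial>N) = exp (- (t\<^sup>2 * l) / 2)"
      using LIMSEQ_unique by metis
  qed
qed

text \<open>The variance \<open>s\<close> may be 0, since a linear combination of limit values can
  be degenerate; all summands then vanish almost surely.\<close>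

lemma clt_cis:
  assumes M: "prob_space M" and indep: "prob_space.indep_vars M (\<lambda>_. borel) V {1..}"
    and ident: "\<And>i. 1 \<le> i \<Longrightarrow> distr M borel (V i) = distr M borel (V 1)"
    and mean: "\<And>i. 1 \<le> i \<Longrightarrow> (\<integral>\<omega>. V i \<omega> \<partial>M) = 0"
    and sq: "\<And>i. 1 \<le> i \<Longrightarrow> integrable M (\<lambda>\<omega>. (V i \<omega>)\<^sup>2)"
      "\<And>i. 1 \<le> i \<Longrightarrow> (\<integral>\<omega>. (V i \<omega>)\<^sup>2 \<partial>M) = (s :: real)"
  shows "(\<lambda>n. \<integral>\<omega>. cis ((\<Sum>i=1..n. V i \<omega>) / sqrt (real n)) \<partial>M) \<longlonglongrightarrow> exp (- s / 2)"
proof -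
  interpret prob_space M by fact
  have rv[measurable]: "V (Suc i) \<in> borel_measurable M" for i
    using indep by (auto simp: indep_vars_def)
  have sum_eq: "(\<Sum>i=1..n. V i \<omega>) = (\<Sum>i<n. V (Suc i) \<omega>)" for n \<omega>
    by (simp add: sum.shift_bounds_Suc_ivl lessThan_atLeast0 sum.atLeast1_atMost_eq)
  have "0 \<le> s" using sq(2)[of 1] by (metis integral_nonneg_AE AE_I2 le_refl zero_le_power2)
  show ?thesis
  proof (cases "s = 0")
    case True
    have "AE \<omega> in M. V (Suc i) \<omega> = 0" for i
    proof -
      have "(\<integral>\<omega>. (V (Suc i) \<omega>)\<^sup>2 \<partial>M) = 0" using sq(2)[of "Suc i"] True by simp
      then show ?thesis using sq(1)[of "Suc i"] by (subst (asm) integral_nonneg_eq_0_iff_AE) auto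
    qed
    then have "AE \<omega> in M. \<forall>i. V (Suc i) \<omega> = 0" by (simp add: AE_all_countable)
    then have "(\<integral>\<omega>. cis ((\<Sum>i=1..n. V i \<omega>) / sqrt (real n)) \<partial>M) = (\<integral>\<omega>. 1 \<partial>M)" for n
      unfolding sum_eq by (intro integral_cong_AE) (auto simp: cis_conv_exp)
    then show ?thesis using True by (simp add: prob_space)
  next
    case False
    define \<sigma> where "\<sigma> = sqrt s"
    have \<sigma>: "0 < \<sigma>" "\<sigma>\<^sup>2 = s" using False \<open>0 \<le> s\<close> by (auto simp: \<sigma>_def)
    \<comment> \<open>Samples start at index 1 while \<open>central_limit_theorem_zero_mean\<close>
      sums from 0; independence is transported along \<open>Suc\<close>.\<close>
    have indep': "indep_vars (\<lambda>_. borel) (\<lambda>i. V (Suc i)) UNIV"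
      unfolding indep_vars_def2
    proof (intro conjI indep_setsI ballI)
      have V: "indep_sets (\<lambda>i. {V i -` A \<inter> space M |A. A \<in> sets borel}) {1..}"
        using indep by (simp add: indep_vars_def2)
      fix A and J :: "nat set"
      assume J: "J \<noteq> {}" "J \<subseteq> UNIV" "finite J" and A: "\<forall>j\<in>J. A j \<in> {V (Suc j) -` A \<inter> space M |A. A \<in> sets borel}"
      have "prob (\<Inter>j\<in>Suc ` J. A (j - 1)) = (\<Prod>j\<in>Suc ` J. prob (A (j - 1)))"
        by (rule indep_setsD[OF V]) (use J A in auto)
      then show "prob (\<Inter> (A ` J)) = (\<Prod>j\<in>J. prob (A j))"
        by (simp add: prod.reindex)
    qed auto
    have clt: "weak_conv_m (\<lambda>n. distr M borel (\<lambda>x. (\<Sum>i<n. V (Suc i) x) / sqrt (real n * \<sigma>\<^sup>2))) std_normal_distribution"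
      by (rule central_limit_theorem_zero_mean[OF indep' _ \<sigma>(1)])
        (use mean sq \<sigma> ident[of "Suc _"] in auto)
    \<comment> \<open>Evaluation at \<sigma> cancels the \<sigma> in the normalisation of the
      sum.\<close>
    have "(\<lambda>n. char (distr M borel (\<lambda>x. (\<Sum>i<n. V (Suc i) x) / sqrt (real n * \<sigma>\<^sup>2))) \<sigma>)
        \<longlonglongrightarrow> char std_normal_distribution \<sigma>"
      by (rule levy_continuity1[OF _ real_dist_normal_dist clt]) (rule real_distribution_distr, simp)
    moreover have "char (distr M borel (\<lambda>x. (\<Sum>i<n. V (Suc i) x) / sqrt (real n * \<sigma>\<^sup>2))) \<sigma> =
        (\<integral>\<omega>. cis ((\<Sum>i=1..n. V i \<omega>) / sqrt (real n)) \<partial>M)" for n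
      unfolding sum_eq using \<sigma>(1) by (subst char_eq_cis) (simp_all add: real_sqrt_mult field_simps)
    ultimately show ?thesis using \<sigma> by (simp add: char_std_normal_distribution)
  qed
qed

section \<open>Square integrals of random fields\<close>

text \<open>A common framework for the empirical process, a single observation, the bridge and its
  grid versions: what is needed about their integrals follows from joint measurability, bounded
  paths and a uniform second moment.\<close>

locale random_field = S: prob_space S + M: prob_space M
  for S :: "'s measure" and M :: "'a measure" +
  fixes g :: "'s \<Rightarrow> 'a \<Rightarrow> real" and c :: real
  assumes g_pair[measurable]: "(\<lambda>(z, \<omega>). g z \<omega>) \<in> borel_measurable (S \<Otimes>\<^sub>M M)"
    and path_bound: "\<And>\<omega>. \<omega> \<in> space M \<Longrightarrow> \<exists>b. \<forall>z\<in>space S. \<bar>g z \<omega>\<bar> \<le> b"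
    and sq_integrable: "\<And>z. z \<in> space S \<Longrightarrow> integrable M (\<lambda>\<omega>. (g z \<omega>)\<^sup>2)"
    and sq_bound: "\<And>z. z \<in> space S \<Longrightarrow> (\<integral>\<omega>. (g z \<omega>)\<^sup>2 \<partial>M) \<le> c"
begin

sublocale P: pair_prob_space S M ..

definition energy :: "'a \<Rightarrow> real" where "energy \<omega> = (\<integral>z. (g z \<omega>)\<^sup>2 \<partial>S)"

lemma g_section1[measurable]: "z \<in> space S \<Longrightarrow> g z \<in> borel_measurable M"
  using measurable_Pair2[OF g_pair] by simp

lemma g_section2[measurable]: "\<omega> \<in> space M \<Longrightarrow> (\<lambda>z. g z \<omega>) \<in> borel_measurable S"
  using measurable_Pair1[OF g_pair] by simp

lemma path_integrable:
  assumes "\<omega> \<in> space M" and [measurable]: "w \<in> borel_measurable S" and w: "\<And>z. z \<in> space S \<Longrightarrow> \<bar>w z\<bar> \<le> 1"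
  shows "integrable S (\<lambda>z. w z * g z \<omega>)" "integrable S (\<lambda>z. (w z * g z \<omega>)\<^sup>2)"
proof -
  obtain b where b: "\<forall>z\<in>space S. \<bar>g z \<omega>\<bar> \<le> b" using path_bound[OF assms(1)] by blast
  have *: "\<bar>w z * g z \<omega>\<bar> \<le> b" if "z \<in> space S" for z
    using mult_mono[OF w[OF that] b[rule_format, OF that]] by (simp add: abs_mult)
  note g_section2[OF assms(1), measurable]
  show "integrable S (\<lambda>z. w z * g z \<omega>)"
    by (rule S.integrable_const_bound[of _ b]) (use * in auto)
  have "\<bar>w z * g z \<omega>\<bar>\<^sup>2 \<le> b\<^sup>2" if "z \<in> space S" for z
    using *[OF that] by (intro power_mono) auto
  then show "integrable S (\<lambda>z. (w z * g z \<omega>)\<^sup>2)"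
    by (intro S.integrable_const_bound[of _ "b\<^sup>2"]) auto
qed

lemma sq_pair_integrable: "integrable (S \<Otimes>\<^sub>M M) (\<lambda>(z, \<omega>). (g z \<omega>)\<^sup>2)"
proof (rule P.Fubini_integrable)
  have "(\<lambda>z. \<integral>\<omega>. norm ((case (z, \<omega>) of (z, \<omega>) \<Rightarrow> (g z \<omega>)\<^sup>2)) \<partial>M) \<in> borel_measurable S" by measurable
  then show "integrable S (\<lambda>z. \<integral>\<omega>. norm ((case (z, \<omega>) of (z, \<omega>) \<Rightarrow> (g z \<omega>)\<^sup>2)) \<partial>M)"
    using sq_bound by (intro S.integrable_const_bound[of _ c]) auto
qed (use sq_integrable in auto)

lemma energy_integrable: "integrable M energy" and energy_bound: "(\<integral>\<omega>. energy \<omega> \<partial>M) \<le> c"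
proof -
  show "integrable M energy"
    unfolding energy_def using P.integrable_snd[OF sq_pair_integrable] by simp
  have "(\<integral>\<omega>. energy \<omega> \<partial>M) = (\<integral>z. \<integral>\<omega>. (g z \<omega>)\<^sup>2 \<partial>M \<partial>S)"
    unfolding energy_def using P.Fubini_integral[OF sq_pair_integrable] by simp
  also have "\<dots> \<le> (\<integral>z. c \<partial>S)"
  proof (rule integral_mono)
    show "integrable S (\<lambda>z. \<integral>\<omega>. (g z \<omega>)\<^sup>2 \<partial>M)"
      using P.integrable_fst[OF sq_pair_integrable] by simp
  qed (use sq_bound in auto)
  finally show "(\<integral>\<omega>. energy \<omega> \<partial>M) \<le> c" by (simp add: S.prob_space)
qed

lemma energy_nonneg: "0 \<le> energy \<omega>"
  by (simp add: energy_def)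

definition functional :: "('s \<Rightarrow> real) \<Rightarrow> 'a \<Rightarrow> real" where
  "functional w \<omega> = (\<integral>z. w z * g z \<omega> \<partial>S)"

context
  fixes w :: "'s \<Rightarrow> real"
  assumes w_meas[measurable]: "w \<in> borel_measurable S" and w_bound: "\<And>z. z \<in> space S \<Longrightarrow> \<bar>w z\<bar> \<le> 1"
begin

lemma functional_measurable[measurable]: "functional w \<in> borel_measurable M"
  unfolding functional_def by measurable

lemma weighted_sq_le: "z \<in> space S \<Longrightarrow> (w z * g z \<omega>)\<^sup>2 \<le> (g z \<omega>)\<^sup>2"
  using w_bound[of z] by (simp add: power_mult_distrib abs_square_le_1 mult_left_le_one_le)

lemma functional_sq_le: "\<omega> \<in> space M \<Longrightarrow> (functional w \<omega>)\<^sup>2 \<le> energy \<omega>"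
proof -
  assume \<omega>: "\<omega> \<in> space M"
  note i = path_integrable[OF \<omega> w_meas w_bound]
  have "(functional w \<omega>)\<^sup>2 \<le> (\<integral>z. (w z * g z \<omega>)\<^sup>2 \<partial>S)"
    using S.variance_positive[of "\<lambda>z. w z * g z \<omega>"] S.variance_eq[OF i] by (simp add: functional_def)
  also have "\<dots> \<le> energy \<omega>"
    unfolding energy_def using i(2) path_integrable(2)[OF \<omega>, of "\<lambda>_. 1"] weighted_sq_le
    by (intro integral_mono) auto
  finally show ?thesis .
qed

lemma functional_sq_integrable: "integrable M (\<lambda>\<omega>. (functional w \<omega>)\<^sup>2)"
  by (rule Bochner_Integration.integrable_bound[OF energy_integrable])
    (use functional_sq_le energy_nonneg in auto)

lemma functional_sq_bound: "(\<integral>\<omega>. (functional w \<omega>)\<^sup>2 \<partial>M) \<le> c"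
proof -
  have "(\<integral>\<omega>. (functional w \<omega>)\<^sup>2 \<partial>M) \<le> (\<integral>\<omega>. energy \<omega> \<partial>M)"
    using functional_sq_integrable energy_integrable functional_sq_le by (intro integral_mono) auto
  then show ?thesis using energy_bound by linarith
qed

text \<open>The integrand is dominated by
  \<open>(g z \<omega>)\<^sup>2 + (H \<omega>)\<^sup>2\<close>, whose mean is bounded uniformly in
  \<open>z\<close>. The choice \<open>H = 1\<close> gives means, and \<open>H\<close> another
  functional gives covariances.\<close>

lemma functional_fubini:
  assumes [measurable]: "H \<in> borel_measurable M" and H: "integrable M (\<lambda>\<omega>. (H \<omega>)\<^sup>2)"
  shows "(\<integral>\<omega>. functional w \<omega> * H \<omega> \<partial>M) = (\<integral>z. w z * (\<integral>\<omega>. g z \<omega> * H \<omega> \<partial>M) \<partial>S)"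
proof -
  have dom: "norm (w z * g z \<omega> * H \<omega>) \<le> (g z \<omega>)\<^sup>2 + (H \<omega>)\<^sup>2" if "z \<in> space S" for z \<omega>
  proof -
    have "\<bar>w z\<bar> * \<bar>g z \<omega> * H \<omega>\<bar> \<le> 1 * \<bar>g z \<omega> * H \<omega>\<bar>"
      by (rule mult_right_mono[OF w_bound[OF that]]) simp
    also have "\<dots> \<le> (g z \<omega>)\<^sup>2 + (H \<omega>)\<^sup>2"
      using sum_squares_bound[of "\<bar>g z \<omega>\<bar>" "\<bar>H \<omega>\<bar>"] abs_ge_zero[of "g z \<omega> * H \<omega>"]
      unfolding abs_mult mult.assoc power2_abs by linarith
    finally show ?thesis by (simp add: abs_mult mult.assoc)
  qed
  have int1: "integrable M (\<lambda>\<omega>. w z * g z \<omega> * H \<omega>)" if z: "z \<in> space S" for z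
    by (rule Bochner_Integration.integrable_bound[of M "\<lambda>\<omega>. (g z \<omega>)\<^sup>2 + (H \<omega>)\<^sup>2"])
      (use z sq_integrable[OF z] H in \<open>auto intro!: AE_I2 order_trans[OF dom[OF z, unfolded real_norm_def]]\<close>)
  have "integrable (S \<Otimes>\<^sub>M M) (\<lambda>(z, \<omega>). w z * g z \<omega> * H \<omega>)"
  proof (rule P.Fubini_integrable)
    have m: "(\<lambda>z. \<integral>\<omega>. norm (case (z, \<omega>) of (z, \<omega>) \<Rightarrow> w z * g z \<omega> * H \<omega>) \<partial>M) \<in> borel_measurable S" by measurable
    have "(\<integral>\<omega>. norm (w z * g z \<omega> * H \<omega>) \<partial>M) \<le> c + (\<integral>\<omega>. (H \<omega>)\<^sup>2 \<partial>M)" if z: "z \<in> space S" for z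
    proof -
      have "(\<integral>\<omega>. norm (w z * g z \<omega> * H \<omega>) \<partial>M) \<le> (\<integral>\<omega>. (g z \<omega>)\<^sup>2 + (H \<omega>)\<^sup>2 \<partial>M)"
        using int1[OF z] sq_integrable[OF z] H dom[OF z] by (intro integral_mono) auto
      then show ?thesis using sq_integrable[OF z] H sq_bound[OF z] by simp
    qed
    then show "integrable S (\<lambda>z. \<integral>\<omega>. norm (case (z, \<omega>) of (z, \<omega>) \<Rightarrow> w z * g z \<omega> * H \<omega>) \<partial>M)"
      using m by (intro S.integrable_const_bound[of _ "c + (\<integral>\<omega>. (H \<omega>)\<^sup>2 \<partial>M)"]) auto
  qed (use int1 in auto)
  from P.Fubini_integral[OF this]
  have "(\<integral>\<omega>. (\<integral>z. w z * g z \<omega> * H \<omega> \<partial>S) \<partial>M) = (\<integral>z. (\<integral>\<omega>. w z * g z \<omega> * H \<omega> \<partial>M) \<partial>S)"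
    by simp
  then show ?thesis
    unfolding functional_def integral_mult_left_zero by (simp only: mult.assoc integral_mult_right_zero)
qed

lemma functional_expectation: "(\<integral>\<omega>. functional w \<omega> \<partial>M) = (\<integral>z. w z * (\<integral>\<omega>. g z \<omega> \<partial>M) \<partial>S)"
  using functional_fubini[of "\<lambda>_. 1"] by simp

lemma functional_abs_le: "\<omega> \<in> space M \<Longrightarrow> \<bar>functional w \<omega>\<bar> \<le> 1 + energy \<omega>"
proof -
  assume \<omega>: "\<omega> \<in> space M"
  have "\<bar>functional w \<omega>\<bar> \<le> 1 + (functional w \<omega>)\<^sup>2"
    using sum_squares_bound[of 1 "\<bar>functional w \<omega>\<bar>"] zero_le_power2[of "functional w \<omega>"]
    by simp
  then show ?thesis using functional_sq_le[OF \<omega>] by linarith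
qed

end

lemma functional_covariance:
  assumes w: "w \<in> borel_measurable S" "\<And>z. z \<in> space S \<Longrightarrow> \<bar>w z\<bar> \<le> 1"
    and w': "w' \<in> borel_measurable S" "\<And>z. z \<in> space S \<Longrightarrow> \<bar>w' z\<bar> \<le> 1"
  shows "(\<integral>\<omega>. functional w \<omega> * functional w' \<omega> \<partial>M) =
    (\<integral>z. w z * (\<integral>z'. w' z' * (\<integral>\<omega>. g z \<omega> * g z' \<omega> \<partial>M) \<partial>S) \<partial>S)"
proof -
  have "(\<integral>\<omega>. functional w \<omega> * functional w' \<omega> \<partial>M) = (\<integral>z. w z * (\<integral>\<omega>. g z \<omega> * functional w' \<omega> \<partial>M) \<partial>S)"
    by (rule functional_fubini[OF w functional_measurable[OF w'] functional_sq_integrable[OF w']])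
  also have "\<dots> = (\<integral>z. w z * (\<integral>z'. w' z' * (\<integral>\<omega>. g z \<omega> * g z' \<omega> \<partial>M) \<partial>S) \<partial>S)"
  proof (rule Bochner_Integration.integral_cong[OF refl])
    fix z assume z: "z \<in> space S"
    show "w z * (\<integral>\<omega>. g z \<omega> * functional w' \<omega> \<partial>M) = w z * (\<integral>z'. w' z' * (\<integral>\<omega>. g z \<omega> * g z' \<omega> \<partial>M) \<partial>S)"
      using functional_fubini[OF w' g_section1[OF z] sq_integrable[OF z]] by (simp add: mult.commute)
  qed
  finally show ?thesis .
qed

text \<open>Cauchy--Schwarz with the root removed: where the weights differ,
  \<open>\<bar>g\<bar>\<close> is at most \<open>1 / r + r * g\<^sup>2\<close>, and the first term
  integrates to at most \<open>r\<close>. The factor \<open>1 + energy\<close> has finite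
  expectation.\<close>

lemma functional_diff_le:
  assumes w: "w \<in> borel_measurable S" "\<And>z. z \<in> space S \<Longrightarrow> \<bar>w z\<bar> \<le> 1"
    and w': "w' \<in> borel_measurable S" "\<And>z. z \<in> space S \<Longrightarrow> \<bar>w' z\<bar> \<le> 1"
    and A: "A \<in> sets S" "\<And>z. z \<in> space S \<Longrightarrow> \<bar>w z - w' z\<bar> \<le> indicator A z"
    and r: "0 < r" "measure S A \<le> r\<^sup>2" and \<omega>: "\<omega> \<in> space M"
  shows "\<bar>functional w \<omega> - functional w' \<omega>\<bar> \<le> r * (1 + energy \<omega>)"
proof -
  note i = path_integrable(1)[OF \<omega> w] path_integrable(1)[OF \<omega> w']
  have sq: "integrable S (\<lambda>z. (g z \<omega>)\<^sup>2)" using path_integrable(2)[OF \<omega>, of "\<lambda>_. 1"] by simp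
  have iA: "integrable S (indicat_real A)" using A(1) by (intro S.integrable_const_bound[of _ 1]) auto
  have "\<bar>functional w \<omega> - functional w' \<omega>\<bar> = \<bar>\<integral>z. w z * g z \<omega> - w' z * g z \<omega> \<partial>S\<bar>"
    using i by (simp add: functional_def)
  also have "\<dots> \<le> (\<integral>z. \<bar>w z * g z \<omega> - w' z * g z \<omega>\<bar> \<partial>S)" by (rule integral_abs_bound)
  also have "\<dots> \<le> (\<integral>z. (1 / r * indicator A z + r * (g z \<omega>)\<^sup>2) \<partial>S)"
  proof (rule integral_mono)
    fix z assume z: "z \<in> space S"
    have "\<bar>w z * g z \<omega> - w' z * g z \<omega>\<bar> = \<bar>w z - w' z\<bar> * \<bar>g z \<omega>\<bar>"
      by (simp add: abs_mult flip: left_diff_distrib)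
    also have "\<dots> \<le> indicator A z * \<bar>g z \<omega>\<bar>" by (rule mult_right_mono[OF A(2)[OF z]]) simp
    also have "\<dots> \<le> 1 / r * indicator A z + r * (g z \<omega>)\<^sup>2"
    proof (cases "z \<in> A")
      case True
      have "2 * (1 * (r * \<bar>g z \<omega>\<bar>)) \<le> 1\<^sup>2 + (r * \<bar>g z \<omega>\<bar>)\<^sup>2"
        using sum_squares_bound[of 1 "r * \<bar>g z \<omega>\<bar>"] by (simp only: mult.assoc)
      then have "r * \<bar>g z \<omega>\<bar> \<le> 1 + (r * \<bar>g z \<omega>\<bar>)\<^sup>2"
      proof -
        have "0 \<le> r * \<bar>g z \<omega>\<bar>" using \<open>0 < r\<close> by simp
        moreover assume "2 * (1 * (r * \<bar>g z \<omega>\<bar>)) \<le> 1\<^sup>2 + (r * \<bar>g z \<omega>\<bar>)\<^sup>2"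
        ultimately show ?thesis unfolding mult_1 one_power2 by linarith
      qed
      then have "\<bar>g z \<omega>\<bar> \<le> 1 / r + r * (g z \<omega>)\<^sup>2"
        using \<open>0 < r\<close> by (simp add: field_simps power2_eq_square)
      then show ?thesis using True by simp
    qed (use \<open>0 < r\<close> in simp)
    finally show "\<bar>w z * g z \<omega> - w' z * g z \<omega>\<bar> \<le> 1 / r * indicator A z + r * (g z \<omega>)\<^sup>2" .
  qed (use i sq iA in auto)
  also have "\<dots> = 1 / r * measure S A + r * energy \<omega>"
    using sq iA A(1) by (simp add: energy_def)
  also have "1 / r * measure S A \<le> 1 / r * r\<^sup>2"
    using r by (intro mult_left_mono) auto
  finally show ?thesis using \<open>0 < r\<close> by (simp add: distrib_left power2_eq_square)
qed

end

section \<open>Lebesgue measure on the open unit square\<close>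

definition open_square :: "(real \<times> real) set" where "open_square = {0<..<1} \<times> {0<..<1}"

text \<open>The open square carries the full measure and avoids the boundary, where the partial
  derivatives may have arbitrary values.\<close>

definition usq :: "(real \<times> real) measure" where "usq = restrict_space lborel open_square"

abbreviation lower_square :: "real \<Rightarrow> real \<times> real \<Rightarrow> real" where
  "lower_square p \<equiv> indicat_real ({..p} \<times> {..p})"

lemma open_square_borel[measurable, simp]: "open_square \<in> sets borel"
  by (auto simp: open_square_def intro!: borel_open open_Times)

lemma space_usq[simp]: "space usq = open_square" by (simp add: usq_def space_restrict_space)

lemma measurable_usqI: "f \<in> borel_measurable borel \<Longrightarrow> f \<in> borel_measurable usq"
  unfolding usq_def by (rule measurable_restrict_space1) simp

lemma id_usq_measurable[measurable]: "(\<lambda>z. z) \<in> measurable usq borel"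
  unfolding usq_def by (rule measurable_restrict_space1) simp

lemma fst_usq[measurable]: "fst \<in> borel_measurable usq" and snd_usq[measurable]: "snd \<in> borel_measurable usq"
  by (rule measurable_usqI, intro borel_measurable_continuous_onI continuous_intros)+

lemma lower_square_measurable[measurable]: "lower_square p \<in> borel_measurable usq"
  by (rule measurable_usqI) (auto intro!: borel_measurable_indicator borel_closed closed_Times)

lemma measure_strip:
  assumes "0 \<le> a" "a \<le> b" "b \<le> 1"
  shows "measure lborel ({a<..<b} \<times> {0<..<1 :: real}) = b - a" "measure lborel ({0<..<1 :: real} \<times> {a<..<b}) = b - a"
proof -
  have "emeasure lborel ({a<..<b} \<times> {0<..<1 :: real}) = ennreal (b - a)"
    using assms by (simp add: lborel_prod[symmetric] lborel.emeasure_pair_measure_Times)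
  moreover have "emeasure lborel ({0<..<1 :: real} \<times> {a<..<b}) = ennreal (b - a)"
    using assms by (simp add: lborel_prod[symmetric] lborel.emeasure_pair_measure_Times)
  ultimately show "measure lborel ({a<..<b} \<times> {0<..<1 :: real}) = b - a"
    "measure lborel ({0<..<1 :: real} \<times> {a<..<b}) = b - a"
    using assms by (simp_all add: measure_def)
qed

lemma prob_space_usq: "prob_space usq"
proof
  have "emeasure lborel open_square = 1"
    by (simp add: open_square_def lborel_prod[symmetric] lborel.emeasure_pair_measure_Times)
  then show "emeasure usq (space usq) = 1"
    by (simp add: usq_def emeasure_restrict_space space_restrict_space)
qed

text \<open>The two lower squares differ only inside one vertical and one horizontal strip, each of
  width \<open>q - p\<close>.\<close>

lemma usq_lower_diff:
  assumes "0 \<le> p" "p \<le> q" "q \<le> 1"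
  defines "A \<equiv> {z \<in> open_square. p < fst z \<and> fst z \<le> q \<or> p < snd z \<and> snd z \<le> q}"
  shows "A \<in> sets usq" "measure usq A \<le> 2 * (q - p)"
    "\<And>z. z \<in> open_square \<Longrightarrow> \<bar>lower_square p z - lower_square q z\<bar> \<le> indicator A z"
proof -
  interpret prob_space usq by (rule prob_space_usq)
  show "\<bar>lower_square p z - lower_square q z\<bar> \<le> indicator A z" if "z \<in> open_square" for z
    using that assms by (cases z) (auto simp: indicator_def)
  have A_eq: "A = {z \<in> space usq. p < fst z \<and> fst z \<le> q \<or> p < snd z \<and> snd z \<le> q}"
    by (simp only: A_def space_usq)
  show A: "A \<in> sets usq" unfolding A_eq by measurable
  let ?s = "\<lambda>f. {z \<in> space usq. p < f z \<and> f z \<le> q}"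
  have null: "measure usq {z \<in> space usq. f z = q} = 0" if "f = fst \<or> f = snd" for f :: "real \<times> real \<Rightarrow> real"
  proof -
    have 0: "emeasure lborel ({q} \<times> {0<..<1 :: real}) = 0" "emeasure lborel ({0<..<1 :: real} \<times> {q}) = 0"
      by (simp_all add: lborel_prod[symmetric] lborel.emeasure_pair_measure_Times)
    have "emeasure lborel {z \<in> open_square. fst z = q} \<le> emeasure lborel ({q} \<times> {0<..<1 :: real})"
      by (rule emeasure_mono) (auto simp: open_square_def intro: borel_Times)
    moreover have "emeasure lborel {z \<in> open_square. snd z = q} \<le> emeasure lborel ({0<..<1 :: real} \<times> {q})"
      by (rule emeasure_mono) (auto simp: open_square_def intro: borel_Times)
    ultimately have "emeasure lborel {z \<in> open_square. f z = q} = 0"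
      using that 0 by auto
    then show ?thesis
      by (subst usq_def, subst measure_restrict_space) (auto simp: measure_def)
  qed
  have strip: "measure usq {z \<in> space usq. p < f z \<and> f z < q} \<le> q - p"
    if "f = fst \<or> f = snd" for f :: "real \<times> real \<Rightarrow> real"
  proof -
    have "{z \<in> open_square. p < fst z \<and> fst z < q} = {p<..<q} \<times> {0<..<1}"
      "{z \<in> open_square. p < snd z \<and> snd z < q} = {0<..<1} \<times> {p<..<q}"
      using assms(1-3) by (auto simp: open_square_def)
    then have "measure lborel {z \<in> open_square. p < f z \<and> f z < q} \<le> q - p"
      using that measure_strip[OF assms(1-3)] by (elim disjE) simp_all
    moreover have "measure usq {z \<in> space usq. p < f z \<and> f z < q} = measure lborel {z \<in> open_square. p < f z \<and> f z < q}"
      unfolding space_usq by (subst usq_def, subst measure_restrict_space) auto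
    ultimately show ?thesis by simp
  qed
  have f: "measure usq (?s f) \<le> q - p" if "f = fst \<or> f = snd" for f :: "real \<times> real \<Rightarrow> real"
  proof -
    have [measurable]: "f \<in> borel_measurable usq" using that by auto
    have m: "{z \<in> space usq. p < f z \<and> f z < q} \<in> sets usq" "{z \<in> space usq. f z = q} \<in> sets usq"
      by measurable
    have "measure usq (?s f) \<le> measure usq ({z \<in> space usq. p < f z \<and> f z < q} \<union> {z \<in> space usq. f z = q})"
      by (rule finite_measure_mono[OF _ sets.Un[OF m]]) auto
    also have "\<dots> \<le> measure usq {z \<in> space usq. p < f z \<and> f z < q} + measure usq {z \<in> space usq. f z = q}"
      by (rule measure_Un_le[OF m])
    finally show ?thesis using null[OF that] strip[OF that] by linarith
  qed
  have m: "?s fst \<in> sets usq" "?s snd \<in> sets usq" by measurable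
  have "measure usq A \<le> measure usq (?s fst \<union> ?s snd)"
    by (rule finite_measure_mono[OF _ sets.Un[OF m]]) (auto simp: A_def)
  also have "\<dots> \<le> measure usq (?s fst) + measure usq (?s snd)"
    by (rule measure_Un_le[OF m])
  finally show "measure usq A \<le> 2 * (q - p)" using f[of fst] f[of snd] by simp
qed

lemma negligible_square_boundary: "{z :: real \<times> real. fst z = a \<or> snd z = b} \<in> null_sets lebesgue"
proof -
  have "negligible ({z :: real \<times> real. z \<bullet> (1, 0) = a} \<union> {z. z \<bullet> (0, 1) = b})"
    by (intro negligible_Un negligible_standard_hyperplane) (auto simp: Basis_prod_def)
  then show ?thesis
    by (simp add: negligible_iff_null_sets inner_prod_def Collect_disj_eq)
qed

text \<open>The edges of the unit square form a null set. On them \<open>h\<close> is unrestricted,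
  so completeness of the Lebesgue measure is what makes the original integrand measurable.\<close>

lemma square_integral_usq:
  assumes h: "h \<in> borel_measurable usq" and p: "0 \<le> p" "p \<le> 1"
  shows "square_integral h p = (\<integral>z. lower_square p z * h z \<partial>usq)"
proof -
  define E where "E = {z :: real \<times> real. fst z = 0 \<or> snd z = 0} \<union> {z. fst z = 1 \<or> snd z = 1}"
  have E: "E \<in> null_sets lebesgue"
    unfolding E_def using negligible_square_boundary by blast
  define h0 where "h0 z = indicator open_square z * (lower_square p z * h z)" for z
  define h1 where "h1 z = indicator ({0..p} \<times> {0..p}) z *\<^sub>R h z" for z
  have eq: "h1 z = h0 z" if "z \<notin> E" for z
    using that p by (cases z) (auto simp: h0_def h1_def E_def open_square_def indicator_def)
  have m: "(\<lambda>z. lower_square p z * h z) \<in> borel_measurable usq"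
    using h by measurable
  then have h0: "h0 \<in> borel_measurable lborel"
    unfolding h0_def usq_def by (subst (asm) borel_measurable_restrict_space_iff) (auto simp: mult_ac)
  have h0': "h0 \<in> borel_measurable lebesgue" by (rule measurable_completion[OF h0])
  have "h1 \<in> borel_measurable lebesgue"
  proof (rule measurableI)
    fix A :: "real set" assume A: "A \<in> sets borel"
    have B: "h0 -` A \<in> sets lebesgue" using measurable_sets[OF h0' A] by simp
    have "h1 -` A = (h0 -` A - E) \<union> (h1 -` A \<inter> E)" using eq by auto
    moreover have "h1 -` A \<inter> E \<in> null_sets lebesgue" using E by (rule completion.complete2[rotated]) auto
    moreover have "(h0 -` A - E) \<union> (h1 -` A \<inter> E) \<in> sets lebesgue"
      by (rule sets.Un[OF sets.Diff[OF B null_setsD2[OF E]] null_setsD2[OF calculation(2)]])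
    ultimately show "h1 -` A \<inter> space lebesgue \<in> sets lebesgue" by simp
  qed simp
  then have "integral\<^sup>L lebesgue h1 = integral\<^sup>L lebesgue h0"
    using AE_not_in[OF E] eq by (intro integral_cong_AE h0') auto
  also have "\<dots> = integral\<^sup>L lborel h0" by (rule integral_completion[OF h0])
  also have "\<dots> = (\<integral>z. lower_square p z * h z \<partial>usq)"
    unfolding usq_def by (subst integral_restrict_space) (simp_all add: h0_def[abs_def])
  finally show ?thesis by (simp add: square_integral_def set_lebesgue_integral_def h1_def[abs_def])
qed

section \<open>Copulas\<close>

abbreviation unit_square :: "(real \<times> real) set" where "unit_square \<equiv> {0..1} \<times> {0..1}"

lemma open_square_subset: "z \<in> open_square \<Longrightarrow> z \<in> unit_square"
  by (auto simp: open_square_def)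

context
  fixes C :: "real \<times> real \<Rightarrow> real"
  assumes C: "copula C"
begin

lemma copula_boundary:
  assumes "u \<in> {0..1}"
  shows "C (u, 0) = 0" "C (0, u) = 0" "C (u, 1) = u" "C (1, u) = u"
  using C assms by (auto simp: copula_def)

lemma copula_rectangle:
  assumes "u \<in> {0..1}" "u' \<in> {0..1}" "v \<in> {0..1}" "v' \<in> {0..1}" "u \<le> u'" "v \<le> v'"
  shows "0 \<le> C (u', v') - C (u', v) - C (u, v') + C (u, v)"
  using C assms by (auto simp: copula_def)

text \<open>The rectangle inequality with lower edge at height 0 gives monotonicity; with upper edge
  at height 1 it gives the Lipschitz constant 1.\<close>

lemma copula_mono_fst:
  assumes "u \<in> {0..1}" "u' \<in> {0..1}" "v \<in> {0..1}" "u \<le> u'"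
  shows "C (u, v) \<le> C (u', v)" "C (u', v) - C (u, v) \<le> u' - u"
  using copula_rectangle[of u u' 0 v] copula_rectangle[of u u' v 1] assms
    copula_boundary[of u] copula_boundary[of u'] by auto

lemma copula_mono_snd:
  assumes "u \<in> {0..1}" "v \<in> {0..1}" "v' \<in> {0..1}" "v \<le> v'"
  shows "C (u, v) \<le> C (u, v')" "C (u, v') - C (u, v) \<le> v' - v"
  using copula_rectangle[of 0 u v v'] copula_rectangle[of u 1 v v'] assms
    copula_boundary[of v] copula_boundary[of v'] by auto

lemma copula_Lipschitz_fst:
  assumes "u \<in> {0..1}" "u' \<in> {0..1}" "v \<in> {0..1}"
  shows "\<bar>C (u, v) - C (u', v)\<bar> \<le> \<bar>u - u'\<bar>"
  using copula_mono_fst[of u u' v] copula_mono_fst[of u' u v] assms by (cases "u \<le> u'") auto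

lemma copula_Lipschitz_snd:
  assumes "u \<in> {0..1}" "v \<in> {0..1}" "v' \<in> {0..1}"
  shows "\<bar>C (u, v) - C (u, v')\<bar> \<le> \<bar>v - v'\<bar>"
  using copula_mono_snd[of u v v'] copula_mono_snd[of u v' v] assms by (cases "v \<le> v'") auto

lemma copula_Lipschitz:
  assumes "(u, v) \<in> unit_square" "(u', v') \<in> unit_square"
  shows "\<bar>C (u, v) - C (u', v')\<bar> \<le> \<bar>u - u'\<bar> + \<bar>v - v'\<bar>"
  using copula_Lipschitz_fst[of u u' v] copula_Lipschitz_snd[of u' v v'] assms by auto

lemma copula_range: "z \<in> unit_square \<Longrightarrow> 0 \<le> C z" "z \<in> unit_square \<Longrightarrow> C z \<le> 1"
  using copula_mono_fst[of 0 "fst z" "snd z"] copula_mono_fst[of "fst z" 1 "snd z"]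
    copula_boundary[of "snd z"] by (auto simp: mem_Times_iff)

lemma copula_continuous: "continuous_on unit_square C"
proof (rule lipschitz_on_continuous_on[of 2], rule lipschitz_onI)
  fix x y assume "x \<in> unit_square" "y \<in> unit_square"
  then have "\<bar>C x - C y\<bar> \<le> \<bar>fst x - fst y\<bar> + \<bar>snd x - snd y\<bar>"
    using copula_Lipschitz[of "fst x" "snd x" "fst y" "snd y"] by (simp add: mem_Times_iff)
  then show "dist (C x) (C y) \<le> 2 * dist x y"
    using dist_fst_le[of x y] dist_snd_le[of x y] by (simp add: dist_real_def)
qed simp

text \<open>Difference quotients of a 1-Lipschitz section are at most 1 in absolute value.\<close>

lemma copula_derivative_bound_fst:
  assumes "u \<in> {0<..<1}" "v \<in> {0..1}" "((\<lambda>s. C (s, v)) has_real_derivative D) (at u)"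
  shows "\<bar>D\<bar> \<le> 1"
proof -
  have "((\<lambda>h. u + h) \<longlongrightarrow> u + 0) (at 0)" by (intro tendsto_intros)
  then have "\<forall>\<^sub>F h in at 0. u + h \<in> {0<..<1}"
    by (rule topological_tendstoD) (use assms(1) in auto)
  then have "\<forall>\<^sub>F h in at 0. norm ((C (u + h, v) - C (u, v)) / h) \<le> 1"
  proof eventually_elim
    case (elim h)
    then have "\<bar>C (u + h, v) - C (u, v)\<bar> \<le> \<bar>h\<bar>"
      using copula_Lipschitz_fst[of "u + h" u v] assms by auto
    then show ?case by (simp add: divide_le_eq_1)
  qed
  then have "norm D \<le> 1"
    using assms(3) by (intro Lim_norm_ubound[of "at (0::real)" "\<lambda>h. (C (u + h, v) - C (u, v)) / h"]) (auto simp: DERIV_def)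
  then show ?thesis by simp
qed

lemma copula_derivative_bound_snd:
  assumes "u \<in> {0..1}" "v \<in> {0<..<1}" "((\<lambda>t. C (u, t)) has_real_derivative D) (at v)"
  shows "\<bar>D\<bar> \<le> 1"
proof -
  have "((\<lambda>h. v + h) \<longlongrightarrow> v + 0) (at 0)" by (intro tendsto_intros)
  then have "\<forall>\<^sub>F h in at 0. v + h \<in> {0<..<1}"
    by (rule topological_tendstoD) (use assms(2) in auto)
  then have "\<forall>\<^sub>F h in at 0. norm ((C (u, v + h) - C (u, v)) / h) \<le> 1"
  proof eventually_elim
    case (elim h)
    then have "\<bar>C (u, v + h) - C (u, v)\<bar> \<le> \<bar>h\<bar>"
      using copula_Lipschitz_snd[of u "v + h" v] assms by auto
    then show ?case by (simp add: divide_le_eq_1)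
  qed
  then have "norm D \<le> 1"
    using assms(3) by (intro Lim_norm_ubound[of "at (0::real)" "\<lambda>h. (C (u, v + h) - C (u, v)) / h"]) (auto simp: DERIV_def)
  then show ?thesis by simp
qed

end

text \<open>As \<open>p ^ 4 \<le> p ^ 3\<close>, the divisor is at least
  \<open>(1/3 - 1/4) * p ^ 3\<close>.\<close>

lemma D_norm_lower:
  assumes "0 < p0" "p0 \<le> p" "p \<le> 1"
  shows "p0 ^ 3 / 12 \<le> D_norm p"
proof -
  have "p0 ^ 3 \<le> p ^ 3" using assms by (intro power_mono) auto
  moreover have "p ^ 4 \<le> p ^ 3" using assms by (intro power_decreasing) auto
  ultimately show ?thesis by (simp add: D_norm_def)
qed

lemma D_norm_Lipschitz:
  assumes "p \<in> {0..1}" "q \<in> {0..1}"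
  shows "\<bar>D_norm p - D_norm q\<bar> \<le> 2 * \<bar>p - q\<bar>"
proof -
  have pw: "0 \<le> p ^ i * q ^ j \<and> p ^ i * q ^ j \<le> 1" for i j
    using assms by (auto intro!: mult_le_one power_le_one)
  \<comment> \<open>The cofactor of \<open>p - q\<close>: a difference of two averages of numbers in
    the unit interval, which the crude constant 2 covers.\<close>
  define r where "r = (p\<^sup>2 + p * q + q\<^sup>2) / 3 - (p ^ 3 + p\<^sup>2 * q + p * q\<^sup>2 + q ^ 3) / 4"
  have "D_norm p - D_norm q = r * (p - q)"
    by (simp add: D_norm_def r_def field_simps power2_eq_square power3_eq_cube power4_eq_xxxx)
  moreover have "\<bar>r\<bar> \<le> 2"
  proof -
    have "0 \<le> p\<^sup>2 + p * q + q\<^sup>2" "p\<^sup>2 + p * q + q\<^sup>2 \<le> 3"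
      using pw[of 2 0] pw[of 1 1] pw[of 0 2] by auto
    then have 1: "0 \<le> (p\<^sup>2 + p * q + q\<^sup>2) / 3" "(p\<^sup>2 + p * q + q\<^sup>2) / 3 \<le> 1" by simp_all
    have "0 \<le> p ^ 3 + p\<^sup>2 * q" "p ^ 3 + p\<^sup>2 * q \<le> 2" "0 \<le> p * q\<^sup>2 + q ^ 3" "p * q\<^sup>2 + q ^ 3 \<le> 2"
      using pw[of 3 0] pw[of 2 1] pw[of 1 2] pw[of 0 3] by auto
    then have "0 \<le> p ^ 3 + p\<^sup>2 * q + p * q\<^sup>2 + q ^ 3" "p ^ 3 + p\<^sup>2 * q + p * q\<^sup>2 + q ^ 3 \<le> 4" by linarith+
    then have 2: "0 \<le> (p ^ 3 + p\<^sup>2 * q + p * q\<^sup>2 + q ^ 3) / 4" "(p ^ 3 + p\<^sup>2 * q + p * q\<^sup>2 + q ^ 3) / 4 \<le> 1" by simp_all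
    show ?thesis unfolding r_def by (rule abs_leI; use 1 2 in \<open>linarith\<close>)
  qed
  ultimately show ?thesis by (simp add: abs_mult mult_right_mono)
qed

section \<open>Centred processes on the square and their Spearman functionals\<close>

lemma borel_fst_snd[measurable]:
  "(fst :: real \<times> real \<Rightarrow> real) \<in> borel_measurable borel" "(snd :: real \<times> real \<Rightarrow> real) \<in> borel_measurable borel"
  by (intro borel_measurable_continuous_onI continuous_intros)+

text \<open>The edge values of \<open>b\<close> enter \<open>g\<close>, so \<open>b\<close> is
  controlled on the closed square, while \<open>C1\<close> and \<open>C2\<close> are controlled on
  the open square.\<close>

locale bounded_process = M: prob_space M for M :: "'a measure" +
  fixes b :: "real \<times> real \<Rightarrow> 'a \<Rightarrow> real" and C1 C2 :: "real \<times> real \<Rightarrow> real"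
  assumes b_pair: "(\<lambda>(z, \<omega>). b z \<omega>) \<in> borel_measurable (restrict_space borel unit_square \<Otimes>\<^sub>M M)"
    and b_path: "\<And>\<omega>. \<omega> \<in> space M \<Longrightarrow> \<exists>B. \<forall>z\<in>unit_square. \<bar>b z \<omega>\<bar> \<le> B"
    and b_mean: "\<And>z. z \<in> unit_square \<Longrightarrow> (\<integral>\<omega>. b z \<omega> \<partial>M) = 0"
    and b_sq: "\<And>z. z \<in> unit_square \<Longrightarrow> integrable M (\<lambda>\<omega>. (b z \<omega>)\<^sup>2)"
    and b_sq_le: "\<And>z. z \<in> unit_square \<Longrightarrow> (\<integral>\<omega>. (b z \<omega>)\<^sup>2 \<partial>M) \<le> 1"
    and C1_meas[measurable]: "C1 \<in> borel_measurable usq" and C1_bound: "\<And>z. z \<in> open_square \<Longrightarrow> \<bar>C1 z\<bar> \<le> 1"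
    and C2_meas[measurable]: "C2 \<in> borel_measurable usq" and C2_bound: "\<And>z. z \<in> open_square \<Longrightarrow> \<bar>C2 z\<bar> \<le> 1"
begin

abbreviation g :: "real \<times> real \<Rightarrow> 'a \<Rightarrow> real" where "g \<equiv> G_process C1 C2 b"

lemma b_compose:
  assumes "f \<in> measurable usq borel" "\<And>z. z \<in> open_square \<Longrightarrow> f z \<in> unit_square"
  shows "(\<lambda>(z, \<omega>). b (f z) \<omega>) \<in> borel_measurable (usq \<Otimes>\<^sub>M M)"
proof -
  have [measurable]: "f \<in> measurable usq (restrict_space borel unit_square)"
    using assms by (intro measurable_restrict_space2) auto
  have "(\<lambda>(z, \<omega>). (f z, \<omega>)) \<in> measurable (usq \<Otimes>\<^sub>M M) (restrict_space borel unit_square \<Otimes>\<^sub>M M)"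
    by measurable
  from measurable_compose[OF this b_pair] show ?thesis by (simp add: case_prod_unfold)
qed

lemma b_meas: "z \<in> unit_square \<Longrightarrow> b z \<in> borel_measurable M"
  using measurable_Pair2[OF b_pair, of z] by (simp add: space_restrict_space)

lemma b_integrable: "z \<in> unit_square \<Longrightarrow> integrable M (b z)"
  by (rule M.square_integrable_imp_integrable[OF b_meas b_sq])

lemma b_prod_integrable:
  assumes "z \<in> unit_square" "w \<in> unit_square"
  shows "integrable M (\<lambda>\<omega>. b z \<omega> * b w \<omega>)"
proof (rule Bochner_Integration.integrable_bound[of M "\<lambda>\<omega>. (b z \<omega>)\<^sup>2 + (b w \<omega>)\<^sup>2"])
  show "(\<lambda>\<omega>. b z \<omega> * b w \<omega>) \<in> borel_measurable M" using b_meas assms by measurable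
  have "\<bar>x * y\<bar> \<le> x\<^sup>2 + y\<^sup>2" for x y :: real
    using sum_squares_bound[of "\<bar>x\<bar>" "\<bar>y\<bar>"] abs_ge_zero[of "x * y"]
    unfolding abs_mult mult.assoc power2_abs by linarith
  then show "AE \<omega> in M. norm (b z \<omega> * b w \<omega>) \<le> norm ((b z \<omega>)\<^sup>2 + (b w \<omega>)\<^sup>2)" by simp
qed (use b_sq assms in auto)

lemma edges_in_unit_square:
  "z \<in> open_square \<Longrightarrow> (fst z, 1) \<in> unit_square" "z \<in> open_square \<Longrightarrow> (1, snd z) \<in> unit_square"
  by (auto simp: open_square_def)

lemma g_eq: "g z \<omega> = b z \<omega> - C1 z * b (fst z, 1) \<omega> - C2 z * b (1, snd z) \<omega>"
  by (simp add: G_process_def case_prod_unfold)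

lemma g_abs_le: "z \<in> open_square \<Longrightarrow> \<bar>g z \<omega>\<bar> \<le> \<bar>b z \<omega>\<bar> + \<bar>b (fst z, 1) \<omega>\<bar> + \<bar>b (1, snd z) \<omega>\<bar>"
proof -
  assume z: "z \<in> open_square"
  have "\<bar>C1 z * b (fst z, 1) \<omega>\<bar> \<le> \<bar>b (fst z, 1) \<omega>\<bar>" "\<bar>C2 z * b (1, snd z) \<omega>\<bar> \<le> \<bar>b (1, snd z) \<omega>\<bar>"
    using C1_bound[OF z] C2_bound[OF z] by (auto simp: abs_mult mult_left_le_one_le)
  then show ?thesis unfolding g_eq by linarith
qed

text \<open>As \<open>C1\<close> and \<open>C2\<close> are at most 1 in absolute value, three second
  moments bounded by 1 lead to the constant 9 of the random field.\<close>

lemma g_sq_le: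
  assumes "z \<in> open_square"
  shows "(g z \<omega>)\<^sup>2 \<le> 3 * ((b z \<omega>)\<^sup>2 + (b (fst z, 1) \<omega>)\<^sup>2 + (b (1, snd z) \<omega>)\<^sup>2)"
proof -
  have *: "(x + y + t)\<^sup>2 \<le> 3 * (x\<^sup>2 + y\<^sup>2 + t\<^sup>2)" for x y t :: real
    using sum_squares_bound[of x y] sum_squares_bound[of x t] sum_squares_bound[of y t]
    by (simp add: power2_sum algebra_simps)
  have "\<bar>g z \<omega>\<bar>\<^sup>2 \<le> (\<bar>b z \<omega>\<bar> + \<bar>b (fst z, 1) \<omega>\<bar> + \<bar>b (1, snd z) \<omega>\<bar>)\<^sup>2"
    by (rule power_mono[OF g_abs_le[OF assms]]) simp
  also have "\<dots> \<le> 3 * (\<bar>b z \<omega>\<bar>\<^sup>2 + \<bar>b (fst z, 1) \<omega>\<bar>\<^sup>2 + \<bar>b (1, snd z) \<omega>\<bar>\<^sup>2)" by (rule *)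
  finally show ?thesis by simp
qed

lemma g_measurable_pair: "(\<lambda>(z, \<omega>). g z \<omega>) \<in> borel_measurable (usq \<Otimes>\<^sub>M M)"
proof -
  have [measurable]: "(\<lambda>z. (fst z, 1 :: real)) \<in> measurable usq borel" "(\<lambda>z. (1 :: real, snd z)) \<in> measurable usq borel"
    by (intro borel_measurable_Pair; measurable)+
  have m: "(\<lambda>(z, \<omega>). b z \<omega>) \<in> borel_measurable (usq \<Otimes>\<^sub>M M)"
    "(\<lambda>(z, \<omega>). b (fst z, 1) \<omega>) \<in> borel_measurable (usq \<Otimes>\<^sub>M M)"
    "(\<lambda>(z, \<omega>). b (1, snd z) \<omega>) \<in> borel_measurable (usq \<Otimes>\<^sub>M M)"
    by (intro b_compose edges_in_unit_square open_square_subset; simp)+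
  have m': "(\<lambda>(z, \<omega>). C1 z) \<in> borel_measurable (usq \<Otimes>\<^sub>M M)" "(\<lambda>(z, \<omega>). C2 z) \<in> borel_measurable (usq \<Otimes>\<^sub>M M)"
    by measurable
  show ?thesis
    using borel_measurable_diff[OF borel_measurable_diff[OF m(1) borel_measurable_times[OF m'(1) m(2)]]
        borel_measurable_times[OF m'(2) m(3)]]
    by (simp add: g_eq case_prod_unfold)
qed

sublocale random_field usq M g 9
proof (rule random_field.intro)
  show "prob_space usq" by (rule prob_space_usq)
  show "prob_space M" by (rule M.prob_space_axioms)
  show "random_field_axioms usq M g 9"
  proof
    show "(\<lambda>(z, \<omega>). g z \<omega>) \<in> borel_measurable (usq \<Otimes>\<^sub>M M)" by (rule g_measurable_pair)
    show "\<exists>B. \<forall>z\<in>space usq. \<bar>g z \<omega>\<bar> \<le> B" if \<omega>: "\<omega> \<in> space M" for \<omega>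
    proof -
      obtain B where B: "\<forall>z\<in>unit_square. \<bar>b z \<omega>\<bar> \<le> B" using b_path[OF \<omega>] by blast
      have "\<bar>g z \<omega>\<bar> \<le> 3 * B" if "z \<in> open_square" for z
        using g_abs_le[OF that, of \<omega>] B[rule_format, OF open_square_subset[OF that]]
          B[rule_format, OF edges_in_unit_square(1)[OF that]] B[rule_format, OF edges_in_unit_square(2)[OF that]]
        by linarith
      then show ?thesis by (intro exI[of _ "3 * B"]) simp
    qed
    fix z assume "z \<in> space usq"
    then have z: "z \<in> open_square" by simp
    let ?s = "\<lambda>\<omega>. 3 * ((b z \<omega>)\<^sup>2 + (b (fst z, 1) \<omega>)\<^sup>2 + (b (1, snd z) \<omega>)\<^sup>2)"
    note sq = b_sq[OF open_square_subset[OF z]] b_sq[OF edges_in_unit_square(1)[OF z]] b_sq[OF edges_in_unit_square(2)[OF z]]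
    have gm: "g z \<in> borel_measurable M"
      using measurable_Pair2[OF g_measurable_pair, of z] z by simp
    show i: "integrable M (\<lambda>\<omega>. (g z \<omega>)\<^sup>2)"
      by (rule Bochner_Integration.integrable_bound[of M ?s])
        (use sq gm g_sq_le[OF z] in auto)
    have "(\<integral>\<omega>. (g z \<omega>)\<^sup>2 \<partial>M) \<le> (\<integral>\<omega>. ?s \<omega> \<partial>M)"
      using i sq g_sq_le[OF z] by (intro integral_mono) auto
    also have "\<dots> \<le> 9"
      using sq b_sq_le[OF open_square_subset[OF z]] b_sq_le[OF edges_in_unit_square(1)[OF z]]
        b_sq_le[OF edges_in_unit_square(2)[OF z]] by simp
    finally show "(\<integral>\<omega>. (g z \<omega>)\<^sup>2 \<partial>M) \<le> 9" .
  qed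
qed

lemma g_mean: "z \<in> open_square \<Longrightarrow> (\<integral>\<omega>. g z \<omega> \<partial>M) = 0"
  unfolding g_eq
  using b_integrable[OF open_square_subset] b_integrable[OF edges_in_unit_square(1)] b_integrable[OF edges_in_unit_square(2)]
    b_mean[OF open_square_subset] b_mean[OF edges_in_unit_square(1)] b_mean[OF edges_in_unit_square(2)]
  by simp

abbreviation Z :: "real \<Rightarrow> 'a \<Rightarrow> real" where "Z \<equiv> Z_limit C1 C2 b"

lemma lower_square_bound: "\<bar>lower_square p z\<bar> \<le> 1" by (simp add: indicator_def)

lemma Z_eq:
  assumes "\<omega> \<in> space M" "p \<in> {0..1}"
  shows "Z p \<omega> = functional (lower_square p) \<omega> / D_norm p"
  unfolding Z_limit_def functional_def using assms
  by (subst square_integral_usq) (auto intro: g_section2)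

lemma Z_measurable: "p \<in> {0..1} \<Longrightarrow> Z p \<in> borel_measurable M"
  using functional_measurable[OF lower_square_measurable lower_square_bound]
  by (subst measurable_cong[OF Z_eq]) auto

lemma Z_sq_integrable: "p \<in> {0..1} \<Longrightarrow> integrable M (\<lambda>\<omega>. (Z p \<omega>)\<^sup>2)"
proof -
  assume p: "p \<in> {0..1}"
  have "integrable M (\<lambda>\<omega>. (functional (lower_square p) \<omega>)\<^sup>2 / (D_norm p)\<^sup>2)"
    using functional_sq_integrable[OF lower_square_measurable lower_square_bound, of p] by simp
  then show ?thesis
    by (rule Bochner_Integration.integrable_cong[THEN iffD1, OF refl, rotated]) (simp add: Z_eq[OF _ p] power_divide)
qed

lemma Z_integrable: "p \<in> {0..1} \<Longrightarrow> integrable M (Z p)"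
  by (rule M.square_integrable_imp_integrable[OF Z_measurable Z_sq_integrable])

lemma Z_mean:
  assumes "p \<in> {0..1}"
  shows "(\<integral>\<omega>. Z p \<omega> \<partial>M) = 0"
proof -
  have "(\<integral>\<omega>. Z p \<omega> \<partial>M) = (\<integral>\<omega>. functional (lower_square p) \<omega> / D_norm p \<partial>M)"
    using assms by (intro Bochner_Integration.integral_cong refl Z_eq)
  also have "\<dots> = (\<integral>z. lower_square p z * (\<integral>\<omega>. g z \<omega> \<partial>M) \<partial>usq) / D_norm p"
    using functional_expectation[OF lower_square_measurable lower_square_bound] by simp
  also have "(\<integral>z. lower_square p z * (\<integral>\<omega>. g z \<omega> \<partial>M) \<partial>usq) = (\<integral>z. 0 \<partial>usq)"
    by (intro Bochner_Integration.integral_cong refl) (simp add: g_mean)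
  finally show ?thesis by simp
qed

lemma Z_product:
  assumes "p \<in> {0..1}" "q \<in> {0..1}"
  shows "(\<integral>\<omega>. Z p \<omega> * Z q \<omega> \<partial>M) = 1 / (D_norm p * D_norm q) *
    (\<integral>z. lower_square p z * (\<integral>w. lower_square q w * (\<integral>\<omega>. g z \<omega> * g w \<omega> \<partial>M) \<partial>usq) \<partial>usq)"
proof -
  have "(\<integral>\<omega>. Z p \<omega> * Z q \<omega> \<partial>M) =
      (\<integral>\<omega>. 1 / (D_norm p * D_norm q) * (functional (lower_square p) \<omega> * functional (lower_square q) \<omega>) \<partial>M)"
    using assms by (intro Bochner_Integration.integral_cong refl) (simp add: Z_eq)
  then show ?thesis
    using functional_covariance[OF lower_square_measurable lower_square_bound lower_square_measurable lower_square_bound]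
    by simp
qed

lemma Z_sq_le:
  assumes "0 < p0" "p \<in> {p0..1}"
  shows "(\<integral>\<omega>. (Z p \<omega>)\<^sup>2 \<partial>M) \<le> 9 / (p0 ^ 3 / 12)\<^sup>2"
proof -
  have D: "p0 ^ 3 / 12 \<le> D_norm p" "0 < p0 ^ 3 / 12" using assms D_norm_lower by auto
  have "(\<integral>\<omega>. (Z p \<omega>)\<^sup>2 \<partial>M) = (\<integral>\<omega>. (functional (lower_square p) \<omega>)\<^sup>2 / (D_norm p)\<^sup>2 \<partial>M)"
    using assms by (intro Bochner_Integration.integral_cong refl) (simp add: Z_eq power_divide)
  also have "\<dots> = (\<integral>\<omega>. (functional (lower_square p) \<omega>)\<^sup>2 \<partial>M) / (D_norm p)\<^sup>2" by simp
  also have "\<dots> \<le> 9 / (p0 ^ 3 / 12)\<^sup>2"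
    using functional_sq_bound[OF lower_square_measurable lower_square_bound] D
    by (intro frac_le power_mono zero_less_power) auto
  finally show ?thesis .
qed

text \<open>Moving \<open>p\<close> changes both the domain of integration and the divisor. The
  domain contributes the order \<open>sqrt d\<close>, through two strips; the divisor contributes
  the order \<open>d \<le> sqrt d\<close> times the functional itself.\<close>

lemma Z_hoelder:
  assumes p0: "0 < p0" and p: "p \<in> {p0..1}" and q: "q \<in> {p0..1}" and d: "\<bar>p - q\<bar> \<le> d" "0 < d" "d \<le> 1"
    and \<omega>: "\<omega> \<in> space M"
  shows "\<bar>Z p \<omega> - Z q \<omega>\<bar> \<le> sqrt d * ((2 / (p0 ^ 3 / 12) + 2 / (p0 ^ 3 / 12)\<^sup>2) * (1 + energy \<omega>))"
proof -
  define D0 where "D0 = p0 ^ 3 / 12"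
  have D: "D0 \<le> D_norm p" "D0 \<le> D_norm q" "0 < D0" using p0 p q D_norm_lower by (auto simp: D0_def)
  have diff: "\<bar>functional (lower_square p) \<omega> - functional (lower_square q) \<omega>\<bar> \<le> 2 * sqrt d * (1 + energy \<omega>)"
    if "p \<le> q" "p \<in> {p0..1}" "q \<in> {p0..1}" "\<bar>p - q\<bar> \<le> d" for p q
  proof (rule functional_diff_le[OF lower_square_measurable lower_square_bound lower_square_measurable lower_square_bound])
    have o: "0 \<le> p" "p \<le> q" "q \<le> 1" using that p0 by auto
    note u = usq_lower_diff[OF o]
    show "{z \<in> open_square. p < fst z \<and> fst z \<le> q \<or> p < snd z \<and> snd z \<le> q} \<in> sets usq" by (rule u(1))
    \<comment> \<open>The radius for \<open>functional_diff_le\<close> is \<open>2 * sqrt d\<close>,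
      because its square exceeds the total measure of the strips.\<close>
    have "2 * (q - p) \<le> 4 * d" using that d(2) by (simp add: abs_real_def split: if_splits)
    also have "\<dots> = (2 * sqrt d)\<^sup>2" using d by (simp add: power_mult_distrib)
    finally show "measure usq {z \<in> open_square. p < fst z \<and> fst z \<le> q \<or> p < snd z \<and> snd z \<le> q} \<le> (2 * sqrt d)\<^sup>2"
      using u(2) by linarith
    show "\<bar>lower_square p z - lower_square q z\<bar> \<le> indicator {z \<in> open_square. p < fst z \<and> fst z \<le> q \<or> p < snd z \<and> snd z \<le> q} z"
      if "z \<in> space usq" for z
      using that unfolding space_usq by (rule u(3))
  qed (use d \<omega> in auto)
  define I where "I p = functional (lower_square p) \<omega>" for p
  have I_diff: "\<bar>I p - I q\<bar> \<le> 2 * sqrt d * (1 + energy \<omega>)"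
    using diff[of p q] diff[of q p] p q d unfolding I_def by (cases "p \<le> q") (auto simp: abs_minus_commute)
  have I_le: "\<bar>I q\<bar> \<le> 1 + energy \<omega>"
    unfolding I_def by (rule functional_abs_le[OF lower_square_measurable lower_square_bound \<omega>])
  have e: "0 \<le> 1 + energy \<omega>" using energy_nonneg[of \<omega>] by linarith
  have "d \<le> sqrt d" using d by (simp add: real_le_rsqrt power2_eq_square mult_left_le_one_le)
  have inv: "\<bar>1 / D_norm p - 1 / D_norm q\<bar> \<le> 2 * d / D0\<^sup>2"
  proof -
    have "\<bar>1 / D_norm p - 1 / D_norm q\<bar> = \<bar>D_norm p - D_norm q\<bar> / (D_norm p * D_norm q)"
      using D by (simp add: field_simps abs_minus_commute)
    also have "\<dots> \<le> (2 * d) / (D0 * D0)"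
      using D D_norm_Lipschitz[of p q] p q p0 d by (intro frac_le mult_mono) auto
    finally show ?thesis by (simp add: power2_eq_square)
  qed
  have "Z p \<omega> - Z q \<omega> = (I p - I q) / D_norm p + I q * (1 / D_norm p - 1 / D_norm q)"
    using p q p0 \<omega> by (simp add: Z_eq I_def diff_divide_distrib right_diff_distrib)
  then have "\<bar>Z p \<omega> - Z q \<omega>\<bar> \<le> \<bar>I p - I q\<bar> / D_norm p + \<bar>I q\<bar> * \<bar>1 / D_norm p - 1 / D_norm q\<bar>"
    using D abs_triangle_ineq[of "(I p - I q) / D_norm p" "I q * (1 / D_norm p - 1 / D_norm q)"]
    by (simp add: abs_mult)
  also have "\<dots> \<le> (2 * sqrt d * (1 + energy \<omega>)) / D0 + (1 + energy \<omega>) * (2 * d / D0\<^sup>2)"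
    using D I_diff I_le inv e d by (intro add_mono frac_le mult_mono) auto
  also have "(1 + energy \<omega>) * (2 * d / D0\<^sup>2) \<le> (1 + energy \<omega>) * (2 * sqrt d / D0\<^sup>2)"
    using e \<open>d \<le> sqrt d\<close> by (intro mult_left_mono divide_right_mono) auto
  finally show ?thesis by (simp add: D0_def algebra_simps)
qed

end

section \<open>The limit process\<close>

definition bridge_cov :: "(real \<times> real \<Rightarrow> real) \<Rightarrow> real \<times> real \<Rightarrow> real \<times> real \<Rightarrow> real" where
  "bridge_cov C z w = C (min (fst z) (fst w), min (snd z) (snd w)) - C z * C w"

text \<open>Bilinear expansion of the covariance of \<open>g\<close>, with \<open>K\<close>
  absorbing the second argument \<open>w\<close>. It mentions no process and so can be shared by
  processes on different probability spaces.\<close>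

definition G_cov :: "(real \<times> real \<Rightarrow> real) \<Rightarrow> (real \<times> real \<Rightarrow> real) \<Rightarrow> (real \<times> real \<Rightarrow> real) \<Rightarrow>
    real \<times> real \<Rightarrow> real \<times> real \<Rightarrow> real" where
  "G_cov C C1 C2 z w = (let K = (\<lambda>x. bridge_cov C x w - C1 w * bridge_cov C x (fst w, 1) - C2 w * bridge_cov C x (1, snd w))
     in K z - C1 z * K (fst z, 1) - C2 z * K (1, snd z))"

definition Z_cov :: "(real \<times> real \<Rightarrow> real) \<Rightarrow> (real \<times> real \<Rightarrow> real) \<Rightarrow> (real \<times> real \<Rightarrow> real) \<Rightarrow> real \<Rightarrow> real \<Rightarrow> real" where
  "Z_cov C C1 C2 p q = 1 / (D_norm p * D_norm q) *
    (\<integral>z. lower_square p z * (\<integral>w. lower_square q w * G_cov C C1 C2 z w \<partial>usq) \<partial>usq)"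

lemma bridge_cov_diag_le: "copula C \<Longrightarrow> z \<in> unit_square \<Longrightarrow> bridge_cov C z z \<le> 1"
  using copula_range[of C z] by (auto simp: bridge_cov_def intro: order_trans[of _ "C z"])

text \<open>Two instances matter: the Brownian bridge, and the centred indicator of a single
  observation. Their common covariance makes the limit of the central limit theorem agree with the
  bridge functional.\<close>

locale copula_process = bounded_process +
  fixes C :: "real \<times> real \<Rightarrow> real"
  assumes b_cov: "\<And>z w. z \<in> unit_square \<Longrightarrow> w \<in> unit_square \<Longrightarrow> (\<integral>\<omega>. b z \<omega> * b w \<omega> \<partial>M) = bridge_cov C z w"
begin

lemma g_cov:
  assumes z: "z \<in> open_square" and w: "w \<in> open_square"
  shows "(\<integral>\<omega>. g z \<omega> * g w \<omega> \<partial>M) = G_cov C C1 C2 z w"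
proof -
  note zs = open_square_subset[OF z] edges_in_unit_square(1)[OF z] edges_in_unit_square(2)[OF z]
  note ws = open_square_subset[OF w] edges_in_unit_square(1)[OF w] edges_in_unit_square(2)[OF w]
  define h where "h x \<omega> = b x \<omega> * b w \<omega> - C1 w * (b x \<omega> * b (fst w, 1) \<omega>) - C2 w * (b x \<omega> * b (1, snd w) \<omega>)" for x \<omega>
  have h: "integrable M (h x)"
      "(\<integral>\<omega>. h x \<omega> \<partial>M) = bridge_cov C x w - C1 w * bridge_cov C x (fst w, 1) - C2 w * bridge_cov C x (1, snd w)"
    if "x \<in> unit_square" for x
    using b_prod_integrable[OF that ws(1)] b_prod_integrable[OF that ws(2)] b_prod_integrable[OF that ws(3)]
      b_cov[OF that ws(1)] b_cov[OF that ws(2)] b_cov[OF that ws(3)]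
    by (simp_all add: h_def[abs_def])
  have "g z \<omega> * g w \<omega> = h z \<omega> - C1 z * h (fst z, 1) \<omega> - C2 z * h (1, snd z) \<omega>" for \<omega>
    unfolding g_eq h_def by (simp add: algebra_simps)
  then have "(\<integral>\<omega>. g z \<omega> * g w \<omega> \<partial>M) = (\<integral>\<omega>. h z \<omega> - C1 z * h (fst z, 1) \<omega> - C2 z * h (1, snd z) \<omega> \<partial>M)"
    by presburger
  also have "\<dots> = (\<integral>\<omega>. h z \<omega> \<partial>M) - C1 z * (\<integral>\<omega>. h (fst z, 1) \<omega> \<partial>M) - C2 z * (\<integral>\<omega>. h (1, snd z) \<omega> \<partial>M)"
  proof -
    note i = h(1)[OF zs(1)] integrable_mult_right[OF h(1)[OF zs(2)], of "C1 z"] integrable_mult_right[OF h(1)[OF zs(3)], of "C2 z"]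
    show ?thesis
      unfolding Bochner_Integration.integral_diff[OF Bochner_Integration.integrable_diff[OF i(1,2)] i(3)]
        Bochner_Integration.integral_diff[OF i(1,2)] integral_mult_right_zero by (rule refl)
  qed
  also have "\<dots> = G_cov C C1 C2 z w"
    unfolding h(2)[OF zs(1)] h(2)[OF zs(2)] h(2)[OF zs(3)] G_cov_def Let_def by (rule refl)
  finally show ?thesis .
qed

lemma Z_product_cov:
  assumes "p \<in> {0..1}" "q \<in> {0..1}"
  shows "(\<integral>\<omega>. Z p \<omega> * Z q \<omega> \<partial>M) = Z_cov C C1 C2 p q"
proof -
  have "(\<integral>z. lower_square p z * (\<integral>w. lower_square q w * (\<integral>\<omega>. g z \<omega> * g w \<omega> \<partial>M) \<partial>usq) \<partial>usq) =
      (\<integral>z. lower_square p z * (\<integral>w. lower_square q w * G_cov C C1 C2 z w \<partial>usq) \<partial>usq)"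
    by (intro Bochner_Integration.integral_cong refl arg_cong2[where f = "(*)"]) (simp add: g_cov)
  then show ?thesis unfolding Z_product[OF assms] Z_cov_def by simp
qed

lemma Z_prod_integrable:
  assumes "p \<in> {0..1}" "q \<in> {0..1}"
  shows "integrable M (\<lambda>\<omega>. Z p \<omega> * Z q \<omega>)"
proof (rule Bochner_Integration.integrable_bound[of M "\<lambda>\<omega>. (Z p \<omega>)\<^sup>2 + (Z q \<omega>)\<^sup>2"])
  show "(\<lambda>\<omega>. Z p \<omega> * Z q \<omega>) \<in> borel_measurable M" using Z_measurable assms by measurable
  have "\<bar>x * y\<bar> \<le> x\<^sup>2 + y\<^sup>2" for x y :: real
    using sum_squares_bound[of "\<bar>x\<bar>" "\<bar>y\<bar>"] abs_ge_zero[of "x * y"]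
    unfolding abs_mult mult.assoc power2_abs by linarith
  then show "AE \<omega> in M. norm (Z p \<omega> * Z q \<omega>) \<le> norm ((Z p \<omega>)\<^sup>2 + (Z q \<omega>)\<^sup>2)" by simp
qed (use Z_sq_integrable assms in auto)

lemma Z_combination:
  assumes t: "\<And>j. j \<in> J \<Longrightarrow> t j \<in> {0..1}"
  shows "(\<integral>\<omega>. (\<Sum>j\<in>J. a j * Z (t j) \<omega>)\<^sup>2 \<partial>M) = (\<Sum>i\<in>J. \<Sum>j\<in>J. a i * a j * Z_cov C C1 C2 (t i) (t j))"
    "integrable M (\<lambda>\<omega>. (\<Sum>j\<in>J. a j * Z (t j) \<omega>)\<^sup>2)"
proof -
  have sq: "(\<Sum>j\<in>J. a j * Z (t j) \<omega>)\<^sup>2 = (\<Sum>i\<in>J. \<Sum>j\<in>J. a i * a j * (Z (t i) \<omega> * Z (t j) \<omega>))" for \<omega>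
    by (simp add: power2_eq_square sum_product mult_ac)
  have i: "integrable M (\<lambda>\<omega>. a i * a j * (Z (t i) \<omega> * Z (t j) \<omega>))" if "i \<in> J" "j \<in> J" for i j
    using Z_prod_integrable[OF t t] that by (intro integrable_mult_right) auto
  show "integrable M (\<lambda>\<omega>. (\<Sum>j\<in>J. a j * Z (t j) \<omega>)\<^sup>2)"
    unfolding sq using i by (intro Bochner_Integration.integrable_sum) auto
  show "(\<integral>\<omega>. (\<Sum>j\<in>J. a j * Z (t j) \<omega>)\<^sup>2 \<partial>M) = (\<Sum>i\<in>J. \<Sum>j\<in>J. a i * a j * Z_cov C C1 C2 (t i) (t j))"
    unfolding sq using i t
    by (simp add: Bochner_Integration.integral_sum Bochner_Integration.integrable_sum Z_product_cov cong: sum.cong_simp)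
qed

text \<open>Each Lebesgue integral over a square is moved to \<open>usq\<close>, the inner one
  before the outer one. In the open square \<open>g\<close> has mean zero, so
  \<open>Gamma_cov\<close> is a mean product there, and \<open>Z_product\<close> supplies the
  rest.\<close>

lemma covariance_Z:
  assumes p: "p \<in> {0..1}" and q: "q \<in> {0..1}"
  shows "covariance M (Z p) (Z q) = 1 / (D_norm p * D_norm q) *
    (LINT w:{0..p} \<times> {0..p}|lebesgue. LINT z:{0..q} \<times> {0..q}|lebesgue. Gamma_cov M C1 C2 b w z)"
proof -
  have \<Gamma>: "Gamma_cov M C1 C2 b w z = (\<integral>\<omega>. g w \<omega> * g z \<omega> \<partial>M)" if "w \<in> open_square" "z \<in> open_square" for w z
    using that by (simp add: Gamma_cov_def covariance_def g_mean)
  have inner: "square_integral (Gamma_cov M C1 C2 b w) q = (\<integral>z. lower_square q z * (\<integral>\<omega>. g w \<omega> * g z \<omega> \<partial>M) \<partial>usq)"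
    if w: "w \<in> open_square" for w
  proof -
    have [measurable]: "g w \<in> borel_measurable M" using w g_section1 by simp
    have "(\<lambda>z. \<integral>\<omega>. g w \<omega> * g z \<omega> \<partial>M) \<in> borel_measurable usq" by measurable
    then have "Gamma_cov M C1 C2 b w \<in> borel_measurable usq"
      by (rule measurable_cong[THEN iffD1, rotated]) (simp add: \<Gamma> w)
    then have "square_integral (Gamma_cov M C1 C2 b w) q = (\<integral>z. lower_square q z * Gamma_cov M C1 C2 b w z \<partial>usq)"
      using q by (intro square_integral_usq) auto
    also have "\<dots> = (\<integral>z. lower_square q z * (\<integral>\<omega>. g w \<omega> * g z \<omega> \<partial>M) \<partial>usq)"
      by (intro Bochner_Integration.integral_cong refl) (simp add: \<Gamma> w)
    finally show ?thesis .
  qed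
  have "(\<lambda>w. \<integral>z. lower_square q z * (\<integral>\<omega>. g w \<omega> * g z \<omega> \<partial>M) \<partial>usq) \<in> borel_measurable usq" by measurable
  then have "(\<lambda>w. square_integral (Gamma_cov M C1 C2 b w) q) \<in> borel_measurable usq"
    by (rule measurable_cong[THEN iffD1, rotated]) (simp add: inner)
  then have "square_integral (\<lambda>w. square_integral (Gamma_cov M C1 C2 b w) q) p =
      (\<integral>w. lower_square p w * square_integral (Gamma_cov M C1 C2 b w) q \<partial>usq)"
    using p by (intro square_integral_usq) auto
  also have "\<dots> = (\<integral>w. lower_square p w * (\<integral>z. lower_square q z * (\<integral>\<omega>. g w \<omega> * g z \<omega> \<partial>M) \<partial>usq) \<partial>usq)"
    by (intro Bochner_Integration.integral_cong refl) (simp add: inner)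
  finally show ?thesis
    using Z_product[OF p q] by (simp add: covariance_def Z_mean[OF p] Z_mean[OF q] square_integral_def)
qed

end

text \<open>Values on grids approximate a process with continuous paths and so give its joint measurability.\<close>

definition grid_up :: "nat \<Rightarrow> real \<times> real \<Rightarrow> real \<times> real" where
  "grid_up k z = (of_int \<lceil>real (Suc k) * fst z\<rceil> / real (Suc k), of_int \<lceil>real (Suc k) * snd z\<rceil> / real (Suc k))"

definition grid :: "nat \<Rightarrow> (real \<times> real) set" where
  "grid k = (\<lambda>(i, j). (real i / real (Suc k), real j / real (Suc k))) ` ({..Suc k} \<times> {..Suc k})"

lemma finite_grid: "finite (grid k)" by (simp add: grid_def)

lemma grid_subset: "grid k \<subseteq> unit_square" by (auto simp: grid_def divide_le_eq_1)

lemma grid_up_in_grid: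
  assumes "z \<in> unit_square"
  shows "grid_up k z \<in> grid k"
proof -
  have *: "\<exists>i\<in>{..Suc k}. of_int \<lceil>real (Suc k) * u\<rceil> / real (Suc k) = real i / real (Suc k)" if u: "u \<in> {0..1}" for u
  proof (intro bexI[of _ "nat \<lceil>real (Suc k) * u\<rceil>"])
    have "real (Suc k) * u \<le> real (Suc k) * 1" using u by (intro mult_left_mono) auto
    then have "\<lceil>real (Suc k) * u\<rceil> \<le> int (Suc k)" by (simp add: ceiling_le_iff)
    then show "nat \<lceil>real (Suc k) * u\<rceil> \<in> {..Suc k}" by (simp only: atMost_iff nat_le_iff)
    have "0 \<le> real (Suc k) * u" using u by (intro mult_nonneg_nonneg) auto
    then have "0 \<le> \<lceil>real (Suc k) * u\<rceil>" by (simp add: zero_le_ceiling)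
    then show "of_int \<lceil>real (Suc k) * u\<rceil> / real (Suc k) = real (nat \<lceil>real (Suc k) * u\<rceil>) / real (Suc k)"
      by (simp add: of_nat_nat)
  qed
  then obtain i j where "i \<in> {..Suc k}" "j \<in> {..Suc k}" "grid_up k z = (real i / real (Suc k), real j / real (Suc k))"
    using *[of "fst z"] *[of "snd z"] assms by (fastforce simp: grid_up_def mem_Times_iff)
  then show ?thesis unfolding grid_def by auto
qed

lemma grid_up_unit: "z \<in> unit_square \<Longrightarrow> grid_up k z \<in> unit_square"
  using grid_up_in_grid grid_subset by blast

lemma grid_up_tendsto: "(\<lambda>k. grid_up k z) \<longlonglongrightarrow> z"
proof -
  have *: "(\<lambda>k. of_int \<lceil>real (Suc k) * u\<rceil> / real (Suc k)) \<longlonglongrightarrow> u" for u :: real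
  proof (rule real_tendsto_sandwich)
    have b: "real (Suc k) * u \<le> of_int \<lceil>real (Suc k) * u\<rceil>" "of_int \<lceil>real (Suc k) * u\<rceil> \<le> real (Suc k) * u + 1" for k
      by linarith+
    show "\<forall>\<^sub>F k in sequentially. u \<le> of_int \<lceil>real (Suc k) * u\<rceil> / real (Suc k)"
      using b(1) by (auto simp: pos_le_divide_eq mult.commute simp del: of_nat_Suc)
    show "\<forall>\<^sub>F k in sequentially. of_int \<lceil>real (Suc k) * u\<rceil> / real (Suc k) \<le> u + 1 / real (Suc k)"
    proof (intro always_eventually allI)
      fix k
      have "(u + 1 / real (Suc k)) * real (Suc k) = real (Suc k) * u + 1" by (simp add: field_simps del: of_nat_Suc)
      then show "of_int \<lceil>real (Suc k) * u\<rceil> / real (Suc k) \<le> u + 1 / real (Suc k)"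
        using b(2)[of k] by (simp only: pos_divide_le_eq of_nat_0_less_iff zero_less_Suc)
    qed
    have "(\<lambda>k. u + 1 / real (Suc k)) \<longlonglongrightarrow> u + 0" by (intro tendsto_intros LIMSEQ_Suc[OF lim_1_over_n])
    then show "(\<lambda>k. u + 1 / real (Suc k)) \<longlonglongrightarrow> u" by simp
  qed auto
  show ?thesis unfolding grid_up_def using tendsto_Pair[OF *[of "fst z"] *[of "snd z"]] by simp
qed

lemma grid_up_measurable[measurable]: "grid_up k \<in> measurable borel borel"
  unfolding grid_up_def[abs_def] by (intro borel_measurable_Pair; measurable)

text \<open>Separates the dependence on \<open>z\<close> (indicator coefficients) from the finitely
  many values of \<open>f\<close>. Joint measurability and the form of a finite linear combination
  can then be read off.\<close>

lemma grid_up_sum: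
  fixes f :: "real \<times> real \<Rightarrow> real"
  assumes "z \<in> unit_square"
  shows "f (grid_up k z) = (\<Sum>x\<in>grid k. of_bool (grid_up k z = x) * f x)"
proof -
  have "(\<Sum>x\<in>grid k. of_bool (grid_up k z = x) * f x) = (\<Sum>x\<in>grid k. if grid_up k z = x then f x else 0)"
    by (intro sum.cong) auto
  then show ?thesis using grid_up_in_grid[OF assms] finite_grid by (simp add: sum.delta')
qed

section \<open>Gaussianity of the integrated bridge functional\<close>

context
  fixes N :: "'b measure" and C C1 C2 :: "real \<times> real \<Rightarrow> real" and B :: "real \<times> real \<Rightarrow> 'b \<Rightarrow> real"
  assumes N: "prob_space N" and C: "copula C" and B: "brownian_bridge N C B"
    and C1: "C1 \<in> borel_measurable usq" "\<And>z. z \<in> open_square \<Longrightarrow> \<bar>C1 z\<bar> \<le> 1"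
    and C2: "C2 \<in> borel_measurable usq" "\<And>z. z \<in> open_square \<Longrightarrow> \<bar>C2 z\<bar> \<le> 1"
begin

lemma bridge_gaussian: "centered_gaussian_process N unit_square B"
  using B by (simp add: brownian_bridge_def)

lemma bridge_meas: "z \<in> unit_square \<Longrightarrow> B z \<in> borel_measurable N"
  and bridge_mean: "z \<in> unit_square \<Longrightarrow> (\<integral>\<omega>. B z \<omega> \<partial>N) = 0"
  using bridge_gaussian by (auto simp: centered_gaussian_process_def)

lemma bridge_normal:
  assumes "finite I" "I \<subseteq> unit_square"
  shows "normal_rv N (\<lambda>\<omega>. \<Sum>t\<in>I. a t * B t \<omega>)"
  using bridge_gaussian[unfolded centered_gaussian_process_def, THEN conjunct2, rule_format, OF conjI[OF assms]] .

lemma bridge_sq: "z \<in> unit_square \<Longrightarrow> integrable N (\<lambda>\<omega>. (B z \<omega>)\<^sup>2)"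
proof -
  assume z: "z \<in> unit_square"
  have "normal_rv N (B z)"
    using bridge_normal[of "{z}" "\<lambda>_. 1"] z by simp
  from centered_normal_rv(2)[OF N this bridge_mean[OF z]] show ?thesis .
qed

lemma bridge_covariance:
  assumes "z \<in> unit_square" "w \<in> unit_square"
  shows "(\<integral>\<omega>. B z \<omega> * B w \<omega> \<partial>N) = bridge_cov C z w"
proof -
  have "covariance N (B z) (B w) = bridge_cov C z w"
    using B assms unfolding brownian_bridge_def bridge_cov_def by (cases z; cases w) auto
  then show ?thesis using assms by (simp add: covariance_def bridge_mean)
qed

lemma bridge_path_continuous: "\<omega> \<in> space N \<Longrightarrow> continuous_on unit_square (\<lambda>z. B z \<omega>)"
  using B by (simp add: brownian_bridge_def)

lemma bridge_path_bounded: "\<omega> \<in> space N \<Longrightarrow> \<exists>b. \<forall>z\<in>unit_square. \<bar>B z \<omega>\<bar> \<le> b"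
  using compact_imp_bounded[OF compact_continuous_image[OF bridge_path_continuous]]
  by (auto simp: bounded_iff compact_Times)

lemma bridge_sq_le: "z \<in> unit_square \<Longrightarrow> (\<integral>\<omega>. (B z \<omega>)\<^sup>2 \<partial>N) \<le> 1"
  using bridge_covariance[of z z] bridge_cov_diag_le[OF C, of z] by (simp add: power2_eq_square)

lemma bridge_grid_pair:
  "(\<lambda>(z, \<omega>). B (grid_up k z) \<omega>) \<in> borel_measurable (restrict_space borel unit_square \<Otimes>\<^sub>M N)"
proof -
  have [measurable]: "grid_up k \<in> measurable (restrict_space borel unit_square) borel"
    by (rule measurable_restrict_space1) simp
  have "(\<lambda>(z, \<omega>). of_bool (grid_up k z = x) * B x \<omega>) \<in> borel_measurable (restrict_space borel unit_square \<Otimes>\<^sub>M N)"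
    if "x \<in> grid k" for x
  proof -
    have [measurable]: "B x \<in> borel_measurable N" using that grid_subset bridge_meas by blast
    show ?thesis by measurable
  qed
  then have "(\<lambda>p. \<Sum>x\<in>grid k. (case p of (z, \<omega>) \<Rightarrow> of_bool (grid_up k z = x) * B x \<omega>)) \<in>
      borel_measurable (restrict_space borel unit_square \<Otimes>\<^sub>M N)"
    by (rule borel_measurable_sum)
  then show ?thesis
    by (rule measurable_cong[THEN iffD1, rotated])
      (auto simp: space_pair_measure space_restrict_space grid_up_sum[symmetric, where f = "\<lambda>x. B x _"])
qed

lemma bridge_grid_tendsto:
  "\<omega> \<in> space N \<Longrightarrow> z \<in> unit_square \<Longrightarrow> (\<lambda>k. B (grid_up k z) \<omega>) \<longlonglongrightarrow> B z \<omega>"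
  by (rule continuous_on_tendsto_compose[OF bridge_path_continuous grid_up_tendsto _ always_eventually[OF allI[OF grid_up_unit]]])

lemma bridge_pair: "(\<lambda>(z, \<omega>). B z \<omega>) \<in> borel_measurable (restrict_space borel unit_square \<Otimes>\<^sub>M N)"
  by (rule borel_measurable_LIMSEQ_real[OF _ bridge_grid_pair])
    (auto simp: space_pair_measure space_restrict_space intro: bridge_grid_tendsto)

lemma bridge_copula_process: "copula_process N B C1 C2 C"
proof (intro copula_process.intro bounded_process.intro N)
  show "bounded_process_axioms N B C1 C2"
    by unfold_locales
      (fact bridge_pair bridge_path_bounded bridge_mean bridge_sq bridge_sq_le C1 C2 | assumption)+
  show "copula_process_axioms N B C"
    by unfold_locales (rule bridge_covariance)
qed

text \<open>Rounding \<open>z\<close> to a grid point preserves the mean and the moment bound but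
  changes the covariance, so the framework is \<open>bounded_process\<close> and not
  \<open>copula_process\<close>.\<close>

lemma bridge_grid_process: "bounded_process N (\<lambda>z. B (grid_up k z)) C1 C2"
proof (intro bounded_process.intro N)
  show "bounded_process_axioms N (\<lambda>z. B (grid_up k z)) C1 C2"
  proof
    show "(\<lambda>(z, \<omega>). B (grid_up k z) \<omega>) \<in> borel_measurable (restrict_space borel unit_square \<Otimes>\<^sub>M N)"
      by (rule bridge_grid_pair)
    show "\<exists>b. \<forall>z\<in>unit_square. \<bar>B (grid_up k z) \<omega>\<bar> \<le> b" if \<omega>: "\<omega> \<in> space N" for \<omega>
    proof -
      obtain b where "\<forall>z\<in>unit_square. \<bar>B z \<omega>\<bar> \<le> b" using bridge_path_bounded[OF \<omega>] by blast
      then show ?thesis by (intro exI[of _ b] ballI) (simp only: grid_up_unit)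
    qed
  qed (use grid_up_unit bridge_mean bridge_sq bridge_sq_le C1 C2 in auto)
qed

interpretation BB: copula_process N B C1 C2 C by (rule bridge_copula_process)

text \<open>The coefficient of \<open>B x\<close> when \<open>g\<close> of the gridded bridge at
  \<open>z\<close> is written as a finite linear combination of grid values.\<close>

definition weight :: "nat \<Rightarrow> real \<times> real \<Rightarrow> real \<times> real \<Rightarrow> real" where
  "weight k x z = of_bool (grid_up k z = x) - C1 z * of_bool (grid_up k (fst z, 1) = x) - C2 z * of_bool (grid_up k (1, snd z) = x)"

lemma weight_integrable: "integrable usq (\<lambda>z. lower_square p z * weight k x z)"
proof -
  have [measurable]: "(\<lambda>z. (fst z, 1 :: real)) \<in> measurable usq borel" "(\<lambda>z. (1 :: real, snd z)) \<in> measurable usq borel"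
    by (intro borel_measurable_Pair; measurable)+
  have [measurable]: "C1 \<in> borel_measurable usq" "C2 \<in> borel_measurable usq" by (fact C1 C2)+
  have [measurable]: "grid_up k \<in> measurable usq borel" by (rule measurable_compose[OF id_usq_measurable]) measurable
  have "\<bar>weight k x z\<bar> \<le> 3" if "z \<in> open_square" for z
    using C1(2)[OF that] C2(2)[OF that] by (auto simp: weight_def of_bool_def)
  then have "\<bar>lower_square p z * weight k x z\<bar> \<le> 3" if "z \<in> open_square" for z
    using that by (auto simp: abs_mult indicator_def)
  moreover have "(\<lambda>z. lower_square p z * weight k x z) \<in> borel_measurable usq"
    unfolding weight_def by measurable
  ultimately show ?thesis by (intro BB.S.integrable_const_bound[of _ 3]) auto
qed

lemma bridge_grid_Z:
  assumes \<omega>: "\<omega> \<in> space N" and p: "p \<in> {0..1}"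
  shows "Z_limit C1 C2 (\<lambda>z. B (grid_up k z)) p \<omega> =
    (\<Sum>x\<in>grid k. (\<integral>z. lower_square p z * weight k x z \<partial>usq) / D_norm p * B x \<omega>)"
proof -
  interpret Bk: bounded_process N "\<lambda>z. B (grid_up k z)" C1 C2 by (rule bridge_grid_process)
  have "Bk.functional (lower_square p) \<omega> = (\<integral>z. (\<Sum>x\<in>grid k. lower_square p z * weight k x z * B x \<omega>) \<partial>usq)"
    unfolding Bk.functional_def
  proof (intro Bochner_Integration.integral_cong refl)
    fix z assume "z \<in> space usq"
    then have z: "z \<in> open_square" by simp
    have "Bk.g z \<omega> = (\<Sum>x\<in>grid k. weight k x z * B x \<omega>)"
      unfolding Bk.g_eq grid_up_sum[OF open_square_subset[OF z], where f = "\<lambda>x. B x \<omega>"]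
        grid_up_sum[OF BB.edges_in_unit_square(1)[OF z], where f = "\<lambda>x. B x \<omega>"]
        grid_up_sum[OF BB.edges_in_unit_square(2)[OF z], where f = "\<lambda>x. B x \<omega>"]
      by (simp add: weight_def sum_distrib_left left_diff_distrib sum_subtractf mult.assoc)
    then show "lower_square p z * Bk.g z \<omega> = (\<Sum>x\<in>grid k. lower_square p z * weight k x z * B x \<omega>)"
      by (simp add: sum_distrib_left mult.assoc)
  qed
  also have "\<dots> = (\<Sum>x\<in>grid k. (\<integral>z. lower_square p z * weight k x z \<partial>usq) * B x \<omega>)"
    by (subst Bochner_Integration.integral_sum) (auto intro: weight_integrable)
  finally show ?thesis by (simp add: Bk.Z_eq[OF \<omega> p] sum_divide_distrib)
qed

text \<open>Continuity of the path gives convergence of the integrand at every \<open>z\<close>; the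
  path bound, tripled by the three terms of \<open>g\<close>, dominates.\<close>

lemma bridge_grid_Z_tendsto:
  assumes \<omega>: "\<omega> \<in> space N" and p: "p \<in> {0..1}"
  shows "(\<lambda>k. Z_limit C1 C2 (\<lambda>z. B (grid_up k z)) p \<omega>) \<longlonglongrightarrow> Z_limit C1 C2 B p \<omega>"
proof -
  obtain b where b: "\<And>z. z \<in> unit_square \<Longrightarrow> \<bar>B z \<omega>\<bar> \<le> b" using bridge_path_bounded[OF \<omega>] by blast
  let ?gk = "\<lambda>k. G_process C1 C2 (\<lambda>z. B (grid_up k z))"
  have "(\<lambda>k. \<integral>z. lower_square p z * ?gk k z \<omega> \<partial>usq) \<longlonglongrightarrow> (\<integral>z. lower_square p z * BB.g z \<omega> \<partial>usq)"
  proof (rule integral_dominated_convergence[where w = "\<lambda>_. 3 * b"])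
    show "(\<lambda>z. lower_square p z * BB.g z \<omega>) \<in> borel_measurable usq"
      using BB.g_section2[OF \<omega>] by measurable
    show "(\<lambda>z. lower_square p z * ?gk k z \<omega>) \<in> borel_measurable usq" for k
    proof -
      interpret Bk: bounded_process N "\<lambda>z. B (grid_up k z)" C1 C2 by (rule bridge_grid_process)
      show ?thesis using Bk.g_section2[OF \<omega>] by measurable
    qed
    show "AE z in usq. (\<lambda>k. lower_square p z * ?gk k z \<omega>) \<longlonglongrightarrow> lower_square p z * BB.g z \<omega>"
    proof (rule AE_I2)
      fix z assume "z \<in> space usq"
      then have z: "z \<in> open_square" by simp
      note t = bridge_grid_tendsto[OF \<omega> open_square_subset[OF z]] bridge_grid_tendsto[OF \<omega> BB.edges_in_unit_square(1)[OF z]]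
        bridge_grid_tendsto[OF \<omega> BB.edges_in_unit_square(2)[OF z]]
      have "(\<lambda>k. B (grid_up k z) \<omega> - C1 z * B (grid_up k (fst z, 1)) \<omega> - C2 z * B (grid_up k (1, snd z)) \<omega>) \<longlonglongrightarrow>
          B z \<omega> - C1 z * B (fst z, 1) \<omega> - C2 z * B (1, snd z) \<omega>"
        by (intro tendsto_intros t)
      then show "(\<lambda>k. lower_square p z * ?gk k z \<omega>) \<longlonglongrightarrow> lower_square p z * BB.g z \<omega>"
        by (intro tendsto_intros) (simp add: G_process_def case_prod_unfold)
    qed
    show "AE z in usq. norm (lower_square p z * ?gk k z \<omega>) \<le> 3 * b" for k
    proof (rule AE_I2)
      interpret Bk: bounded_process N "\<lambda>z. B (grid_up k z)" C1 C2 by (rule bridge_grid_process)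
      fix z assume "z \<in> space usq"
      then have z: "z \<in> open_square" by simp
      have "\<bar>Bk.g z \<omega>\<bar> \<le> 3 * b"
        using Bk.g_abs_le[OF z, of \<omega>] b[OF grid_up_unit[OF open_square_subset[OF z]], of k]
          b[OF grid_up_unit[OF BB.edges_in_unit_square(1)[OF z]], of k]
          b[OF grid_up_unit[OF BB.edges_in_unit_square(2)[OF z]], of k] by linarith
      then show "norm (lower_square p z * ?gk k z \<omega>) \<le> 3 * b"
        by (auto simp: indicator_def)
    qed
  qed simp
  then have "(\<lambda>k. (\<integral>z. lower_square p z * ?gk k z \<omega> \<partial>usq) / D_norm p) \<longlonglongrightarrow> (\<integral>z. lower_square p z * BB.g z \<omega> \<partial>usq) / D_norm p"
    by (simp only: divide_inverse) (rule tendsto_mult_right)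
  moreover have "Z_limit C1 C2 (\<lambda>z. B (grid_up k z)) p \<omega> = (\<integral>z. lower_square p z * ?gk k z \<omega> \<partial>usq) / D_norm p" for k
  proof -
    interpret Bk: bounded_process N "\<lambda>z. B (grid_up k z)" C1 C2 by (rule bridge_grid_process)
    show ?thesis by (simp only: Bk.Z_eq[OF \<omega> p] Bk.functional_def)
  qed
  ultimately show ?thesis by (simp only: BB.Z_eq[OF \<omega> p] BB.functional_def)
qed

text \<open>Linear combinations of the functionals are pathwise limits of finite linear combinations
  of bridge values, which are normal by hypothesis; \<open>normal_rv_limit\<close> passes to the
  limit.\<close>

lemma Z_limit_gaussian:
  assumes p0: "0 < p0"
  shows "centered_gaussian_process N {p0..1} (Z_limit C1 C2 B)"
  unfolding centered_gaussian_process_def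
proof (intro conjI ballI allI impI)
  show "Z_limit C1 C2 B t \<in> borel_measurable N" "(\<integral>\<omega>. Z_limit C1 C2 B t \<omega> \<partial>N) = 0" if "t \<in> {p0..1}" for t
    using that p0 BB.Z_measurable BB.Z_mean by auto
  fix I a assume I: "finite I \<and> I \<subseteq> {p0..1}"
  then have I01: "t \<in> I \<Longrightarrow> t \<in> {0..1}" for t using p0 by auto
  define co where "co k x = (\<Sum>t\<in>I. a t * ((\<integral>z. lower_square t z * weight k x z \<partial>usq) / D_norm t))" for k x
  let ?Zk = "\<lambda>k. Z_limit C1 C2 (\<lambda>z. B (grid_up k z))"
  have comb: "(\<Sum>x\<in>grid k. co k x * B x \<omega>) = (\<Sum>t\<in>I. a t * ?Zk k t \<omega>)" if \<omega>: "\<omega> \<in> space N" for k \<omega>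
    unfolding co_def sum_distrib_right
    by (subst sum.swap) (simp add: bridge_grid_Z[OF \<omega> I01] sum_distrib_left mult.assoc cong: sum.cong_simp)
  show "normal_rv N (\<lambda>\<omega>. \<Sum>t\<in>I. a t * Z_limit C1 C2 B t \<omega>)"
  proof (rule normal_rv_limit[OF N, where V = "\<lambda>k \<omega>. \<Sum>x\<in>grid k. co k x * B x \<omega>"])
    show "normal_rv N (\<lambda>\<omega>. \<Sum>x\<in>grid k. co k x * B x \<omega>)" for k
      by (rule bridge_normal[OF finite_grid grid_subset])
    show "(\<integral>\<omega>. (\<Sum>x\<in>grid k. co k x * B x \<omega>) \<partial>N) = 0" for k
    proof -
      have "integrable N (\<lambda>\<omega>. co k x * B x \<omega>)" if "x \<in> grid k" for x
        using BB.b_integrable that grid_subset by (intro integrable_mult_right) blast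
      moreover have "(\<integral>\<omega>. B x \<omega> \<partial>N) = 0" if "x \<in> grid k" for x
        using bridge_mean that grid_subset by blast
      ultimately show ?thesis by (simp add: Bochner_Integration.integral_sum)
    qed
    show "(\<lambda>\<omega>. \<Sum>t\<in>I. a t * Z_limit C1 C2 B t \<omega>) \<in> borel_measurable N"
      using BB.Z_measurable[OF I01] by (intro borel_measurable_sum borel_measurable_times) auto
    show "(\<lambda>k. \<Sum>x\<in>grid k. co k x * B x \<omega>) \<longlonglongrightarrow> (\<Sum>t\<in>I. a t * Z_limit C1 C2 B t \<omega>)" if "\<omega> \<in> space N" for \<omega>
      unfolding comb[OF that] using bridge_grid_Z_tendsto[OF that I01] by (intro tendsto_intros) auto
    \<comment> \<open>Cauchy--Schwarz over the finite set \<open>I\<close> and the moment bound for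
      gridded bridges give a bound independent of \<open>k\<close>, as
      \<open>normal_rv_limit\<close> requires.\<close>
    show "(\<integral>\<omega>. (\<Sum>x\<in>grid k. co k x * B x \<omega>)\<^sup>2 \<partial>N) \<le> (\<Sum>t\<in>I. (a t)\<^sup>2) * (\<Sum>t\<in>I. 9 / (p0 ^ 3 / 12)\<^sup>2)" for k
    proof -
      interpret Bk: bounded_process N "\<lambda>z. B (grid_up k z)" C1 C2 by (rule bridge_grid_process)
      have i: "integrable N (\<lambda>\<omega>. \<Sum>t\<in>I. (Bk.Z t \<omega>)\<^sup>2)"
        using Bk.Z_sq_integrable[OF I01] by (intro Bochner_Integration.integrable_sum) auto
      have le: "(\<Sum>t\<in>I. a t * Bk.Z t \<omega>)\<^sup>2 \<le> (\<Sum>t\<in>I. (a t)\<^sup>2) * (\<Sum>t\<in>I. (Bk.Z t \<omega>)\<^sup>2)" for \<omega>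
        by (rule Cauchy_Schwarz_ineq_sum)
      have m: "(\<lambda>\<omega>. (\<Sum>t\<in>I. a t * Bk.Z t \<omega>)\<^sup>2) \<in> borel_measurable N"
        using Bk.Z_measurable[OF I01] by (intro borel_measurable_power borel_measurable_sum borel_measurable_times) auto
      have i': "integrable N (\<lambda>\<omega>. (\<Sum>t\<in>I. a t * Bk.Z t \<omega>)\<^sup>2)"
        by (rule Bochner_Integration.integrable_bound[OF integrable_mult_right[OF i, of "\<Sum>t\<in>I. (a t)\<^sup>2"] m])
          (use le in \<open>auto intro!: AE_I2 order_trans[OF _ abs_ge_self]\<close>)
      have "(\<integral>\<omega>. (\<Sum>x\<in>grid k. co k x * B x \<omega>)\<^sup>2 \<partial>N) = (\<integral>\<omega>. (\<Sum>t\<in>I. a t * Bk.Z t \<omega>)\<^sup>2 \<partial>N)"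
        by (intro Bochner_Integration.integral_cong refl) (simp add: comb)
      also have "\<dots> \<le> (\<integral>\<omega>. (\<Sum>t\<in>I. (a t)\<^sup>2) * (\<Sum>t\<in>I. (Bk.Z t \<omega>)\<^sup>2) \<partial>N)"
        using i i' le by (intro integral_mono) auto
      also have "\<dots> = (\<Sum>t\<in>I. (a t)\<^sup>2) * (\<Sum>t\<in>I. \<integral>\<omega>. (Bk.Z t \<omega>)\<^sup>2 \<partial>N)"
        using Bk.Z_sq_integrable[OF I01] by (simp add: Bochner_Integration.integral_sum)
      also have "\<dots> \<le> (\<Sum>t\<in>I. (a t)\<^sup>2) * (\<Sum>t\<in>I. 9 / (p0 ^ 3 / 12)\<^sup>2)"
        using I Bk.Z_sq_le[OF p0] by (intro mult_left_mono sum_mono sum_nonneg) auto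
      finally show ?thesis .
    qed
  qed
qed

end

section \<open>The empirical process of the transformed sample\<close>

text \<open>The family \<open>t\<close> may repeat points, whereas the definition of a Gaussian
  process speaks of sums over finite sets; the coefficients of equal points are collected.\<close>

lemma gaussian_combination:
  assumes N: "prob_space N" and Z: "centered_gaussian_process N T Z" and t: "\<And>j. j \<in> J \<Longrightarrow> t j \<in> T" and J: "finite J"
  shows "(\<integral>\<omega>. cis (\<Sum>j\<in>J. a j * Z (t j) \<omega>) \<partial>N) = exp (- (\<integral>\<omega>. (\<Sum>j\<in>J. a j * Z (t j) \<omega>)\<^sup>2 \<partial>N) / 2)"
proof -
  have eq: "(\<Sum>j\<in>J. a j * Z (t j) \<omega>) = (\<Sum>s\<in>t ` J. (\<Sum>j | j \<in> J \<and> t j = s. a j) * Z s \<omega>)" for \<omega>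
    by (subst sum.image_gen[OF J, of _ t]) (auto simp: sum_distrib_right intro!: sum.cong)
  have "finite (t ` J) \<and> t ` J \<subseteq> T" using t J by auto
  then have n: "normal_rv N (\<lambda>\<omega>. \<Sum>j\<in>J. a j * Z (t j) \<omega>)"
    unfolding eq by (rule Z[unfolded centered_gaussian_process_def, THEN conjunct2, rule_format])
  have "integrable N (Z s)" if "s \<in> T" for s
  proof -
    have "normal_rv N (\<lambda>\<omega>. \<Sum>t\<in>{s}. 1 * Z t \<omega>)"
      using that by (intro Z[unfolded centered_gaussian_process_def, THEN conjunct2, rule_format]) simp
    then have "normal_rv N (Z s)" by simp
    moreover have "(\<integral>\<omega>. Z s \<omega> \<partial>N) = 0" "Z s \<in> borel_measurable N"
      using Z that by (auto simp: centered_gaussian_process_def)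
    ultimately show ?thesis
      using finite_measure.square_integrable_imp_integrable[OF prob_space.finite_measure[OF N]] centered_normal_rv(2)[OF N]
      by metis
  qed
  then have "(\<integral>\<omega>. (\<Sum>j\<in>J. a j * Z (t j) \<omega>) \<partial>N) = (\<Sum>j\<in>J. a j * (\<integral>\<omega>. Z (t j) \<omega> \<partial>N))"
    using t by (subst Bochner_Integration.integral_sum) auto
  also have "\<dots> = 0" using Z t by (simp add: centered_gaussian_process_def)
  finally show ?thesis using centered_normal_rv(3)[OF N n, of 1] by simp
qed

definition indicator_process :: "(real \<times> real \<Rightarrow> real) \<Rightarrow> real \<times> real \<Rightarrow> real \<times> real \<Rightarrow> real" where
  "indicator_process C z x = of_bool (fst x \<le> fst z \<and> snd x \<le> snd z) - C z"

text \<open>\<open>P i\<close> stands for the pair of probability transforms of the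
  \<open>i\<close>-th observation; its distribution function on the unit square is the copula
  itself.\<close>

locale iid_copula_sample = prob_space M for M :: "'a measure" +
  fixes P :: "nat \<Rightarrow> 'a \<Rightarrow> real \<times> real" and C C1 C2 :: "real \<times> real \<Rightarrow> real"
  assumes C: "copula C"
    and indep: "indep_vars (\<lambda>_. borel) P {1..}"
    and ident: "\<And>i. 1 \<le> i \<Longrightarrow> distr M borel (P i) = distr M borel (P 1)"
    and cdf: "\<And>z. z \<in> unit_square \<Longrightarrow> prob {\<omega> \<in> space M. fst (P 1 \<omega>) \<le> fst z \<and> snd (P 1 \<omega>) \<le> snd z} = C z"
    and C1: "C1 \<in> borel_measurable usq" "\<And>z. z \<in> open_square \<Longrightarrow> \<bar>C1 z\<bar> \<le> 1"
    and C2: "C2 \<in> borel_measurable usq" "\<And>z. z \<in> open_square \<Longrightarrow> \<bar>C2 z\<bar> \<le> 1"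
begin

definition law :: "(real \<times> real) measure" where "law = distr M borel (P 1)"

lemma P_measurable[measurable]: "1 \<le> i \<Longrightarrow> P i \<in> measurable M borel"
  using indep by (auto simp: indep_vars_def)

lemma law_sets[measurable_cong, simp]: "sets law = sets borel" and law_space[simp]: "space law = UNIV"
  by (simp_all add: law_def)

lemma law_distr: "1 \<le> i \<Longrightarrow> distr M borel (P i) = law"
  unfolding law_def by (rule ident)

lemma law_measurable: "f \<in> borel_measurable borel \<Longrightarrow> f \<in> borel_measurable law"
  by (simp cong: measurable_cong_sets)

lemma prob_space_law: "prob_space law"
  unfolding law_def by (rule prob_space_distr) simp

lemma expectation_law: "1 \<le> i \<Longrightarrow> f \<in> borel_measurable borel \<Longrightarrow> (\<integral>\<omega>. f (P i \<omega>) \<partial>M) = (\<integral>x. f x \<partial>law)"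
  for f :: "real \<times> real \<Rightarrow> real"
  by (subst law_distr[of i, symmetric]) (auto simp: integral_distr)

lemma integrable_law: "1 \<le> i \<Longrightarrow> integrable law f \<Longrightarrow> integrable M (\<lambda>\<omega>. f (P i \<omega>))"
  for f :: "real \<times> real \<Rightarrow> real"
  using integrable_distr[OF P_measurable, of i f] law_distr[of i] by simp

definition below :: "real \<times> real \<Rightarrow> real \<times> real \<Rightarrow> real" where
  "below z x = of_bool (fst x \<le> fst z \<and> snd x \<le> snd z)"

lemma below_measurable[measurable]: "below z \<in> borel_measurable borel"
  unfolding below_def[abs_def] by measurable

lemma expectation_below: "z \<in> unit_square \<Longrightarrow> (\<integral>x. below z x \<partial>law) = C z"
proof -
  assume z: "z \<in> unit_square"
  have "(\<integral>x. below z x \<partial>law) = (\<integral>\<omega>. below z (P 1 \<omega>) \<partial>M)"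
    by (rule expectation_law[OF order_refl below_measurable, symmetric])
  also have "\<dots> = (\<integral>\<omega>. indicator {\<omega> \<in> space M. fst (P 1 \<omega>) \<le> fst z \<and> snd (P 1 \<omega>) \<le> snd z} \<omega> \<partial>M)"
    by (intro Bochner_Integration.integral_cong refl) (auto simp: below_def indicator_def)
  also have "\<dots> = C z" using cdf[OF z] by simp
  finally show ?thesis .
qed

lemma below_mult: "below z x * below w x = below (min (fst z) (fst w), min (snd z) (snd w)) x"
  by (auto simp: below_def)

lemma below_integrable: "integrable law (below z)"
proof -
  interpret law: prob_space law by (rule prob_space_law)
  have "\<bar>below z x\<bar> \<le> 1" for x by (simp add: below_def)
  then show ?thesis by (intro law.integrable_const_bound[of _ 1] law_measurable[OF below_measurable]) simp
qed

abbreviation ind :: "real \<times> real \<Rightarrow> real \<times> real \<Rightarrow> real" where "ind \<equiv> indicator_process C"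

lemma ind_eq: "ind z x = below z x - C z" by (simp add: indicator_process_def below_def)

lemma ind_measurable[measurable]: "ind z \<in> borel_measurable borel"
  unfolding ind_eq[abs_def] by measurable

lemma ind_bound: "z \<in> unit_square \<Longrightarrow> \<bar>ind z x\<bar> \<le> 1"
  using copula_range[OF C] by (auto simp: indicator_process_def)

text \<open>Stated for any measurable \<open>f\<close>, to serve both the law of one observation and
  each \<open>P i\<close>.\<close>

lemma ind_pair:
  assumes [measurable]: "f \<in> measurable L borel"
  shows "(\<lambda>(z, \<omega>). ind z (f \<omega>)) \<in> borel_measurable (restrict_space borel unit_square \<Otimes>\<^sub>M L)"
proof -
  have [measurable]: "C \<in> borel_measurable (restrict_space borel unit_square)"
    by (rule borel_measurable_continuous_on_restrict[OF copula_continuous[OF C]])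
  have [measurable]: "fst \<in> borel_measurable (restrict_space borel unit_square)" "snd \<in> borel_measurable (restrict_space borel unit_square)"
    by (rule measurable_restrict_space1; measurable)+
  show ?thesis unfolding indicator_process_def by measurable
qed

text \<open>The product of two lower-quadrant indicators is again one, at the coordinatewise
  minimum; this produces the bridge covariance exactly.\<close>

sublocale ind: copula_process law ind C1 C2 C
proof (intro copula_process.intro bounded_process.intro prob_space_law)
  interpret law: prob_space law by (rule prob_space_law)
  have U: "law.prob UNIV = 1" using law.prob_space by simp
  show "bounded_process_axioms law ind C1 C2"
  proof
    show "(\<lambda>(z, \<omega>). ind z \<omega>) \<in> borel_measurable (restrict_space borel unit_square \<Otimes>\<^sub>M law)"
      using ind_pair[OF measurable_ident_sets[OF law_sets]] by simp
    show "\<exists>b. \<forall>z\<in>unit_square. \<bar>ind z x\<bar> \<le> b" for x using ind_bound by blast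
    fix z assume z: "z \<in> unit_square"
    show "(\<integral>x. ind z x \<partial>law) = 0"
      unfolding ind_eq using below_integrable by (simp add: expectation_below z U)
    have le: "\<bar>(ind z x)\<^sup>2\<bar> \<le> 1" for x using ind_bound[OF z, of x] by (simp add: abs_square_le_1)
    show i: "integrable law (\<lambda>x. (ind z x)\<^sup>2)"
      by (intro law.integrable_const_bound[of _ 1] law_measurable) (use le in auto)
    have "(\<integral>x. (ind z x)\<^sup>2 \<partial>law) \<le> (\<integral>x. 1 \<partial>law)"
      using i le by (intro integral_mono) auto
    then show "(\<integral>x. (ind z x)\<^sup>2 \<partial>law) \<le> 1" by (simp add: U)
  qed (fact C1 C2)+
  show "copula_process_axioms law ind C"
  proof
    fix z w assume z: "z \<in> unit_square" and w: "w \<in> unit_square"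
    have "ind z x * ind w x = below (min (fst z) (fst w), min (snd z) (snd w)) x - C w * below z x - C z * below w x + C z * C w" for x
      unfolding below_mult[symmetric] ind_eq by (simp add: algebra_simps)
    then have "(\<integral>x. ind z x * ind w x \<partial>law) =
        (\<integral>x. below (min (fst z) (fst w), min (snd z) (snd w)) x - C w * below z x - C z * below w x + C z * C w \<partial>law)"
      by presburger
    also have "\<dots> = bridge_cov C z w"
      using z w by (simp add: below_integrable expectation_below bridge_cov_def U min_le_iff_disj mem_Times_iff)
    finally show "(\<integral>x. ind z x * ind w x \<partial>law) = bridge_cov C z w" .
  qed
qed

lemma expectation_product:
  fixes f h :: "real \<times> real \<Rightarrow> real"
  assumes ij: "1 \<le> i" "1 \<le> j" "i \<noteq> j" and m: "f \<in> borel_measurable borel" "h \<in> borel_measurable borel"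
    and int: "integrable law f" "integrable law h"
  shows "(\<integral>\<omega>. f (P i \<omega>) * h (P j \<omega>) \<partial>M) = (\<integral>x. f x \<partial>law) * (\<integral>x. h x \<partial>law)"
    "integrable M (\<lambda>\<omega>. f (P i \<omega>) * h (P j \<omega>))"
proof -
  have "indep_var (Pi\<^sub>M {i} (\<lambda>_. borel)) (\<lambda>\<omega>. restrict (\<lambda>k. P k \<omega>) {i}) (Pi\<^sub>M {j} (\<lambda>_. borel)) (\<lambda>\<omega>. restrict (\<lambda>k. P k \<omega>) {j})"
    by (rule indep_var_restrict[OF indep]) (use ij in auto)
  from indep_var_compose[OF this, of "\<lambda>x. f (x i)" borel "\<lambda>x. h (x j)" borel]
  have iv: "indep_var borel (f \<circ> P i) borel (h \<circ> P j)"
    using m by (simp add: comp_def)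
  note i = integrable_law[OF ij(1) int(1)] integrable_law[OF ij(2) int(2)]
  show "(\<integral>\<omega>. f (P i \<omega>) * h (P j \<omega>) \<partial>M) = (\<integral>x. f x \<partial>law) * (\<integral>x. h x \<partial>law)"
    using indep_var_lebesgue_integral[OF iv] i m ij by (simp add: comp_def expectation_law)
  show "integrable M (\<lambda>\<omega>. f (P i \<omega>) * h (P j \<omega>))"
    using indep_var_integrable[OF iv] i by (simp add: comp_def)
qed

text \<open>Independence and centring remove the mixed terms. An inequality rather than an equality,
  because the normalised sum is 0 for \<open>n = 0\<close>.\<close>

lemma normalized_sum_sq:
  fixes f :: "real \<times> real \<Rightarrow> real"
  assumes m: "f \<in> borel_measurable borel" and int: "integrable law (\<lambda>x. (f x)\<^sup>2)" and mean: "(\<integral>x. f x \<partial>law) = 0"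
  shows "integrable M (\<lambda>\<omega>. ((\<Sum>i=1..n. f (P i \<omega>)) / sqrt (real n))\<^sup>2)"
    "(\<integral>\<omega>. ((\<Sum>i=1..n. f (P i \<omega>)) / sqrt (real n))\<^sup>2 \<partial>M) \<le> (\<integral>x. (f x)\<^sup>2 \<partial>law)"
proof -
  interpret law: prob_space law by (rule prob_space_law)
  have f: "integrable law f" by (rule ind.M.square_integrable_imp_integrable[OF law_measurable[OF m] int])
  have prod: "integrable M (\<lambda>\<omega>. f (P i \<omega>) * f (P j \<omega>))"
      "(\<integral>\<omega>. f (P i \<omega>) * f (P j \<omega>) \<partial>M) = (if i = j then \<integral>x. (f x)\<^sup>2 \<partial>law else 0)"
    if "1 \<le> i" "1 \<le> j" for i j
    using that expectation_product[OF that _ m m f f] integrable_law[OF that(1) int]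
      expectation_law[OF that(1), of "\<lambda>x. (f x)\<^sup>2"] m mean
    by (cases "i = j"; simp add: power2_eq_square)+
  have sq: "((\<Sum>i=1..n. f (P i \<omega>)) / sqrt (real n))\<^sup>2 = (\<Sum>i=1..n. \<Sum>j=1..n. f (P i \<omega>) * f (P j \<omega>)) / real n" for \<omega>
    by (simp add: power_divide power2_eq_square sum_product)
  have i: "integrable M (\<lambda>\<omega>. \<Sum>i=1..n. \<Sum>j=1..n. f (P i \<omega>) * f (P j \<omega>))"
    using prod(1) by (intro Bochner_Integration.integrable_sum) auto
  then show "integrable M (\<lambda>\<omega>. ((\<Sum>i=1..n. f (P i \<omega>)) / sqrt (real n))\<^sup>2)" unfolding sq by simp
  have "(\<integral>\<omega>. (\<Sum>i=1..n. \<Sum>j=1..n. f (P i \<omega>) * f (P j \<omega>)) \<partial>M) = (\<Sum>i=1..n. \<Sum>j=1..n. if i = j then \<integral>x. (f x)\<^sup>2 \<partial>law else 0)"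
  proof -
    have "(\<integral>\<omega>. (\<Sum>i=1..n. \<Sum>j=1..n. f (P i \<omega>) * f (P j \<omega>)) \<partial>M) = (\<Sum>i=1..n. \<integral>\<omega>. (\<Sum>j=1..n. f (P i \<omega>) * f (P j \<omega>)) \<partial>M)"
      using prod(1) by (intro Bochner_Integration.integral_sum Bochner_Integration.integrable_sum) auto
    also have "\<dots> = (\<Sum>i=1..n. \<Sum>j=1..n. \<integral>\<omega>. f (P i \<omega>) * f (P j \<omega>) \<partial>M)"
      using prod(1) by (intro sum.cong refl Bochner_Integration.integral_sum) auto
    also have "\<dots> = (\<Sum>i=1..n. \<Sum>j=1..n. if i = j then \<integral>x. (f x)\<^sup>2 \<partial>law else 0)"
      using prod(2) by (intro sum.cong refl) auto
    finally show ?thesis .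
  qed
  also have "\<dots> = real n * (\<integral>x. (f x)\<^sup>2 \<partial>law)"
    by (simp add: sum.delta)
  finally have "(\<integral>\<omega>. ((\<Sum>i=1..n. f (P i \<omega>)) / sqrt (real n))\<^sup>2 \<partial>M) = real n * (\<integral>x. (f x)\<^sup>2 \<partial>law) / real n"
    unfolding sq by simp
  also have "\<dots> \<le> (\<integral>x. (f x)\<^sup>2 \<partial>law)" by (cases "n = 0") auto
  finally show "(\<integral>\<omega>. ((\<Sum>i=1..n. f (P i \<omega>)) / sqrt (real n))\<^sup>2 \<partial>M) \<le> (\<integral>x. (f x)\<^sup>2 \<partial>law)" .
qed

definition ep :: "nat \<Rightarrow> real \<times> real \<Rightarrow> 'a \<Rightarrow> real" where
  "ep n z \<omega> = (\<Sum>i=1..n. ind z (P i \<omega>)) / sqrt (real n)"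

lemma ep_bound: "z \<in> unit_square \<Longrightarrow> \<bar>ep n z \<omega>\<bar> \<le> real n"
proof -
  assume z: "z \<in> unit_square"
  have "\<bar>\<Sum>i=1..n. ind z (P i \<omega>)\<bar> \<le> (\<Sum>i=1..n. \<bar>ind z (P i \<omega>)\<bar>)" by (rule sum_abs)
  also have "\<dots> \<le> (\<Sum>i=1..n. 1)" by (intro sum_mono ind_bound z)
  finally have 1: "\<bar>\<Sum>i=1..n. ind z (P i \<omega>)\<bar> \<le> real n" by simp
  show ?thesis
  proof (cases "n = 0")
    case False
    then have "real n / sqrt (real n) \<le> real n / 1" by (intro divide_left_mono) auto
    moreover have "\<bar>ep n z \<omega>\<bar> \<le> real n / sqrt (real n)"
      unfolding ep_def abs_divide using 1 by (simp add: divide_right_mono)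
    ultimately show ?thesis by simp
  qed (simp add: ep_def)
qed

text \<open>A \<open>bounded_process\<close> rather than a \<open>copula_process\<close>: for
  \<open>n = 0\<close> the sum is empty, so the bridge covariance may fail.\<close>

sublocale ep: bounded_process M "ep n" C1 C2 for n
proof (intro bounded_process.intro prob_space_axioms)
  show "bounded_process_axioms M (ep n) C1 C2"
  proof
    have "(\<lambda>p. \<Sum>i=1..n. (case p of (z, \<omega>) \<Rightarrow> ind z (P i \<omega>))) \<in> borel_measurable (restrict_space borel unit_square \<Otimes>\<^sub>M M)"
      by (intro borel_measurable_sum ind_pair) auto
    then have "(\<lambda>p. (\<Sum>i=1..n. (case p of (z, \<omega>) \<Rightarrow> ind z (P i \<omega>))) / sqrt (real n)) \<in> borel_measurable (restrict_space borel unit_square \<Otimes>\<^sub>M M)"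
      by measurable
    then show "(\<lambda>(z, \<omega>). ep n z \<omega>) \<in> borel_measurable (restrict_space borel unit_square \<Otimes>\<^sub>M M)"
      by (simp add: ep_def case_prod_unfold)
    show "\<exists>b. \<forall>z\<in>unit_square. \<bar>ep n z \<omega>\<bar> \<le> b" for \<omega> using ep_bound by blast
    fix z assume z: "z \<in> unit_square"
    have "integrable M (\<lambda>\<omega>. ind z (P i \<omega>))" "(\<integral>\<omega>. ind z (P i \<omega>) \<partial>M) = 0" if "1 \<le> i" for i
      using integrable_law[OF that ind.b_integrable[OF z]] expectation_law[OF that ind_measurable] ind.b_mean[OF z] by auto
    then show "(\<integral>\<omega>. ep n z \<omega> \<partial>M) = 0"
      unfolding ep_def by (simp add: Bochner_Integration.integral_sum)
    show "integrable M (\<lambda>\<omega>. (ep n z \<omega>)\<^sup>2)" "(\<integral>\<omega>. (ep n z \<omega>)\<^sup>2 \<partial>M) \<le> 1"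
      using normalized_sum_sq[OF ind_measurable ind.b_sq[OF z] ind.b_mean[OF z], of n] ind.b_sq_le[OF z]
      unfolding ep_def by auto
  qed (fact C1 C2)+
qed

text \<open>With \<open>m\<close> the coordinatewise minimum, one summand has mean square
  \<open>(C z - C m) + (C w - C m) - (C z - C w)\<^sup>2\<close>. The Lipschitz bounds of the two
  differences add up to the distance, since one of the two coordinates is the minimum.\<close>

lemma ep_increment:
  assumes z: "z \<in> unit_square" and w: "w \<in> unit_square"
  shows "integrable M (\<lambda>\<omega>. (ep n z \<omega> - ep n w \<omega>)\<^sup>2)"
    "(\<integral>\<omega>. (ep n z \<omega> - ep n w \<omega>)\<^sup>2 \<partial>M) \<le> \<bar>fst z - fst w\<bar> + \<bar>snd z - snd w\<bar>"
proof -
  let ?f = "\<lambda>x. ind z x - ind w x"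
  have sq: "(?f x)\<^sup>2 = (ind z x)\<^sup>2 + (ind w x)\<^sup>2 - 2 * (ind z x * ind w x)" for x
    by (simp add: power2_diff)
  have i: "integrable law (\<lambda>x. (?f x)\<^sup>2)"
    unfolding sq using ind.b_sq[OF z] ind.b_sq[OF w] ind.b_prod_integrable[OF z w] by simp
  have mean: "(\<integral>x. ?f x \<partial>law) = 0"
    using ind.b_integrable[OF z] ind.b_integrable[OF w] ind.b_mean[OF z] ind.b_mean[OF w] by simp
  let ?m = "(min (fst z) (fst w), min (snd z) (snd w))"
  have m: "?m \<in> unit_square" using z w by (auto simp: mem_Times_iff)
  have "(\<integral>x. (?f x)\<^sup>2 \<partial>law) = bridge_cov C z z + bridge_cov C w w - 2 * bridge_cov C z w"
    unfolding sq using ind.b_sq[OF z] ind.b_sq[OF w] ind.b_prod_integrable[OF z w]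
      ind.b_cov[OF z z] ind.b_cov[OF w w] ind.b_cov[OF z w] by (simp add: power2_eq_square)
  also have "\<dots> = (C z - C ?m) + (C w - C ?m) - (C z - C w)\<^sup>2"
    by (simp add: bridge_cov_def power2_eq_square algebra_simps)
  also have "\<dots> \<le> \<bar>fst z - fst w\<bar> + \<bar>snd z - snd w\<bar>"
  proof -
    have min: "\<bar>x - min x y\<bar> + \<bar>y - min x y\<bar> = \<bar>x - y\<bar>" for x y :: real by (simp add: min_def)
    have "\<bar>C z - C ?m\<bar> \<le> \<bar>fst z - min (fst z) (fst w)\<bar> + \<bar>snd z - min (snd z) (snd w)\<bar>"
      "\<bar>C w - C ?m\<bar> \<le> \<bar>fst w - min (fst z) (fst w)\<bar> + \<bar>snd w - min (snd z) (snd w)\<bar>"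
      using copula_Lipschitz[OF C, of "fst z" "snd z" "fst ?m" "snd ?m"]
        copula_Lipschitz[OF C, of "fst w" "snd w" "fst ?m" "snd ?m"] z w m by auto
    note lip = abs_le_D1[OF this(1)] abs_le_D1[OF this(2)]
    have "cz + cw - s \<le> d1 + d2" if "cz \<le> a1 + a2" "cw \<le> b1 + b2" "0 \<le> s" "a1 + b1 = d1" "a2 + b2 = d2"
      for cz cw s d1 d2 a1 a2 b1 b2 :: real using that by linarith
    from this[OF lip zero_le_power2 min min] show ?thesis .
  qed
  finally have le: "(\<integral>x. (?f x)\<^sup>2 \<partial>law) \<le> \<bar>fst z - fst w\<bar> + \<bar>snd z - snd w\<bar>" .
  have eq: "ep n z \<omega> - ep n w \<omega> = (\<Sum>i=1..n. ?f (P i \<omega>)) / sqrt (real n)" for \<omega>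
    by (simp add: ep_def sum_subtractf diff_divide_distrib)
  have fm: "?f \<in> borel_measurable borel" by measurable
  show "integrable M (\<lambda>\<omega>. (ep n z \<omega> - ep n w \<omega>)\<^sup>2)"
    unfolding eq by (rule normalized_sum_sq(1)[OF fm i mean])
  show "(\<integral>\<omega>. (ep n z \<omega> - ep n w \<omega>)\<^sup>2 \<partial>M) \<le> \<bar>fst z - fst w\<bar> + \<bar>snd z - snd w\<bar>"
    unfolding eq using normalized_sum_sq(2)[OF fm i mean, of n] le by linarith
qed

lemma ep_Z:
  assumes p: "p \<in> {0..1}" and \<omega>: "\<omega> \<in> space M"
  shows "ep.Z n p \<omega> = (\<Sum>i=1..n. ind.Z p (P i \<omega>)) / sqrt (real n)"
proof -
  have g: "G_process C1 C2 (ep n) z \<omega> = (\<Sum>i=1..n. G_process C1 C2 ind z (P i \<omega>)) / sqrt (real n)" for z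
    by (simp add: G_process_def case_prod_unfold ep_def sum_subtractf sum_distrib_left diff_divide_distrib)
  have "ep.functional n (lower_square p) \<omega> = (\<integral>z. (\<Sum>i=1..n. lower_square p z * G_process C1 C2 ind z (P i \<omega>)) / sqrt (real n) \<partial>usq)"
    unfolding ep.functional_def g by (simp add: sum_distrib_left)
  also have "\<dots> = (\<Sum>i=1..n. ind.functional (lower_square p) (P i \<omega>)) / sqrt (real n)"
  proof -
    have "(\<integral>z. (\<Sum>i=1..n. lower_square p z * G_process C1 C2 ind z (P i \<omega>)) \<partial>usq) = (\<Sum>i=1..n. ind.functional (lower_square p) (P i \<omega>))"
      unfolding ind.functional_def
      by (rule Bochner_Integration.integral_sum, rule ind.path_integrable(1)[OF _ lower_square_measurable ind.lower_square_bound]) simp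
    then show ?thesis by (simp only: integral_divide_zero)
  qed
  finally show ?thesis
    using p \<omega> by (simp add: ep.Z_eq ind.Z_eq sum_divide_distrib mult.commute)
qed

text \<open>A linear combination of the functionals is itself a normalised sum, of the variables
  \<open>\<Psi> (P i \<omega>)\<close>, whose variance is the quadratic form of
  \<open>Z_cov\<close>. This reduces the multivariate limit to \<open>clt_cis\<close>.\<close>

lemma ep_clt:
  assumes t: "\<And>j. j \<in> J \<Longrightarrow> t j \<in> {0..1}" and J: "finite J"
  shows "(\<lambda>n. \<integral>\<omega>. cis (\<Sum>j\<in>J. a j * ep.Z n (t j) \<omega>) \<partial>M) \<longlonglongrightarrow>
    exp (- (\<Sum>i\<in>J. \<Sum>j\<in>J. a i * a j * Z_cov C C1 C2 (t i) (t j)) / 2)"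
proof -
  define \<Psi> where "\<Psi> x = (\<Sum>j\<in>J. a j * ind.Z (t j) x)" for x
  have Zm: "ind.Z (t j) \<in> borel_measurable borel" if "j \<in> J" for j
    using ind.Z_measurable[OF t[OF that]] by (simp cong: measurable_cong_sets)
  have \<Psi>: "\<Psi> \<in> borel_measurable borel"
    unfolding \<Psi>_def[abs_def] using Zm by (intro borel_measurable_sum borel_measurable_times) auto
  have mean: "(\<integral>x. \<Psi> x \<partial>law) = 0"
    unfolding \<Psi>_def using ind.Z_integrable[OF t] ind.Z_mean[OF t]
    by (subst Bochner_Integration.integral_sum) auto
  have sq: "integrable law (\<lambda>x. (\<Psi> x)\<^sup>2)"
    "(\<integral>x. (\<Psi> x)\<^sup>2 \<partial>law) = (\<Sum>i\<in>J. \<Sum>j\<in>J. a i * a j * Z_cov C C1 C2 (t i) (t j))"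
    unfolding \<Psi>_def using ind.Z_combination[of J t a] t by auto
  have "(\<lambda>n. \<integral>\<omega>. cis ((\<Sum>i=1..n. \<Psi> (P i \<omega>)) / sqrt (real n)) \<partial>M) \<longlonglongrightarrow>
      exp (- (\<Sum>i\<in>J. \<Sum>j\<in>J. a i * a j * Z_cov C C1 C2 (t i) (t j)) / 2)"
  proof (rule clt_cis[OF prob_space_axioms])
    show "indep_vars (\<lambda>_. borel) (\<lambda>i \<omega>. \<Psi> (P i \<omega>)) {1..}"
      by (rule indep_vars_compose2[OF indep]) (rule \<Psi>)
    fix i :: nat assume i: "1 \<le> i"
    have "distr M borel (\<lambda>\<omega>. \<Psi> (P i \<omega>)) = distr law borel \<Psi>" if "1 \<le> i" for i
      using that \<Psi> by (subst law_distr[symmetric, OF that], subst distr_distr) (auto simp: comp_def)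
    then show "distr M borel (\<lambda>\<omega>. \<Psi> (P i \<omega>)) = distr M borel (\<lambda>\<omega>. \<Psi> (P 1 \<omega>))" using i by simp
    show "(\<integral>\<omega>. \<Psi> (P i \<omega>) \<partial>M) = 0" using expectation_law[OF i \<Psi>] mean by simp
    show "integrable M (\<lambda>\<omega>. (\<Psi> (P i \<omega>))\<^sup>2)" by (rule integrable_law[OF i sq(1)])
    show "(\<integral>\<omega>. (\<Psi> (P i \<omega>))\<^sup>2 \<partial>M) = (\<Sum>i\<in>J. \<Sum>j\<in>J. a i * a j * Z_cov C C1 C2 (t i) (t j))"
      using expectation_law[OF i, of "\<lambda>x. (\<Psi> x)\<^sup>2"] \<Psi> sq(2) by simp
  qed
  moreover have "(\<integral>\<omega>. cis ((\<Sum>i=1..n. \<Psi> (P i \<omega>)) / sqrt (real n)) \<partial>M) = (\<integral>\<omega>. cis (\<Sum>j\<in>J. a j * ep.Z n (t j) \<omega>) \<partial>M)" for n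
  proof (intro Bochner_Integration.integral_cong refl arg_cong[where f = cis])
    fix \<omega> assume \<omega>: "\<omega> \<in> space M"
    show "(\<Sum>i=1..n. \<Psi> (P i \<omega>)) / sqrt (real n) = (\<Sum>j\<in>J. a j * ep.Z n (t j) \<omega>)"
      unfolding \<Psi>_def using ep_Z[OF t \<omega>]
      by (subst sum.swap) (simp add: sum_divide_distrib sum_distrib_left cong: sum.cong_simp)
  qed
  ultimately show ?thesis by simp
qed

end

section \<open>Ranks\<close>

definition sample_rank :: "nat \<Rightarrow> (nat \<Rightarrow> real) \<Rightarrow> nat \<Rightarrow> nat" where
  "sample_rank n x i = card {j\<in>{1..n}. x j \<le> x i}"

text \<open>The empirical distribution function of the transformed sample
  \<open>F (x j)\<close>.\<close>

definition sample_frac :: "nat \<Rightarrow> (nat \<Rightarrow> real) \<Rightarrow> (real \<Rightarrow> real) \<Rightarrow> real \<Rightarrow> real" where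
  "sample_frac n x F s = real (card {j\<in>{1..n}. F (x j) \<le> s}) / real n"

context
  fixes n :: nat and x :: "nat \<Rightarrow> real" and F :: "real \<Rightarrow> real"
  assumes n: "0 < n" and F: "mono F"
begin

abbreviation rank :: "nat \<Rightarrow> nat" where "rank \<equiv> sample_rank n x"

abbreviation frac :: "real \<Rightarrow> real" where "frac \<equiv> sample_frac n x F"

text \<open>Every sample value not above \<open>x i\<close> also has its transform at most
  \<open>s\<close>, so the rank of \<open>i\<close> is at most the count behind
  \<open>frac s\<close>.\<close>

lemma rank_le_of_frac:
  assumes "frac s \<le> u" "F (x i) \<le> s"
  shows "real (rank i) / real n \<le> u"
proof -
  have "F (x j) \<le> s" if "x j \<le> x i" for j
    using monoD[OF F that] assms(2) by linarith
  then have "rank i \<le> card {j\<in>{1..n}. F (x j) \<le> s}"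
    unfolding sample_rank_def by (intro card_mono) auto
  then have "real (rank i) / real n \<le> frac s"
    unfolding sample_frac_def by (intro divide_right_mono) auto
  then show ?thesis using assms(1) by linarith
qed

text \<open>If the transform of \<open>x i\<close> exceeded \<open>s\<close>, all observations
  counted by \<open>frac s\<close> would lie at or below \<open>x i\<close>, and the rank would be
  too large. The strict inequality is what an upper comparison of the empirical copula has to
  secure.\<close>

lemma le_of_rank_le:
  assumes "u < frac s" "real (rank i) / real n \<le> u"
  shows "F (x i) \<le> s"
proof (rule ccontr)
  assume "\<not> F (x i) \<le> s"
  then have "x j \<le> x i" if "F (x j) \<le> s" for j
    using that monoD[OF F, of "x i" "x j"] by (cases "x j \<le> x i") auto
  then have "card {j\<in>{1..n}. F (x j) \<le> s} \<le> rank i"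
    unfolding sample_rank_def by (intro card_mono) auto
  then have "frac s \<le> real (rank i) / real n"
    unfolding sample_frac_def by (intro divide_right_mono) auto
  then show False using assms by linarith
qed

context
  assumes inj: "inj_on x {1..n}"
begin

lemma rank_bij: "bij_betw rank {1..n} {1..n}"
proof -
  have less: "rank i < rank j" if "x i < x j" "j \<in> {1..n}" for i j
  proof -
    have "j \<in> {k\<in>{1..n}. x k \<le> x j} - {k\<in>{1..n}. x k \<le> x i}" using that by auto
    moreover have "{k\<in>{1..n}. x k \<le> x i} \<subseteq> {k\<in>{1..n}. x k \<le> x j}" using that by auto
    ultimately show ?thesis unfolding sample_rank_def by (intro psubset_card_mono psubsetI) auto
  qed
  have "inj_on rank {1..n}"
  proof (rule inj_onI, rule ccontr)
    fix i j assume ij: "i \<in> {1..n}" "j \<in> {1..n}" "rank i = rank j" "i \<noteq> j"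
    then have "x i \<noteq> x j" using inj by (auto dest: inj_onD)
    then show False using less[of i j] less[of j i] ij by (cases "x i < x j") auto
  qed
  moreover have "rank ` {1..n} \<subseteq> {1..n}"
  proof
    fix k assume "k \<in> rank ` {1..n}"
    then obtain i where i: "i \<in> {1..n}" "k = rank i" by blast
    have "card {i} \<le> rank i" unfolding sample_rank_def using i by (intro card_mono) auto
    moreover have "rank i \<le> card {1..n}" unfolding sample_rank_def by (intro card_mono) auto
    ultimately show "k \<in> {1..n}" using i by simp
  qed
  ultimately show ?thesis by (metis bij_betw_def card_image card_subset_eq finite_atLeastAtMost)
qed

text \<open>Without ties the ranks permute \<open>{1..n}\<close>, so exactly the integer part of
  \<open>n * u\<close> of them are at most \<open>n * u\<close>.\<close>

lemma card_rank_le: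
  assumes "u \<in> {0..1}"
  shows "\<bar>real (card {i\<in>{1..n}. real (rank i) / real n \<le> u}) / real n - u\<bar> \<le> 1 / real n"
proof -
  define m where "m = nat \<lfloor>real n * u\<rfloor>"
  have nu: "0 \<le> real n * u" "real n * u \<le> real n" using assms by (auto simp: mult_left_le)
  have m: "real m \<le> real n * u" "real n * u < real m + 1" using nu by (auto simp: m_def)
  have "m \<le> n" using m nu by linarith
  have "{i\<in>{1..n}. real (rank i) / real n \<le> u} = {i\<in>{1..n}. rank i \<le> m}"
  proof -
    have "real k / real n \<le> u \<longleftrightarrow> real k \<le> real n * u" for k
      using n by (simp add: pos_divide_le_eq mult.commute)
    moreover have "real k \<le> real n * u \<longleftrightarrow> k \<le> m" for k
      using m by linarith
    ultimately have "real k / real n \<le> u \<longleftrightarrow> k \<le> m" for k by blast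
    then show ?thesis by auto
  qed
  also have "card \<dots> = card {k\<in>{1..n}. k \<le> m}"
  proof (rule bij_betw_same_card)
    show "bij_betw rank {i\<in>{1..n}. rank i \<le> m} {k\<in>{1..n}. k \<le> m}"
    proof (rule bij_betw_imageI)
      show "inj_on rank {i\<in>{1..n}. rank i \<le> m}"
        using bij_betw_imp_inj_on[OF rank_bij] by (rule inj_on_subset) auto
      have "rank ` {i\<in>{1..n}. rank i \<le> m} = {k\<in>rank ` {1..n}. k \<le> m}" by auto
      then show "rank ` {i\<in>{1..n}. rank i \<le> m} = {k\<in>{1..n}. k \<le> m}"
        unfolding bij_betw_imp_surj_on[OF rank_bij] .
    qed
  qed
  also have "{k\<in>{1..n}. k \<le> m} = {1..m}" using \<open>m \<le> n\<close> by auto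
  finally have "real (card {i\<in>{1..n}. real (rank i) / real n \<le> u}) = real m" by simp
  moreover have "\<bar>real m / real n - u\<bar> \<le> 1 / real n"
  proof -
    have "real m / real n - u = (real m - real n * u) / real n" using n by (simp add: field_simps)
    moreover have "\<bar>real m - real n * u\<bar> \<le> 1" using m by linarith
    ultimately show ?thesis by (simp add: abs_divide divide_right_mono)
  qed
  ultimately show ?thesis by simp
qed

text \<open>The two inversion lemmas at \<open>s = u\<close> show that one of the index sets
  \<open>R\<close>, \<open>V\<close> contains the other. The sum of the differences of their
  indicators is thus a difference of cardinalities, and \<open>R\<close> has about
  \<open>n * u\<close> elements.\<close>

lemma rank_frac_difference:
  assumes "u \<in> {0..1}"
  shows "(\<Sum>i=1..n. \<bar>of_bool (real (rank i) / real n \<le> u) - of_bool (F (x i) \<le> u)\<bar>) / real n \<le> \<bar>frac u - u\<bar> + 1 / real n"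
proof -
  define R where "R = {i\<in>{1..n}. real (rank i) / real n \<le> u}"
  define V where "V = {i\<in>{1..n}. F (x i) \<le> u}"
  have R: "of_bool (real (rank i) / real n \<le> u) = (of_bool (i \<in> R) :: real)"
    and V: "of_bool (F (x i) \<le> u) = (of_bool (i \<in> V) :: real)" if "i \<in> {1..n}" for i
    using that by (simp_all add: R_def V_def)
  have fin: "finite R" "finite V" "R \<subseteq> {1..n}" "V \<subseteq> {1..n}" by (auto simp: R_def V_def)
  have card: "(\<Sum>i=1..n. of_bool (i \<in> A)) = real (card A)" if "A \<subseteq> {1..n}" for A
    using that by (simp add: of_bool_def sum.If_cases Int_absorb1)
  have nested: "(\<Sum>i=1..n. \<bar>of_bool (i \<in> A) - of_bool (i \<in> B)\<bar>) = \<bar>real (card A) - real (card B)\<bar>"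
    if "B \<subseteq> A" "A \<subseteq> {1..n}" for A B
  proof -
    have "(\<Sum>i=1..n. \<bar>of_bool (i \<in> A) - of_bool (i \<in> B) :: real\<bar>) = (\<Sum>i=1..n. of_bool (i \<in> A) - of_bool (i \<in> B))"
      using that by (intro sum.cong) auto
    also have "\<dots> = real (card A) - real (card B)"
      using card[of A] card[of B] that by (simp add: sum_subtractf)
    also have "\<dots> = \<bar>real (card A) - real (card B)\<bar>"
      using card_mono[OF finite_subset[OF that(2)] that(1)] by simp
    finally show ?thesis .
  qed
  have "V \<subseteq> R \<or> R \<subseteq> V"
  proof (cases "frac u \<le> u")
    case True
    then show ?thesis using rank_le_of_frac[of u u] by (auto simp: R_def V_def)
  next
    case False
    then show ?thesis using le_of_rank_le[of u u] by (auto simp: R_def V_def)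
  qed
  then have "(\<Sum>i=1..n. \<bar>of_bool (i \<in> R) - of_bool (i \<in> V)\<bar>) = \<bar>real (card R) - real (card V)\<bar>"
    using nested[of V R] nested[of R V] fin by (auto simp: abs_minus_commute)
  then have "(\<Sum>i=1..n. \<bar>of_bool (real (rank i) / real n \<le> u) - of_bool (F (x i) \<le> u)\<bar>) = \<bar>real (card R) - real (card V)\<bar>"
    using R V by (simp cong: sum.cong_simp)
  then have "(\<Sum>i=1..n. \<bar>of_bool (real (rank i) / real n \<le> u) - of_bool (F (x i) \<le> u)\<bar>) / real n =
      \<bar>real (card R) / real n - frac u\<bar>"
    unfolding sample_frac_def V_def[symmetric] by (simp add: diff_divide_distrib[symmetric] abs_divide)
  also have "\<dots> \<le> \<bar>real (card R) / real n - u\<bar> + \<bar>frac u - u\<bar>" by linarith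
  also have "\<bar>real (card R) / real n - u\<bar> \<le> 1 / real n"
    unfolding R_def by (rule card_rank_le[OF assms])
  finally show ?thesis by simp
qed

end

end

text \<open>Continuity of the partial derivatives makes one linearisation, with coefficients frozen
  at \<open>z\<close>, valid for increments between any two points of a box. In the application both
  end points may differ from the centre.\<close>

lemma copula_differential:
  assumes D1: "\<And>z. z \<in> open_square \<Longrightarrow> ((\<lambda>s. C (s, snd z)) has_real_derivative C1 z) (at (fst z))"
    and D2: "\<And>z. z \<in> open_square \<Longrightarrow> ((\<lambda>t. C (fst z, t)) has_real_derivative C2 z) (at (snd z))"
    and c1: "continuous_on open_square C1" and c2: "continuous_on open_square C2"
    and z: "z \<in> open_square" and \<kappa>: "0 < \<kappa>"
  obtains r where "0 < r" "{fst z - r..fst z + r} \<times> {snd z - r..snd z + r} \<subseteq> open_square"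
    "\<And>s t s' t'. s \<in> {fst z - r..fst z + r} \<Longrightarrow> s' \<in> {fst z - r..fst z + r} \<Longrightarrow>
      t \<in> {snd z - r..snd z + r} \<Longrightarrow> t' \<in> {snd z - r..snd z + r} \<Longrightarrow>
      \<bar>C (s, t) - C (s', t') - C1 z * (s - s') - C2 z * (t - t')\<bar> \<le> \<kappa> * (\<bar>s - s'\<bar> + \<bar>t - t'\<bar>)"
proof -
  have open_sq: "open open_square" by (simp add: open_square_def open_Times)
  have cont: "isCont C1 z" "isCont C2 z"
    using c1 c2 z open_sq by (simp_all add: continuous_on_eq_continuous_at)
  obtain e1 where e1: "0 < e1" "\<forall>w. dist w z < e1 \<longrightarrow> dist (C1 w) (C1 z) < \<kappa>"
    using cont(1) \<kappa> unfolding continuous_at_eps_delta by blast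
  obtain e2 where e2: "0 < e2" "\<forall>w. dist w z < e2 \<longrightarrow> dist (C2 w) (C2 z) < \<kappa>"
    using cont(2) \<kappa> unfolding continuous_at_eps_delta by blast
  obtain e3 where e3: "0 < e3" "\<forall>w. dist w z < e3 \<longrightarrow> w \<in> open_square"
    using open_sq z unfolding open_dist by blast
  \<comment> \<open>Each coordinate deviates by at most \<open>r\<close>, so a point of the box is
    within \<open>2 * r < 3 * r\<close> of \<open>z\<close>.\<close>
  define r where "r = min e1 (min e2 e3) / 3"
  have r: "0 < r" "3 * r \<le> e1" "3 * r \<le> e2" "3 * r \<le> e3" using e1(1) e2(1) e3(1) by (auto simp: r_def)
  have near: "dist w z < 3 * r" if "fst w \<in> {fst z - r..fst z + r}" "snd w \<in> {snd z - r..snd z + r}" for w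
  proof -
    have "dist w z \<le> \<bar>fst w - fst z\<bar> + \<bar>snd w - snd z\<bar>"
      using sqrt_sum_squares_le_sum_abs[of "fst w - fst z" "snd w - snd z"]
      by (simp add: dist_prod_def dist_real_def)
    also have "\<dots> \<le> r + r" using that by (intro add_mono) (auto simp: abs_le_iff)
    finally show ?thesis using r by linarith
  qed
  show thesis
  proof (rule that[OF r(1)])
    show "{fst z - r..fst z + r} \<times> {snd z - r..snd z + r} \<subseteq> open_square"
    proof
      fix w assume "w \<in> {fst z - r..fst z + r} \<times> {snd z - r..snd z + r}"
      then have "dist w z < e3" using near[of w] r by (simp add: mem_Times_iff)
      then show "w \<in> open_square" using e3(2) by blast
    qed
    fix s t s' t'
    assume st: "s \<in> {fst z - r..fst z + r}" "s' \<in> {fst z - r..fst z + r}"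
      "t \<in> {snd z - r..snd z + r}" "t' \<in> {snd z - r..snd z + r}"
    have w: "(a, b) \<in> open_square" "\<bar>C1 (a, b) - C1 z\<bar> \<le> \<kappa>" "\<bar>C2 (a, b) - C2 z\<bar> \<le> \<kappa>"
      if "a \<in> {fst z - r..fst z + r}" "b \<in> {snd z - r..snd z + r}" for a b
    proof -
      have d: "dist (a, b) z < 3 * r" using near[of "(a, b)"] that by simp
      show "(a, b) \<in> open_square" using e3(2) d r by fastforce
      have "dist (C1 (a, b)) (C1 z) < \<kappa>" using e1(2) d r by fastforce
      then show "\<bar>C1 (a, b) - C1 z\<bar> \<le> \<kappa>" by (simp add: dist_real_def)
      have "dist (C2 (a, b)) (C2 z) < \<kappa>" using e2(2) d r by fastforce
      then show "\<bar>C2 (a, b) - C2 z\<bar> \<le> \<kappa>" by (simp add: dist_real_def)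
    qed
    \<comment> \<open>The increment is taken along the first coordinate at fixed \<open>t\<close>
      and along the second at fixed \<open>s'\<close>; the mean value inequality is applied to
      \<open>C\<close> minus its frozen linear part.\<close>
    have 1: "norm ((C (s, t) - C1 z * s) - (C (s', t) - C1 z * s')) \<le> \<kappa> * norm (s - s')"
    proof (rule field_differentiable_bound[where f = "\<lambda>s. C (s, t) - C1 z * s" and f' = "\<lambda>a. C1 (a, t) - C1 z"])
      show "convex {fst z - r..fst z + r}" by (rule convex_real_interval)
      fix a assume a: "a \<in> {fst z - r..fst z + r}"
      show "((\<lambda>s. C (s, t) - C1 z * s) has_real_derivative C1 (a, t) - C1 z) (at a within {fst z - r..fst z + r})"
      proof (rule has_field_derivative_at_within, rule DERIV_diff[OF _ DERIV_cmult_Id])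
        show "((\<lambda>s. C (s, t)) has_real_derivative C1 (a, t)) (at a)" using D1[OF w(1)[OF a st(3)]] by simp
      qed
      show "norm (C1 (a, t) - C1 z) \<le> \<kappa>" using w(2)[OF a st(3)] by simp
    qed (use st in auto)
    have 2: "norm ((C (s', t) - C2 z * t) - (C (s', t') - C2 z * t')) \<le> \<kappa> * norm (t - t')"
    proof (rule field_differentiable_bound[where f = "\<lambda>t. C (s', t) - C2 z * t" and f' = "\<lambda>b. C2 (s', b) - C2 z"])
      show "convex {snd z - r..snd z + r}" by (rule convex_real_interval)
      fix b assume b: "b \<in> {snd z - r..snd z + r}"
      show "((\<lambda>t. C (s', t) - C2 z * t) has_real_derivative C2 (s', b) - C2 z) (at b within {snd z - r..snd z + r})"
      proof (rule has_field_derivative_at_within, rule DERIV_diff[OF _ DERIV_cmult_Id])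
        show "((\<lambda>t. C (s', t)) has_real_derivative C2 (s', b)) (at b)" using D2[OF w(1)[OF st(2) b]] by simp
      qed
      show "norm (C2 (s', b) - C2 z) \<le> \<kappa>" using w(3)[OF st(2) b] by simp
    qed (use st in auto)
    have "C (s, t) - C (s', t') - C1 z * (s - s') - C2 z * (t - t') =
        ((C (s, t) - C1 z * s) - (C (s', t) - C1 z * s')) + ((C (s', t) - C2 z * t) - (C (s', t') - C2 z * t'))"
      by (simp add: algebra_simps)
    also have "\<bar>\<dots>\<bar> \<le> \<kappa> * \<bar>s - s'\<bar> + \<kappa> * \<bar>t - t'\<bar>"
      using 1 2 unfolding real_norm_def by (rule order_trans[OF abs_triangle_ineq add_mono])
    finally show "\<bar>C (s, t) - C (s', t') - C1 z * (s - s') - C2 z * (t - t')\<bar> \<le> \<kappa> * (\<bar>s - s'\<bar> + \<bar>t - t'\<bar>)"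
      by (simp add: distrib_left)
  qed
qed

section \<open>The empirical copula\<close>

text \<open>The ranks come from \<open>X\<close> and \<open>Y\<close>, the empirical process from
  their transforms; monotonicity of \<open>F\<close> and \<open>G\<close> links the two.\<close>

locale rank_sample = iid_copula_sample +
  fixes X Y :: "nat \<Rightarrow> 'a \<Rightarrow> real" and F G :: "real \<Rightarrow> real"
  assumes F: "mono F" and G: "mono G"
    and P_eq: "\<And>i \<omega>. P i \<omega> = (F (X i \<omega>), G (Y i \<omega>))"
    and P_unit: "\<And>i \<omega>. P i \<omega> \<in> unit_square"
    and X_measurable[measurable]: "\<And>i. 1 \<le> i \<Longrightarrow> X i \<in> borel_measurable M"
    and Y_measurable[measurable]: "\<And>i. 1 \<le> i \<Longrightarrow> Y i \<in> borel_measurable M"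
    and no_ties: "AE \<omega> in M. \<forall>n. inj_on (\<lambda>i. X i \<omega>) {1..n} \<and> inj_on (\<lambda>i. Y i \<omega>) {1..n}"
    and D1: "\<And>z. z \<in> open_square \<Longrightarrow> ((\<lambda>s. C (s, snd z)) has_real_derivative C1 z) (at (fst z))"
    and D2: "\<And>z. z \<in> open_square \<Longrightarrow> ((\<lambda>t. C (fst z, t)) has_real_derivative C2 z) (at (snd z))"
    and C1_continuous: "continuous_on open_square C1" and C2_continuous: "continuous_on open_square C2"
begin

definition rx :: "nat \<Rightarrow> 'a \<Rightarrow> nat \<Rightarrow> real" where "rx n \<omega> i = real (sample_rank n (\<lambda>i. X i \<omega>) i) / real n"
definition ry :: "nat \<Rightarrow> 'a \<Rightarrow> nat \<Rightarrow> real" where "ry n \<omega> i = real (sample_rank n (\<lambda>i. Y i \<omega>) i) / real n"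
definition fx :: "nat \<Rightarrow> 'a \<Rightarrow> real \<Rightarrow> real" where "fx n \<omega> s = sample_frac n (\<lambda>i. X i \<omega>) F s"
definition fy :: "nat \<Rightarrow> 'a \<Rightarrow> real \<Rightarrow> real" where "fy n \<omega> s = sample_frac n (\<lambda>i. Y i \<omega>) G s"

definition emp :: "nat \<Rightarrow> real \<times> real \<Rightarrow> 'a \<Rightarrow> real" where "emp n z \<omega> = emp_copula X Y n \<omega> z"
text \<open>The empirical distribution function of the transforms, the unobservable counterpart of
  \<open>emp\<close>.\<close>

definition ecdf :: "nat \<Rightarrow> real \<times> real \<Rightarrow> 'a \<Rightarrow> real" where "ecdf n z \<omega> = (\<Sum>i=1..n. below z (P i \<omega>)) / real n"
text \<open>The empirical copula process.\<close>

definition cn :: "nat \<Rightarrow> real \<times> real \<Rightarrow> 'a \<Rightarrow> real" where "cn n z \<omega> = sqrt (real n) * (emp n z \<omega> - C z)"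

lemma emp_cdf_ranks: "emp_cdf X n \<omega> (X i \<omega>) = rx n \<omega> i" "emp_cdf Y n \<omega> (Y i \<omega>) = ry n \<omega> i"
  by (simp_all add: emp_cdf_def rx_def ry_def sample_rank_def indicator_def of_bool_def sum.If_cases Int_def)

lemma emp_eq: "emp n z \<omega> = (\<Sum>i=1..n. of_bool (rx n \<omega> i \<le> fst z) * of_bool (ry n \<omega> i \<le> snd z)) / real n"
proof -
  have "indicat_real ({..u} \<times> {..v}) (a, b) = of_bool (a \<le> u) * of_bool (b \<le> v)" for u v a b :: real
    by (auto simp: indicator_def)
  then show ?thesis by (simp add: emp_def emp_copula_def case_prod_unfold emp_cdf_ranks)
qed

lemma emp_measurable[measurable]: "emp n z \<in> borel_measurable M"
proof -
  have "(\<lambda>\<omega>. emp_cdf X n \<omega> (X i \<omega>)) \<in> borel_measurable M" "(\<lambda>\<omega>. emp_cdf Y n \<omega> (Y i \<omega>)) \<in> borel_measurable M" if "1 \<le> i" for i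
  proof -
    have [measurable]: "X i \<in> borel_measurable M" "Y i \<in> borel_measurable M" using that by auto
    have "(\<lambda>\<omega>. indicat_real {..X i \<omega>} (X j \<omega>)) \<in> borel_measurable M" "(\<lambda>\<omega>. indicat_real {..Y i \<omega>} (Y j \<omega>)) \<in> borel_measurable M" if "1 \<le> j" for j
    proof -
      have [measurable]: "X j \<in> borel_measurable M" "Y j \<in> borel_measurable M" using that by auto
      have "(\<lambda>\<omega>. of_bool (X j \<omega> \<le> X i \<omega>) :: real) \<in> borel_measurable M" "(\<lambda>\<omega>. of_bool (Y j \<omega> \<le> Y i \<omega>) :: real) \<in> borel_measurable M"
        by measurable
      then show "(\<lambda>\<omega>. indicat_real {..X i \<omega>} (X j \<omega>)) \<in> borel_measurable M" "(\<lambda>\<omega>. indicat_real {..Y i \<omega>} (Y j \<omega>)) \<in> borel_measurable M"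
        by (simp_all add: indicator_def)
    qed
    then show "(\<lambda>\<omega>. emp_cdf X n \<omega> (X i \<omega>)) \<in> borel_measurable M" "(\<lambda>\<omega>. emp_cdf Y n \<omega> (Y i \<omega>)) \<in> borel_measurable M"
      unfolding emp_cdf_def by (intro borel_measurable_divide borel_measurable_sum borel_measurable_const; simp)+
  qed
  then have m: "(\<lambda>\<omega>. rx n \<omega> i) \<in> borel_measurable M" "(\<lambda>\<omega>. ry n \<omega> i) \<in> borel_measurable M" if "1 \<le> i" for i
    using that unfolding emp_cdf_ranks by auto
  have "(\<lambda>\<omega>. of_bool (rx n \<omega> i \<le> fst z) * of_bool (ry n \<omega> i \<le> snd z) :: real) \<in> borel_measurable M" if "1 \<le> i" for i
  proof -
    note m[OF that, measurable]
    show ?thesis by measurable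
  qed
  then show ?thesis unfolding emp_eq[abs_def] by (intro borel_measurable_divide borel_measurable_sum borel_measurable_const) auto
qed

lemma cn_measurable[measurable]: "cn n z \<in> borel_measurable M"
  unfolding cn_def[abs_def] by measurable

lemma emp_range: "0 \<le> emp n z \<omega>" "emp n z \<omega> \<le> 1"
proof -
  show "0 \<le> emp n z \<omega>" unfolding emp_eq by (intro divide_nonneg_nonneg sum_nonneg) auto
  have "(\<Sum>i=1..n. of_bool (rx n \<omega> i \<le> fst z) * of_bool (ry n \<omega> i \<le> snd z) :: real) \<le> (\<Sum>i=1..n. 1)"
    by (intro sum_mono) auto
  then have "(\<Sum>i=1..n. of_bool (rx n \<omega> i \<le> fst z) * of_bool (ry n \<omega> i \<le> snd z)) \<le> real n" by simp
  then show "emp n z \<omega> \<le> 1" unfolding emp_eq by (cases "n = 0") (auto simp: divide_le_eq_1)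
qed

lemma cn_bound: "z \<in> unit_square \<Longrightarrow> \<bar>cn n z \<omega>\<bar> \<le> sqrt (real n)"
proof -
  assume z: "z \<in> unit_square"
  have "\<bar>emp n z \<omega> - C z\<bar> \<le> 1" using emp_range[of n z \<omega>] copula_range[OF C z] by linarith
  then show ?thesis unfolding cn_def abs_mult by (simp add: mult_left_le)
qed

lemma ep_ecdf: "ep n z \<omega> = sqrt (real n) * (ecdf n z \<omega> - C z)"
proof (cases "n = 0")
  case False
  let ?S = "\<Sum>i=1..n. below z (P i \<omega>)"
  have "(\<Sum>i=1..n. ind z (P i \<omega>)) = ?S - real n * C z" by (simp add: ind_eq sum_subtractf)
  also have "\<dots> = (sqrt (real n) * sqrt (real n)) * (?S / real n - C z)" using False by (simp add: right_diff_distrib)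
  finally have S: "(\<Sum>i=1..n. ind z (P i \<omega>)) = (sqrt (real n) * sqrt (real n)) * (?S / real n - C z)" .
  show ?thesis
    unfolding ep_def ecdf_def S mult.assoc by (rule nonzero_mult_div_cancel_left) (use False in simp)
qed (simp add: ep_def)

text \<open>All transforms are at most 1, so a coordinate equal to 1 imposes no restriction and the
  marginal frequency remains; the margins of a copula are the identity.\<close>

lemma ep_edges:
  assumes s: "s \<in> {0..1}"
  shows "ep n (s, 1) \<omega> = sqrt (real n) * (fx n \<omega> s - s)" "ep n (1, s) \<omega> = sqrt (real n) * (fy n \<omega> s - s)"
proof -
  have u: "0 \<le> F (X i \<omega>)" "F (X i \<omega>) \<le> 1" "0 \<le> G (Y i \<omega>)" "G (Y i \<omega>) \<le> 1" for i
    using P_unit[of i \<omega>] by (auto simp: P_eq)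
  have "ecdf n (s, 1) \<omega> = fx n \<omega> s" "ecdf n (1, s) \<omega> = fy n \<omega> s"
    using u by (simp_all add: ecdf_def fx_def fy_def sample_frac_def below_def P_eq of_bool_def sum.If_cases Int_def)
  then show "ep n (s, 1) \<omega> = sqrt (real n) * (fx n \<omega> s - s)" "ep n (1, s) \<omega> = sqrt (real n) * (fy n \<omega> s - s)"
    using copula_boundary[OF C s] by (simp_all add: ep_ecdf)
qed

text \<open>If the marginal frequencies at \<open>(s, t)\<close> do not exceed \<open>z\<close>,
  every observation counted by \<open>ecdf\<close> also has normalised ranks at most
  \<open>z\<close>. Together with \<open>emp_upper\<close> this bounds the empirical copula by
  \<open>ecdf\<close> at shifted arguments.\<close>

lemma emp_lower:
  assumes n: "0 < n" and "fx n \<omega> s \<le> fst z" "fy n \<omega> t \<le> snd z"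
  shows "ecdf n (s, t) \<omega> \<le> emp n z \<omega>"
  unfolding ecdf_def emp_eq
proof (intro divide_right_mono sum_mono)
  fix i
  show "below (s, t) (P i \<omega>) \<le> of_bool (rx n \<omega> i \<le> fst z) * of_bool (ry n \<omega> i \<le> snd z)"
    using rank_le_of_frac[OF n F, of "\<lambda>i. X i \<omega>" s "fst z" i] rank_le_of_frac[OF n G, of "\<lambda>i. Y i \<omega>" t "snd z" i] assms(2,3)
    by (auto simp: below_def P_eq rx_def ry_def fx_def fy_def)
qed simp

lemma emp_upper:
  assumes n: "0 < n" and "fst z < fx n \<omega> s" "snd z < fy n \<omega> t"
  shows "emp n z \<omega> \<le> ecdf n (s, t) \<omega>"
  unfolding ecdf_def emp_eq
proof (intro divide_right_mono sum_mono)
  fix i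
  show "of_bool (rx n \<omega> i \<le> fst z) * of_bool (ry n \<omega> i \<le> snd z) \<le> below (s, t) (P i \<omega>)"
    using le_of_rank_le[OF n F, of "fst z" "\<lambda>i. X i \<omega>" s i] le_of_rank_le[OF n G, of "snd z" "\<lambda>i. Y i \<omega>" t i] assms(2,3)
    by (auto simp: below_def P_eq rx_def ry_def fx_def fy_def)
qed simp

text \<open>A product of two indicators changes by at most the sum of the changes of its factors,
  and \<open>rank_frac_difference\<close> bounds each average change by a marginal deviation plus
  \<open>1 / n\<close>. After scaling, the rounding terms are at most 2.\<close>

lemma cn_le_ep:
  assumes n: "0 < n" and z: "z \<in> unit_square"
    and inj: "inj_on (\<lambda>i. X i \<omega>) {1..n}" "inj_on (\<lambda>i. Y i \<omega>) {1..n}"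
  shows "\<bar>cn n z \<omega>\<bar> \<le> \<bar>ep n z \<omega>\<bar> + \<bar>ep n (fst z, 1) \<omega>\<bar> + \<bar>ep n (1, snd z) \<omega>\<bar> + 2"
proof -
  have uv: "fst z \<in> {0..1}" "snd z \<in> {0..1}" using z by (auto simp: mem_Times_iff)
  let ?dx = "\<lambda>i. \<bar>of_bool (rx n \<omega> i \<le> fst z) - of_bool (F (X i \<omega>) \<le> fst z) :: real\<bar>"
  let ?dy = "\<lambda>i. \<bar>of_bool (ry n \<omega> i \<le> snd z) - of_bool (G (Y i \<omega>) \<le> snd z) :: real\<bar>"
  have dx: "(\<Sum>i=1..n. ?dx i) / real n \<le> \<bar>fx n \<omega> (fst z) - fst z\<bar> + 1 / real n"
    using rank_frac_difference[OF n F inj(1) uv(1)] by (simp add: rx_def fx_def)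
  have dy: "(\<Sum>i=1..n. ?dy i) / real n \<le> \<bar>fy n \<omega> (snd z) - snd z\<bar> + 1 / real n"
    using rank_frac_difference[OF n G inj(2) uv(2)] by (simp add: ry_def fy_def)
  have "\<bar>emp n z \<omega> - ecdf n z \<omega>\<bar> = \<bar>\<Sum>i=1..n. of_bool (rx n \<omega> i \<le> fst z) * of_bool (ry n \<omega> i \<le> snd z) - below z (P i \<omega>)\<bar> / real n"
    by (simp add: emp_eq ecdf_def sum_subtractf diff_divide_distrib[symmetric] abs_divide)
  also have "\<dots> \<le> (\<Sum>i=1..n. \<bar>of_bool (rx n \<omega> i \<le> fst z) * of_bool (ry n \<omega> i \<le> snd z) - below z (P i \<omega>)\<bar>) / real n"
    by (intro divide_right_mono sum_abs) simp
  also have "\<dots> \<le> (\<Sum>i=1..n. ?dx i + ?dy i) / real n"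
    by (intro divide_right_mono sum_mono) (auto simp: below_def P_eq)
  also have "\<dots> = (\<Sum>i=1..n. ?dx i) / real n + (\<Sum>i=1..n. ?dy i) / real n"
    by (simp add: sum.distrib add_divide_distrib)
  also have "\<dots> \<le> \<bar>fx n \<omega> (fst z) - fst z\<bar> + \<bar>fy n \<omega> (snd z) - snd z\<bar> + 2 / real n"
    using dx dy by (simp add: add_divide_distrib[symmetric] algebra_simps) (smt (verit) add_divide_distrib)
  finally have d: "\<bar>emp n z \<omega> - ecdf n z \<omega>\<bar> \<le> \<bar>fx n \<omega> (fst z) - fst z\<bar> + \<bar>fy n \<omega> (snd z) - snd z\<bar> + 2 / real n" .
  have "cn n z \<omega> - ep n z \<omega> = sqrt (real n) * (emp n z \<omega> - ecdf n z \<omega>)"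
    by (simp add: cn_def ep_ecdf algebra_simps)
  then have "\<bar>cn n z \<omega> - ep n z \<omega>\<bar> = sqrt (real n) * \<bar>emp n z \<omega> - ecdf n z \<omega>\<bar>" by (simp add: abs_mult)
  also have "\<dots> \<le> sqrt (real n) * (\<bar>fx n \<omega> (fst z) - fst z\<bar> + \<bar>fy n \<omega> (snd z) - snd z\<bar> + 2 / real n)"
    by (rule mult_left_mono[OF d]) simp
  also have "\<dots> = \<bar>ep n (fst z, 1) \<omega>\<bar> + \<bar>ep n (1, snd z) \<omega>\<bar> + 2 * (sqrt (real n) / real n)"
    by (simp add: ep_edges[OF uv(1)] ep_edges[OF uv(2)] abs_mult distrib_left)
  also have "sqrt (real n) / real n \<le> 1"
  proof -
    have "sqrt (real n) \<le> real n" by (rule real_le_lsqrt) (use n in \<open>auto simp: power2_eq_square\<close>)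
    then show ?thesis using n by (simp add: divide_le_eq_1)
  qed
  finally show ?thesis by linarith
qed

text \<open>The constant is \<open>4 * (1 + 1 + 1 + 4)\<close>, from Cauchy--Schwarz for four terms
  in \<open>cn_le_ep\<close>. It is the same for all \<open>z\<close> and all positive
  \<open>n\<close>.\<close>

lemma cn_sq:
  assumes n: "0 < n" and z: "z \<in> unit_square"
  shows "integrable M (\<lambda>\<omega>. (cn n z \<omega>)\<^sup>2)" "(\<integral>\<omega>. (cn n z \<omega>)\<^sup>2 \<partial>M) \<le> 28"
proof -
  have e: "(fst z, 1) \<in> unit_square" "(1, snd z) \<in> unit_square" using z by (auto simp: mem_Times_iff)
  have b: "\<bar>(cn n z \<omega>)\<^sup>2\<bar> \<le> (sqrt (real n))\<^sup>2" for \<omega>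
    using power_mono[OF cn_bound[OF z, of n \<omega>], of 2] by simp
  show i: "integrable M (\<lambda>\<omega>. (cn n z \<omega>)\<^sup>2)"
    by (rule integrable_const_bound[of _ "(sqrt (real n))\<^sup>2"]) (use b in auto)
  let ?s = "\<lambda>\<omega>. 4 * ((ep n z \<omega>)\<^sup>2 + (ep n (fst z, 1) \<omega>)\<^sup>2 + (ep n (1, snd z) \<omega>)\<^sup>2 + 4)"
  have q: "(x + y + t + 2)\<^sup>2 \<le> 4 * (x\<^sup>2 + y\<^sup>2 + t\<^sup>2 + 4)" for x y t :: real
  proof -
    have "4 * (x\<^sup>2 + y\<^sup>2 + t\<^sup>2 + 4) - (x + y + t + 2)\<^sup>2 =
        (x - y)\<^sup>2 + (x - t)\<^sup>2 + (y - t)\<^sup>2 + (x - 2)\<^sup>2 + (y - 2)\<^sup>2 + (t - 2)\<^sup>2"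
      by (simp add: power2_eq_square algebra_simps)
    then show ?thesis by (smt (verit) zero_le_power2)
  qed
  have "AE \<omega> in M. (cn n z \<omega>)\<^sup>2 \<le> ?s \<omega>"
    using no_ties
  proof eventually_elim
    case (elim \<omega>)
    then have "\<bar>cn n z \<omega>\<bar>\<^sup>2 \<le> (\<bar>ep n z \<omega>\<bar> + \<bar>ep n (fst z, 1) \<omega>\<bar> + \<bar>ep n (1, snd z) \<omega>\<bar> + 2)\<^sup>2"
      by (intro power_mono cn_le_ep[OF n z]) auto
    also have "\<dots> \<le> ?s \<omega>" using q[of "\<bar>ep n z \<omega>\<bar>" "\<bar>ep n (fst z, 1) \<omega>\<bar>" "\<bar>ep n (1, snd z) \<omega>\<bar>"] by simp
    finally show ?case by simp
  qed
  then have "(\<integral>\<omega>. (cn n z \<omega>)\<^sup>2 \<partial>M) \<le> (\<integral>\<omega>. ?s \<omega> \<partial>M)"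
    using i ep.b_sq[OF z] ep.b_sq[OF e(1)] ep.b_sq[OF e(2)] by (intro integral_mono_AE) auto
  also have "\<dots> \<le> 28"
    using ep.b_sq[OF z, of n] ep.b_sq[OF e(1), of n] ep.b_sq[OF e(2), of n]
      ep.b_sq_le[OF z, of n] ep.b_sq_le[OF e(1), of n] ep.b_sq_le[OF e(2), of n] by (simp add: prob_space)
  finally show "(\<integral>\<omega>. (cn n z \<omega>)\<^sup>2 \<partial>M) \<le> 28" .
qed

text \<open>\<open>z0\<close> is the interior point of interest and \<open>z\<close> a nearby node.
  The points \<open>gs j\<close>, \<open>gt j\<close> form a grid around \<open>z\<close> of mesh
  \<open>\<eta> / sqrt n\<close>, long enough (\<open>J\<close>) to follow marginal fluctuations up
  to \<open>K\<close>; \<kappa> is the slope error of the linearisation frozen at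
  \<open>z0\<close>.\<close>

context
  fixes n :: nat and \<omega> :: 'a and z z0 :: "real \<times> real" and K \<eta> \<kappa> r :: real and J :: int
  assumes n: "0 < n" and z: "z \<in> unit_square" and z0: "z0 \<in> open_square"
    and \<eta>: "0 < \<eta>" and K: "0 \<le> K" and \<kappa>: "0 \<le> \<kappa>" and J: "K + 2 * \<eta> \<le> of_int J * \<eta>"
    and r: "{fst z0 - r..fst z0 + r} \<times> {snd z0 - r..snd z0 + r} \<subseteq> open_square"
    and near: "\<bar>fst z - fst z0\<bar> + of_int J * \<eta> / sqrt (real n) \<le> r" "\<bar>snd z - snd z0\<bar> + of_int J * \<eta> / sqrt (real n) \<le> r"
    and diff: "\<And>s t s' t'. s \<in> {fst z0 - r..fst z0 + r} \<Longrightarrow> s' \<in> {fst z0 - r..fst z0 + r} \<Longrightarrow>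
      t \<in> {snd z0 - r..snd z0 + r} \<Longrightarrow> t' \<in> {snd z0 - r..snd z0 + r} \<Longrightarrow>
      \<bar>C (s, t) - C (s', t') - C1 z0 * (s - s') - C2 z0 * (t - t')\<bar> \<le> \<kappa> * (\<bar>s - s'\<bar> + \<bar>t - t'\<bar>)"
begin

definition gs :: "int \<Rightarrow> real" where "gs j = fst z + of_int j * \<eta> / sqrt (real n)"
definition gt :: "int \<Rightarrow> real" where "gt j = snd z + of_int j * \<eta> / sqrt (real n)"

lemma grid_shift: "j \<in> {- J..J} \<Longrightarrow> \<bar>of_int j * \<eta> / sqrt (real n)\<bar> \<le> of_int J * \<eta> / sqrt (real n)"
proof -
  assume "j \<in> {- J..J}"
  then have "\<bar>of_int j\<bar> \<le> (of_int J :: real)" by (auto simp: abs_le_iff)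
  then show ?thesis using \<eta> by (simp add: abs_mult divide_right_mono mult_right_mono)
qed

lemma grid_near:
  assumes "j \<in> {- J..J}"
  shows "gs j \<in> {fst z0 - r..fst z0 + r}" "gt j \<in> {snd z0 - r..snd z0 + r}"
  using grid_shift[OF assms] near unfolding gs_def gt_def atLeastAtMost_iff
  by (simp_all only: abs_le_iff) linarith+

lemma J_nonneg: "0 \<le> J"
proof -
  have "0 < of_int J * \<eta>" using J K \<eta> by linarith
  then show ?thesis using \<eta> by (simp add: zero_less_mult_iff)
qed

lemma z_near: "fst z \<in> {fst z0 - r..fst z0 + r}" "snd z \<in> {snd z0 - r..snd z0 + r}"
  using grid_near[of 0] J_nonneg by (simp_all add: gs_def gt_def)

lemma grid_unit:
  assumes "j \<in> {- J..J}" "l \<in> {- J..J}"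
  shows "(gs j, gt l) \<in> open_square" "gs j \<in> {0..1}" "gt l \<in> {0..1}"
proof -
  show "(gs j, gt l) \<in> open_square" using r grid_near(1)[OF assms(1)] grid_near(2)[OF assms(2)] by blast
  then show "gs j \<in> {0..1}" "gt l \<in> {0..1}" by (auto simp: open_square_def)
qed

text \<open>The good event at a single sample point: the empirical process is nearly constant over
  the grid, and its margins at \<open>z\<close> are at most \<open>K\<close>. All conclusions drawn
  from it are deterministic.\<close>

context
  assumes close: "\<And>j l. j \<in> {- J..J} \<Longrightarrow> l \<in> {- J..J} \<Longrightarrow> \<bar>ep n (gs j, gt l) \<omega> - ep n z \<omega>\<bar> \<le> \<eta>"
    "\<And>j. j \<in> {- J..J} \<Longrightarrow> \<bar>ep n (gs j, 1) \<omega> - ep n (fst z, 1) \<omega>\<bar> \<le> \<eta>"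
    "\<And>j. j \<in> {- J..J} \<Longrightarrow> \<bar>ep n (1, gt j) \<omega> - ep n (1, snd z) \<omega>\<bar> \<le> \<eta>"
    and small: "\<bar>ep n (fst z, 1) \<omega>\<bar> \<le> K" "\<bar>ep n (1, snd z) \<omega>\<bar> \<le> K"
begin

abbreviation b1 :: real where "b1 \<equiv> ep n (fst z, 1) \<omega>"
abbreviation b2 :: real where "b2 \<equiv> ep n (1, snd z) \<omega>"

lemma sqrt_n_pos: "0 < sqrt (real n)" using n by simp

text \<open>Where the grid shifts cancel the marginal fluctuations \<open>b1\<close>,
  \<open>b2\<close> up to \<open>2 * \<eta>\<close>, linearisation turns the scaled increment of
  \<open>C\<close> into minus the two correction terms of \<open>g\<close>. The mismatch costs
  \<open>4 * \<eta>\<close>, the linearisation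
  \<open>2 * \<kappa> * (K + 2 * \<eta>)\<close>.\<close>

lemma drift_bound:
  assumes j: "j \<in> {- J..J}" and l: "l \<in> {- J..J}"
    and c: "\<bar>of_int j * \<eta> + b1\<bar> \<le> 2 * \<eta>" "\<bar>of_int l * \<eta> + b2\<bar> \<le> 2 * \<eta>"
  shows "\<bar>sqrt (real n) * (C (gs j, gt l) - C z) + C1 z0 * b1 + C2 z0 * b2\<bar> \<le> 4 * \<eta> + 2 * \<kappa> * (K + 2 * \<eta>)"
proof -
  define a where "a = of_int j * \<eta>"
  define d where "d = of_int l * \<eta>"
  define q where "q = sqrt (real n)"
  have q: "0 < q" using sqrt_n_pos by (simp add: q_def)
  have ad: "\<bar>a\<bar> \<le> K + 2 * \<eta>" "\<bar>d\<bar> \<le> K + 2 * \<eta>" using c small unfolding a_def d_def by linarith+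
  have s: "gs j - fst z = a / q" "gt l - snd z = d / q" by (simp_all add: gs_def gt_def a_def d_def q_def)
  have "\<bar>C (gs j, gt l) - C z - C1 z0 * (a / q) - C2 z0 * (d / q)\<bar> \<le> \<kappa> * (\<bar>a / q\<bar> + \<bar>d / q\<bar>)"
    using diff[OF grid_near(1)[OF j] z_near(1) grid_near(2)[OF l] z_near(2)] unfolding s by simp
  then have "q * \<bar>C (gs j, gt l) - C z - C1 z0 * (a / q) - C2 z0 * (d / q)\<bar> \<le> q * (\<kappa> * (\<bar>a / q\<bar> + \<bar>d / q\<bar>))"
    using q by (intro mult_left_mono) auto
  also have "q * (\<kappa> * (\<bar>a / q\<bar> + \<bar>d / q\<bar>)) = \<kappa> * (\<bar>a\<bar> + \<bar>d\<bar>)"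
    using q by (simp add: abs_divide add_divide_distrib[symmetric])
  also have "q * \<bar>C (gs j, gt l) - C z - C1 z0 * (a / q) - C2 z0 * (d / q)\<bar> =
      \<bar>q * (C (gs j, gt l) - C z - C1 z0 * (a / q) - C2 z0 * (d / q))\<bar>"
    using q by (simp add: abs_mult)
  also have "q * (C (gs j, gt l) - C z - C1 z0 * (a / q) - C2 z0 * (d / q)) = q * (C (gs j, gt l) - C z) - C1 z0 * a - C2 z0 * d"
    using q by (simp add: right_diff_distrib)
  finally have 1: "\<bar>q * (C (gs j, gt l) - C z) - C1 z0 * a - C2 z0 * d\<bar> \<le> \<kappa> * (\<bar>a\<bar> + \<bar>d\<bar>)" .
  have "\<kappa> * (\<bar>a\<bar> + \<bar>d\<bar>) \<le> \<kappa> * ((K + 2 * \<eta>) + (K + 2 * \<eta>))"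
    using ad \<kappa> by (intro mult_left_mono add_mono) auto
  then have 2: "\<kappa> * (\<bar>a\<bar> + \<bar>d\<bar>) \<le> 2 * \<kappa> * (K + 2 * \<eta>)" by (simp add: algebra_simps)
  have "\<bar>C1 z0 * (a + b1)\<bar> \<le> 1 * (2 * \<eta>)" "\<bar>C2 z0 * (d + b2)\<bar> \<le> 1 * (2 * \<eta>)"
    unfolding abs_mult using C1(2)[OF z0] C2(2)[OF z0] c \<eta> unfolding a_def d_def by (intro mult_mono; simp)+
  moreover have "q * (C (gs j, gt l) - C z) + C1 z0 * b1 + C2 z0 * b2 =
      (q * (C (gs j, gt l) - C z) - C1 z0 * a - C2 z0 * d) + C1 z0 * (a + b1) + C2 z0 * (d + b2)"
    by (simp add: algebra_simps)
  ultimately show ?thesis using 1 2 unfolding q_def by linarith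
qed

lemma fx_shift: "j \<in> {- J..J} \<Longrightarrow> sqrt (real n) * (fx n \<omega> (gs j) - fst z) = of_int j * \<eta> + ep n (gs j, 1) \<omega>"
  and fy_shift: "j \<in> {- J..J} \<Longrightarrow> sqrt (real n) * (fy n \<omega> (gt j) - snd z) = of_int j * \<eta> + ep n (1, gt j) \<omega>"
proof -
  assume j: "j \<in> {- J..J}"
  show "sqrt (real n) * (fx n \<omega> (gs j) - fst z) = of_int j * \<eta> + ep n (gs j, 1) \<omega>"
    unfolding ep_edges[OF grid_unit(2)[OF j j]] using sqrt_n_pos by (simp add: gs_def field_simps)
  show "sqrt (real n) * (fy n \<omega> (gt j) - snd z) = of_int j * \<eta> + ep n (1, gt j) \<omega>"
    unfolding ep_edges[OF grid_unit(3)[OF j j]] using sqrt_n_pos by (simp add: gt_def field_simps)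
qed

text \<open>Two grid shifts that just overshoot and undershoot \<open>- b\<close>. The margin \<eta>
  survives the oscillation allowed by \<open>close\<close>, so the signs required by
  \<open>emp_upper\<close> and \<open>emp_lower\<close> are certain.\<close>

lemma choose_index:
  assumes b: "\<bar>b\<bar> \<le> K"
  obtains j i where "j \<in> {- J..J}" "\<eta> < of_int j * \<eta> + b" "of_int j * \<eta> + b \<le> 2 * \<eta>"
    "i \<in> {- J..J}" "- 2 * \<eta> \<le> of_int i * \<eta> + b" "of_int i * \<eta> + b \<le> - \<eta>"
proof
  define j where "j = \<lfloor>(\<eta> - b) / \<eta>\<rfloor> + 1"
  define i where "i = \<lfloor>(- \<eta> - b) / \<eta>\<rfloor>"
  have "(\<eta> - b) / \<eta> < of_int j" "of_int j \<le> (\<eta> - b) / \<eta> + 1" unfolding j_def by linarith+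
  then show j: "\<eta> < of_int j * \<eta> + b" "of_int j * \<eta> + b \<le> 2 * \<eta>"
    using \<eta> by (simp_all add: field_simps)
  have "of_int i \<le> (- \<eta> - b) / \<eta>" "(- \<eta> - b) / \<eta> - 1 \<le> of_int i" unfolding i_def by linarith+
  then show i: "- 2 * \<eta> \<le> of_int i * \<eta> + b" "of_int i * \<eta> + b \<le> - \<eta>"
    using \<eta> by (simp_all add: field_simps)
  have range: "k \<in> {- J..J}" if "\<bar>of_int k * \<eta>\<bar> \<le> of_int J * \<eta>" for k
  proof -
    have "\<bar>of_int k\<bar> * \<eta> \<le> of_int J * \<eta>" using that \<eta> by (simp add: abs_mult)
    then have "\<bar>of_int k :: real\<bar> \<le> of_int J" using \<eta> by simp
    then have "of_int \<bar>k\<bar> \<le> (of_int J :: real)" by simp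
    then have "\<bar>k\<bar> \<le> J" by (simp only: of_int_le_iff)
    then show ?thesis by auto
  qed
  show "j \<in> {- J..J}" using j b J by (intro range) linarith
  show "i \<in> {- J..J}" using i b J by (intro range) linarith
qed

text \<open>The empirical copula at \<open>z\<close> is caught between the values of
  \<open>ecdf\<close> at two grid points. Each side is \<open>ep n z\<close> up to \<eta> plus a
  drift estimated by \<open>drift_bound\<close>; hence the factor \<open>1 + 4 = 5\<close>.\<close>

lemma local_expansion:
  "\<bar>cn n z \<omega> - (ep n z \<omega> - C1 z0 * b1 - C2 z0 * b2)\<bar> \<le> 5 * \<eta> + 2 * \<kappa> * (K + 2 * \<eta>)"
proof -
  obtain j i where j: "j \<in> {- J..J}" "\<eta> < of_int j * \<eta> + b1" "of_int j * \<eta> + b1 \<le> 2 * \<eta>"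
    "i \<in> {- J..J}" "- 2 * \<eta> \<le> of_int i * \<eta> + b1" "of_int i * \<eta> + b1 \<le> - \<eta>"
    using choose_index[OF small(1)] by blast
  obtain l k where l: "l \<in> {- J..J}" "\<eta> < of_int l * \<eta> + b2" "of_int l * \<eta> + b2 \<le> 2 * \<eta>"
    "k \<in> {- J..J}" "- 2 * \<eta> \<le> of_int k * \<eta> + b2" "of_int k * \<eta> + b2 \<le> - \<eta>"
    using choose_index[OF small(2)] by blast
  have pos: "0 < y - x" if "0 < sqrt (real n) * (y - x)" for x y
    using that sqrt_n_pos by (simp add: zero_less_mult_iff)
  have neg: "y - x \<le> 0" if "sqrt (real n) * (y - x) \<le> 0" for x y
    using that sqrt_n_pos by (simp add: mult_le_0_iff)
  have split: "cn n z \<omega> - sqrt (real n) * (e - C z) = sqrt (real n) * (emp n z \<omega> - e)" for e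
    by (simp add: cn_def algebra_simps)
  have at: "sqrt (real n) * (ecdf n w \<omega> - C z) = ep n w \<omega> + sqrt (real n) * (C w - C z)" for w
    by (simp add: ep_ecdf algebra_simps)
  have "0 < sqrt (real n) * (fx n \<omega> (gs j) - fst z)"
    using fx_shift[OF j(1)] j(2) close(2)[OF j(1)] by linarith
  moreover have "0 < sqrt (real n) * (fy n \<omega> (gt l) - snd z)"
    using fy_shift[OF l(1)] l(2) close(3)[OF l(1)] by linarith
  ultimately have "emp n z \<omega> \<le> ecdf n (gs j, gt l) \<omega>"
    using pos by (intro emp_upper[OF n]) force+
  then have "sqrt (real n) * (emp n z \<omega> - ecdf n (gs j, gt l) \<omega>) \<le> 0"
    using sqrt_n_pos by (simp add: mult_le_0_iff)
  then have up: "cn n z \<omega> \<le> ep n (gs j, gt l) \<omega> + sqrt (real n) * (C (gs j, gt l) - C z)"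
    using split[of "ecdf n (gs j, gt l) \<omega>"] at[of "(gs j, gt l)"] by linarith
  have "sqrt (real n) * (fx n \<omega> (gs i) - fst z) \<le> 0"
    using fx_shift[OF j(4)] j(6) close(2)[OF j(4)] by linarith
  moreover have "sqrt (real n) * (fy n \<omega> (gt k) - snd z) \<le> 0"
    using fy_shift[OF l(4)] l(6) close(3)[OF l(4)] by linarith
  ultimately have "ecdf n (gs i, gt k) \<omega> \<le> emp n z \<omega>"
    using neg by (intro emp_lower[OF n]) force+
  then have "0 \<le> sqrt (real n) * (emp n z \<omega> - ecdf n (gs i, gt k) \<omega>)"
    using sqrt_n_pos by simp
  then have lo: "ep n (gs i, gt k) \<omega> + sqrt (real n) * (C (gs i, gt k) - C z) \<le> cn n z \<omega>"
    using split[of "ecdf n (gs i, gt k) \<omega>"] at[of "(gs i, gt k)"] by linarith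
  have a: "\<bar>of_int j * \<eta> + b1\<bar> \<le> 2 * \<eta>" "\<bar>of_int l * \<eta> + b2\<bar> \<le> 2 * \<eta>"
    "\<bar>of_int i * \<eta> + b1\<bar> \<le> 2 * \<eta>" "\<bar>of_int k * \<eta> + b2\<bar> \<le> 2 * \<eta>"
    by (rule abs_leI; use j(2,3,5,6) l(2,3,5,6) \<eta> in linarith)+
  note d1 = drift_bound[OF j(1) l(1) a(1,2)] and d2 = drift_bound[OF j(4) l(4) a(3,4)]
  note e1 = close(1)[OF j(1) l(1)] and e2 = close(1)[OF j(4) l(4)]
  show ?thesis
  proof (rule abs_leI)
    show "cn n z \<omega> - (ep n z \<omega> - C1 z0 * b1 - C2 z0 * b2) \<le> 5 * \<eta> + 2 * \<kappa> * (K + 2 * \<eta>)"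
      using up abs_le_D1[OF d1] abs_le_D1[OF e1] by linarith
    show "- (cn n z \<omega> - (ep n z \<omega> - C1 z0 * b1 - C2 z0 * b2)) \<le> 5 * \<eta> + 2 * \<kappa> * (K + 2 * \<eta>)"
      using lo abs_le_D2[OF d2] abs_le_D2[OF e2] by linarith
  qed
qed

end

text \<open>Bounds the indicator of the event that the hypotheses \<open>close\<close> and \<open>small\<close> of the local expansion fail
  (Chebyshev), so its expectation controls the probability of that event.\<close>

definition defect :: "'a \<Rightarrow> real" where
  "defect \<xi> = (\<Sum>j\<in>{- J..J}. \<Sum>l\<in>{- J..J}. (ep n (gs j, gt l) \<xi> - ep n z \<xi>)\<^sup>2 +
      (ep n (gs j, 1) \<xi> - ep n (fst z, 1) \<xi>)\<^sup>2 + (ep n (1, gt l) \<xi> - ep n (1, snd z) \<xi>)\<^sup>2) / \<eta>\<^sup>2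
    + ((ep n (fst z, 1) \<xi>)\<^sup>2 + (ep n (1, snd z) \<xi>)\<^sup>2) / K\<^sup>2"

lemma defect_nonneg: "0 \<le> defect \<xi>"
  unfolding defect_def by (intro add_nonneg_nonneg divide_nonneg_nonneg sum_nonneg) auto

text \<open>A defect below 1 forces the good event. Otherwise
  \<open>1 / \<theta> \<le> defect / \<theta>\<close>, and the plain triangle bound \<open>T\<close>
  is at most \<open>1 / \<theta> + \<theta> * T\<^sup>2\<close>. The outcome is one inequality that
  holds at every sample point and can be integrated.\<close>

lemma expansion_or_defect:
  assumes K0: "0 < K" and \<theta>: "0 < \<theta>"
  shows "\<bar>cn n z \<omega> - (ep n z \<omega> - C1 z0 * ep n (fst z, 1) \<omega> - C2 z0 * ep n (1, snd z) \<omega>)\<bar> \<le>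
    5 * \<eta> + 2 * \<kappa> * (K + 2 * \<eta>) + defect \<omega> / \<theta> +
    \<theta> * (4 * ((cn n z \<omega>)\<^sup>2 + (ep n z \<omega>)\<^sup>2 + (ep n (fst z, 1) \<omega>)\<^sup>2 + (ep n (1, snd z) \<omega>)\<^sup>2))"
proof (cases "defect \<omega> < 1")
  case True
  let ?h = "\<lambda>j l. (ep n (gs j, gt l) \<omega> - ep n z \<omega>)\<^sup>2 +
      (ep n (gs j, 1) \<omega> - ep n (fst z, 1) \<omega>)\<^sup>2 + (ep n (1, gt l) \<omega> - ep n (1, snd z) \<omega>)\<^sup>2"
  have sum0: "0 \<le> (\<Sum>j\<in>{- J..J}. \<Sum>l\<in>{- J..J}. ?h j l)" by (intro sum_nonneg) auto
  have "(\<Sum>j\<in>{- J..J}. \<Sum>l\<in>{- J..J}. ?h j l) / \<eta>\<^sup>2 < 1" "((ep n (fst z, 1) \<omega>)\<^sup>2 + (ep n (1, snd z) \<omega>)\<^sup>2) / K\<^sup>2 < 1"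
    using True sum0 unfolding defect_def by (smt (verit) divide_nonneg_nonneg zero_le_power2 add_nonneg_nonneg)+
  then have lt: "(\<Sum>j\<in>{- J..J}. \<Sum>l\<in>{- J..J}. ?h j l) < \<eta>\<^sup>2" "(ep n (fst z, 1) \<omega>)\<^sup>2 + (ep n (1, snd z) \<omega>)\<^sup>2 < K\<^sup>2"
    using \<eta> K0 by (simp_all add: divide_less_eq_1)
  have h: "?h j l \<le> \<eta>\<^sup>2" if "j \<in> {- J..J}" "l \<in> {- J..J}" for j l
  proof -
    have "?h j l \<le> (\<Sum>l\<in>{- J..J}. ?h j l)" using that by (intro member_le_sum) auto
    also have "\<dots> \<le> (\<Sum>j\<in>{- J..J}. \<Sum>l\<in>{- J..J}. ?h j l)"
      using that by (intro member_le_sum[of j "{- J..J}" "\<lambda>j. \<Sum>l\<in>{- J..J}. ?h j l"] sum_nonneg) auto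
    finally show ?thesis using lt(1) by linarith
  qed
  have root: "\<bar>x\<bar> \<le> y" if "x\<^sup>2 \<le> y\<^sup>2" "0 < y" for x y :: real
    using that abs_le_square_iff[of x y] by simp
  have 0: "0 \<in> {- J..J}" using J_nonneg by simp
  have "\<bar>ep n (gs j, gt l) \<omega> - ep n z \<omega>\<bar> \<le> \<eta>" if "j \<in> {- J..J}" "l \<in> {- J..J}" for j l
  proof (rule root[OF _ \<eta>])
    have "(ep n (gs j, gt l) \<omega> - ep n z \<omega>)\<^sup>2 \<le> ?h j l" by simp
    then show "(ep n (gs j, gt l) \<omega> - ep n z \<omega>)\<^sup>2 \<le> \<eta>\<^sup>2" using h[OF that] by (rule order_trans)
  qed
  moreover have "\<bar>ep n (gs j, 1) \<omega> - ep n (fst z, 1) \<omega>\<bar> \<le> \<eta>" if "j \<in> {- J..J}" for j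
  proof (rule root[OF _ \<eta>])
    have "(ep n (gs j, 1) \<omega> - ep n (fst z, 1) \<omega>)\<^sup>2 \<le> ?h j 0" by simp
    then show "(ep n (gs j, 1) \<omega> - ep n (fst z, 1) \<omega>)\<^sup>2 \<le> \<eta>\<^sup>2" using h[OF that 0] by (rule order_trans)
  qed
  moreover have "\<bar>ep n (1, gt l) \<omega> - ep n (1, snd z) \<omega>\<bar> \<le> \<eta>" if "l \<in> {- J..J}" for l
  proof (rule root[OF _ \<eta>])
    have "(ep n (1, gt l) \<omega> - ep n (1, snd z) \<omega>)\<^sup>2 \<le> ?h 0 l" by simp
    then show "(ep n (1, gt l) \<omega> - ep n (1, snd z) \<omega>)\<^sup>2 \<le> \<eta>\<^sup>2" using h[OF 0 that] by (rule order_trans)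
  qed
  moreover have "\<bar>ep n (fst z, 1) \<omega>\<bar> \<le> K"
    by (rule root[OF _ K0]) (use lt(2) zero_le_power2[of "ep n (1, snd z) \<omega>"] in linarith)
  moreover have "\<bar>ep n (1, snd z) \<omega>\<bar> \<le> K"
    by (rule root[OF _ K0]) (use lt(2) zero_le_power2[of "ep n (fst z, 1) \<omega>"] in linarith)
  ultimately have "\<bar>cn n z \<omega> - (ep n z \<omega> - C1 z0 * ep n (fst z, 1) \<omega> - C2 z0 * ep n (1, snd z) \<omega>)\<bar> \<le> 5 * \<eta> + 2 * \<kappa> * (K + 2 * \<eta>)"
    by (rule local_expansion)
  moreover have "0 \<le> defect \<omega> / \<theta>" using \<theta> defect_nonneg by simp
  moreover have "0 \<le> \<theta> * (4 * ((cn n z \<omega>)\<^sup>2 + (ep n z \<omega>)\<^sup>2 + (ep n (fst z, 1) \<omega>)\<^sup>2 + (ep n (1, snd z) \<omega>)\<^sup>2))"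
    using \<theta> by simp
  ultimately show ?thesis by linarith
next
  case False
  define a where "a = \<bar>cn n z \<omega>\<bar>"
  define b where "b = \<bar>ep n z \<omega>\<bar>"
  define c where "c = \<bar>ep n (fst z, 1) \<omega>\<bar>"
  define d where "d = \<bar>ep n (1, snd z) \<omega>\<bar>"
  have "\<bar>C1 z0 * ep n (fst z, 1) \<omega>\<bar> \<le> c" "\<bar>C2 z0 * ep n (1, snd z) \<omega>\<bar> \<le> d"
    using C1(2)[OF z0] C2(2)[OF z0] by (auto simp: abs_mult mult_left_le_one_le c_def d_def)
  then have "\<bar>cn n z \<omega> - (ep n z \<omega> - C1 z0 * ep n (fst z, 1) \<omega> - C2 z0 * ep n (1, snd z) \<omega>)\<bar> \<le> a + b + c + d"
    unfolding a_def b_def by linarith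
  also have "a + b + c + d \<le> 1 / \<theta> + \<theta> * (a + b + c + d)\<^sup>2"
  proof -
    have "T \<le> 1 / \<theta> + \<theta> * T\<^sup>2" if "0 \<le> T" for T
    proof -
      have "2 * (1 * (\<theta> * T)) \<le> 1\<^sup>2 + (\<theta> * T)\<^sup>2"
        using sum_squares_bound[of 1 "\<theta> * T"] by (simp only: mult.assoc)
      moreover have "0 \<le> \<theta> * T" using that \<theta> by simp
      ultimately have "\<theta> * T \<le> 1 + (\<theta> * T)\<^sup>2" unfolding mult_1 one_power2 by linarith
      also have "\<dots> = \<theta> * (1 / \<theta> + \<theta> * T\<^sup>2)"
        using \<theta> by (simp add: distrib_left power2_eq_square)
      finally show ?thesis using \<theta> by simp
    qed
    from this[of "a + b + c + d"] show ?thesis by (simp add: a_def b_def c_def d_def)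
  qed
  also have "1 / \<theta> \<le> defect \<omega> / \<theta>" using False \<theta> by (simp add: divide_right_mono)
  also have "(a + b + c + d)\<^sup>2 \<le> 4 * (a\<^sup>2 + b\<^sup>2 + c\<^sup>2 + d\<^sup>2)"
  proof -
    have "4 * (a\<^sup>2 + b\<^sup>2 + c\<^sup>2 + d\<^sup>2) - (a + b + c + d)\<^sup>2 =
        (a - b)\<^sup>2 + (a - c)\<^sup>2 + (b - c)\<^sup>2 + (a - d)\<^sup>2 + (b - d)\<^sup>2 + (c - d)\<^sup>2"
      by (simp add: power2_eq_square algebra_simps)
    then show ?thesis by (smt (verit) zero_le_power2)
  qed
  finally have "\<bar>cn n z \<omega> - (ep n z \<omega> - C1 z0 * ep n (fst z, 1) \<omega> - C2 z0 * ep n (1, snd z) \<omega>)\<bar> \<le>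
      defect \<omega> / \<theta> + \<theta> * (4 * ((cn n z \<omega>)\<^sup>2 + (ep n z \<omega>)\<^sup>2 + (ep n (fst z, 1) \<omega>)\<^sup>2 + (ep n (1, snd z) \<omega>)\<^sup>2))"
    using \<theta> by (simp add: a_def b_def c_def d_def)
  moreover have "0 \<le> \<kappa> * (K + 2 * \<eta>)" using \<kappa> K \<eta> by simp
  ultimately show ?thesis using \<eta> by linarith
qed

text \<open>There are \<open>(2 * J + 1)\<^sup>2\<close> index pairs, each with three increments of
  total mean square at most \<open>4 * h\<close>, where \<open>h\<close> is the half-width of the
  grid; the margins add \<open>2 / K\<^sup>2\<close>. For fixed \<open>J\<close> the first part
  vanishes as \<open>n\<close> grows.\<close>

lemma defect_integrable: "integrable M defect"
  and defect_expectation: "(\<integral>\<xi>. defect \<xi> \<partial>M) \<le> (2 * of_int J + 1)\<^sup>2 * (4 * (of_int J * \<eta> / sqrt (real n))) / \<eta>\<^sup>2 + 2 / K\<^sup>2"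
proof -
  define h where "h = of_int J * \<eta> / sqrt (real n)"
  have e: "(fst z, 1) \<in> unit_square" "(1, snd z) \<in> unit_square" using z by (auto simp: mem_Times_iff)
  let ?h = "\<lambda>j l \<xi>. (ep n (gs j, gt l) \<xi> - ep n z \<xi>)\<^sup>2 +
      (ep n (gs j, 1) \<xi> - ep n (fst z, 1) \<xi>)\<^sup>2 + (ep n (1, gt l) \<xi> - ep n (1, snd z) \<xi>)\<^sup>2"
  have sh: "\<bar>gs j - fst z\<bar> \<le> h" "\<bar>gt j - snd z\<bar> \<le> h" if "j \<in> {- J..J}" for j
    using grid_shift[OF that] by (simp_all add: gs_def gt_def h_def)
  have tm: "integrable M (?h j l)" "(\<integral>\<xi>. ?h j l \<xi> \<partial>M) \<le> 4 * h" if j: "j \<in> {- J..J}" and l: "l \<in> {- J..J}" for j l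
  proof -
    have u: "(gs j, gt l) \<in> unit_square" "(gs j, 1) \<in> unit_square" "(1, gt l) \<in> unit_square"
      using grid_unit[OF j l] by auto
    note i = ep_increment[OF u(1) z, of n] ep_increment[OF u(2) e(1), of n] ep_increment[OF u(3) e(2), of n]
    show "integrable M (?h j l)" by (intro Bochner_Integration.integrable_add i)
    have "(\<integral>\<xi>. ?h j l \<xi> \<partial>M) = (\<integral>\<xi>. (ep n (gs j, gt l) \<xi> - ep n z \<xi>)\<^sup>2 \<partial>M) +
        (\<integral>\<xi>. (ep n (gs j, 1) \<xi> - ep n (fst z, 1) \<xi>)\<^sup>2 \<partial>M) + (\<integral>\<xi>. (ep n (1, gt l) \<xi> - ep n (1, snd z) \<xi>)\<^sup>2 \<partial>M)"
      using i by simp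
    also have "\<dots> \<le> (h + h) + h + h"
      using i(2,4,6) sh[OF j] sh[OF l] by simp
    finally show "(\<integral>\<xi>. ?h j l \<xi> \<partial>M) \<le> 4 * h" by simp
  qed
  have int1: "integrable M (\<lambda>\<xi>. \<Sum>j\<in>{- J..J}. \<Sum>l\<in>{- J..J}. ?h j l \<xi>)"
    by (intro Bochner_Integration.integrable_sum tm(1))
  note b = ep.b_sq[OF e(1), of n] ep.b_sq[OF e(2), of n]
  show "integrable M defect"
    unfolding defect_def[abs_def] using int1 b by simp
  have "(\<integral>\<xi>. (\<Sum>j\<in>{- J..J}. \<Sum>l\<in>{- J..J}. ?h j l \<xi>) \<partial>M) = (\<Sum>j\<in>{- J..J}. \<Sum>l\<in>{- J..J}. \<integral>\<xi>. ?h j l \<xi> \<partial>M)"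
    by (subst Bochner_Integration.integral_sum, intro Bochner_Integration.integrable_sum tm(1), assumption+)
      (intro sum.cong refl Bochner_Integration.integral_sum tm(1))
  also have "\<dots> \<le> (\<Sum>j\<in>{- J..J}. \<Sum>l\<in>{- J..J}. 4 * h)"
    by (intro sum_mono tm(2))
  also have "\<dots> = (2 * of_int J + 1)\<^sup>2 * (4 * h)"
    using J_nonneg by (simp add: power2_eq_square algebra_simps)
  finally have s: "(\<integral>\<xi>. (\<Sum>j\<in>{- J..J}. \<Sum>l\<in>{- J..J}. ?h j l \<xi>) \<partial>M) \<le> (2 * of_int J + 1)\<^sup>2 * (4 * h)" .
  have "(\<integral>\<xi>. defect \<xi> \<partial>M) = (\<integral>\<xi>. (\<Sum>j\<in>{- J..J}. \<Sum>l\<in>{- J..J}. ?h j l \<xi>) \<partial>M) / \<eta>\<^sup>2 +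
      ((\<integral>\<xi>. (ep n (fst z, 1) \<xi>)\<^sup>2 \<partial>M) + (\<integral>\<xi>. (ep n (1, snd z) \<xi>)\<^sup>2 \<partial>M)) / K\<^sup>2"
    unfolding defect_def using int1 b by simp
  also have "\<dots> \<le> (2 * of_int J + 1)\<^sup>2 * (4 * h) / \<eta>\<^sup>2 + 2 / K\<^sup>2"
    using s ep.b_sq_le[OF e(1), of n] ep.b_sq_le[OF e(2), of n] by (intro add_mono divide_right_mono) auto
  finally show "(\<integral>\<xi>. defect \<xi> \<partial>M) \<le> (2 * of_int J + 1)\<^sup>2 * (4 * (of_int J * \<eta> / sqrt (real n))) / \<eta>\<^sup>2 + 2 / K\<^sup>2"
    unfolding h_def .
qed

end

end

section \<open>Bernstein smoothing\<close>

text \<open>Bernstein weights are binomial probabilities; up to the factor \<open>m\<^sup>2\<close>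
  the sum is the binomial variance \<open>m * x * (1 - x)\<close>.\<close>

lemma Bernstein_variance:
  assumes m: "0 < m" and x: "x \<in> {0..1}"
  shows "(\<Sum>k\<le>m. (real k / real m - x)\<^sup>2 * Bernstein m k x) \<le> 1 / real m"
proof -
  have "(\<Sum>k\<le>m. (real k - real m * x)\<^sup>2 * Bernstein m k x) =
      (\<Sum>k\<le>m. real k * (real k - 1) * Bernstein m k x) + (1 - 2 * real m * x) * (\<Sum>k\<le>m. real k * Bernstein m k x)
        + (real m * x)\<^sup>2 * (\<Sum>k\<le>m. Bernstein m k x)"
    by (simp add: sum_distrib_left sum.distrib[symmetric] power2_eq_square algebra_simps del: sum_k_Bernstein sum_kk_Bernstein sum_Bernstein)
  also have "\<dots> = real m * (x * (1 - x))"
    unfolding sum_kk_Bernstein sum_k_Bernstein sum_Bernstein by (simp add: power2_eq_square algebra_simps)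
  also have "\<dots> \<le> real m * 1"
    using x by (intro mult_left_mono mult_le_one) auto
  finally have "(\<Sum>k\<le>m. (real k - real m * x)\<^sup>2 * Bernstein m k x) / (real m)\<^sup>2 \<le> real m / (real m)\<^sup>2"
    by (intro divide_right_mono) auto
  moreover have "(real k / real m - x)\<^sup>2 * Bernstein m k x = (real k - real m * x)\<^sup>2 * Bernstein m k x / (real m)\<^sup>2" for k
  proof -
    have "real k / real m - x = (real k - real m * x) / real m" using m by (simp add: field_simps)
    then show ?thesis by (simp add: power_divide)
  qed
  ultimately show ?thesis using m by (simp add: sum_divide_distrib power2_eq_square)
qed

lemma Bernstein_measurable[measurable]: "Bernstein m k \<in> borel_measurable borel"
  unfolding Bernstein_def[abs_def] by measurable

lemma bernstein_op_alt: "bernstein_op m h z =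
    (\<Sum>k\<le>m. \<Sum>l\<le>m. h (real k / real m, real l / real m) * (Bernstein m k (fst z) * Bernstein m l (snd z)))"
  by (simp add: bernstein_op_def case_prod_unfold mult.assoc)

lemma bernstein_weights: "(\<Sum>k\<le>m. \<Sum>l\<le>m. Bernstein m k x * Bernstein m l y) = 1"
  by (simp add: sum_product[symmetric])

lemma bernstein_node: "k \<le> m \<Longrightarrow> l \<le> m \<Longrightarrow> (real k / real m, real l / real m) \<in> unit_square"
  by (cases "m = 0") (auto simp: divide_le_eq_1)

lemma bernstein_op_bound:
  assumes "\<And>w. w \<in> unit_square \<Longrightarrow> \<bar>h w\<bar> \<le> B" and z: "z \<in> unit_square"
  shows "\<bar>bernstein_op m h z\<bar> \<le> B"
proof -
  have P: "0 \<le> Bernstein m k (fst z) * Bernstein m l (snd z)" for k l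
    using z by (intro mult_nonneg_nonneg Bernstein_nonneg) (auto simp: mem_Times_iff)
  have "\<bar>bernstein_op m h z\<bar> \<le> (\<Sum>k\<le>m. \<Sum>l\<le>m. \<bar>h (real k / real m, real l / real m) * (Bernstein m k (fst z) * Bernstein m l (snd z))\<bar>)"
    unfolding bernstein_op_alt by (intro order_trans[OF sum_abs] sum_mono sum_abs)
  also have "\<dots> \<le> (\<Sum>k\<le>m. \<Sum>l\<le>m. B * (Bernstein m k (fst z) * Bernstein m l (snd z)))"
    using P assms(1)[OF bernstein_node] by (intro sum_mono) (simp add: abs_mult[of "h _"] mult_right_mono)
  also have "\<dots> = B" using bernstein_weights[of m "fst z" "snd z"] by (simp flip: sum_distrib_left)
  finally show ?thesis .
qed

lemma bernstein_op_measurable: "bernstein_op m h \<in> borel_measurable usq"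
proof -
  have "(\<lambda>z. Bernstein m k (fst z)) \<in> borel_measurable usq" "(\<lambda>z. Bernstein m k (snd z)) \<in> borel_measurable usq" for k
    using measurable_compose[OF fst_usq Bernstein_measurable] measurable_compose[OF snd_usq Bernstein_measurable] by auto
  then show ?thesis
    unfolding bernstein_op_alt[abs_def] by (intro borel_measurable_sum borel_measurable_times borel_measurable_const)
qed

section \<open>Mean approximation of the smoothed empirical copula process\<close>

context rank_sample
begin

lemma g_split: "ep.g n z0 \<omega> = ep n z0 \<omega> - C1 z0 * ep n (fst z0, 1) \<omega> - C2 z0 * ep n (1, snd z0) \<omega>"
  by (rule ep.g_eq)

lemma cn_integrable: "z \<in> unit_square \<Longrightarrow> integrable M (cn n z)"
proof -
  assume z: "z \<in> unit_square"
  show ?thesis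
  proof (rule integrable_const_bound[of _ "sqrt (real n)"])
    show "AE \<omega> in M. norm (cn n z \<omega>) \<le> sqrt (real n)" using cn_bound[OF z] by simp
    show "cn n z \<in> borel_measurable M" by measurable
  qed
qed

lemma g_integrable: "z0 \<in> open_square \<Longrightarrow> integrable M (ep.g n z0)"
proof -
  assume z0: "z0 \<in> open_square"
  have a: "integrable M (\<lambda>\<omega>. (ep.g n z0 \<omega>)\<^sup>2)" using ep.sq_integrable[of z0 n] z0 by simp
  have b: "ep.g n z0 \<in> borel_measurable M" using ep.g_section1[of z0 n] z0 by simp
  show ?thesis by (rule square_integrable_imp_integrable[OF b a])
qed

text \<open>From \<open>\<bar>x\<bar> \<le> 1 + x\<^sup>2\<close> the constant is
  \<open>(1 + 28) + (1 + 9)\<close>. It serves for distant nodes and as the dominating constant over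
  the square.\<close>

lemma cn_g_crude:
  assumes "0 < n" "z \<in> unit_square" "z0 \<in> open_square"
  shows "(\<integral>\<omega>. \<bar>cn n z \<omega> - ep.g n z0 \<omega>\<bar> \<partial>M) \<le> 39"
proof -
  have gi: "integrable M (\<lambda>\<omega>. (ep.g n z0 \<omega>)\<^sup>2)" "(\<integral>\<omega>. (ep.g n z0 \<omega>)\<^sup>2 \<partial>M) \<le> 9"
    using ep.sq_integrable[of z0 n] ep.sq_bound[of z0 n] assms by auto
  have a: "\<bar>x\<bar> \<le> 1 + x\<^sup>2" for x :: real
    using sum_squares_bound[of 1 "\<bar>x\<bar>"] zero_le_power2[of x] by simp
  have "(\<integral>\<omega>. \<bar>cn n z \<omega> - ep.g n z0 \<omega>\<bar> \<partial>M) \<le> (\<integral>\<omega>. (1 + (cn n z \<omega>)\<^sup>2) + (1 + (ep.g n z0 \<omega>)\<^sup>2) \<partial>M)"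
  proof (rule integral_mono)
    fix \<omega>
    show "\<bar>cn n z \<omega> - ep.g n z0 \<omega>\<bar> \<le> (1 + (cn n z \<omega>)\<^sup>2) + (1 + (ep.g n z0 \<omega>)\<^sup>2)"
      using abs_triangle_ineq4[of "cn n z \<omega>" "ep.g n z0 \<omega>"] a[of "cn n z \<omega>"] a[of "ep.g n z0 \<omega>"] by linarith
  qed (use gi cn_sq[OF assms(1,2)] cn_integrable[OF assms(2)] g_integrable[OF assms(3)] in auto)
  also have "\<dots> \<le> 39" using gi cn_sq[OF assms(1,2)] by (simp add: prob_space)
  finally show ?thesis .
qed

text \<open>\<open>local_expansion\<close> works at scale \<open>1 / sqrt n\<close> around each
  \<open>z\<close>, but \<delta> does not depend on \<open>n\<close>: with the linearisation frozen
  at \<open>z0\<close>, all Bernstein nodes in a fixed neighbourhood of \<open>z0\<close> are served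
  at once.\<close>

lemma local_L1:
  assumes z0: "z0 \<in> open_square" and \<epsilon>: "0 < \<epsilon>"
  obtains \<delta> n0 where "0 < \<delta>" "\<And>n z. n0 \<le> n \<Longrightarrow> z \<in> unit_square \<Longrightarrow> \<bar>fst z - fst z0\<bar> \<le> \<delta> \<Longrightarrow> \<bar>snd z - snd z0\<bar> \<le> \<delta> \<Longrightarrow>
    (\<integral>\<omega>. \<bar>cn n z \<omega> - ep.g n z0 \<omega>\<bar> \<partial>M) \<le> \<epsilon>"
proof -
  \<comment> \<open>The errors will total \<open>3/4 * \<epsilon>\<close>.
    \<open>4 * \<theta> * 31\<close> is at most \<open>\<epsilon> / 8\<close>, with 31 = 28 + 1 + 1
    + 1; \<open>K\<close> and \<open>n0\<close> keep the mean defect below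
    \<open>\<theta> * \<epsilon> / 4\<close>; \<open>5 * \<eta>\<close> and
    \<open>2 * \<kappa> * (K + 2 * \<eta>)\<close> are \<open>\<epsilon> / 16\<close> each;
    \<open>3 * \<rho>\<close> is \<open>\<epsilon> / 8\<close>. The \<open>+ 2\<close> in
    \<open>J\<close> covers the excess \<open>2 * \<eta>\<close>.\<close>
  define \<theta> where "\<theta> = \<epsilon> / 1000"
  define K where "K = 4 / sqrt (\<theta> * \<epsilon>)"
  define \<eta> where "\<eta> = \<epsilon> / 80"
  define \<kappa> where "\<kappa> = \<epsilon> / (32 * (K + 2 * \<eta>))"
  define \<rho> where "\<rho> = \<epsilon> / 24"
  define J :: int where "J = \<lceil>K / \<eta>\<rceil> + 2"
  have \<theta>: "0 < \<theta>" using \<epsilon> by (simp add: \<theta>_def)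
  then have \<theta>\<epsilon>: "0 < \<theta> * \<epsilon>" using \<epsilon> by simp
  then have K0: "0 < K" unfolding K_def by (intro divide_pos_pos) (simp_all only: real_sqrt_gt_0_iff zero_less_numeral)
  have "0 < \<eta>" "0 < \<rho>" using \<epsilon> by (simp_all add: \<eta>_def \<rho>_def)
  note pos = \<theta> K0 this
  have K\<eta>: "0 < K + 2 * \<eta>" using pos by linarith
  then have \<kappa>: "0 < \<kappa>" using \<epsilon> by (simp only: \<kappa>_def zero_less_divide_iff zero_less_mult_iff) simp
  have "K\<^sup>2 = 16 / (\<theta> * \<epsilon>)"
    unfolding K_def power_divide real_sqrt_pow2[OF less_imp_le[OF \<theta>\<epsilon>]] by simp
  then have K2: "2 / K\<^sup>2 = \<theta> * \<epsilon> / 8" by simp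
  have "2 * (\<epsilon> / (32 * L)) * L = \<epsilon> / 16" if "0 < L" for L using that by simp
  from this[OF K\<eta>] have \<kappa>K: "2 * \<kappa> * (K + 2 * \<eta>) = \<epsilon> / 16" unfolding \<kappa>_def .
  have J: "K + 2 * \<eta> \<le> of_int J * \<eta>"
  proof -
    have "K / \<eta> \<le> of_int J - 2" unfolding J_def using le_of_int_ceiling[of "K / \<eta>"] by simp
    then show ?thesis using pos by (simp add: pos_divide_le_eq left_diff_distrib)
  qed
  obtain r where r: "0 < r" "{fst z0 - r..fst z0 + r} \<times> {snd z0 - r..snd z0 + r} \<subseteq> open_square"
    "\<And>s t s' t'. s \<in> {fst z0 - r..fst z0 + r} \<Longrightarrow> s' \<in> {fst z0 - r..fst z0 + r} \<Longrightarrow>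
      t \<in> {snd z0 - r..snd z0 + r} \<Longrightarrow> t' \<in> {snd z0 - r..snd z0 + r} \<Longrightarrow>
      \<bar>C (s, t) - C (s', t') - C1 z0 * (s - s') - C2 z0 * (t - t')\<bar> \<le> \<kappa> * (\<bar>s - s'\<bar> + \<bar>t - t'\<bar>)"
    by (rule copula_differential[OF D1 D2 C1_continuous C2_continuous z0 \<kappa>]) blast+
  have lim: "(\<lambda>n. c / sqrt (real n)) \<longlonglongrightarrow> 0" for c :: real
    by (intro real_tendsto_divide_at_top[OF tendsto_const] filterlim_compose[OF sqrt_at_top filterlim_real_sequentially])
  have "(\<lambda>n. (2 * of_int J + 1)\<^sup>2 * (4 * (of_int J * \<eta> / sqrt (real n))) / \<eta>\<^sup>2) \<longlonglongrightarrow> (2 * of_int J + 1)\<^sup>2 * (4 * 0) / \<eta>\<^sup>2"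
    by (intro tendsto_divide tendsto_mult tendsto_const lim) (use pos in auto)
  then have "(\<lambda>n. (2 * of_int J + 1)\<^sup>2 * (4 * (of_int J * \<eta> / sqrt (real n))) / \<eta>\<^sup>2) \<longlonglongrightarrow> 0" by simp
  then have "\<forall>\<^sub>F n in sequentially. (2 * of_int J + 1)\<^sup>2 * (4 * (of_int J * \<eta> / sqrt (real n))) / \<eta>\<^sup>2 < \<theta> * \<epsilon> / 8"
    by (rule order_tendstoD(2)) (use pos \<epsilon> in auto)
  moreover have "\<forall>\<^sub>F n in sequentially. of_int J * \<eta> / sqrt (real n) < r / 2"
    by (rule order_tendstoD(2)[OF lim]) (use r in auto)
  ultimately have "\<forall>\<^sub>F n in sequentially. (2 * of_int J + 1)\<^sup>2 * (4 * (of_int J * \<eta> / sqrt (real n))) / \<eta>\<^sup>2 < \<theta> * \<epsilon> / 8 \<and>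
      of_int J * \<eta> / sqrt (real n) < r / 2 \<and> 0 < n"
    using eventually_gt_at_top[of 0] by eventually_elim simp
  then obtain n0 where n0: "\<And>n. n0 \<le> n \<Longrightarrow> (2 * of_int J + 1)\<^sup>2 * (4 * (of_int J * \<eta> / sqrt (real n))) / \<eta>\<^sup>2 < \<theta> * \<epsilon> / 8"
      "\<And>n. n0 \<le> n \<Longrightarrow> of_int J * \<eta> / sqrt (real n) < r / 2" "\<And>n. n0 \<le> n \<Longrightarrow> 0 < n"
    unfolding eventually_sequentially by blast
  \<comment> \<open>\<open>r / 2\<close> leaves room for the grid around \<open>z\<close>. The
    second bound makes the squared increments between \<open>z\<close> and \<open>z0\<close>, of
    total mean at most \<open>4 * \<delta>\<close>, cost \<open>\<epsilon> / 8\<close> after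
    division by \<rho>.\<close>
  define \<delta> where "\<delta> = min (r / 2) (\<rho> * \<epsilon> / 32)"
  have \<delta>: "0 < \<delta>" "\<delta> \<le> r / 2" "\<delta> \<le> \<rho> * \<epsilon> / 32" using r pos \<epsilon> by (auto simp: \<delta>_def)
  show thesis
  proof (rule that[OF \<delta>(1)])
    fix n z assume n: "n0 \<le> n" and z: "z \<in> unit_square" and near: "\<bar>fst z - fst z0\<bar> \<le> \<delta>" "\<bar>snd z - snd z0\<bar> \<le> \<delta>"
    note npos = n0(3)[OF n]
    have nr: "\<bar>fst z - fst z0\<bar> + of_int J * \<eta> / sqrt (real n) \<le> r" "\<bar>snd z - snd z0\<bar> + of_int J * \<eta> / sqrt (real n) \<le> r"
      using near n0(2)[OF n] \<delta>(2) by linarith+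
    note hyps = npos z z0 pos(3) less_imp_le[OF pos(2)] less_imp_le[OF \<kappa>] J r(2) nr r(3)
    define df where "df = defect n z K \<eta> J"
    have df_int: "integrable M df" unfolding df_def by (rule defect_integrable[OF hyps])
    have "(\<integral>\<omega>. df \<omega> \<partial>M) \<le> (2 * of_int J + 1)\<^sup>2 * (4 * (of_int J * \<eta> / sqrt (real n))) / \<eta>\<^sup>2 + 2 / K\<^sup>2"
      unfolding df_def by (rule defect_expectation[OF hyps])
    then have df_le: "(\<integral>\<omega>. df \<omega> \<partial>M) / \<theta> \<le> \<epsilon> / 4"
      using n0(1)[OF n] K2 pos by (simp add: pos_divide_le_eq mult.commute)
    have e: "(fst z, 1) \<in> unit_square" "(1, snd z) \<in> unit_square" "z0 \<in> unit_square"
      "(fst z0, 1) \<in> unit_square" "(1, snd z0) \<in> unit_square"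
      using z open_square_subset[OF z0] by (auto simp: mem_Times_iff)
    let ?T = "\<lambda>\<omega>. (cn n z \<omega>)\<^sup>2 + (ep n z \<omega>)\<^sup>2 + (ep n (fst z, 1) \<omega>)\<^sup>2 + (ep n (1, snd z) \<omega>)\<^sup>2"
    let ?I = "\<lambda>\<omega>. (ep n z \<omega> - ep n z0 \<omega>)\<^sup>2 + (ep n (fst z, 1) \<omega> - ep n (fst z0, 1) \<omega>)\<^sup>2 + (ep n (1, snd z) \<omega> - ep n (1, snd z0) \<omega>)\<^sup>2"
    have T: "integrable M ?T" "(\<integral>\<omega>. ?T \<omega> \<partial>M) \<le> 31"
      using cn_sq[OF npos z] ep.b_sq[OF z, of n] ep.b_sq[OF e(1), of n] ep.b_sq[OF e(2), of n]
        ep.b_sq_le[OF z, of n] ep.b_sq_le[OF e(1), of n] ep.b_sq_le[OF e(2), of n] by simp_all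
    note inc = ep_increment[OF z e(3), of n] ep_increment[OF e(1) e(4), of n] ep_increment[OF e(2) e(5), of n]
    have I: "integrable M ?I" "(\<integral>\<omega>. ?I \<omega> \<partial>M) \<le> 4 * \<delta>"
    proof -
      show "integrable M ?I" using inc by simp
      have "(\<integral>\<omega>. ?I \<omega> \<partial>M) = (\<integral>\<omega>. (ep n z \<omega> - ep n z0 \<omega>)\<^sup>2 \<partial>M) +
          (\<integral>\<omega>. (ep n (fst z, 1) \<omega> - ep n (fst z0, 1) \<omega>)\<^sup>2 \<partial>M) + (\<integral>\<omega>. (ep n (1, snd z) \<omega> - ep n (1, snd z0) \<omega>)\<^sup>2 \<partial>M)"
        using inc by simp
      also have "\<dots> \<le> (\<delta> + \<delta>) + \<delta> + \<delta>"
        using inc(2,4,6) near by (intro add_mono) auto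
      finally show "(\<integral>\<omega>. ?I \<omega> \<partial>M) \<le> 4 * \<delta>" by simp
    qed
    have point: "\<bar>cn n z \<omega> - ep.g n z0 \<omega>\<bar> \<le>
        (5 * \<eta> + 2 * \<kappa> * (K + 2 * \<eta>) + 3 * \<rho>) + df \<omega> / \<theta> + \<theta> * (4 * ?T \<omega>) + ?I \<omega> / \<rho>" for \<omega>
    proof -
      \<comment> \<open>Young's inequality with weight \<rho>, which trades a first moment for a
        squared increment.\<close>
      have y: "\<bar>x\<bar> \<le> \<rho> + x\<^sup>2 / \<rho>" for x
      proof -
        have "2 * (\<rho> * \<bar>x\<bar>) \<le> \<rho>\<^sup>2 + x\<^sup>2" using sum_squares_bound[of \<rho> "\<bar>x\<bar>"] by simp
        moreover have "0 \<le> \<rho> * \<bar>x\<bar>" using pos by simp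
        ultimately have "\<rho> * \<bar>x\<bar> \<le> \<rho>\<^sup>2 + x\<^sup>2" by linarith
        also have "\<dots> = \<rho> * (\<rho> + x\<^sup>2 / \<rho>)" using pos by (simp add: distrib_left power2_eq_square)
        finally show ?thesis using pos by simp
      qed
      \<comment> \<open>These increments move the empirical process from the node \<open>z\<close>
        to the centre \<open>z0\<close>; the expansion itself already uses the derivatives at
        \<open>z0\<close>.\<close>
      define a where "a = ep n z \<omega> - ep n z0 \<omega>"
      define b where "b = ep n (fst z, 1) \<omega> - ep n (fst z0, 1) \<omega>"
      define d where "d = ep n (1, snd z) \<omega> - ep n (1, snd z0) \<omega>"
      define A where "A = cn n z \<omega> - (ep n z \<omega> - C1 z0 * ep n (fst z, 1) \<omega> - C2 z0 * ep n (1, snd z) \<omega>)"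
      have A: "\<bar>A\<bar> \<le> 5 * \<eta> + 2 * \<kappa> * (K + 2 * \<eta>) + df \<omega> / \<theta> + \<theta> * (4 * ?T \<omega>)"
        unfolding A_def df_def by (rule expansion_or_defect[OF hyps pos(2) pos(1)])
      have "cn n z \<omega> - ep.g n z0 \<omega> = A + a - C1 z0 * b - C2 z0 * d"
        unfolding g_split A_def a_def b_def d_def by (simp add: algebra_simps)
      then have "\<bar>cn n z \<omega> - ep.g n z0 \<omega>\<bar> \<le> \<bar>A\<bar> + \<bar>a\<bar> + \<bar>C1 z0 * b\<bar> + \<bar>C2 z0 * d\<bar>" by linarith
      also have "\<bar>C1 z0 * b\<bar> \<le> \<bar>b\<bar>" using C1(2)[OF z0] by (simp add: abs_mult mult_left_le_one_le)
      also have "\<bar>C2 z0 * d\<bar> \<le> \<bar>d\<bar>" using C2(2)[OF z0] by (simp add: abs_mult mult_left_le_one_le)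
      finally have "\<bar>cn n z \<omega> - ep.g n z0 \<omega>\<bar> \<le> \<bar>A\<bar> + \<bar>a\<bar> + \<bar>b\<bar> + \<bar>d\<bar>" by linarith
      moreover have "?I \<omega> / \<rho> = a\<^sup>2 / \<rho> + b\<^sup>2 / \<rho> + d\<^sup>2 / \<rho>"
        unfolding a_def b_def d_def by (simp add: add_divide_distrib)
      ultimately show ?thesis using A y[of a] y[of b] y[of d] by linarith
    qed
    have i1: "integrable M (\<lambda>\<omega>. 5 * \<eta> + 2 * \<kappa> * (K + 2 * \<eta>) + 3 * \<rho>)" by simp
    have i2: "integrable M (\<lambda>\<omega>. df \<omega> / \<theta>)" by (rule integrable_divide) (rule df_int)
    have i3: "integrable M (\<lambda>\<omega>. \<theta> * (4 * ?T \<omega>))" by (rule integrable_mult_right, rule integrable_mult_right, rule T(1))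
    have i4: "integrable M (\<lambda>\<omega>. ?I \<omega> / \<rho>)" by (rule integrable_divide) (rule I(1))
    note i = i1 i2 i3 i4
    note int = Bochner_Integration.integrable_add[OF Bochner_Integration.integrable_add[OF Bochner_Integration.integrable_add[OF i(1,2)] i(3)] i(4)]
    have "(\<integral>\<omega>. \<bar>cn n z \<omega> - ep.g n z0 \<omega>\<bar> \<partial>M) \<le>
        (\<integral>\<omega>. (5 * \<eta> + 2 * \<kappa> * (K + 2 * \<eta>) + 3 * \<rho>) + df \<omega> / \<theta> + \<theta> * (4 * ?T \<omega>) + ?I \<omega> / \<rho> \<partial>M)"
      using cn_integrable[OF z] g_integrable[OF z0]
      by (intro integral_mono[OF integrable_abs[OF Bochner_Integration.integrable_diff] int point])
    also have "\<dots> = (5 * \<eta> + 2 * \<kappa> * (K + 2 * \<eta>) + 3 * \<rho>) + (\<integral>\<omega>. df \<omega> \<partial>M) / \<theta> + \<theta> * (4 * (\<integral>\<omega>. ?T \<omega> \<partial>M)) + (\<integral>\<omega>. ?I \<omega> \<partial>M) / \<rho>"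
    proof -
      show ?thesis
        unfolding Bochner_Integration.integral_add[OF Bochner_Integration.integrable_add[OF Bochner_Integration.integrable_add[OF i(1,2)] i(3)] i(4)]
          Bochner_Integration.integral_add[OF Bochner_Integration.integrable_add[OF i(1,2)] i(3)]
          Bochner_Integration.integral_add[OF i(1,2)] integral_divide_zero integral_mult_right_zero
        by (simp add: prob_space)
    qed
    also have "\<dots> \<le> (\<epsilon> / 16 + \<epsilon> / 16 + \<epsilon> / 8) + \<epsilon> / 4 + \<epsilon> / 8 + \<epsilon> / 8"
    proof (intro add_mono df_le)
      show "\<theta> * (4 * (\<integral>\<omega>. ?T \<omega> \<partial>M)) \<le> \<epsilon> / 8"
        using mult_left_mono[OF T(2), of "4 * \<theta>"] pos \<epsilon> by (simp add: \<theta>_def)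
      have "(\<integral>\<omega>. ?I \<omega> \<partial>M) \<le> \<rho> * \<epsilon> / 8" using I(2) \<delta>(3) by linarith
      then show "(\<integral>\<omega>. ?I \<omega> \<partial>M) / \<rho> \<le> \<epsilon> / 8" using pos by (simp add: pos_divide_le_eq mult.commute)
    qed (use \<kappa>K in \<open>auto simp: \<eta>_def \<rho>_def\<close>)
    also have "\<dots> \<le> \<epsilon>" using \<epsilon> by simp
    finally show "(\<integral>\<omega>. \<bar>cn n z \<omega> - ep.g n z0 \<omega>\<bar> \<partial>M) \<le> \<epsilon>" .
  qed
qed

definition bern :: "nat \<Rightarrow> nat \<Rightarrow> real \<times> real \<Rightarrow> 'a \<Rightarrow> real" where
  "bern m n z \<omega> = bernstein_op m (\<lambda>w. cn n w \<omega>) z"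

text \<open>Bernstein weights are nonnegative with sum 1, so the mean error at \<open>z0\<close> is
  at most the weighted average of the errors at the nodes. The bound \<open>Q\<close> varies with
  the node, which lets distant nodes carry a large one.\<close>

lemma bern_L1:
  assumes z0: "z0 \<in> open_square" and Q: "\<And>z. z \<in> unit_square \<Longrightarrow> (\<integral>\<omega>. \<bar>cn n z \<omega> - ep.g n z0 \<omega>\<bar> \<partial>M) \<le> Q z"
  shows "(\<integral>\<omega>. \<bar>bern m n z0 \<omega> - ep.g n z0 \<omega>\<bar> \<partial>M) \<le> bernstein_op m Q z0"
proof -
  let ?p = "\<lambda>k l. Bernstein m k (fst z0) * Bernstein m l (snd z0)"
  let ?w = "\<lambda>k l. (real k / real m, real l / real m)"
  have p: "0 \<le> ?p k l" for k l
    using open_square_subset[OF z0] by (intro mult_nonneg_nonneg Bernstein_nonneg) (auto simp: mem_Times_iff)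
  have eq: "bern m n z0 \<omega> - ep.g n z0 \<omega> = (\<Sum>k\<le>m. \<Sum>l\<le>m. (cn n (?w k l) \<omega> - ep.g n z0 \<omega>) * ?p k l)" for \<omega>
  proof -
    have "ep.g n z0 \<omega> = (\<Sum>k\<le>m. \<Sum>l\<le>m. ep.g n z0 \<omega> * ?p k l)"
      using bernstein_weights[of m "fst z0" "snd z0"] by (simp flip: sum_distrib_left)
    then show ?thesis
      unfolding bern_def bernstein_op_alt by (simp add: left_diff_distrib sum_subtractf)
  qed
  have i: "integrable M (\<lambda>\<omega>. \<bar>cn n (?w k l) \<omega> - ep.g n z0 \<omega>\<bar> * ?p k l)" if "k \<le> m" "l \<le> m" for k l
    using cn_integrable[OF bernstein_node[OF that]] g_integrable[OF z0] by (intro integrable_mult_left integrable_abs) auto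
  have i2: "integrable M (\<lambda>\<omega>. \<Sum>k\<le>m. \<Sum>l\<le>m. \<bar>cn n (?w k l) \<omega> - ep.g n z0 \<omega>\<bar> * ?p k l)"
    using i by (intro Bochner_Integration.integrable_sum) auto
  have i3: "integrable M (\<lambda>\<omega>. (cn n (?w k l) \<omega> - ep.g n z0 \<omega>) * ?p k l)" if "k \<le> m" "l \<le> m" for k l
    using cn_integrable[OF bernstein_node[OF that]] g_integrable[OF z0] by (intro integrable_mult_left) auto
  have "(\<integral>\<omega>. \<bar>bern m n z0 \<omega> - ep.g n z0 \<omega>\<bar> \<partial>M) \<le> (\<integral>\<omega>. (\<Sum>k\<le>m. \<Sum>l\<le>m. \<bar>cn n (?w k l) \<omega> - ep.g n z0 \<omega>\<bar> * ?p k l) \<partial>M)"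
  proof (rule integral_mono[OF _ i2])
    show "integrable M (\<lambda>\<omega>. \<bar>bern m n z0 \<omega> - ep.g n z0 \<omega>\<bar>)"
      unfolding eq using i3 by (intro integrable_abs Bochner_Integration.integrable_sum) auto
    fix \<omega>
    have "\<bar>bern m n z0 \<omega> - ep.g n z0 \<omega>\<bar> \<le> (\<Sum>k\<le>m. \<Sum>l\<le>m. \<bar>(cn n (?w k l) \<omega> - ep.g n z0 \<omega>) * ?p k l\<bar>)"
      unfolding eq by (intro order_trans[OF sum_abs] sum_mono sum_abs)
    then show "\<bar>bern m n z0 \<omega> - ep.g n z0 \<omega>\<bar> \<le> (\<Sum>k\<le>m. \<Sum>l\<le>m. \<bar>cn n (?w k l) \<omega> - ep.g n z0 \<omega>\<bar> * ?p k l)"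
      using p by (simp add: abs_mult[of "cn n _ \<omega> - _"])
  qed
  also have "\<dots> = (\<Sum>k\<le>m. \<Sum>l\<le>m. (\<integral>\<omega>. \<bar>cn n (?w k l) \<omega> - ep.g n z0 \<omega>\<bar> \<partial>M) * ?p k l)"
  proof -
    have "(\<integral>\<omega>. (\<Sum>k\<le>m. \<Sum>l\<le>m. \<bar>cn n (?w k l) \<omega> - ep.g n z0 \<omega>\<bar> * ?p k l) \<partial>M) =
        (\<Sum>k\<le>m. \<integral>\<omega>. (\<Sum>l\<le>m. \<bar>cn n (?w k l) \<omega> - ep.g n z0 \<omega>\<bar> * ?p k l) \<partial>M)"
      using i by (intro Bochner_Integration.integral_sum Bochner_Integration.integrable_sum) auto
    also have "\<dots> = (\<Sum>k\<le>m. \<Sum>l\<le>m. \<integral>\<omega>. \<bar>cn n (?w k l) \<omega> - ep.g n z0 \<omega>\<bar> * ?p k l \<partial>M)"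
      using i by (intro sum.cong refl Bochner_Integration.integral_sum) auto
    finally show ?thesis by (simp only: integral_mult_left_zero)
  qed
  also have "\<dots> \<le> (\<Sum>k\<le>m. \<Sum>l\<le>m. Q (?w k l) * ?p k l)"
    using p Q[OF bernstein_node] by (intro sum_mono mult_right_mono) auto
  finally show ?thesis unfolding bernstein_op_alt .
qed

lemma bern_crude:
  assumes "0 < n" "z0 \<in> open_square"
  shows "(\<integral>\<omega>. \<bar>bern m n z0 \<omega> - ep.g n z0 \<omega>\<bar> \<partial>M) \<le> 39"
proof -
  have "(\<integral>\<omega>. \<bar>bern m n z0 \<omega> - ep.g n z0 \<omega>\<bar> \<partial>M) \<le> bernstein_op m (\<lambda>_. 39) z0"
    by (rule bern_L1[OF assms(2)]) (rule cn_g_crude[OF assms(1) _ assms(2)])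
  also have "\<dots> = 39"
    unfolding bernstein_op_alt using bernstein_weights[of m "fst z0" "snd z0"] by (simp flip: sum_distrib_left)
  finally show ?thesis .
qed

text \<open>Nodes within \<delta> of \<open>z0\<close> are handled by \<open>local_L1\<close>; the
  weight of the others is bounded through the Bernstein variance, of order
  \<open>1 / m\<close>.\<close>

lemma bern_tendsto:
  assumes z0: "z0 \<in> open_square" and m: "filterlim m at_top sequentially"
  shows "(\<lambda>n. \<integral>\<omega>. \<bar>bern (m n) n z0 \<omega> - ep.g n z0 \<omega>\<bar> \<partial>M) \<longlonglongrightarrow> 0"
proof (rule LIMSEQ_I)
  fix e :: real assume e: "0 < e"
  obtain \<delta> n0 where \<delta>: "0 < \<delta>" and near: "\<And>n z. n0 \<le> n \<Longrightarrow> z \<in> unit_square \<Longrightarrow> \<bar>fst z - fst z0\<bar> \<le> \<delta> \<Longrightarrow> \<bar>snd z - snd z0\<bar> \<le> \<delta> \<Longrightarrow>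
    (\<integral>\<omega>. \<bar>cn n z \<omega> - ep.g n z0 \<omega>\<bar> \<partial>M) \<le> e / 3"
    using local_L1[OF z0, of "e / 3"] e by auto
  \<comment> \<open>A quadratic majorant: a distant node has squared distance at least
    \<open>\<delta>\<^sup>2\<close>, so \<open>Q\<close> exceeds the crude constant 39 there, and
    Bernstein averages of squares are explicit.\<close>
  define Q where "Q z = e / 3 + 39 / \<delta>\<^sup>2 * ((fst z - fst z0)\<^sup>2 + (snd z - snd z0)\<^sup>2)" for z
  have Q: "(\<integral>\<omega>. \<bar>cn n z \<omega> - ep.g n z0 \<omega>\<bar> \<partial>M) \<le> Q z" if n: "n0 \<le> n" "0 < n" and z: "z \<in> unit_square" for n z
  proof (cases "\<bar>fst z - fst z0\<bar> \<le> \<delta> \<and> \<bar>snd z - snd z0\<bar> \<le> \<delta>")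
    case True
    have "0 \<le> 39 / \<delta>\<^sup>2 * ((fst z - fst z0)\<^sup>2 + (snd z - snd z0)\<^sup>2)" by (intro mult_nonneg_nonneg add_nonneg_nonneg) auto
    then show ?thesis using near[OF n(1) z] True unfolding Q_def by linarith
  next
    case False
    have "\<delta>\<^sup>2 \<le> (fst z - fst z0)\<^sup>2 + (snd z - snd z0)\<^sup>2"
    proof -
      have "\<delta>\<^sup>2 \<le> (fst z - fst z0)\<^sup>2 \<or> \<delta>\<^sup>2 \<le> (snd z - snd z0)\<^sup>2"
        using False \<delta> abs_le_square_iff[of \<delta> "fst z - fst z0"] abs_le_square_iff[of \<delta> "snd z - snd z0"] by auto
      then show ?thesis using zero_le_power2[of "fst z - fst z0"] zero_le_power2[of "snd z - snd z0"] by linarith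
    qed
    then have "39 / \<delta>\<^sup>2 * \<delta>\<^sup>2 \<le> 39 / \<delta>\<^sup>2 * ((fst z - fst z0)\<^sup>2 + (snd z - snd z0)\<^sup>2)"
      by (intro mult_left_mono) auto
    moreover have "39 / \<delta>\<^sup>2 * \<delta>\<^sup>2 = 39" using \<delta> by simp
    ultimately show ?thesis using cn_g_crude[OF n(2) z z0] e unfolding Q_def by linarith
  qed
  have bQ: "bernstein_op k Q z0 \<le> e / 3 + 39 / \<delta>\<^sup>2 * (2 / real k)" if k: "0 < k" for k
  proof -
    let ?B = "\<lambda>i. Bernstein k i (fst z0)" and ?D = "\<lambda>j. Bernstein k j (snd z0)"
    let ?x = "\<lambda>i. (real i / real k - fst z0)\<^sup>2" and ?y = "\<lambda>j. (real j / real k - snd z0)\<^sup>2"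
    have "bernstein_op k Q z0 = (\<Sum>i\<le>k. \<Sum>j\<le>k. e / 3 * (?B i * ?D j) + 39 / \<delta>\<^sup>2 * ((?x i * ?B i) * ?D j) + 39 / \<delta>\<^sup>2 * (?B i * (?y j * ?D j)))"
      unfolding bernstein_op_alt Q_def by (intro sum.cong refl) (simp add: algebra_simps)
    also have "\<dots> = e / 3 * (\<Sum>i\<le>k. \<Sum>j\<le>k. ?B i * ?D j) + 39 / \<delta>\<^sup>2 * (\<Sum>i\<le>k. \<Sum>j\<le>k. (?x i * ?B i) * ?D j)
        + 39 / \<delta>\<^sup>2 * (\<Sum>i\<le>k. \<Sum>j\<le>k. ?B i * (?y j * ?D j))"
      by (simp only: sum.distrib sum_distrib_left)
    also have "\<dots> = e / 3 + 39 / \<delta>\<^sup>2 * ((\<Sum>i\<le>k. ?x i * ?B i) + (\<Sum>j\<le>k. ?y j * ?D j))"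
      by (simp add: sum_product[symmetric] distrib_left)
    also have "\<dots> \<le> e / 3 + 39 / \<delta>\<^sup>2 * (1 / real k + 1 / real k)"
      using Bernstein_variance[OF k, of "fst z0"] Bernstein_variance[OF k, of "snd z0"] open_square_subset[OF z0]
      by (intro add_left_mono mult_left_mono add_mono) (auto simp: mem_Times_iff)
    finally show ?thesis by simp
  qed
  have "((\<lambda>n. 39 / \<delta>\<^sup>2 * (2 / real (m n))) \<longlongrightarrow> 39 / \<delta>\<^sup>2 * 0) sequentially"
    by (intro tendsto_mult tendsto_const real_tendsto_divide_at_top[OF tendsto_const] filterlim_compose[OF filterlim_real_sequentially m])
  then have "\<forall>\<^sub>F n in sequentially. 39 / \<delta>\<^sup>2 * (2 / real (m n)) < e / 3"
    by (intro order_tendstoD(2)) (use e in auto)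
  moreover have "\<forall>\<^sub>F n in sequentially. 0 < m n" using eventually_compose_filterlim[OF eventually_gt_at_top m] .
  ultimately have "\<forall>\<^sub>F n in sequentially. norm ((\<integral>\<omega>. \<bar>bern (m n) n z0 \<omega> - ep.g n z0 \<omega>\<bar> \<partial>M) - 0) < e"
    using eventually_ge_at_top[of n0] eventually_gt_at_top[of 0]
  proof eventually_elim
    case (elim n)
    have "(\<integral>\<omega>. \<bar>bern (m n) n z0 \<omega> - ep.g n z0 \<omega>\<bar> \<partial>M) \<le> bernstein_op (m n) Q z0"
      by (rule bern_L1[OF z0 Q[OF elim(3,4)]])
    then have "(\<integral>\<omega>. \<bar>bern (m n) n z0 \<omega> - ep.g n z0 \<omega>\<bar> \<partial>M) \<le> e / 3 + e / 3"
      using bQ[OF elim(2)] elim(1) by linarith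
    moreover have "0 \<le> (\<integral>\<omega>. \<bar>bern (m n) n z0 \<omega> - ep.g n z0 \<omega>\<bar> \<partial>M)" by simp
    ultimately show ?case using e by simp
  qed
  then show "\<exists>no. \<forall>n\<ge>no. norm ((\<integral>\<omega>. \<bar>bern (m n) n z0 \<omega> - ep.g n z0 \<omega>\<bar> \<partial>M) - 0) < e"
    by (simp add: eventually_sequentially)
qed

text \<open>An L1 norm over the whole square, which controls the integrals over all squares
  \<open>[0, p]\<^sup>2\<close> simultaneously; uniformity in \<open>p\<close> comes from
  here.\<close>

definition remainder :: "nat \<Rightarrow> nat \<Rightarrow> 'a \<Rightarrow> real" where
  "remainder m n \<omega> = (\<integral>z. \<bar>bern m n z \<omega> - ep.g n z \<omega>\<bar> \<partial>usq)"

lemma bern_bound: "z \<in> unit_square \<Longrightarrow> \<bar>bern m n z \<omega>\<bar> \<le> sqrt (real n)"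
  unfolding bern_def by (rule bernstein_op_bound) (auto intro: cn_bound)

lemma bern_pair: "(\<lambda>(z, \<omega>). bern m n z \<omega>) \<in> borel_measurable (usq \<Otimes>\<^sub>M M)"
  unfolding bern_def bernstein_op_alt by measurable

lemma g_bound: "z \<in> open_square \<Longrightarrow> \<bar>ep.g n z \<omega>\<bar> \<le> 3 * real n"
  using ep.g_abs_le[of z n \<omega>] ep_bound[OF open_square_subset, of z n \<omega>]
    ep_bound[OF ep.edges_in_unit_square(1), of z n \<omega>] ep_bound[OF ep.edges_in_unit_square(2), of z n \<omega>] by linarith

lemma remainder_pair_integrable: "integrable (usq \<Otimes>\<^sub>M M) (\<lambda>(z, \<omega>). \<bar>bern m n z \<omega> - ep.g n z \<omega>\<bar>)"
proof -
  have pp: "finite_measure (usq \<Otimes>\<^sub>M M)"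
    by (rule prob_space.finite_measure[OF prob_space_pair[OF prob_space_usq prob_space_axioms]])
  have b: "\<bar>bern m n z \<omega> - ep.g n z \<omega>\<bar> \<le> sqrt (real n) + 3 * real n" if "z \<in> open_square" for z \<omega>
    using bern_bound[OF open_square_subset[OF that], of m n \<omega>] g_bound[OF that, of n \<omega>] by linarith
  have "(\<lambda>p. \<bar>(case p of (z, \<omega>) \<Rightarrow> bern m n z \<omega>) - (case p of (z, \<omega>) \<Rightarrow> ep.g n z \<omega>)\<bar>) \<in> borel_measurable (usq \<Otimes>\<^sub>M M)"
    using bern_pair ep.g_measurable_pair by (intro borel_measurable_abs borel_measurable_diff)
  then have mm: "(\<lambda>(z, \<omega>). \<bar>bern m n z \<omega> - ep.g n z \<omega>\<bar>) \<in> borel_measurable (usq \<Otimes>\<^sub>M M)"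
    by (simp add: case_prod_unfold)
  show ?thesis
    by (rule finite_measure.integrable_const_bound[OF pp, of _ "sqrt (real n) + 3 * real n"])
      (use b mm in \<open>auto simp: space_pair_measure intro!: AE_I2\<close>)
qed

lemma remainder_integrable: "integrable M (remainder m n)"
  unfolding remainder_def[abs_def] using ep.P.integrable_snd[OF remainder_pair_integrable] by simp

lemma remainder_expectation: "(\<integral>\<omega>. remainder m n \<omega> \<partial>M) = (\<integral>z. \<integral>\<omega>. \<bar>bern m n z \<omega> - ep.g n z \<omega>\<bar> \<partial>M \<partial>usq)"
  unfolding remainder_def using ep.P.Fubini_integral[OF remainder_pair_integrable] by simp

text \<open>Dominated convergence over the square, with the constant 39, upgrades convergence at
  interior points to convergence of the mean remainder.\<close>

lemma remainder_tendsto: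
  assumes m: "filterlim m at_top sequentially"
  shows "(\<lambda>n. \<integral>\<omega>. remainder (m n) n \<omega> \<partial>M) \<longlonglongrightarrow> 0"
proof -
  interpret U: prob_space usq by (rule prob_space_usq)
  have "(\<lambda>n. \<integral>z. \<integral>\<omega>. \<bar>bern (m n) n z \<omega> - ep.g n z \<omega>\<bar> \<partial>M \<partial>usq) \<longlonglongrightarrow> (\<integral>z. 0 \<partial>usq)"
  proof (rule integral_dominated_convergence[where w = "\<lambda>_. 39"])
    show "(\<lambda>z. \<integral>\<omega>. \<bar>bern (m n) n z \<omega> - ep.g n z \<omega>\<bar> \<partial>M) \<in> borel_measurable usq" for n
      using ep.P.integrable_fst[OF remainder_pair_integrable, of "m n" n] by simp
    show "AE z in usq. (\<lambda>n. \<integral>\<omega>. \<bar>bern (m n) n z \<omega> - ep.g n z \<omega>\<bar> \<partial>M) \<longlonglongrightarrow> 0"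
      by (intro AE_I2) (simp add: bern_tendsto[OF _ m])
    show "AE z in usq. norm (\<integral>\<omega>. \<bar>bern (m n) n z \<omega> - ep.g n z \<omega>\<bar> \<partial>M) \<le> 39" for n
    proof (intro AE_I2)
      fix z assume "z \<in> space usq"
      then have z: "z \<in> open_square" by simp
      have "(\<integral>\<omega>. \<bar>bern (m n) n z \<omega> - ep.g n z \<omega>\<bar> \<partial>M) \<le> 39"
      \<comment> \<open>\<open>bern_crude\<close> speaks of positive \<open>n\<close>; at
        \<open>n = 0\<close> both processes vanish.\<close>
      proof (cases "n = 0")
        case True
        have "bern (m n) n z \<omega> - ep.g n z \<omega> = 0" for \<omega>
          using bern_bound[OF open_square_subset[OF z], of "m n" n \<omega>] g_bound[OF z, of n \<omega>] True by simp
        then show ?thesis by simp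
      qed (use bern_crude z in auto)
      then show "norm (\<integral>\<omega>. \<bar>bern (m n) n z \<omega> - ep.g n z \<omega>\<bar> \<partial>M) \<le> 39" by simp
    qed
  qed auto
  then show ?thesis by (simp add: remainder_expectation)
qed

end

section \<open>Reduction to uniform marginals\<close>

text \<open>A sublevel set of a continuous distribution function is closed and downward closed,
  hence a half-line once it is nonempty and bounded above. It can be empty only for
  \<open>u = 0\<close> and unbounded above only for \<open>u = 1\<close>.\<close>

lemma continuous_cdf_sublevel:
  assumes "real_distribution \<mu>" and cont: "continuous_on UNIV (cdf \<mu>)" and u: "u \<in> {0..1}"
  obtains "u = 1" | "u = 0" "{x. cdf \<mu> x \<le> u} = {}" | x where "cdf \<mu> x = u" "{y. cdf \<mu> y \<le> u} = {..x}"
proof -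
  interpret real_distribution \<mu> by fact
  let ?A = "{x. cdf \<mu> x \<le> u}"
  show thesis
  proof (cases "u = 1")
    case True then show ?thesis by (rule that(1))
  next
    case u1: False
    show ?thesis
    proof (cases "?A = {}")
      case True
      have "u = 0"
      proof (rule ccontr)
        assume "u \<noteq> 0"
        then have "0 < u" using u by simp
        from order_tendstoD(2)[OF cdf_lim_at_bot this] have "\<exists>x. cdf \<mu> x < u"
          by (auto simp: eventually_at_bot_linorder)
        then show False using True less_imp_le by blast
      qed
      then show ?thesis using True by (rule that(2))
    next
      case False
      have "u < 1" using u u1 by simp
      from order_tendstoD(1)[OF cdf_lim_at_top_prob this] obtain b where b: "u < cdf \<mu> b"
        by (auto simp: eventually_at_top_linorder)
      have bd: "y \<le> b" if "y \<in> ?A" for y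
        using cdf_nondecreasing[of b y] b that by (cases "y \<le> b") auto
      have bdd: "bdd_above ?A" using bd by (rule bdd_aboveI)
      have "closed ?A"
        by (intro closed_Collect_le cont continuous_intros)
      define x where "x = Sup ?A"
      have xA: "cdf \<mu> x \<le> u" using closed_contains_Sup[OF False bdd \<open>closed ?A\<close>] by (simp add: x_def)
      have A: "?A = {..x}"
        using cSup_upper[OF _ bdd] cdf_nondecreasing[of _ x] xA by (force simp: x_def[symmetric])
      \<comment> \<open>By the intermediate value theorem the level \<open>u\<close> is attained at
        or to the right of the end point \<open>x\<close>; maximality of \<open>x\<close> leaves
        \<open>x\<close> itself.\<close>
      obtain y where y: "x \<le> y" "cdf \<mu> y = u"
        using IVT'[of "cdf \<mu>" x u b] xA b bd[of x] continuous_on_subset[OF cont] by auto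
      then have "y \<in> ?A" by simp
      then have "y = x" using y(1) A by auto
      then show ?thesis using that(3)[of x] y A by simp
    qed
  qed
qed

text \<open>A continuous distribution function has no atoms, so by Fubini the diagonal is null for
  the joint law of two observations, and there are countably many pairs.\<close>

lemma (in prob_space) AE_distinct_of_continuous_cdf:
  fixes U :: "nat \<Rightarrow> 'a \<Rightarrow> real"
  assumes ind: "indep_vars (\<lambda>_. borel) U {1..}"
    and ident: "\<And>i. 1 \<le> i \<Longrightarrow> distr M borel (U i) = distr M borel (U 1)"
    and cont: "continuous_on UNIV (cdf (distr M borel (U 1)))"
  shows "AE \<omega> in M. \<forall>n. inj_on (\<lambda>i. U i \<omega>) {1..n}"
proof -
  let ?\<mu> = "distr M borel (U 1)"
  have U[measurable]: "1 \<le> i \<Longrightarrow> U i \<in> borel_measurable M" for i using ind by (auto simp: indep_vars_def)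
  interpret \<mu>: real_distribution ?\<mu> by (rule real_distribution_distr) (rule U, simp)
  have atom: "emeasure ?\<mu> {x} = 0" for x
    using \<mu>.isCont_cdf[of x] cont \<mu>.emeasure_eq_measure[of "{x}"] by (simp add: continuous_on_eq_continuous_at)
  have ne: "AE \<omega> in M. U i \<omega> \<noteq> U j \<omega>" if ij: "1 \<le> i" "1 \<le> j" "i \<noteq> j" for i j
  proof -
    note [measurable] = U[OF ij(1)] U[OF ij(2)]
    have "indep_var (Pi\<^sub>M {i} (\<lambda>_. borel)) (\<lambda>\<omega>. restrict (\<lambda>k. U k \<omega>) {i}) (Pi\<^sub>M {j} (\<lambda>_. borel)) (\<lambda>\<omega>. restrict (\<lambda>k. U k \<omega>) {j})"
      by (rule indep_var_restrict[OF ind]) (use ij in auto)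
    from indep_var_compose[OF this, of "\<lambda>f. f i" borel "\<lambda>f. f j" borel]
    have "indep_var borel (U i) borel (U j)" by (simp add: comp_def)
    then have d: "?\<mu> \<Otimes>\<^sub>M ?\<mu> = distr M (borel \<Otimes>\<^sub>M borel) (\<lambda>\<omega>. (U i \<omega>, U j \<omega>))"
      using ident[OF ij(1)] ident[OF ij(2)] by (simp add: indep_var_distribution_eq)
    let ?D = "{p :: real \<times> real. fst p = snd p}"
    have D: "?D \<in> sets (borel \<Otimes>\<^sub>M borel)"
    proof -
      have "{p \<in> space (borel \<Otimes>\<^sub>M borel :: (real \<times> real) measure). fst p = snd p} \<in> sets (borel \<Otimes>\<^sub>M borel)" by measurable
      then show ?thesis by (simp add: space_pair_measure)
    qed
    have D': "?D \<in> sets (?\<mu> \<Otimes>\<^sub>M ?\<mu>)" using D by (simp cong: sets_pair_measure_cong)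
    have v: "Pair x -` ?D = {x}" for x by auto
    have "emeasure (?\<mu> \<Otimes>\<^sub>M ?\<mu>) ?D = (\<integral>\<^sup>+x. emeasure ?\<mu> (Pair x -` ?D) \<partial>?\<mu>)"
      by (rule \<mu>.emeasure_pair_measure_alt[OF D'])
    also have "\<dots> = 0" unfolding v atom by simp
    finally have "emeasure M ((\<lambda>\<omega>. (U i \<omega>, U j \<omega>)) -` ?D \<inter> space M) = 0"
      unfolding d by (subst (asm) emeasure_distr) (use D in auto)
    moreover have "(\<lambda>\<omega>. (U i \<omega>, U j \<omega>)) -` ?D \<inter> space M = {\<omega> \<in> space M. \<not> U i \<omega> \<noteq> U j \<omega>}" by auto
    moreover have "{\<omega> \<in> space M. \<not> U i \<omega> \<noteq> U j \<omega>} \<in> sets M" by measurable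
    ultimately show ?thesis by (intro AE_I[of _ _ "{\<omega> \<in> space M. \<not> U i \<omega> \<noteq> U j \<omega>}"]) auto
  qed
  have "AE \<omega> in M. \<forall>i j. 1 \<le> i \<longrightarrow> 1 \<le> j \<longrightarrow> i \<noteq> j \<longrightarrow> U i \<omega> \<noteq> U j \<omega>"
  proof (unfold AE_all_countable, intro allI)
    fix i j show "AE \<omega> in M. 1 \<le> i \<longrightarrow> 1 \<le> j \<longrightarrow> i \<noteq> j \<longrightarrow> U i \<omega> \<noteq> U j \<omega>"
      by (cases "1 \<le> i \<and> 1 \<le> j \<and> i \<noteq> j") (use ne[of i j] in auto)
  qed
  then show ?thesis
  proof eventually_elim
    case (elim \<omega>)
    show ?case
    proof (intro allI inj_onI)
      fix n i j assume "i \<in> {1..n}" "j \<in> {1..n}" "U i \<omega> = U j \<omega>"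
      then show "i = j" using elim by (cases "i = j") auto
    qed
  qed
qed

text \<open>The probability integral transform in two coordinates: sublevel sets of \<open>F\<close>
  and \<open>G\<close> are half-lines, so the distribution function of the transforms at
  \<open>(u, v)\<close> is that of the observations at a point where \<open>F\<close> and
  \<open>G\<close> take the values \<open>u\<close> and \<open>v\<close>. Sklar's identity turns it
  into \<open>C\<close>.\<close>

lemma rank_sample_of_iid:
  fixes M :: "'a measure" and X Y :: "nat \<Rightarrow> 'a \<Rightarrow> real" and F G :: "real \<Rightarrow> real" and C C1 C2 :: "real \<times> real \<Rightarrow> real"
  assumes M: "prob_space M"
    and ind: "prob_space.indep_vars M (\<lambda>_. borel) (\<lambda>i \<omega>. (X i \<omega>, Y i \<omega>)) {1..}"
    and ident: "\<And>i. 1 \<le> i \<Longrightarrow>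
      distr M borel (\<lambda>\<omega>. (X i \<omega>, Y i \<omega>)) = distr M borel (\<lambda>\<omega>. (X 1 \<omega>, Y 1 \<omega>))"
    and F: "F = cdf (distr M borel (X 1))" and contF: "continuous_on UNIV F"
    and G: "G = cdf (distr M borel (Y 1))" and contG: "continuous_on UNIV G"
    and C: "copula C" and sklar: "\<And>x y. joint_cdf (distr M borel (\<lambda>\<omega>. (X 1 \<omega>, Y 1 \<omega>))) (x, y) = C (F x, G y)"
    and d1: "\<And>z. z \<in> open_square \<Longrightarrow> ((\<lambda>s. C (s, snd z)) has_real_derivative C1 z) (at (fst z))"
    and d2: "\<And>z. z \<in> open_square \<Longrightarrow> ((\<lambda>t. C (fst z, t)) has_real_derivative C2 z) (at (snd z))"
    and c1: "continuous_on open_square C1" and c2: "continuous_on open_square C2"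
  shows "rank_sample M (\<lambda>i \<omega>. (F (X i \<omega>), G (Y i \<omega>))) C C1 C2 X Y F G"
proof -
  interpret prob_space M by (rule M)
  have XY[measurable]: "(\<lambda>\<omega>. (X i \<omega>, Y i \<omega>)) \<in> measurable M borel" if "1 \<le> i" for i
    using ind that by (auto simp: indep_vars_def)
  have f: "fst \<in> borel_measurable (borel :: (real \<times> real) measure)" "snd \<in> borel_measurable (borel :: (real \<times> real) measure)"
    by (intro borel_measurable_continuous_onI continuous_intros)+
  have X[measurable]: "X i \<in> borel_measurable M" and Y[measurable]: "Y i \<in> borel_measurable M" if "1 \<le> i" for i
    using measurable_compose[OF XY[OF that] f(1)] measurable_compose[OF XY[OF that] f(2)] by simp_all
  interpret FX: real_distribution "distr M borel (X 1)" by (rule real_distribution_distr) (rule X, simp)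
  interpret GY: real_distribution "distr M borel (Y 1)" by (rule real_distribution_distr) (rule Y, simp)
  have mF: "F x \<le> F y" and mG: "G x \<le> G y" if "x \<le> y" for x y
    using FX.cdf_nondecreasing[OF that] GY.cdf_nondecreasing[OF that] by (simp_all add: F G)
  have rF: "F x \<in> {0..1}" and rG: "G x \<in> {0..1}" for x
    using FX.cdf_nonneg[of x] FX.cdf_bounded_prob[of x] GY.cdf_nonneg[of x] GY.cdf_bounded_prob[of x] by (simp_all add: F G)
  have FG: "(\<lambda>p. (F (fst p), G (snd p))) \<in> measurable borel borel"
    by (intro borel_measurable_continuous_onI continuous_intros continuous_on_compose2[OF contF] continuous_on_compose2[OF contG]) auto
  have X1: "X 1 \<in> borel_measurable M" and Y1: "Y 1 \<in> borel_measurable M" by (auto intro: X Y)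
  note [measurable] = X1 Y1
  have pF: "prob {\<omega> \<in> space M. X 1 \<omega> \<le> x} = F x" for x
  proof -
    have "X 1 -` {..x} \<inter> space M = {\<omega> \<in> space M. X 1 \<omega> \<le> x}" by auto
    then show ?thesis by (simp add: F cdf_def measure_distr)
  qed
  have pG: "prob {\<omega> \<in> space M. Y 1 \<omega> \<le> x} = G x" for x
  proof -
    have "Y 1 -` {..x} \<inter> space M = {\<omega> \<in> space M. Y 1 \<omega> \<le> x}" by auto
    then show ?thesis by (simp add: G cdf_def measure_distr)
  qed
  have pH: "prob {\<omega> \<in> space M. X 1 \<omega> \<le> x \<and> Y 1 \<omega> \<le> y} = C (F x, G y)" for x y
  proof -
    have "(\<lambda>\<omega>. (X 1 \<omega>, Y 1 \<omega>)) -` ({..x} \<times> {..y}) \<inter> space M = {\<omega> \<in> space M. X 1 \<omega> \<le> x \<and> Y 1 \<omega> \<le> y}" by auto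
    moreover have "{..x} \<times> {..y} \<in> sets borel" by (intro borel_closed closed_Times) auto
    ultimately show ?thesis
      using sklar[of x y] measure_distr[OF XY[OF order_refl], of "{..x} \<times> {..y}"] by (simp add: joint_cdf_def)
  qed
  \<comment> \<open>The degenerate shapes of the sublevel sets occur at the levels 0 and 1 and are
    settled by the boundary values of the copula.\<close>
  have cdf: "prob {\<omega> \<in> space M. F (X 1 \<omega>) \<le> u \<and> G (Y 1 \<omega>) \<le> v} = C (u, v)" if u: "u \<in> {0..1}" and v: "v \<in> {0..1}" for u v
  proof -
    note bd = copula_boundary[OF C u] copula_boundary[OF C v]
    have F1: "F x \<le> 1" and G1: "G x \<le> 1" for x using rF[of x] rG[of x] by auto
    show ?thesis
    proof (rule continuous_cdf_sublevel[OF FX.real_distribution_axioms contF[unfolded F] u])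
      assume u: "u = 1"
      show ?thesis
      proof (rule continuous_cdf_sublevel[OF GY.real_distribution_axioms contG[unfolded G] v])
        assume "v = 1" then show ?thesis using u F1 G1 bd by (simp add: prob_space)
      next
        assume v: "v = 0" "{x. cdf (distr M borel (Y 1)) x \<le> v} = {}"
        then have "\<not> G x \<le> v" for x unfolding G[symmetric] by blast
        then show ?thesis using u F1 bd v(1) by simp
      next
        fix y assume y: "cdf (distr M borel (Y 1)) y = v" "{x. cdf (distr M borel (Y 1)) x \<le> v} = {..y}"
        then have ly: "G x \<le> v \<longleftrightarrow> x \<le> y" and gy: "G y = v" for x unfolding G[symmetric] by blast+
        show ?thesis using u F1 bd pG[of y] ly gy by simp
      qed
    next
      assume u: "u = 0" "{x. cdf (distr M borel (X 1)) x \<le> u} = {}"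
      then have "\<not> F x \<le> u" for x unfolding F[symmetric] by blast
      then show ?thesis using bd u(1) by simp
    next
      fix x assume x: "cdf (distr M borel (X 1)) x = u" "{y. cdf (distr M borel (X 1)) y \<le> u} = {..x}"
      then have lx: "F y \<le> u \<longleftrightarrow> y \<le> x" and fx: "F x = u" for y unfolding F[symmetric] by blast+
      show ?thesis
      proof (rule continuous_cdf_sublevel[OF GY.real_distribution_axioms contG[unfolded G] v])
        assume "v = 1" then show ?thesis using lx fx G1 bd pF[of x] by simp
      next
        assume v: "v = 0" "{x. cdf (distr M borel (Y 1)) x \<le> v} = {}"
        then have "\<not> G x \<le> v" for x unfolding G[symmetric] by blast
        then show ?thesis using bd v(1) by simp
      next
        fix y assume y: "cdf (distr M borel (Y 1)) y = v" "{x. cdf (distr M borel (Y 1)) x \<le> v} = {..y}"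
        then have ly: "G x \<le> v \<longleftrightarrow> x \<le> y" and gy: "G y = v" for x unfolding G[symmetric] by blast+
        show ?thesis using lx fx ly gy pH[of x y] by simp
      qed
    qed
  qed
  have oC: "h \<in> borel_measurable usq" if "continuous_on open_square h" for h :: "real \<times> real \<Rightarrow> real"
    using borel_measurable_continuous_on_restrict[OF that] unfolding usq_def
    by (simp cong: measurable_cong_sets add: sets_restrict_space)
  have os: "fst z \<in> {0<..<1}" "snd z \<in> {0<..<1}" if "z \<in> open_square" for z
    using that by (auto simp: open_square_def)
  show ?thesis
  proof (unfold_locales)
    show "copula C" by (rule C)
    show "indep_vars (\<lambda>_. borel) (\<lambda>i \<omega>. (F (X i \<omega>), G (Y i \<omega>))) {1..}"
      using indep_vars_compose2[OF ind, of "\<lambda>_ p. (F (fst p), G (snd p))" "\<lambda>_. borel"] FG by simp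
    show "distr M borel (\<lambda>\<omega>. (F (X i \<omega>), G (Y i \<omega>))) = distr M borel (\<lambda>\<omega>. (F (X 1 \<omega>), G (Y 1 \<omega>)))" if "1 \<le> i" for i
      using distr_distr[OF FG XY[OF that]] distr_distr[OF FG XY[OF order_refl]] ident[OF that] by (simp add: comp_def)
    show "prob {\<omega> \<in> space M. fst (F (X 1 \<omega>), G (Y 1 \<omega>)) \<le> fst z \<and> snd (F (X 1 \<omega>), G (Y 1 \<omega>)) \<le> snd z} = C z"
      if "z \<in> unit_square" for z using cdf[of "fst z" "snd z"] that by (simp add: mem_Times_iff)
    show "C1 \<in> borel_measurable usq" "C2 \<in> borel_measurable usq" using oC c1 c2 by auto
    show "\<bar>C1 z\<bar> \<le> 1" if z: "z \<in> open_square" for z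
      using copula_derivative_bound_fst[OF C _ _ d1[OF z]] os[OF z] by simp
    show "\<bar>C2 z\<bar> \<le> 1" if z: "z \<in> open_square" for z
      using copula_derivative_bound_snd[OF C _ _ d2[OF z]] os[OF z] by simp
    show "mono F" "mono G" using mF mG by (auto intro: monoI)
    show "(F (X i \<omega>), G (Y i \<omega>)) \<in> unit_square" for i \<omega> using rF rG by (simp add: mem_Times_iff)
    show "AE \<omega> in M. \<forall>n. inj_on (\<lambda>i. X i \<omega>) {1..n} \<and> inj_on (\<lambda>i. Y i \<omega>) {1..n}"
    proof -
      have iX: "indep_vars (\<lambda>_. borel) X {1..}" and iY: "indep_vars (\<lambda>_. borel) Y {1..}"
        using indep_vars_compose2[OF ind, of "\<lambda>_. fst" "\<lambda>_. borel"] indep_vars_compose2[OF ind, of "\<lambda>_. snd" "\<lambda>_. borel"] f by simp_all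
      have dX: "distr M borel (X i) = distr M borel (X 1)" and dY: "distr M borel (Y i) = distr M borel (Y 1)" if "1 \<le> i" for i
        using distr_distr[OF f(1) XY[OF that]] distr_distr[OF f(1) XY[OF order_refl]]
          distr_distr[OF f(2) XY[OF that]] distr_distr[OF f(2) XY[OF order_refl]] ident[OF that] by (simp_all add: comp_def)
      have "AE \<omega> in M. \<forall>n. inj_on (\<lambda>i. X i \<omega>) {1..n}" "AE \<omega> in M. \<forall>n. inj_on (\<lambda>i. Y i \<omega>) {1..n}"
        by (rule AE_distinct_of_continuous_cdf[OF iX _ contF[unfolded F]], rule dX, assumption)
          (rule AE_distinct_of_continuous_cdf[OF iY _ contG[unfolded G]], rule dY, assumption)
      then show ?thesis by eventually_elim simp
    qed
  qed (use X Y d1 d2 c1 c2 in auto)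
qed

section \<open>The smoothed Spearman curve\<close>

lemma continuous_on_usq: "continuous_on open_square h \<Longrightarrow> h \<in> borel_measurable usq" for h :: "real \<times> real \<Rightarrow> real"
  using borel_measurable_continuous_on_restrict[of open_square h] unfolding usq_def
  by (simp cong: measurable_cong_sets add: sets_restrict_space)

lemma usq_integral_bound:
  assumes h[measurable]: "h \<in> borel_measurable usq" and B: "\<And>z. z \<in> open_square \<Longrightarrow> \<bar>h z\<bar> \<le> B"
  shows "integrable usq (\<lambda>z. lower_square p z * h z)" "\<bar>\<integral>z. lower_square p z * h z \<partial>usq\<bar> \<le> B"
proof -
  interpret prob_space usq by (rule prob_space_usq)
  have b: "\<bar>lower_square p z * h z\<bar> \<le> B" if "z \<in> open_square" for z
  proof -
    have "\<bar>lower_square p z * h z\<bar> \<le> \<bar>h z\<bar>" by (simp add: indicator_def)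
    then show ?thesis using B[OF that] by linarith
  qed
  have m: "(\<lambda>z. lower_square p z * h z) \<in> borel_measurable usq" by measurable
  show i: "integrable usq (\<lambda>z. lower_square p z * h z)"
    by (rule integrable_const_bound[of _ B, OF _ m]) (use b in auto)
  have "\<bar>\<integral>z. lower_square p z * h z \<partial>usq\<bar> \<le> (\<integral>z. \<bar>lower_square p z * h z\<bar> \<partial>usq)" by (rule integral_abs_bound)
  also have "\<dots> \<le> (\<integral>z. B \<partial>usq)" using i b by (intro integral_mono integrable_abs) auto
  finally show "\<bar>\<integral>z. lower_square p z * h z \<partial>usq\<bar> \<le> B" using prob_space by simp
qed

section \<open>Splitting the estimation error into linear functional, remainder and bias\<close>

context rank_sample
begin

lemma C_usq: "C \<in> borel_measurable usq"
  by (rule continuous_on_usq, rule continuous_on_subset[OF copula_continuous[OF C]]) (rule subsetI, erule open_square_subset)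

text \<open>Smoothing is linear, so the smoothed process is centred at
  \<open>bernstein_op m C\<close> instead of \<open>C\<close>; the gap between the two is the
  bias.\<close>

lemma bern_eq: "bern m n z \<omega> = sqrt (real n) * (bernstein_op m (emp_copula X Y n \<omega>) z - bernstein_op m C z)"
proof -
  have "cn n w \<omega> * x = sqrt (real n) * (emp_copula X Y n \<omega> w * x) - sqrt (real n) * (C w * x)" for w x
    by (simp add: cn_def emp_def algebra_simps)
  then show ?thesis
    unfolding bern_def bernstein_op_alt right_diff_distrib by (simp add: sum_subtractf sum_distrib_left)
qed

lemma bernstein_copula_bound: "z \<in> open_square \<Longrightarrow> \<bar>bernstein_op m C z - C z\<bar> \<le> 2"
  using bernstein_op_bound[of C 1 z m] copula_range[OF C] open_square_subset[of z] by fastforce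

lemma bias_bound:
  assumes "p \<in> {0..1}"
  shows "\<bar>square_integral (\<lambda>z. bernstein_op m C z - C z) p\<bar> \<le> 2"
  using usq_integral_bound(2)[OF borel_measurable_diff[OF bernstein_op_measurable C_usq] bernstein_copula_bound] assms
  by (subst square_integral_usq) (auto intro: borel_measurable_diff bernstein_op_measurable C_usq)

text \<open>The terms \<open>p ^ 4 / 4\<close> cancel; what is left is the integral of the smoothed
  process plus the scaled bias.\<close>

lemma spearman_difference:
  assumes p: "p \<in> {0..1}"
  shows "sqrt (real n) * (spearman_curve (bernstein_op m (emp_copula X Y n \<omega>)) p - spearman_curve C p) =
    ((\<integral>z. lower_square p z * bern m n z \<omega> \<partial>usq) + sqrt (real n) * square_integral (\<lambda>z. bernstein_op m C z - C z) p) / D_norm p"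
proof -
  let ?E = "bernstein_op m (emp_copula X Y n \<omega>)" and ?B = "bernstein_op m C"
  have E: "\<bar>?E z\<bar> \<le> 1" if "z \<in> open_square" for z
    using emp_range[of n _ \<omega>] by (intro bernstein_op_bound open_square_subset[OF that]) (simp add: emp_def)
  have B: "\<bar>?B z\<bar> \<le> 1" if "z \<in> open_square" for z
    using copula_range[OF C] by (intro bernstein_op_bound open_square_subset[OF that]) simp
  have Cb: "\<bar>C z\<bar> \<le> 1" if "z \<in> open_square" for z
    using copula_range[OF C open_square_subset[OF that]] by simp
  have i: "integrable usq (\<lambda>z. lower_square p z * ?E z)" "integrable usq (\<lambda>z. lower_square p z * ?B z)"
      "integrable usq (\<lambda>z. lower_square p z * C z)"
    by (rule usq_integral_bound(1)[OF bernstein_op_measurable E], assumption)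
      (rule usq_integral_bound(1)[OF bernstein_op_measurable B], assumption,
        rule usq_integral_bound(1)[OF C_usq Cb], assumption)
  note p' = p[unfolded atLeastAtMost_iff, THEN conjunct1] p[unfolded atLeastAtMost_iff, THEN conjunct2]
  have s: "square_integral ?E p = (\<integral>z. lower_square p z * ?E z \<partial>usq)"
    "square_integral C p = (\<integral>z. lower_square p z * C z \<partial>usq)"
    "square_integral (\<lambda>z. ?B z - C z) p = (\<integral>z. lower_square p z * (?B z - C z) \<partial>usq)"
    by (rule square_integral_usq[OF _ p'], intro borel_measurable_diff bernstein_op_measurable C_usq)+
  have "(\<integral>z. lower_square p z * (?B z - C z) \<partial>usq) = (\<integral>z. lower_square p z * ?B z - lower_square p z * C z \<partial>usq)"
    by (simp only: right_diff_distrib)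
  also have "\<dots> = (\<integral>z. lower_square p z * ?B z \<partial>usq) - (\<integral>z. lower_square p z * C z \<partial>usq)"
    by (rule Bochner_Integration.integral_diff[OF i(2,3)])
  finally have s3: "square_integral (\<lambda>z. ?B z - C z) p = \<dots>" unfolding s(3) .
  have "(\<integral>z. lower_square p z * bern m n z \<omega> \<partial>usq) =
      (\<integral>z. sqrt (real n) * (lower_square p z * ?E z - lower_square p z * ?B z) \<partial>usq)"
    unfolding bern_eq by (simp only: right_diff_distrib mult.left_commute)
  also have "\<dots> = sqrt (real n) * ((\<integral>z. lower_square p z * ?E z \<partial>usq) - (\<integral>z. lower_square p z * ?B z \<partial>usq))"
    unfolding integral_mult_right_zero Bochner_Integration.integral_diff[OF i(1,2)] ..
  finally have b: "(\<integral>z. lower_square p z * bern m n z \<omega> \<partial>usq) = \<dots>" .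
  show ?thesis
    unfolding spearman_curve_def s(1,2) s3 b by (simp add: diff_divide_distrib add_divide_distrib right_diff_distrib)
qed

text \<open>Restricting an integral to a lower square does not increase the integral of the absolute
  value, so \<open>p\<close> enters the bound only through the bias.\<close>

lemma spearman_remainder:
  assumes p0: "0 < p0" and p: "p \<in> {p0..1}" and \<omega>: "\<omega> \<in> space M"
  shows "\<bar>sqrt (real n) * (spearman_curve (bernstein_op m (emp_copula X Y n \<omega>)) p - spearman_curve C p) - ep.Z n p \<omega>\<bar>
    \<le> (remainder m n \<omega> + sqrt (real n) * \<bar>square_integral (\<lambda>z. bernstein_op m C z - C z) p\<bar>) / (p0 ^ 3 / 12)"
proof -
  have p01: "p \<in> {0..1}" using p p0 by auto
  have D: "0 < p0 ^ 3 / 12" "p0 ^ 3 / 12 \<le> D_norm p" using p0 p D_norm_lower by auto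
  then have Dp: "0 < D_norm p" by linarith
  let ?S = "square_integral (\<lambda>z. bernstein_op m C z - C z) p"
  let ?d = "\<lambda>z. bern m n z \<omega> - ep.g n z \<omega>"
  have bm: "(\<lambda>z. bern m n z \<omega>) \<in> borel_measurable usq" unfolding bern_def by (rule bernstein_op_measurable)
  have gm: "(\<lambda>z. ep.g n z \<omega>) \<in> borel_measurable usq" by (rule ep.g_section2[OF \<omega>])
  have dm: "?d \<in> borel_measurable usq" by (rule borel_measurable_diff[OF bm gm])
  have db: "\<bar>?d z\<bar> \<le> sqrt (real n) + 3 * real n" if "z \<in> open_square" for z
    using bern_bound[OF open_square_subset[OF that], of m n \<omega>] g_bound[OF that, of n \<omega>] by linarith
  have ib: "integrable usq (\<lambda>z. lower_square p z * bern m n z \<omega>)"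
    by (rule usq_integral_bound(1)[OF bm bern_bound[OF open_square_subset]])
  have ig: "integrable usq (\<lambda>z. lower_square p z * ep.g n z \<omega>)"
    by (rule usq_integral_bound(1)[OF gm g_bound])
  have id: "integrable usq (\<lambda>z. lower_square p z * ?d z)"
    by (rule usq_integral_bound(1)[OF dm db])
  have di: "integrable usq (\<lambda>z. \<bar>?d z\<bar>)"
    by (rule finite_measure.integrable_const_bound[OF prob_space.finite_measure[OF prob_space_usq], of _ "sqrt (real n) + 3 * real n"]) (use db dm in auto)
  have "\<bar>(\<integral>z. lower_square p z * bern m n z \<omega> \<partial>usq) - ep.functional n (lower_square p) \<omega>\<bar> = \<bar>\<integral>z. lower_square p z * ?d z \<partial>usq\<bar>"
    unfolding ep.functional_def right_diff_distrib by (subst Bochner_Integration.integral_diff[OF ib ig]) (rule refl)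
  also have "\<dots> \<le> (\<integral>z. \<bar>lower_square p z * ?d z\<bar> \<partial>usq)" by (rule integral_abs_bound)
  also have "\<dots> \<le> remainder m n \<omega>"
    unfolding remainder_def by (intro integral_mono integrable_abs id di) (auto simp: indicator_def)
  finally have F: "\<bar>(\<integral>z. lower_square p z * bern m n z \<omega> \<partial>usq) - ep.functional n (lower_square p) \<omega>\<bar> \<le> remainder m n \<omega>" .
  have "\<bar>(\<integral>z. lower_square p z * bern m n z \<omega> \<partial>usq) + sqrt (real n) * ?S - ep.functional n (lower_square p) \<omega>\<bar>
      \<le> remainder m n \<omega> + \<bar>sqrt (real n) * ?S\<bar>" using F by linarith
  also have "\<bar>sqrt (real n) * ?S\<bar> = sqrt (real n) * \<bar>?S\<bar>" by (simp add: abs_mult)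
  finally have le: "\<bar>(\<integral>z. lower_square p z * bern m n z \<omega> \<partial>usq) + sqrt (real n) * ?S - ep.functional n (lower_square p) \<omega>\<bar>
      \<le> remainder m n \<omega> + sqrt (real n) * \<bar>?S\<bar>" .
  have "\<bar>((\<integral>z. lower_square p z * bern m n z \<omega> \<partial>usq) + sqrt (real n) * ?S) / D_norm p - ep.functional n (lower_square p) \<omega> / D_norm p\<bar>
      = \<bar>(\<integral>z. lower_square p z * bern m n z \<omega> \<partial>usq) + sqrt (real n) * ?S - ep.functional n (lower_square p) \<omega>\<bar> / D_norm p"
    by (simp only: diff_divide_distrib[symmetric] abs_divide abs_of_pos[OF Dp])
  also have "\<dots> \<le> (remainder m n \<omega> + sqrt (real n) * \<bar>?S\<bar>) / (p0 ^ 3 / 12)"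
    using D le by (intro frac_le) auto
  finally show ?thesis unfolding spearman_difference[OF p01] ep.Z_eq[OF \<omega> p01] .
qed

text \<open>Holds at every sample point, so each prelimit curve lies in \<open>linf\<close>; the
  bound is allowed to grow with \<open>n\<close>.\<close>

lemma spearman_crude:
  assumes p0: "0 < p0" and p: "p \<in> {p0..1}"
  shows "\<bar>sqrt (real n) * (spearman_curve (bernstein_op m (emp_copula X Y n \<omega>)) p - spearman_curve C p)\<bar>
    \<le> (3 * sqrt (real n)) / (p0 ^ 3 / 12)"
proof -
  have p01: "p \<in> {0..1}" using p p0 by auto
  have D: "0 < p0 ^ 3 / 12" "p0 ^ 3 / 12 \<le> D_norm p" using p0 p D_norm_lower by auto
  then have Dp: "0 < D_norm p" by linarith
  let ?S = "square_integral (\<lambda>z. bernstein_op m C z - C z) p"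
  have bm: "(\<lambda>z. bern m n z \<omega>) \<in> borel_measurable usq" unfolding bern_def by (rule bernstein_op_measurable)
  have 1: "\<bar>\<integral>z. lower_square p z * bern m n z \<omega> \<partial>usq\<bar> \<le> sqrt (real n)"
    by (rule usq_integral_bound(2)[OF bm bern_bound[OF open_square_subset]])
  have 2: "\<bar>sqrt (real n) * ?S\<bar> \<le> sqrt (real n) * 2"
    unfolding abs_mult using bias_bound[OF p01] by (intro mult_mono) auto
  have "\<bar>(\<integral>z. lower_square p z * bern m n z \<omega> \<partial>usq) + sqrt (real n) * ?S\<bar> / D_norm p \<le> (3 * sqrt (real n)) / (p0 ^ 3 / 12)"
    using D 1 2 by (intro frac_le) linarith+
  then show ?thesis unfolding spearman_difference[OF p01] abs_divide abs_of_pos[OF Dp] .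
qed

end

text \<open>Cells of length \<open>(1 - p0) / Suc k\<close> are used, and the left end point of the
  cell of \<open>t\<close> serves.\<close>

lemma grid_point:
  assumes p0: "0 \<le> p0" "p0 < 1" and t: "t \<in> {p0..1}"
  obtains j where "j \<le> k" "\<bar>t - (p0 + (1 - p0) * (real j / real (Suc k)))\<bar> \<le> 1 / real (Suc k)"
proof -
  define x where "x = (t - p0) / (1 - p0) * real (Suc k)"
  have y: "0 \<le> (t - p0) / (1 - p0)" "(t - p0) / (1 - p0) \<le> 1" using t p0 by (auto simp: divide_le_eq_1)
  have x: "0 \<le> x" unfolding x_def by (intro mult_nonneg_nonneg y) simp
  have x': "x \<le> real (Suc k)" using mult_right_mono[OF y(2), of "real (Suc k)"] by (simp only: x_def) simp
  define i where "i = nat \<lfloor>x\<rfloor>"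
  have i: "real i \<le> x" "x < real i + 1" using x by (simp_all add: i_def) 
  \<comment> \<open>For \<open>t = 1\<close> the integer part is \<open>Suc k\<close> and is clipped
    to \<open>k\<close>; the distance is then exactly one cell.\<close>
  have d: "\<bar>x - real (min i k)\<bar> \<le> 1"
  proof (cases "i \<le> k")
    case True then show ?thesis using i by (simp add: min_def)
  next
    case False
    then have "real (Suc k) \<le> real i" by simp
    then show ?thesis using False x' i(1) by (simp add: min_def)
  qed
  have tx: "t = p0 + (1 - p0) * (x / real (Suc k))" using p0 by (simp add: x_def)
  have "t - (p0 + (1 - p0) * (real (min i k) / real (Suc k))) = (1 - p0) * ((x - real (min i k)) / real (Suc k))"
    by (subst tx) (simp only: add_diff_cancel_left right_diff_distrib[symmetric] diff_divide_distrib[symmetric])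
  then have "\<bar>t - (p0 + (1 - p0) * (real (min i k) / real (Suc k)))\<bar> = (1 - p0) * (\<bar>x - real (min i k)\<bar> / real (Suc k))"
    using p0 by (simp only: abs_mult abs_divide) simp
  also have "\<dots> \<le> (1 - p0) * (1 / real (Suc k))"
    using p0 d by (intro mult_left_mono divide_right_mono) auto
  also have "\<dots> \<le> 1 * (1 / real (Suc k))" using t by (intro mult_right_mono) (use p0 in auto)
  finally show thesis using that[of "min i k"] by simp
qed

text \<open>The pieces fit \<open>linf_approximation\<close>: the linear functionals
  \<open>ep.Z n\<close> as measurable approximation, \<open>K * (1 + energy)\<close> as modulus, the
  L1 remainder plus the scaled bias as error. Nets of mesh \<open>1 / Suc k\<close> turn the Hoelder
  exponent 1/2 into \<open>sqrt (1 / Suc k)\<close>.\<close>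

lemma (in rank_sample) spearman_weak_limit:
  fixes N :: "'b measure" and B :: "real \<times> real \<Rightarrow> 'b \<Rightarrow> real" and m :: "nat \<Rightarrow> nat"
  assumes p0: "0 < p0" "p0 < 1" and m: "filterlim m at_top sequentially"
    and bias: "(\<lambda>r. SUP p\<in>{p0..1}. \<bar>square_integral (\<lambda>z. bernstein_op r C z - C z) p\<bar>) \<in> O(\<lambda>r. 1 / real r)"
    and rate: "(\<lambda>n. sqrt (real n) / real (m n)) \<longlonglongrightarrow> 0"
    and N: "prob_space N" and B: "brownian_bridge N C B"
  shows "weakly_converges_linf M
      (\<lambda>n p \<omega>. sqrt (real n) *
        (spearman_curve (bernstein_op (m n) (emp_copula X Y n \<omega>)) p - spearman_curve C p))
      {p0..1} N (Z_limit C1 C2 B)"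
proof -
  interpret BB: copula_process N B C1 C2 C by (rule bridge_copula_process[OF N C B C1 C2])
  note gauss = Z_limit_gaussian[OF N C B C1 C2 p0(1)]
  define D0 where "D0 = p0 ^ 3 / 12"
  have D0: "0 < D0" using p0 by (simp add: D0_def)
  define K where "K = 2 / D0 + 2 / D0\<^sup>2"
  have K: "0 < K" using D0 by (auto simp: K_def intro!: add_pos_pos)
  define S where "S r = (SUP p\<in>{p0..1}. \<bar>square_integral (\<lambda>z. bernstein_op r C z - C z) p\<bar>)" for r
  \<comment> \<open>A real supremum is an upper bound only of a bounded family;
    \<open>bias_bound\<close> supplies the boundedness.\<close>
  have S: "\<bar>square_integral (\<lambda>z. bernstein_op r C z - C z) p\<bar> \<le> S r" if "p \<in> {p0..1}" for p r
    unfolding S_def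
  proof (rule cSUP_upper[OF that])
    show "bdd_above ((\<lambda>p. \<bar>square_integral (\<lambda>z. bernstein_op r C z - C z) p\<bar>) ` {p0..1})"
      by (rule bdd_aboveI2[of _ _ 2]) (rule bias_bound, use p0 in auto)
  qed
  \<comment> \<open>By (ii) the bias is of order \<open>1 / m\<close>, hence of order
    \<open>sqrt n / m\<close> after scaling, and (iii) sends this to 0.\<close>
  have S_lim: "(\<lambda>n. sqrt (real n) * S (m n)) \<longlonglongrightarrow> 0"
  proof -
    obtain c where c: "\<forall>\<^sub>F r in sequentially. norm (S r) \<le> c * norm (1 / real r)"
      using bias unfolding S_def[symmetric] by (auto elim: landau_o.bigE)
    have "\<forall>\<^sub>F n in sequentially. norm (sqrt (real n) * S (m n)) \<le> c * (sqrt (real n) / real (m n))"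
      using eventually_compose_filterlim[OF c m]
    proof eventually_elim
      case (elim n)
      have "sqrt (real n) * norm (S (m n)) \<le> sqrt (real n) * (c * norm (1 / real (m n)))"
        by (rule mult_left_mono[OF elim]) simp
      then show ?case by (simp add: norm_mult abs_mult mult_ac)
    qed
    then show ?thesis
      by (rule Lim_null_comparison) (use tendsto_mult[OF tendsto_const[of c] rate] in simp)
  qed
  \<comment> \<open>\<open>min j k\<close> keeps \<open>pt k j\<close> in the interval for every
    index \<open>j\<close>; the last point stays one cell below 1.\<close>
  define pt where "pt k j = p0 + (1 - p0) * (real (min j k) / real (Suc k))" for k j
  have pt: "pt k j \<in> {p0..1}" for k j
  proof -
    have "0 \<le> real (min j k) / real (Suc k)" "real (min j k) / real (Suc k) \<le> 1" by (auto simp: divide_le_eq_1)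
    then have "0 \<le> (1 - p0) * (real (min j k) / real (Suc k))" "(1 - p0) * (real (min j k) / real (Suc k)) \<le> (1 - p0) * 1"
      using p0 by (intro mult_nonneg_nonneg mult_left_mono; simp)+
    then show ?thesis by (simp add: pt_def)
  qed
  have ex: "\<exists>j. j \<le> k \<and> \<bar>t - pt k j\<bar> \<le> 1 / real (Suc k)" if t: "t \<in> {p0..1}" for k t
  proof -
    obtain j where "j \<le> k" "\<bar>t - (p0 + (1 - p0) * (real j / real (Suc k)))\<bar> \<le> 1 / real (Suc k)"
      by (rule grid_point[OF less_imp_le[OF p0(1)] p0(2) t])
    then show ?thesis by (auto simp: pt_def min_absorb1 simp del: of_nat_Suc)
  qed
  define idx where "idx k t = (SOME j. j \<le> k \<and> \<bar>t - pt k j\<bar> \<le> 1 / real (Suc k))" for k t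
  have idx: "idx k t \<le> k" "\<bar>t - pt k (idx k t)\<bar> \<le> 1 / real (Suc k)" if "t \<in> {p0..1}" for k t
    using someI_ex[OF ex[OF that, of k]] unfolding idx_def by auto
  have in01: "t \<in> {0..1}" if "t \<in> {p0..1}" for t using that p0 by simp
  let ?Z = "Z_limit C1 C2 B"
  let ?R = "\<lambda>n \<omega>. (remainder (m n) n \<omega> + sqrt (real n) * S (m n)) / D0"
  \<comment> \<open>One constant for two purposes: \<open>9 / D0\<^sup>2\<close> bounds the second
    moments of the functionals, and \<open>K * 10\<close> the mean of the modulus, since the
    energies have mean at most 9.\<close>
  let ?c = "9 / D0\<^sup>2 + K * 10"
  have Qb: "integrable M' (\<lambda>\<omega>. K * (1 + e \<omega>))" "\<bar>\<integral>\<omega>. K * (1 + e \<omega>) \<partial>M'\<bar> \<le> ?c"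
    if "prob_space M'" "integrable M' e" "(\<integral>\<omega>. e \<omega> \<partial>M') \<le> 9" "\<And>\<omega>. 0 \<le> e \<omega>" for M' :: "'c measure" and e
  proof -
    interpret M': prob_space M' by fact
    show i: "integrable M' (\<lambda>\<omega>. K * (1 + e \<omega>))" using that(2) by simp
    have "(\<integral>\<omega>. K * (1 + e \<omega>) \<partial>M') = K * (1 + (\<integral>\<omega>. e \<omega> \<partial>M'))" using that(2) by (simp add: M'.prob_space)
    also have "\<dots> \<le> K * 10" using that(3) K by (intro mult_left_mono) auto
    also have "\<dots> \<le> ?c" by simp
    finally have "(\<integral>\<omega>. K * (1 + e \<omega>) \<partial>M') \<le> ?c" .
    moreover have "0 \<le> (\<integral>\<omega>. K * (1 + e \<omega>) \<partial>M')" using K that(4) by (intro Bochner_Integration.integral_nonneg) simp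
    ultimately show "\<bar>\<integral>\<omega>. K * (1 + e \<omega>) \<partial>M'\<bar> \<le> ?c" by simp
  qed
  have d: "0 < 1 / real (Suc k)" "1 / real (Suc k) \<le> 1" for k by simp_all
  have c0: "9 / D0\<^sup>2 \<le> ?c" using K by simp
  interpret linf_approximation "{p0..1}" M N pt idx
    "\<lambda>n p \<omega>. sqrt (real n) * (spearman_curve (bernstein_op (m n) (emp_copula X Y n \<omega>)) p - spearman_curve C p)"
    "\<lambda>n. ep.Z n" ?Z ?c "\<lambda>k. sqrt (1 / real (Suc k))" "\<lambda>n \<omega>. K * (1 + ep.energy n \<omega>)" ?R "\<lambda>\<omega>. K * (1 + BB.energy \<omega>)"
  proof (rule linf_approximation.intro)
    show "prob_space M" by (rule prob_space_axioms)
    show "prob_space N" by (rule N)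
    show "{p0..1} \<noteq> {}" using p0 by simp
    show "pt k j \<in> {p0..1}" for k j by (rule pt)
    show "idx k t \<le> k" if "t \<in> {p0..1}" for k t by (rule idx(1)[OF that])
    show "(\<lambda>p\<in>{p0..1}. sqrt (real n) * (spearman_curve (bernstein_op (m n) (emp_copula X Y n \<omega>)) p - spearman_curve C p))
        \<in> mspace (linf {p0..1})" for n \<omega>
      by (rule restrict_in_linf) (rule spearman_crude[OF p0(1)])
    show "(\<lambda>p\<in>{p0..1}. ?Z p \<omega>) \<in> mspace (linf {p0..1})" if \<omega>: "\<omega> \<in> space N" for \<omega>
    proof (rule restrict_in_linf)
      fix p assume p: "p \<in> {p0..1}"
      have "\<bar>?Z p \<omega> - ?Z 1 \<omega>\<bar> \<le> sqrt 1 * (K * (1 + BB.energy \<omega>))"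
        unfolding K_def D0_def by (rule BB.Z_hoelder[OF p0(1) p _ _ _ _ \<omega>]) (use p p0 in auto)
      then show "\<bar>?Z p \<omega>\<bar> \<le> \<bar>?Z 1 \<omega>\<bar> + K * (1 + BB.energy \<omega>)" by simp
    qed
    show "ep.Z n t \<in> borel_measurable M" if "t \<in> {p0..1}" for n t by (rule ep.Z_measurable[OF in01[OF that]])
    show "?Z t \<in> borel_measurable N" if "t \<in> {p0..1}" for t by (rule BB.Z_measurable[OF in01[OF that]])
    show "integrable M (\<lambda>\<omega>. (ep.Z n t \<omega>)\<^sup>2)" if "t \<in> {p0..1}" for n t by (rule ep.Z_sq_integrable[OF in01[OF that]])
    show "integrable N (\<lambda>\<omega>. (?Z t \<omega>)\<^sup>2)" if "t \<in> {p0..1}" for t by (rule BB.Z_sq_integrable[OF in01[OF that]])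
    show "(\<integral>\<omega>. (ep.Z n t \<omega>)\<^sup>2 \<partial>M) \<le> ?c" if "t \<in> {p0..1}" for n t
      using ep.Z_sq_le[OF p0(1) that, of n] c0 unfolding D0_def by linarith
    show "(\<integral>\<omega>. (?Z t \<omega>)\<^sup>2 \<partial>N) \<le> ?c" if "t \<in> {p0..1}" for t
      using BB.Z_sq_le[OF p0(1) that] c0 unfolding D0_def by linarith
    show "(\<lambda>n. \<integral>\<omega>. cis (\<Sum>j<Suc k. a j * ep.Z n (pt k j) \<omega>) \<partial>M) \<longlonglongrightarrow> (\<integral>\<omega>. cis (\<Sum>j<Suc k. a j * ?Z (pt k j) \<omega>) \<partial>N)" for k a
    proof -
      have "(\<integral>\<omega>. cis (\<Sum>j<Suc k. a j * ?Z (pt k j) \<omega>) \<partial>N) =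
          exp (- (\<integral>\<omega>. (\<Sum>j<Suc k. a j * ?Z (pt k j) \<omega>)\<^sup>2 \<partial>N) / 2)"
        by (rule gaussian_combination[OF N gauss]) (use pt in auto)
      also have "(\<integral>\<omega>. (\<Sum>j<Suc k. a j * ?Z (pt k j) \<omega>)\<^sup>2 \<partial>N) =
          (\<Sum>i<Suc k. \<Sum>j<Suc k. a i * a j * Z_cov C C1 C2 (pt k i) (pt k j))"
        by (rule BB.Z_combination(1)) (rule in01[OF pt])
      finally have e: "(\<integral>\<omega>. cis (\<Sum>j<Suc k. a j * ?Z (pt k j) \<omega>) \<partial>N) =
        exp (- (\<Sum>i<Suc k. \<Sum>j<Suc k. a i * a j * Z_cov C C1 C2 (pt k i) (pt k j)) / 2)" .
      show ?thesis unfolding e by (rule ep_clt) (use in01[OF pt] in auto)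
    qed
    show "(\<lambda>k. sqrt (1 / real (Suc k))) \<longlonglongrightarrow> 0"
      using tendsto_real_sqrt[OF LIMSEQ_inverse_real_of_nat] by (simp add: inverse_eq_divide)
    show "\<bar>ep.Z n t \<omega> - ep.Z n (pt k (idx k t)) \<omega>\<bar> \<le> sqrt (1 / real (Suc k)) * (K * (1 + ep.energy n \<omega>))"
      if "\<omega> \<in> space M" "t \<in> {p0..1}" for n k t \<omega>
      unfolding K_def D0_def by (rule ep.Z_hoelder[OF p0(1) that(2) pt idx(2)[OF that(2)] d that(1)])
    show "\<bar>?Z t \<omega> - ?Z (pt k (idx k t)) \<omega>\<bar> \<le> sqrt (1 / real (Suc k)) * (K * (1 + BB.energy \<omega>))"
      if "\<omega> \<in> space N" "t \<in> {p0..1}" for k t \<omega>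
      unfolding K_def D0_def by (rule BB.Z_hoelder[OF p0(1) that(2) pt idx(2)[OF that(2)] d that(1)])
    show "integrable M (\<lambda>\<omega>. K * (1 + ep.energy n \<omega>))" "\<bar>\<integral>\<omega>. K * (1 + ep.energy n \<omega>) \<partial>M\<bar> \<le> ?c" for n
      using Qb[OF prob_space_axioms ep.energy_integrable ep.energy_bound ep.energy_nonneg] by auto
    show "\<bar>sqrt (real n) * (spearman_curve (bernstein_op (m n) (emp_copula X Y n \<omega>)) t - spearman_curve C t) - ep.Z n t \<omega>\<bar> \<le> ?R n \<omega>"
      if \<omega>: "\<omega> \<in> space M" and t: "t \<in> {p0..1}" for n t \<omega>
    proof -
      have "(remainder (m n) n \<omega> + sqrt (real n) * \<bar>square_integral (\<lambda>z. bernstein_op (m n) C z - C z) t\<bar>) / D0 \<le> ?R n \<omega>"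
        using S[OF t, of "m n"] D0 by (intro divide_right_mono add_left_mono mult_left_mono) auto
      with spearman_remainder[OF p0(1) t \<omega>, of n "m n"] show ?thesis unfolding D0_def by (rule order_trans)
    qed
    show "integrable M (?R n)" for n using remainder_integrable by simp
    have e: "(\<integral>\<omega>. ?R n \<omega> \<partial>M) = ((\<integral>\<omega>. remainder (m n) n \<omega> \<partial>M) + sqrt (real n) * S (m n)) / D0" for n
      using remainder_integrable by (simp add: prob_space)
    have "(\<lambda>n. ((\<integral>\<omega>. remainder (m n) n \<omega> \<partial>M) + sqrt (real n) * S (m n)) / D0) \<longlonglongrightarrow> (0 + 0) / D0"
      by (intro tendsto_divide tendsto_add remainder_tendsto[OF m] S_lim tendsto_const) (use D0 in simp)
    then show "(\<lambda>n. \<integral>\<omega>. ?R n \<omega> \<partial>M) \<longlonglongrightarrow> 0" unfolding e by simp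
  qed
  show ?thesis by (rule weak_convergence)
qed

theorem theorem2p3:
  fixes M :: "'a measure" and N :: "'b measure"
    and X Y :: "nat \<Rightarrow> 'a \<Rightarrow> real"
    and H :: "real \<times> real \<Rightarrow> real" and F G :: "real \<Rightarrow> real"
    and C C1 C2 :: "real \<times> real \<Rightarrow> real"
    and B :: "real \<times> real \<Rightarrow> 'b \<Rightarrow> real"
    and p0 :: real and m :: "nat \<Rightarrow> nat"
  assumes "prob_space M"
    and indep: "prob_space.indep_vars M (\<lambda>_. borel) (\<lambda>i \<omega>. (X i \<omega>, Y i \<omega>)) {1..}"
    and ident: "\<And>i. 1 \<le> i \<Longrightarrow>
      distr M borel (\<lambda>\<omega>. (X i \<omega>, Y i \<omega>)) = distr M borel (\<lambda>\<omega>. (X 1 \<omega>, Y 1 \<omega>))"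
    and H: "H = joint_cdf (distr M borel (\<lambda>\<omega>. (X 1 \<omega>, Y 1 \<omega>)))"
    and F: "F = cdf (distr M borel (X 1))" and "continuous_on UNIV F"
    and G: "G = cdf (distr M borel (Y 1))" and "continuous_on UNIV G"
    and "copula C" and sklar: "\<And>x y. H (x, y) = C (F x, G y)"
    and "0 < p0" "p0 < 1"
    \<comment> \<open>(i)\<close>
    and "\<And>u v. u \<in> {0<..<1} \<Longrightarrow> v \<in> {0..1} \<Longrightarrow>
      ((\<lambda>s. C (s, v)) has_real_derivative C1 (u, v)) (at u)"
    and "\<And>u v. u \<in> {0..1} \<Longrightarrow> v \<in> {0<..<1} \<Longrightarrow>
      ((\<lambda>t. C (u, t)) has_real_derivative C2 (u, v)) (at v)"
    and "continuous_on ({0<..<1} \<times> {0..1}) C1"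
    and "continuous_on ({0..1} \<times> {0<..<1}) C2"
    \<comment> \<open>(ii)\<close>
    and "(\<lambda>r. SUP p\<in>{p0..1}. \<bar>square_integral (\<lambda>z. bernstein_op r C z - C z) p\<bar>)
      \<in> O(\<lambda>r. 1 / real r)"
    \<comment> \<open>(iii)\<close>
    and "\<And>n. 1 \<le> n \<Longrightarrow> 1 \<le> m n"
    and "filterlim m at_top sequentially"
    and "(\<lambda>n. sqrt (real n) / real (m n)) \<longlonglongrightarrow> 0"
    \<comment> \<open>a version of the \<open>C\<close>-Brownian bridge, on an arbitrary probability space\<close>
    and "prob_space N" and "brownian_bridge N C B"
  shows "weakly_converges_linf M
      (\<lambda>n p \<omega>. sqrt (real n) *
        (spearman_curve (bernstein_op (m n) (emp_copula X Y n \<omega>)) p - spearman_curve C p))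
      {p0..1} N (Z_limit C1 C2 B)
    \<and> centered_gaussian_process N {p0..1} (Z_limit C1 C2 B)
    \<and> (\<forall>p\<in>{p0..1}. \<forall>q\<in>{p0..1}.
      covariance N (Z_limit C1 C2 B p) (Z_limit C1 C2 B q) =
      1 / (D_norm p * D_norm q) *
        (LINT w:{0..p} \<times> {0..p}|lebesgue. LINT z:{0..q} \<times> {0..q}|lebesgue.
          Gamma_cov N C1 C2 B w z))"
proof -
  \<comment> \<open>The two domains in (i) meet exactly in the open square, which is where the
    integrals are evaluated.\<close>
  have os: "open_square \<subseteq> {0<..<1} \<times> {0..1}" "open_square \<subseteq> {0..1} \<times> {0<..<1}"
    by (auto simp: open_square_def)
  interpret rank_sample M "\<lambda>i \<omega>. (F (X i \<omega>), G (Y i \<omega>))" C C1 C2 X Y F G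
  proof (rule rank_sample_of_iid[OF assms(1) indep ident F assms(6) G assms(8,9)])
    show "joint_cdf (distr M borel (\<lambda>\<omega>. (X 1 \<omega>, Y 1 \<omega>))) (x, y) = C (F x, G y)" for x y
      using sklar[of x y] unfolding H .
    show "((\<lambda>s. C (s, snd z)) has_real_derivative C1 z) (at (fst z))" if "z \<in> open_square" for z
      using assms(13)[of "fst z" "snd z"] that by (auto simp: open_square_def)
    show "((\<lambda>t. C (fst z, t)) has_real_derivative C2 z) (at (snd z))" if "z \<in> open_square" for z
      using assms(14)[of "fst z" "snd z"] that by (auto simp: open_square_def)
    show "continuous_on open_square C1" by (rule continuous_on_subset[OF assms(15) os(1)])
    show "continuous_on open_square C2" by (rule continuous_on_subset[OF assms(16) os(2)])
  qed
  interpret BB: copula_process N B C1 C2 C by (rule bridge_copula_process[OF assms(21) C assms(22) C1 C2])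
  show ?thesis
  proof (intro conjI ballI)
    show "weakly_converges_linf M
      (\<lambda>n p \<omega>. sqrt (real n) *
        (spearman_curve (bernstein_op (m n) (emp_copula X Y n \<omega>)) p - spearman_curve C p))
      {p0..1} N (Z_limit C1 C2 B)"
      by (rule spearman_weak_limit[OF assms(11,12,19,17,20,21,22)])
    show "centered_gaussian_process N {p0..1} (Z_limit C1 C2 B)"
      by (rule Z_limit_gaussian[OF assms(21) C assms(22) C1 C2 assms(11)])
  qed (rule BB.covariance_Z, use assms(11) in auto)
qed

end
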